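(* Let $u\in H^{1,a}(B_1^+)$ be the unique solution of the boundary value problem with datum $g$ described in the context. Let $k=\lim_{r\to0^+}\tilde{\mathcal{N}}(r)$ and let $p_k\in\mathbb{P}_k^a$, i.e. let $p_k$ be an $a$-harmonic homogeneous polynomial of degree $k$, even in $y$. Then $M_k(u,p_k,\cdot)\in C^1(0,R_0/2)$ and $$\frac{d}{dr}M_k(u,p_k,r)\ge-\hat C\,r^{k(p-2)-a},$$ for some $\hat C>0$ depending on $N$, $a$, $\|g\|_{L^\infty(S_1^+)}$ and $k$.
   Context: Fix an integer $N\ge1$, $a\in(-1,1)$, $p\ge2$ and constants $\lambda_-,\lambda_+\ge0$. Write $t^+=\max\{t,0\}$, $t^-=\max\{-t,0\}$, $z=(x,y)\in\mathbb{R}^N\times\mathbb{R}$, $\mathbb{R}^{N+1}_+=\mathbb{R}^N\times(0,\infty)$, $B_r^+=\{z\in\mathbb{R}^{N+1}_+:|z|<r\}$, $S_r^+=\{z\in\mathbb{R}^{N+1}_+:|z|=r\}$, $B_r'=\{x\in\mathbb{R}^N:|x|<r\}$ (identified with $B_r'\times\{0\}$). $H^{1,a}(B_r^+)$ is the completion of $C^\infty(\overline{B_r^+})$ in the norm $\left(\int_{B_r^+}y^a(|\nabla u|^2+u^2)\,dx\,dy\right)^{1/2}$, and $H^{1,a}_{0,S_r^+}(B_r^+)$ is the closure of $C_c^\infty(\overline{B_r^+}\setminus\overline{S_r^+})$ in it. Given $g\in H^{1,a}(B_1^+)\cap C(\overline{B_1^+})$, a solution of $$-\mathrm{div}(y^a\nabla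 u)=0\text{ in }B_1^+,\quad u=g\text{ on }S_1^+,\quad -\lim_{y\to0^+}y^a\partial_yu=\lambda_-(u^-)^{p-1}-\lambda_+(u^+)^{p-1}\text{ on }B_1'$$ is a function $u\in H^{1,a}(B_1^+)\cap L^p(B_1')$ (in the sense of traces on $B_1'$) with $u-g\in H^{1,a}_{0,S_1^+}(B_1^+)$ and $\int_{B_1^+}y^a\nabla u\cdot\nabla\varphi\,dx\,dy=\int_{B_1'}(\lambda_-(u^-)^{p-1}-\lambda_+(u^+)^{p-1})\varphi\,dx$ for all $\varphi\in H^{1,a}_{0,S_1^+}(B_1^+)$. The solution exists, is unique, and is bounded and continuous on $B_1^+\cup B_1'$. $R_0\in(0,1/4)$ is a fixed radius, possibly depending on $N,a,p,\|g\|_{L^\infty(S_1^+)}$, for which, with some $\alpha\in(0,1)\cap(0,1-a)$ and $C>0$ (possibly depending on the same quantities), $\|\nabla_xu\|_{C^{0,\alpha}(B_{R_0}^+)}\le C\left(\int_{B_1^+}y^a|\nabla u|^2\,dx\,dy\right)^{1/2}$ and $\|y^a\partial_yu\|_{C^{0,\alpha}(B_{R_0}^+)}\le C$. For functions $v$ set $D(v,r)=r^{-(N+a-1)}\int_{B_r^+}y^a|\nabla v|^2\,dx\,dy$, $H(v,r)=r^{-(N+a)}\int_{S_r^+}y^av^2\,dS$, $G(v,r)=r^{-(N+a-1)}\int_{B_r'}(\lambda_-(v^-)^p+\lambda_+(v^+)^p)\,dx$. The perturbed frequency of $u$ is $\tilde{\mathcal{N}}(r)=\left(D(u,r)+\frac2pG(u,r)\right)/H(u,r)$.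 It is understood that $u\not\equiv0$, so that $H(u,r)>0$ for $r\in(0,R_0)$; then $\tilde{\mathcal{N}}$ is nondecreasing on $(0,R_0)$ and its limit at $0^+$ exists in $[0,\infty)$. The Monneau-type functional is $M_k(v,w,r)=r^{-2k}H(v-w,r)$. $\mathbb{P}_k^a$ is the space of polynomials $q:\mathbb{R}^{N+1}\to\mathbb{R}$ with $q(x,-y)=q(x,y)$, $q(\mu z)=\mu^kq(z)$ for all $\mu\ge0$, and $-\mathrm{div}(|y|^a\nabla q)=0$ in $\mathbb{R}^{N+1}$.
   Formalization: The constant Ĉ is allowed to depend also on p_k (it stays uniform in g and u for given ‖g‖): with g=1, λ_+>0, k=0, p_0=c and c→∞, no Ĉ independent of p_k exists. p, λ_±, R_0 are fixed beforehand. *)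

theory Defs
  imports "HOL-Analysis.Analysis"
begin

text \<open>
  Points \<open>z = (x, y)\<close> of \<open>N + 1\<close>-dimensional space have type \<open>(real ^ 'n) \<times> real\<close>, with
  \<open>N = CARD('n)\<close>.
\<close>

type_synonym 'n point = "(real ^ 'n) \<times> real"

definition half_ball :: "real \<Rightarrow> ('n::finite) point set" where
  "half_ball r = {z. 0 < snd z \<and> norm z < r}"

definition half_sphere :: "real \<Rightarrow> ('n::finite) point set" where
  "half_sphere r = {z. 0 < snd z \<and> norm z = r}"

text \<open>
  \<open>B\<^sub>r'\<close>, as a subset of the hyperplane \<open>y = 0\<close>. Integrals over it are written as integrals over
  \<open>ball 0 r :: (real ^ 'n) set\<close>.
\<close>

definition thin_ball :: "real \<Rightarrow> ('n::finite) point set" where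
  "thin_ball r = ball 0 r \<times> {0}"

text \<open>
  Surface measure on the sphere of radius \<open>r\<close> in dimension \<open>d = DIM('a)\<close>, defined through cones:
  a Borel subset \<open>A\<close> of the unit sphere has measure
  \<open>d * vol {z. norm z < 1 \<and> z / norm z \<in> A}\<close>, and dilation by \<open>r\<close> multiplies surface
  measure by \<open>r ^ (d - 1)\<close>. The origin (where \<open>sgn 0 = 0\<close>) is a null set.
\<close>

definition sphere_measure :: "real \<Rightarrow> ('a::euclidean_space) measure" where
  "sphere_measure r =
     scale_measure (ennreal (real DIM('a) * r ^ (DIM('a) - 1)))
       (distr (restrict_space lborel (ball 0 1)) borel (\<lambda>z. r *\<^sub>R sgn z))"

definition grad :: "('a::euclidean_space \<Rightarrow> real) \<Rightarrow> 'a \<Rightarrow> 'a" where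
  "grad f z = (\<Sum>b\<in>Basis. frechet_derivative f (at z) b *\<^sub>R b)"

primrec Ck :: "nat \<Rightarrow> ('a::euclidean_space \<Rightarrow> real) \<Rightarrow> bool" where
  "Ck 0 f = continuous_on UNIV f"
| "Ck (Suc m) f =
     ((\<forall>z. f differentiable (at z)) \<and> (\<forall>v. Ck m (\<lambda>z. frechet_derivative f (at z) v)))"

definition smooth :: "('a::euclidean_space \<Rightarrow> real) \<Rightarrow> bool" where
  "smooth f \<longleftrightarrow> (\<forall>m. Ck m f)"

text \<open>
  The weighted Sobolev space. Functions smooth up to the boundary of the half ball are
  represented by smooth functions on the whole space. An element of the completion is
  represented by its limit \<open>u\<close> in the weighted \<open>L\<^sup>2\<close> space, the gradients of an approximating
  sequence having a limit \<open>F\<close> there as well. Only the values of \<open>u\<close> and \<open>F\<close> in the half ball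
  matter, and \<open>F\<close> is determined by \<open>u\<close> almost everywhere.
\<close>

definition H1a_tendsto ::
  "real \<Rightarrow> real \<Rightarrow> (nat \<Rightarrow> ('n::finite) point \<Rightarrow> real) \<Rightarrow> ('n point \<Rightarrow> real) \<Rightarrow> ('n point \<Rightarrow> 'n point) \<Rightarrow> bool"
where
  "H1a_tendsto a r \<phi> u F \<longleftrightarrow>
     set_borel_measurable lborel (half_ball r) u \<and>
     set_borel_measurable lborel (half_ball r) F \<and>
     (\<lambda>n. set_nn_integral lborel (half_ball r)
        (\<lambda>z. ennreal (snd z powr a * ((norm (grad (\<phi> n) z - F z))\<^sup>2 + (\<phi> n z - u z)\<^sup>2))))
       \<longlonglongrightarrow> 0"

definition is_H1a_grad ::
  "real \<Rightarrow> real \<Rightarrow> (('n::finite) point \<Rightarrow> real) \<Rightarrow> ('n point \<Rightarrow> 'n point) \<Rightarrow> bool" where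
  "is_H1a_grad a r u F \<longleftrightarrow> (\<exists>\<phi>. (\<forall>n. smooth (\<phi> n)) \<and> H1a_tendsto a r \<phi> u F)"

definition H1a :: "real \<Rightarrow> real \<Rightarrow> (('n::finite) point \<Rightarrow> real) set" where
  "H1a a r = {u. \<exists>F. is_H1a_grad a r u F}"

definition H1a_grad :: "real \<Rightarrow> real \<Rightarrow> (('n::finite) point \<Rightarrow> real) \<Rightarrow> 'n point \<Rightarrow> 'n point" where
  "H1a_grad a r u = (SOME F. is_H1a_grad a r u F)"

text \<open>
  The trace on \<open>B\<^sub>r'\<close>: the \<open>L\<^sup>2\<close> limit of the restrictions to \<open>y = 0\<close> of an approximating
  sequence of smooth functions; like the gradient, it is determined almost everywhere.
\<close>

definition is_H1a_trace ::
  "real \<Rightarrow> real \<Rightarrow> (('n::finite) point \<Rightarrow> real) \<Rightarrow> (real ^ 'n \<Rightarrow> real) \<Rightarrow> bool" where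
  "is_H1a_trace a r u T \<longleftrightarrow>
     set_borel_measurable lborel (ball 0 r) T \<and>
     (\<exists>\<phi> F. (\<forall>n. smooth (\<phi> n)) \<and> H1a_tendsto a r \<phi> u F \<and>
        (\<lambda>n. set_nn_integral lborel (ball 0 r) (\<lambda>x. ennreal ((\<phi> n (x, 0) - T x)\<^sup>2)))
          \<longlonglongrightarrow> 0)"

definition H1a_trace :: "real \<Rightarrow> real \<Rightarrow> (('n::finite) point \<Rightarrow> real) \<Rightarrow> real ^ 'n \<Rightarrow> real" where
  "H1a_trace a r u = (SOME T. is_H1a_trace a r u T)"

definition Cc_off_sphere :: "real \<Rightarrow> (('n::finite) point \<Rightarrow> real) set" where
  "Cc_off_sphere r =
     {\<phi>. smooth \<phi> \<and>
        (\<exists>K. compact K \<and> K \<subseteq> closure (half_ball r) - closure (half_sphere r) \<and>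
             (\<forall>z\<in>closure (half_ball r) - K. \<phi> z = 0))}"

definition H1a0 :: "real \<Rightarrow> real \<Rightarrow> (('n::finite) point \<Rightarrow> real) set" where
  "H1a0 a r = {u. \<exists>\<phi> F. (\<forall>n. \<phi> n \<in> Cc_off_sphere r) \<and> H1a_tendsto a r \<phi> u F}"

definition pos_part :: "real \<Rightarrow> real" where "pos_part t = max t 0"
definition neg_part :: "real \<Rightarrow> real" where "neg_part t = max (- t) 0"

text \<open>
  The nonlinearity \<open>\<lambda>\<^sub>- (u\<^sup>-)\<^sup>p\<^sup>-\<^sup>1 - \<lambda>\<^sub>+ (u\<^sup>+)\<^sup>p\<^sup>-\<^sup>1\<close>; throughout, \<open>lm\<close> and \<open>lp\<close> stand for \<open>\<lambda>\<^sub>-\<close> and \<open>\<lambda>\<^sub>+\<close>.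
\<close>

definition boundary_term :: "real \<Rightarrow> real \<Rightarrow> real \<Rightarrow> real \<Rightarrow> real" where
  "boundary_term p lm lp t = lm * neg_part t powr (p - 1) - lp * pos_part t powr (p - 1)"

definition datum :: "real \<Rightarrow> (('n::finite) point \<Rightarrow> real) \<Rightarrow> bool" where
  "datum a g \<longleftrightarrow> g \<in> H1a a 1 \<and> continuous_on (closure (half_ball 1)) g"

text \<open>
  The supremum norm on the unit half sphere; for a datum, continuous up to the boundary, it is the
  \<open>L\<^sup>\<infinity>\<close> norm.
\<close>

definition sup_norm_sphere :: "(('n::finite) point \<Rightarrow> real) \<Rightarrow> real" where
  "sup_norm_sphere g = (SUP z\<in>half_sphere 1. \<bar>g z\<bar>)"

text \<open>
  Since the Bochner integral of a non-integrable function is 0, the integrability of the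
  right-hand side is stated explicitly; for the left-hand side it is automatic.
\<close>

definition weak_solution ::
  "real \<Rightarrow> real \<Rightarrow> real \<Rightarrow> real \<Rightarrow> (('n::finite) point \<Rightarrow> real) \<Rightarrow> ('n point \<Rightarrow> real) \<Rightarrow> bool" where
  "weak_solution a p lm lp g u \<longleftrightarrow>
     u \<in> H1a a 1 \<and>
     set_integrable lborel (ball 0 1) (\<lambda>x. \<bar>H1a_trace a 1 u x\<bar> powr p) \<and>
     (\<lambda>z. u z - g z) \<in> H1a0 a 1 \<and>
     (\<forall>\<phi>\<in>H1a0 a 1.
        set_integrable lborel (ball 0 1)
          (\<lambda>x. boundary_term p lm lp (H1a_trace a 1 u x) * H1a_trace a 1 \<phi> x) \<and>
        (LINT z:half_ball 1|lborel. snd z powr a * (H1a_grad a 1 u z \<bullet> H1a_grad a 1 \<phi> z)) =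
        (LINT x:ball 0 1|lborel.
           boundary_term p lm lp (H1a_trace a 1 u x) * H1a_trace a 1 \<phi> x))"

definition holder_norm ::
  "real \<Rightarrow> ('a::metric_space) set \<Rightarrow> ('a \<Rightarrow> 'b::real_normed_vector) \<Rightarrow> ennreal" where
  "holder_norm \<alpha> S f =
     (SUP z\<in>S. ennreal (norm (f z))) +
     (SUP z\<in>S. SUP w\<in>S - {z}. ennreal (norm (f z - f w) / dist z w powr \<alpha>))"

text \<open>
  The radius, the exponent and the constant in the regularity estimates may depend on the
  sup norm \<open>K\<close> of the datum, but not on the datum itself. The estimates are claimed for a
  representative \<open>F\<close> of the gradient, with components \<open>fst (F z)\<close> in \<open>x\<close> and \<open>snd (F z)\<close> in \<open>y\<close>.
\<close>

definition regularity_radius ::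
  "'n::finite itself \<Rightarrow> real \<Rightarrow> real \<Rightarrow> real \<Rightarrow> real \<Rightarrow> real \<Rightarrow> real \<Rightarrow> bool" where
  "regularity_radius _ a p lm lp K R \<longleftrightarrow>
     0 < R \<and> R < 1 / 4 \<and>
     (\<exists>\<alpha> C. 0 < \<alpha> \<and> \<alpha> < 1 \<and> \<alpha> < 1 - a \<and> 0 < C \<and>
        (\<forall>(g :: 'n point \<Rightarrow> real) u.
           datum a g \<and> sup_norm_sphere g = K \<and> weak_solution a p lm lp g u \<longrightarrow>
           (\<exists>F. is_H1a_grad a 1 u F \<and>
              holder_norm \<alpha> (half_ball R) (\<lambda>z. fst (F z))
                \<le> ennreal (C * sqrt (LINT z:half_ball 1|lborel. snd z powr a * (norm (F z))\<^sup>2)) \<and>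
              holder_norm \<alpha> (half_ball R) (\<lambda>z. snd z powr a * snd (F z)) \<le> ennreal C)))"

definition energy_D :: "real \<Rightarrow> (('n::finite) point \<Rightarrow> real) \<Rightarrow> real \<Rightarrow> real" where
  "energy_D a v r =
     r powr (- (real CARD('n) + a - 1)) *
     (LINT z:half_ball r|lborel. snd z powr a * (norm (H1a_grad a r v z))\<^sup>2)"

text \<open>
  The integral over the half sphere uses pointwise values of \<open>v\<close>; \<open>v\<close> is always continuous in the
  open unit half ball when this is applied.
\<close>

definition height_H :: "real \<Rightarrow> (('n::finite) point \<Rightarrow> real) \<Rightarrow> real \<Rightarrow> real" where
  "height_H a v r =
     r powr (- (real CARD('n) + a)) *
     (LINT z:half_sphere r|sphere_measure r. snd z powr a * (v z)\<^sup>2)"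

definition boundary_G ::
  "real \<Rightarrow> real \<Rightarrow> real \<Rightarrow> real \<Rightarrow> (('n::finite) point \<Rightarrow> real) \<Rightarrow> real \<Rightarrow> real" where
  "boundary_G a p lm lp v r =
     r powr (- (real CARD('n) + a - 1)) *
     (LINT x:ball 0 r|lborel.
        lm * neg_part (H1a_trace a r v x) powr p + lp * pos_part (H1a_trace a r v x) powr p)"

definition perturbed_frequency ::
  "real \<Rightarrow> real \<Rightarrow> real \<Rightarrow> real \<Rightarrow> (('n::finite) point \<Rightarrow> real) \<Rightarrow> real \<Rightarrow> real" where
  "perturbed_frequency a p lm lp u r =
     (energy_D a u r + 2 / p * boundary_G a p lm lp u r) / height_H a u r"

definition monneau ::
  "real \<Rightarrow> nat \<Rightarrow> (('n::finite) point \<Rightarrow> real) \<Rightarrow> ('n point \<Rightarrow> real) \<Rightarrow> real \<Rightarrow> real" where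
  "monneau a k v w r = height_H a (\<lambda>z. v z - w z) r / r ^ (2 * k)"

text \<open>
  The equation \<open>- div (\<bar>y\<bar>\<^sup>a \<nabla>q) = 0\<close> in the whole space is understood in the weak sense; \<open>\<bar>y\<bar>\<^sup>a\<close> is
  singular or degenerate on \<open>y = 0\<close>.
\<close>

definition a_harmonic :: "real \<Rightarrow> (('n::finite) point \<Rightarrow> real) \<Rightarrow> bool" where
  "a_harmonic a q \<longleftrightarrow>
     (\<forall>\<phi> K. smooth \<phi> \<and> compact K \<and> (\<forall>z\<in>- K. \<phi> z = 0) \<longrightarrow>
        (LINT z|lborel. \<bar>snd z\<bar> powr a * (grad q z \<bullet> grad \<phi> z)) = 0)"

definition hom_polys :: "real \<Rightarrow> nat \<Rightarrow> (('n::finite) point \<Rightarrow> real) set" where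
  "hom_polys a k =
     {q. real_polynomial_function q \<and>
         (\<forall>x y. q (x, - y) = q (x, y)) \<and>
         (\<forall>\<mu>\<ge>0. \<forall>z. q (\<mu> *\<^sub>R z) = \<mu> ^ k * q z) \<and>
         a_harmonic a q}"

end

theory Submission
  imports Defs "HOL-Computational_Algebra.Polynomial"
begin

text \<open>
  The derivative of the Monneau functional is at least \<open>2 r\<^sup>-\<^sup>2\<^sup>k\<^sup>-\<^sup>1\<close> times the sum of the Weiss functional
  \<open>D + (2/p) G - k H\<close> of \<open>u\<close> and of the term \<open>r\<^sup>1\<^sup>-\<^sup>N\<^sup>-\<^sup>a \<integral> f(u) p\<^sub>k dx\<close> over the thin ball, where \<open>f\<close> is the
  nonlinearity. The Weiss functional is nonnegative: the functionals with exponents \<open>\<kappa> < k\<close> are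
  nondecreasing, by convexity of the energy and comparison of \<open>u\<close> with its homogeneous rescalings,
  so a negative value at some radius would keep the frequency below some \<open>\<kappa> < k\<close> at all smaller
  radii. The remaining term is of the stated order because \<open>u = O(r\<^sup>k)\<close> on the thin ball. This
  growth, with a uniform constant, follows from the monotonicity of \<open>r\<^sup>-\<^sup>2\<^sup>k H\<close>, the subharmonicity
  of \<open>u\<^sup>2\<close>, the one-sided bound that the nonlinearity imposes on \<open>u\<close> and a Harnack argument. All
  identities come from the divergence theorem on half balls, obtained from the weak formulation by
  radial cutoffs and polar coordinates.
\<close>

text \<open>The gradient of \<open>u\<close> is only known to be continuous with weighted bounds, so
  no Rellich-Pohozaev identity is derived and the energy is never differentiated in
  \<open>r\<close>: rescalings of \<open>u\<close> as competitors replace that computation, and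
  monotonicity is read off one-sided difference quotients. Every boundary identity is an instance of
  a single divergence theorem, for a field without interior sources tested with a scalar function.
  The final constant has to serve all data with the same sup norm \<open>K\<close>. The only
  quantitative information on \<open>u\<close> is therefore the uniform bound of y^a u_y; from it
  the bound of the nonlinearity and the growth constant are computed explicitly instead of being
  obtained by compactness. Gradients and traces are defined by choice and up to null sets, whereas
  spheres and the thin ball are null sets themselves: much of the first half identifies them with
  pointwise values. The exponent is a count of powers of r: -2k-1 and 1-N-a from the prefactors,
  k(p-1) from the nonlinearity, k from the polynomial and N from the thin ball add up to
  k(p-2)-a.\<close>

abbreviation nn_lborel :: "('a::euclidean_space => ennreal) => ennreal" (binder "NN " 10) where
 "nn_lborel f == nn_integral lborel f"

abbreviation bmeas :: "'a measure => ('a => 'b::topological_space) set" where "bmeas == borel_measurable"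

abbreviation lim_seq :: "(nat => 'a::topological_space) => 'a => bool" (infix "---->" 60) where
"lim_seq X l == filterlim X (nhds l) sequentially"

abbreviation lim_filter :: "('b => 'a::topological_space) => 'a => 'b filter => bool" (infixr "--->" 55) where
"lim_filter f l == filterlim f (nhds l)"

abbreviation ind :: "'a set => 'a => 'b::zero_neq_one" where "ind == indicator"

abbreviation scale_R :: "real => 'a => 'a::real_vector" (infixr "*." 75) where "scale_R == scaleR"

abbreviation lborel2 :: "('a::euclidean_space * 'b::euclidean_space) measure" where "lborel2 == lborel \<Otimes>\<^sub>M lborel"

subsection \<open>Calculus of smooth functions\<close>

lemma Ck_Suc_imp: "Ck (Suc m) f ==> Ck m f"
proof (induction m arbitrary: f)
case 0
thus ?case by (auto simp: continuous_on_eq_continuous_at intro!: differentiable_imp_continuous_within)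
next
case (Suc m)
thus ?case by simp
qed

lemma Ck_SucI:
assumes "!!z. (f has_derivative f' z) (at z)" "!!v. Ck m (%z. f' z v)"
shows "Ck (Suc m) f"
proof -
have "frechet_derivative f (at z) = f' z" for z
 using assms(1) by (metis frechet_derivative_at)
with assms show ?thesis by (auto simp: differentiable_def)
qed

lemma Ck_frechet:
assumes "Ck (Suc m) f"
shows "(f has_derivative frechet_derivative f (at z)) (at z)"
 and "Ck m (%z. frechet_derivative f (at z) v)"
using assms by (auto simp: frechet_derivative_works)

lemma Ck_const: "Ck m (%z. c)"
proof (induction m arbitrary: c)
case (Suc m)
show ?case by (rule Ck_SucI[where f' = "%z v. 0"]) (auto intro!: Suc)
qed auto

lemma Ck_bounded_linear: "bounded_linear f ==> Ck m f"
proof (induction m)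
case 0
thus ?case by (simp add: linear_continuous_on)
next
case (Suc m)
show ?case
 by (rule Ck_SucI[where f' = "%z. f"]) (auto intro!: Ck_const bounded_linear_imp_has_derivative Suc)
qed

lemma Ck_add: "Ck m f ==> Ck m g ==> Ck m (%z. f z + g z)"
proof (induction m arbitrary: f g)
case (Suc m)
show ?case
 by (rule Ck_SucI[where f' = "%z v. frechet_derivative f (at z) v + frechet_derivative g (at z) v"])
  (auto intro!: has_derivative_add Ck_frechet Suc)
qed (auto intro!: continuous_intros)

lemma Ck_mult: "Ck m f ==> Ck m g ==> Ck m (%z. f z * g z)"
proof (induction m arbitrary: f g)
case (Suc m)
show ?case
proof (rule Ck_SucI)
 show "((%z. f z * g z) has_derivative
  (%v. f z * frechet_derivative g (at z) v + frechet_derivative f (at z) v * g z)) (at z)" for z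
  by (intro has_derivative_mult Ck_frechet[OF Suc.prems(1)] Ck_frechet[OF Suc.prems(2)])
 show "Ck m (%z. f z * frechet_derivative g (at z) v + frechet_derivative f (at z) v * g z)" for v
  by (intro Ck_add Suc.IH Ck_frechet Suc.prems Ck_Suc_imp[OF Suc.prems(1)] Ck_Suc_imp[OF Suc.prems(2)])
qed
qed (auto intro!: continuous_intros)

lemma Ck_compose:
fixes f :: "real => real"
shows "Ck m f ==> Ck m g ==> Ck m (%z. f (g z))"
proof (induction m arbitrary: f g)
case 0
thus ?case by (auto intro: continuous_on_compose2)
next
case (Suc m)
show ?case
proof (rule Ck_SucI)
 show "((%z. f (g z)) has_derivative
   (%v. frechet_derivative g (at z) v * frechet_derivative f (at (g z)) 1)) (at z)" for z
 proof -
  have lin: "linear (frechet_derivative f (at (g z)))"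
   using Ck_frechet(1)[OF Suc.prems(1)] has_derivative_linear by blast
  have "frechet_derivative f (at (g z)) c = c * frechet_derivative f (at (g z)) 1" for c
   using linear_scale[OF lin, of c 1] unfolding real_scaleR_def mult_1_right .
  hence "(%v. frechet_derivative f (at (g z)) (frechet_derivative g (at z) v)) =
    (%v. frechet_derivative g (at z) v * frechet_derivative f (at (g z)) 1)"
   by blast
  thus ?thesis
   using has_derivative_compose[OF Ck_frechet(1)[OF Suc.prems(2)] Ck_frechet(1)[OF Suc.prems(1)]]
   by (rule has_derivative_eq_rhs[rotated])
 qed
 show "Ck m (%z. frechet_derivative g (at z) v * frechet_derivative f (at (g z)) 1)" for v
  by (intro Ck_mult Suc.IH[where f = "%t. frechet_derivative f (at t) 1"] Ck_frechet Suc.prems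
    Ck_Suc_imp[OF Suc.prems(2)])
qed
qed

lemma Ck_affine:
fixes f :: "'a::euclidean_space => real"
shows "Ck m f ==> Ck m (%z. f (c *. z + w))"
proof (induction m arbitrary: f)
case 0
have "continuous_on UNIV (%z. c *. z + w)" by (intro continuous_intros)
with 0 show ?case
 using continuous_on_compose2[of UNIV f UNIV "%z. c *. z + w"] by simp
next
case (Suc m)
show ?case
proof (rule Ck_SucI)
 show "((%z. f (c *. z + w)) has_derivative
   (%v. c * frechet_derivative f (at (c *. z + w)) v)) (at z)" for z
 proof -
  have lin: "linear (frechet_derivative f (at (c *. z + w)))"
   using Ck_frechet(1)[OF Suc.prems(1)] has_derivative_linear by blast
  have "((%z. f (c *. z + w)) has_derivative
    (%v. frechet_derivative f (at (c *. z + w)) (c *. v))) (at z)"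
   by (rule has_derivative_compose[where g = f and f = "%z. c *. z + w"])
    (auto intro!: derivative_eq_intros Ck_frechet[OF Suc.prems])
  thus ?thesis using linear_scale[OF lin] by simp
 qed
 show "Ck m (%z. c * frechet_derivative f (at (c *. z + w)) v)" for v
  by (intro Ck_mult Ck_const Suc.IH[where f = "%z. frechet_derivative f (at z) v"] Ck_frechet Suc.prems)
qed
qed

text \<open>The inner map changes the last coordinate only, so the chain rule yields two products,
  both within reach of the induction hypothesis. It serves test functions of the form
  \<open>ph (x, sqrt (y^2 + ep))\<close>.\<close>

lemma Ck_graph:
fixes f :: "('a::euclidean_space \<times> real) => real" and g :: "real => real"
shows "Ck m f ==> smooth g ==> Ck m (%z. f (fst z, g (snd z)))"
proof (induction m arbitrary: f)
case 0
hence "continuous_on UNIV g" by (auto simp: smooth_def dest!: spec[of _ 0])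
hence "continuous_on UNIV (%z::'a\<times>real. (fst z, g (snd z)))"
 by (intro continuous_on_Pair continuous_on_compose2[of UNIV g UNIV snd] continuous_on_fst
   continuous_on_snd continuous_on_id) auto
with 0 show ?case
 using continuous_on_compose2[of UNIV f UNIV "%z. (fst z, g (snd z))"] by simp
next
case (Suc m)
have g: "Ck (Suc j) g" for j using Suc.prems unfolding smooth_def by blast
have g': "Ck m (%z::'a\<times>real. frechet_derivative g (at (snd z)) 1)"
 by (rule Ck_compose[of m "%t. frechet_derivative g (at t) 1" snd, OF Ck_frechet(2)[OF g]
    Ck_bounded_linear[OF bounded_linear_snd]])
show ?case
proof (rule Ck_SucI)
 show "((%z. f (fst z, g (snd z))) has_derivative
   (%v. frechet_derivative f (at (fst z, g (snd z))) (fst v, 0) +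
    (snd v * frechet_derivative g (at (snd z)) 1) *
     frechet_derivative f (at (fst z, g (snd z))) (0, 1))) (at z)" for z
 proof -
  let ?f' = "frechet_derivative f (at (fst z, g (snd z)))"
  let ?g' = "frechet_derivative g (at (snd z))"
  have lin: "linear ?f'"
   using Ck_frechet(1)[OF Suc.prems(1)] has_derivative_linear by blast
  have ling: "linear ?g'"
   using Ck_frechet(1)[OF g] has_derivative_linear by blast
  have dg: "((%z::'a\<times>real. g (snd z)) has_derivative (%v. ?g' (snd v))) (at z)"
   by (rule has_derivative_compose[where g = g and f = snd])
    (auto intro!: derivative_eq_intros Ck_frechet(1)[OF g])
  have d: "((%z. f (fst z, g (snd z))) has_derivative (%v. ?f' (fst v, ?g' (snd v)))) (at z)"
   by (rule has_derivative_compose[where g = f and f = "%z. (fst z, g (snd z))"])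
    (auto intro!: derivative_eq_intros dg Ck_frechet(1)[OF Suc.prems(1)])
  have "?f' (fst v, ?g' (snd v)) = ?f' (fst v, 0) + (snd v * ?g' 1) * ?f' (0, 1)" for v
  proof -
   have 1: "?g' (snd v) = snd v * ?g' 1"
    using linear_scale[OF ling, of "snd v" 1] unfolding real_scaleR_def mult_1_right .
   have "(fst v, ?g' (snd v)) = (fst v, 0) + (snd v * ?g' 1) *. (0, 1)"
    unfolding 1 by simp
   thus ?thesis using linear_add[OF lin] linear_scale[OF lin]
    unfolding real_scaleR_def[symmetric] by metis
  qed
  hence "(%v. ?f' (fst v, ?g' (snd v))) =
    (%v. ?f' (fst v, 0) + (snd v * ?g' 1) * ?f' (0, 1))" by blast
  with d show ?thesis by (rule has_derivative_eq_rhs)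
 qed
 show "Ck m (%z. frechet_derivative f (at (fst z, g (snd z))) (fst v, 0) +
    (snd v * frechet_derivative g (at (snd z)) 1) *
     frechet_derivative f (at (fst z, g (snd z))) (0, 1))" for v
  by (intro Ck_add Ck_mult Ck_const g' Suc.prems Ck_frechet
    Suc.IH[where f = "%w. frechet_derivative f (at w) (fst v, 0)"]
    Suc.IH[where f = "%w. frechet_derivative f (at w) (0, 1)"])
qed
qed

lemma smooth_const: "smooth (%z. c)"
and smooth_bounded_linear: "bounded_linear f ==> smooth f"
and smooth_add: "smooth f ==> smooth g ==> smooth (%z. f z + g z)"
and smooth_mult: "smooth f ==> smooth g ==> smooth (%z. f z * g z)"
and smooth_compose: "smooth h ==> smooth f ==> smooth (%z. h (f z))"
and smooth_affine: "smooth f ==> smooth (%z. f (c *. z + w))"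
for f g :: "'a::euclidean_space => real" and h :: "real => real"
unfolding smooth_def
by (blast intro: Ck_const Ck_add Ck_mult Ck_bounded_linear Ck_compose[of _ h f] Ck_affine[of _ f])+

lemma smooth_graph:
"smooth f ==> smooth g ==> smooth (%z::'a::euclidean_space \<times> real. f (fst z, g (snd z)))"
using Ck_graph smooth_def by blast

lemma smooth_diff: "smooth f ==> smooth g ==> smooth (%z. f z - g z)"
using smooth_add[OF _ smooth_mult[OF smooth_const[of "-1"]], of f g] by simp

lemma smooth_prod: "finite I ==> (!!i. i : I ==> smooth (f i)) ==> smooth (%z. \<Prod>i\<in>I. f i z)"
by (induction I rule: finite_induct) (auto intro: smooth_const smooth_mult)

lemma smooth_sum: "finite I ==> (!!i. i : I ==> smooth (f i)) ==> smooth (%z. \<Sum>i\<in>I. f i z)"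
by (induction I rule: finite_induct) (auto intro: smooth_const smooth_add)

lemma smooth_norm2: "smooth (%z::'a::euclidean_space. (norm z)^2)"
proof -
have "smooth (%z::'a. \<Sum>b\<in>Basis. (z \<bullet> b) * (z \<bullet> b))"
 by (intro smooth_sum smooth_mult smooth_bounded_linear bounded_linear_inner_left) auto
thus ?thesis by (simp add: power2_norm_eq_inner euclidean_inner[symmetric])
qed

lemma smooth_real_polynomial_function: "real_polynomial_function q ==> smooth q"
by (induction rule: real_polynomial_function.induct)
 (auto intro: smooth_bounded_linear smooth_const smooth_add smooth_mult)

lemma smooth_frechet:
assumes "smooth f"
shows "(f has_derivative frechet_derivative f (at z)) (at z)"
 and "smooth (%z. frechet_derivative f (at z) v)"
using assms Ck_frechet unfolding smooth_def by blast+

lemma smooth_continuous: "smooth f ==> continuous_on S f"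
unfolding smooth_def by (metis Ck.simps(1) continuous_on_subset subset_UNIV)

lemma has_derivative_grad:
assumes "(f has_derivative f') (at z)"
shows "f' = (%h. grad f z \<bullet> h)"
proof
fix h
have f': "frechet_derivative f (at z) = f'" using assms by (metis frechet_derivative_at)
interpret f': bounded_linear f' using assms has_derivative_bounded_linear by blast
have "f' h = f' (\<Sum>b\<in>Basis. (h \<bullet> b) *. b)" by (simp add: euclidean_representation)
also have "... = (\<Sum>b\<in>Basis. (h \<bullet> b) * f' b)" by (simp add: f'.sum f'.scaleR)
also have "... = grad f z \<bullet> h"
 unfolding grad_def f' inner_sum_left by (simp add: inner_commute[of h] mult.commute)
finally show "f' h = grad f z \<bullet> h" .
qed

lemma grad_unique:
assumes "(f has_derivative (%h. v \<bullet> h)) (at z)"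
shows "grad f z = v"
proof -
have "grad f z \<bullet> h = v \<bullet> h" for h using fun_cong[OF has_derivative_grad[OF assms], of h] by simp
hence "ALL h. h \<bullet> grad f z = h \<bullet> v" by (simp add: inner_commute)
thus ?thesis using vector_eq_ldot[of "grad f z" v] vector_eq_rdot[of "grad f z" v] by blast
qed

lemma smooth_has_derivative: "smooth f ==> (f has_derivative (%h. grad f z \<bullet> h)) (at z)"
using has_derivative_grad[OF smooth_frechet(1)[of f z]] smooth_frechet(1)[of f z] by simp

lemma smooth_grad_inner: "smooth f ==> smooth (%z. grad f z \<bullet> v)"
using smooth_frechet(2)[of f v] has_derivative_grad[OF smooth_frechet(1)[of f]] by simp

lemma continuous_grad: "smooth f ==> continuous_on S (grad f)"
using smooth_continuous[OF smooth_grad_inner]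
by (subst continuous_on_componentwise) auto

section \<open>Smooth cutoffs built from exp(-1/t)\<close>

definition flat :: "real poly => real => real" where
"flat P t = (if 0 < t then poly P (1 / t) * exp (- (1 / t)) else 0)"

lemma poly_exp_tendsto_0: "((%w::real. poly P w * exp (- w)) ---> 0) at_top"
proof -
have "((%w::real. \<Sum>i\<le>degree P. coeff P i * (w ^ i / exp w)) ---> (\<Sum>i\<le>degree P. coeff P i * 0)) at_top"
 by (intro tendsto_intros tendsto_power_div_exp_0)
thus ?thesis
 by (simp add: poly_altdef sum_distrib_right exp_minus divide_inverse mult.assoc)
qed

text \<open>The polynomial factor makes the family closed under differentiation: the derivative of
  P(1/t) exp(-1/t) is t^-2 (P - P')(1/t) exp(-1/t). Smoothness of all members then follows by one
  induction.\<close>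

lemma flat_has_derivative:
"(flat P has_field_derivative flat ([:0, 0, 1:] * (P - pderiv P)) t) (at t)"
proof -
let ?Q = "[:0, 0, 1:] * (P - pderiv P)"
let ?A = "((%h. flat P h / h) ---> 0)"
consider "t > 0" | "t < 0" | "t = 0" by linarith
thus ?thesis
proof cases
 case 1
 have "((%t. poly P (1 / t) * exp (- (1 / t))) has_field_derivative
   flat ?Q t) (at t)"
  using 1 unfolding flat_def
  by (auto intro!: derivative_eq_intros poly_DERIV[THEN DERIV_chain2] simp: field_simps power2_eq_square)
 thus ?thesis
  by (rule has_field_derivative_transform_within_open[where S = "{0<..}"]) (use 1 in \<open>auto simp: flat_def\<close>)
next
 case 2
 have "((%t. 0) has_field_derivative flat ?Q t) (at t)" using 2 by (simp add: flat_def)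
 thus ?thesis
  by (rule has_field_derivative_transform_within_open[where S = "{..<0}"]) (use 2 in \<open>auto simp: flat_def\<close>)
next
 case 3
 have "?A (at_right 0)"
 proof -
  \<comment> \<open>With w = 1/h the right difference quotient at 0 is w P(w) exp(-w).\<close>
  have "((%h. poly ([:0, 1:] * P) (inverse h) * exp (- inverse h)) ---> 0) (at_right (0::real))"
   by (rule filterlim_compose[OF poly_exp_tendsto_0 filterlim_inverse_at_top_right])
  thus ?thesis
   by (rule Lim_transform_eventually)
    (auto simp: flat_def eventually_at_right_less field_simps intro!: eventually_mono[OF eventually_at_right_less])
 qed
 moreover have "?A (at_left 0)"
  by (rule Lim_transform_eventually[OF tendsto_const])
   (auto simp: flat_def eventually_at_filter)
 ultimately have "?A (at 0)"
  using filterlim_split_at by blast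
 thus ?thesis using 3 by (simp add: DERIV_def flat_def)
qed
qed

lemma smooth_flat: "smooth (flat P)"
proof -
have "Ck m (flat P)" for m
proof (induction m arbitrary: P)
 case 0
 show ?case
  by (auto intro!: continuous_at_imp_continuous_on DERIV_isCont flat_has_derivative)
next
 case (Suc m)
 show ?case
 proof (rule Ck_SucI)
  show "(flat P has_derivative (%v. flat ([:0, 0, 1:] * (P - pderiv P)) z * v)) (at z)" for z
   using flat_has_derivative[of P z] unfolding has_field_derivative_def .
  show "Ck m (%z. flat ([:0, 0, 1:] * (P - pderiv P)) z * v)" for v
   by (intro Ck_mult Ck_const Suc)
 qed
qed
thus ?thesis by (simp add: smooth_def)
qed

text \<open>
As \<open>j \<rightarrow> \<infinity>\<close>, \<open>ramp (j t)\<close> increases to the indicator function of \<open>t > 0\<close>: composed with smooth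
functions this yields smooth approximations of the indicator functions of boxes and balls.
\<close>

definition ramp :: "real => real" where "ramp = flat 1"

definition ramp' :: "real => real" where "ramp' = flat ([:0, 0, 1:] * (1 - pderiv 1))"

lemma smooth_ramp: "smooth ramp" unfolding ramp_def by (rule smooth_flat)

lemma ramp_deriv: "(ramp has_field_derivative ramp' t) (at t)"
unfolding ramp_def ramp'_def by (rule flat_has_derivative)

lemma continuous_ramp': "continuous_on A ramp'"
unfolding ramp'_def by (rule smooth_continuous[OF smooth_flat])

lemma ramp_zero [simp]: "t <= 0 ==> ramp t = 0" "t <= 0 ==> ramp' t = 0"
by (auto simp: ramp_def ramp'_def flat_def)

lemma ramp_pos: "0 < t ==> ramp t = exp (- (1 / t))"
by (simp add: ramp_def flat_def)

lemma ramp_bounds: "0 <= ramp t" "ramp t <= 1" "0 <= ramp' t"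
by (auto simp: ramp_def ramp'_def flat_def)

lemma ramp_tendsto:
"(%j. ramp (real (Suc j) * t)) ----> (if 0 < t then 1 else 0)"
proof (cases "0 < t")
case True
have "(%j. exp (- (inverse (real (Suc j)) * (1 / t)))) ----> exp (- (0 * (1 / t)))"
 by (intro tendsto_intros LIMSEQ_inverse_real_of_nat)
moreover have "ramp (real (Suc j) * t) = exp (- (inverse (real (Suc j)) * (1 / t)))" for j
proof -
 have "0 < real (Suc j) * t" using True by simp
 thus ?thesis by (simp add: ramp_pos inverse_eq_divide)
qed
ultimately show ?thesis using True by simp
next
case False
hence "real (Suc j) * t <= 0" for j by (simp add: mult_le_0_iff)
thus ?thesis using False by simp
qed

section \<open>Integration by parts for compactly supported functions\<close>

lemma integrable_continuous_compact_support:
fixes f :: "'a::euclidean_space => 'b::euclidean_space"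
assumes "continuous_on UNIV f" "!!z. R <= norm z ==> f z = 0"
shows "integrable lborel f"
proof -
have "integrable lborel (%x. ind (cball 0 R) x *. f x)"
 by (rule borel_integrable_compact) (auto intro: continuous_on_subset assms)
moreover have "ind (cball 0 R) x *. f x = f x" for x
 using assms(2)[of x] by (auto simp: indicator_def)
ultimately show ?thesis by simp
qed

text \<open>Outside the closed ball \<open>f\<close> vanishes locally; on the sphere the gradient
  vanishes by continuity, the point being a limit of outer points reached by moving radially. The
  centre, which can occur for \<open>R <= 0\<close>, has no radial direction and is moved along a
  basis vector.\<close>

lemma smooth_grad_eq_0:
assumes "smooth f" "!!z. R <= norm z ==> f z = 0" "R <= norm z"
shows "grad f z = 0"
proof (rule ccontr)
assume nz: "grad f z ~= 0"
have "continuous (at z) (grad f)"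
 using continuous_grad[OF assms(1), of UNIV] by (simp add: continuous_on_eq_continuous_at)
hence "eventually (%w. grad f w ~= 0) (at z)"
 using nz by (simp add: continuous_at tendsto_imp_eventually_ne)
moreover have "eventually (%w. grad f w ~= 0 --> norm w <= R) (at z)"
proof (rule always_eventually, intro allI impI)
 fix w assume "grad f w ~= 0"
 show "norm w <= R"
 proof (rule ccontr)
  assume "~ norm w <= R"
  hence w: "w : {w. R < norm w}" by auto
  have "open {w::'a. R < norm w}" by (intro open_Collect_less continuous_intros)
  from this w have "(f has_derivative (%h. 0)) (at w)"
   by (rule has_derivative_transform_within_open[OF has_derivative_const]) (auto simp: assms(2))
  hence "(f has_derivative (%h. 0 \<bullet> h)) (at w)" by simp
  thus False using grad_unique \<open>grad f w ~= 0\<close> by blast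
 qed
qed
ultimately have "eventually (%w. norm w <= R) (at z)"
 by eventually_elim auto
then obtain d where d: "d > 0" "!!w. w ~= z ==> dist w z < d ==> norm w <= R"
 unfolding eventually_at by auto
show False
proof (cases "z = 0")
 case True
 obtain b :: 'a where "b : Basis" using nonempty_Basis by blast
 hence "norm ((d/2) *. b) = d / 2" using d(1) by simp
 moreover have "dist ((d/2) *. b) z = norm ((d/2) *. b)" using True by simp
 moreover have "(d/2) *. b ~= z" using True d(1) \<open>b : Basis\<close> by auto
 ultimately have "d / 2 <= R" using d(2)[of "(d/2) *. b"] d(1) by simp
 thus False using d(1) True assms(3) by simp
next
 case False
 define w where "w = (1 + d / (2 * norm z)) *. z"
 have "dist w z = d / 2" using False d(1) unfolding w_def dist_norm
  by (simp add: algebra_simps)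
 moreover have "norm w = norm z + d / 2"
  using False d(1) unfolding w_def by (simp add: field_simps)
 moreover have "w ~= z" using \<open>dist w z = d / 2\<close> d(1) by auto
 ultimately show False using d(2)[of w] d(1) assms(3) by auto
qed
qed

text \<open>The directional derivative is the limit of difference quotients, and each of these has
  integral 0 because the Lebesgue measure is translation invariant. The mean value inequality
  supplies a bounded majorant with compact support.\<close>

lemma integral_grad_compact_support:
fixes f :: "'a::euclidean_space => real"
assumes f: "smooth f" "!!z. R <= norm z ==> f z = 0"
shows "(LINT z|lborel. grad f z \<bullet> v) = 0"
proof -
let ?A = "(cball 0 (\<bar>R\<bar> + norm v))"
let ?B = "(LINT z|lborel. f z)"
let ?C = "(LINT z|lborel. grad f z \<bullet> v)"
\<comment> \<open>Large enough to contain the points of \<open>?A\<close> together with their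
  translates by at most \<open>v\<close>, on which the Lipschitz bound is used.\<close>
define S where "S = cball (0::'a) (\<bar>R\<bar> + 2 * norm v)"
have "continuous_on S (%z. norm (grad f z))" by (intro continuous_intros continuous_grad f)
hence "bounded ((%z. norm (grad f z)) ` S)"
 unfolding S_def by (intro compact_imp_bounded compact_continuous_image) auto
then obtain L where L: "!!z. z : S ==> norm (grad f z) <= L" "0 < L"
 by (auto simp: bounded_pos)
define g where "g n z = (f (z + inverse (real (Suc n)) *. v) - f z) * real (Suc n)" for n z
have int: "integrable lborel f"
 by (rule integrable_continuous_compact_support[of _ R]) (auto intro: smooth_continuous f)
have tr: "integrable lborel (%z. f (z + w))" "(LINT z|lborel. f (z + w)) = ?B" for w
proof -
 have "lborel = distr lborel borel ((+) w)" by (rule lborel_distr_plus[symmetric])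
 hence "integrable (distr lborel borel ((+) w)) f" "integral\<^sup>L (distr lborel borel ((+) w)) f = ?B"
  using int by auto
 moreover have "f : bmeas borel" using int by auto
 ultimately show "integrable lborel (%z. f (z + w))" "(LINT z|lborel. f (z + w)) = ?B"
  by (auto simp: integrable_distr_eq integral_distr add.commute)
qed
have 0: "(LINT z|lborel. g n z) = 0" for n
 unfolding g_def using tr int by (simp add: Bochner_Integration.integral_diff)
have "(%n. LINT z|lborel. g n z) ----> ?C"
proof (rule integral_dominated_convergence[where w = "%z. ind ?A z *. (L * norm v)"])
 have fm[measurable]: "f : bmeas borel"
  using smooth_continuous[OF f(1), of UNIV] by (rule borel_measurable_continuous_onI)
 have "grad f : bmeas borel"
  using continuous_grad[OF f(1), of UNIV] by (rule borel_measurable_continuous_onI)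
 thus "(%z. grad f z \<bullet> v) : bmeas lborel" by simp
 show "g n : bmeas lborel" for n unfolding g_def by measurable
 show "integrable lborel (%z::'a. ind ?A z *. (L * norm v))"
  by (rule borel_integrable_compact) auto
 show "AE z in lborel. (%n. g n z) ----> grad f z \<bullet> v"
 proof (rule AE_I2)
  fix z
  have "((%t. f (z + t *. v)) has_real_derivative grad f z \<bullet> v) (at 0)"
  proof -
   have "((%t. f (z + t *. v)) has_derivative (%t. grad f (z + 0 *. v) \<bullet> (t *. v))) (at 0)"
    by (rule has_derivative_compose[where g = f and f = "%t. z + t *. v"])
     (auto intro!: derivative_eq_intros smooth_has_derivative f)
   thus ?thesis by (simp add: has_field_derivative_def mult_commute_abs)
  qed
  hence "((%h. (f (z + h *. v) - f z) / h) ---> grad f z \<bullet> v) (at 0)"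
   by (simp add: DERIV_def)
  hence "(%n. (f (z + inverse (real (Suc n)) *. v) - f z) / inverse (real (Suc n))) ----> grad f z \<bullet> v"
   using LIMSEQ_inverse_real_of_nat by (auto simp: tendsto_at_iff_sequentially comp_def)
  thus "(%n. g n z) ----> grad f z \<bullet> v"
   by (simp add: g_def divide_inverse)
 qed
 show "AE z in lborel. norm (g n z) <= ind ?A z *. (L * norm v)" for n
 proof (rule AE_I2)
  fix z :: 'a
  let ?e = "inverse (real (Suc n))"
  have e: "0 < ?e" "?e <= 1" by (auto simp: field_simps)
  have ev: "norm (?e *. v) <= norm v"
   using mult_right_mono[OF e(2), of "norm v"] by simp
  show "norm (g n z) <= ind ?A z *. (L * norm v)"
  proof (cases "norm z <= \<bar>R\<bar> + norm v")
   case True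
   have "norm (z + ?e *. v) <= \<bar>R\<bar> + 2 * norm v" "norm z <= \<bar>R\<bar> + 2 * norm v"
    using True ev norm_triangle_ineq[of z "?e *. v"] norm_ge_zero[of v] by linarith+
   hence "z + ?e *. v : S" "z : S" unfolding S_def mem_cball_0 by auto
   hence "norm (f (z + ?e *. v) - f z) <= L * norm ((z + ?e *. v) - z)"
   proof (rule differentiable_bound[where f' = "%x h. grad f x \<bullet> h" and S = S, rotated 3])
    show "convex S" unfolding S_def by simp
   next
    fix x assume "x : S"
    show "(f has_derivative (%h. grad f x \<bullet> h)) (at x within S)"
     using smooth_has_derivative[OF f(1)] has_derivative_at_withinI by blast
   next
    fix x assume "x : S"
    hence "norm (grad f x) * norm h <= L * norm h" for h
     using L by (intro mult_right_mono) auto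
    hence "norm (grad f x \<bullet> h) <= L * norm h" for h
     using order_trans[OF Cauchy_Schwarz_ineq2] by (metis real_norm_def)
    thus "onorm (%h. grad f x \<bullet> h) <= L" by (rule onorm_le)
   qed
   hence "\<bar>f (z + ?e *. v) - f z\<bar> * real (Suc n) <= (?e * norm v * L) * real (Suc n)"
    by (intro mult_right_mono) (auto simp: mult.commute)
   also have "... = L * norm v" by (simp add: field_simps)
   finally show ?thesis using True by (simp add: g_def abs_mult del: of_nat_Suc)
  next
   case False
   hence "norm (z + ?e *. v) >= R" "norm z >= R"
    using ev norm_triangle_ineq2[of z "- (?e *. v)"] norm_ge_zero[of v]
    unfolding norm_minus_cancel diff_minus_eq_add by linarith+
   thus ?thesis using False f(2) by (simp add: g_def)
  qed
 qed
qed
hence "(%n::nat. 0) ----> ?C" unfolding 0 .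
thus ?thesis using LIMSEQ_unique[OF _ tendsto_const] by blast
qed

lemma grad_mult:
assumes "smooth f" "smooth g"
shows "grad (%z. f z * g z) z = f z *. grad g z + g z *. grad f z"
proof (rule grad_unique)
show "((%z. f z * g z) has_derivative (%h. (f z *. grad g z + g z *. grad f z) \<bullet> h)) (at z)"
 using has_derivative_mult[OF smooth_has_derivative[OF assms(1)] smooth_has_derivative[OF assms(2)]]
 by (simp add: algebra_simps inner_add_left)
qed

lemma grad_diff:
assumes "smooth f" "smooth g"
shows "grad (%z. f z - g z) z = grad f z - grad g z"
proof (rule grad_unique)
show "((%z. f z - g z) has_derivative (%h. (grad f z - grad g z) \<bullet> h)) (at z)"
 using has_derivative_diff[OF smooth_has_derivative[OF assms(1)] smooth_has_derivative[OF assms(2)]]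
 by (simp add: inner_diff_left)
qed

lemma integral_by_parts:
fixes f g :: "'a::euclidean_space => real"
assumes "smooth f" "smooth g" "!!z. R <= norm z ==> g z = 0"
shows "(LINT z|lborel. g z * (grad f z \<bullet> v)) = - (LINT z|lborel. f z * (grad g z \<bullet> v))"
proof -
have "(LINT z|lborel. grad (%z. f z * g z) z \<bullet> v) = 0"
 using assms by (intro integral_grad_compact_support[of _ R]) (auto intro: smooth_mult)
moreover have "integrable lborel (%z. f z * (grad g z \<bullet> v))"
 using assms smooth_grad_eq_0[OF assms(2,3)]
 by (intro integrable_continuous_compact_support[of _ R] continuous_intros smooth_continuous continuous_grad) auto
moreover have "integrable lborel (%z. g z * (grad f z \<bullet> v))"
 using assms
 by (intro integrable_continuous_compact_support[of _ R] continuous_intros smooth_continuous continuous_grad) auto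
ultimately show ?thesis
 by (simp add: grad_mult assms inner_add_left)
qed

subsection \<open>Weighted Sobolev functions\<close>

definition wt :: "real => ('a::euclidean_space \<times> real) set => ('a \<times> real) measure" where
"wt a S = density (restrict_space lborel S) (%z. ennreal (snd z powr a))"

abbreviation hwt :: "real => real => ('n::finite) point measure" where "hwt a r == wt a (half_ball r)"

lemma space_wt [simp]: "space (wt a S) = S"
and sets_wt: "sets (wt a S) = sets (restrict_space borel S)"
by (auto simp: wt_def space_restrict_space sets_restrict_space)

lemma measurable_wt: "measurable (wt a S) M = measurable (restrict_space borel S) M"
by (rule measurable_cong_sets) (auto simp: sets_wt)

lemma borel_measurable_wt_iff:
fixes f :: "_ => 'b::real_normed_vector"
shows "S : sets borel ==>
 f : bmeas (wt a S) \<longleftrightarrow> (%z. ind S z *. f z) : bmeas borel"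
unfolding measurable_wt by (subst borel_measurable_restrict_space_iff) auto

lemma continuous_on_measurable_wt:
"continuous_on S f ==> f : bmeas (wt a S)"
for f :: "_ => 'b::topological_space"
unfolding measurable_wt by (rule borel_measurable_continuous_on_restrict)

lemma borel_measurable_wtI: "f : bmeas borel ==> f : bmeas (wt a S)"
unfolding measurable_wt by (rule measurable_restrict_space1)

lemma measurable_snd_powr [measurable]:
"(%z::'a::euclidean_space \<times> real. snd z powr a) : bmeas borel"
proof -
have [measurable]: "(snd :: 'a \<times> real => real) : bmeas borel"
 by (intro borel_measurable_continuous_onI continuous_intros)
show ?thesis by measurable
qed

lemma nn_integral_wt:
assumes "S : sets borel" "f : bmeas (wt a S)"
shows "(\<integral>\<^sup>+z. f z \<partial>wt a S) = (\<integral>\<^sup>+z\<in>S. (ennreal (snd z powr a) * f z) \<partial>lborel)"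
proof -
have "(\<integral>\<^sup>+z. f z \<partial>wt a S) = (\<integral>\<^sup>+z. ennreal (snd z powr a) * f z \<partial>restrict_space lborel S)"
 unfolding wt_def using assms(2)
 by (intro nn_integral_density) (auto simp: measurable_wt cong: measurable_cong_sets
   intro!: measurable_restrict_space1)
also have "... = (\<integral>\<^sup>+z\<in>S. (ennreal (snd z powr a) * f z) \<partial>lborel)"
 using assms(1) by (subst nn_integral_restrict_space) auto
finally show ?thesis .
qed

lemma integral_wt:
fixes f :: "_ => 'b::{banach, second_countable_topology}"
assumes "S : sets borel" "f : bmeas (wt a S)"
shows "(\<integral>z. f z \<partial>wt a S) = (LINT z:S|lborel. snd z powr a *. f z)"
proof -
have "(\<integral>z. f z \<partial>wt a S) = (\<integral>z. snd z powr a *. f z \<partial>restrict_space lborel S)"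
 unfolding wt_def using assms(2)
 by (intro integral_density) (auto simp: measurable_wt cong: measurable_cong_sets
   intro!: measurable_restrict_space1)
also have "... = (LINT z:S|lborel. snd z powr a *. f z)"
 unfolding set_lebesgue_integral_def using assms(1) by (subst integral_restrict_space) auto
finally show ?thesis .
qed

lemma integrable_wt_iff:
fixes f :: "_ => 'b::{banach, second_countable_topology}"
assumes "S : sets borel" "f : bmeas (wt a S)"
shows "integrable (wt a S) f \<longleftrightarrow> set_integrable lborel S (%z. snd z powr a *. f z)"
proof -
let ?A = "(%z. snd z powr a *. f z)"
have "integrable (wt a S) f \<longleftrightarrow> integrable (restrict_space lborel S) ?A"
 unfolding wt_def using assms(2)
 by (intro integrable_density) (auto simp: measurable_wt cong: measurable_cong_sets
   intro!: measurable_restrict_space1)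
also have "... \<longleftrightarrow> set_integrable lborel S ?A"
 using assms(1) by (subst integrable_restrict_space) (auto simp: set_integrable_def)
finally show ?thesis .
qed

lemma AE_wt_iff:
assumes "S : sets borel" "!!z. z : S ==> 0 < snd z"
shows "(AE z in wt a S. P z) \<longleftrightarrow> (AE z in lborel. z : S --> P z)"
proof -
have "(AE z in wt a S. P z) \<longleftrightarrow> (AE z in restrict_space lborel S. 0 < ennreal (snd z powr a) --> P z)"
 unfolding wt_def by (rule AE_density) (auto intro!: measurable_restrict_space1)
also have "... \<longleftrightarrow> (AE z in lborel. z : S --> 0 < ennreal (snd z powr a) --> P z)"
 using assms(1) by (subst AE_restrict_space_iff) auto
also have "... \<longleftrightarrow> (AE z in lborel. z : S --> P z)"
 using assms(2) by (intro AE_cong) (fastforce simp: ennreal_zero_less_mult_iff)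
finally show ?thesis .
qed

lemma open_half_ball: "open (half_ball r :: ('a::finite) point set)"
proof -
have "half_ball r = {z::'a point. 0 < snd z} \<inter> {z. norm z < r}" by (auto simp: half_ball_def)
moreover have "open {z::'a point. 0 < snd z}" "open {z::'a point. norm z < r}"
 by (intro open_Collect_less continuous_intros)+
ultimately show ?thesis by (simp add: open_Int)
qed

lemma half_ball_borel [measurable, simp]: "half_ball r : sets borel"
using open_half_ball by (rule borel_open)

lemma half_ballD: "z : half_ball r ==> 0 < snd z" "z : half_ball r ==> norm z < r"
by (auto simp: half_ball_def)

lemma half_ball_mono: "r <= s ==> half_ball r <= half_ball s"
by (auto simp: half_ball_def)

lemma nn_integral_powr_finite:
assumes "-1 < a" "0 <= r"
shows "(\<integral>\<^sup>+y\<in>{0<..<r}. ennreal (y powr a) \<partial>lborel) = ennreal (r powr (a + 1) / (a + 1))"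
proof -
let ?A = "(\<integral>\<^sup>+y\<in>{0..r}. ennreal (y powr a) \<partial>lborel)"
have "((%y. y powr a) has_integral (r powr (a + 1) / (a + 1))) {0..r}"
 by (rule has_integral_powr_from_0) (use assms in auto)
hence "?A = ennreal (r powr (a + 1) / (a + 1))"
 by (intro nn_integral_has_integral_lebesgue') auto
moreover have "?A = (\<integral>\<^sup>+y\<in>{0<..<r}. ennreal (y powr a) \<partial>lborel)"
proof (rule nn_integral_cong_AE)
 have "AE y in lborel. y ~= 0 & y ~= r"
  using AE_lborel_singleton[of 0] AE_lborel_singleton[of r] by eventually_elim auto
 thus "AE y in lborel. ennreal (y powr a) * ind {0..r} y = ennreal (y powr a) * ind {0<..<r} y"
  by eventually_elim (auto simp: indicator_def)
qed
ultimately show ?thesis by simp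
qed

text \<open>The half ball lies in the cylinder over a ball of the same radius, where Tonelli
  separates the variables.\<close>

lemma nn_integral_half_ball_le:
assumes f: "f : bmeas borel" and "0 <= r"
shows "(\<integral>\<^sup>+z\<in>half_ball r. f (snd z) \<partial>(lborel :: ('n::finite) point measure)) <=
 emeasure (lborel :: (real ^ 'n) measure) (cball 0 r) * (\<integral>\<^sup>+y\<in>{0<..<r}. f y \<partial>lborel)"
proof -
let ?A = "(%z::'n point. ind (cball 0 r) (fst z) * (f (snd z) * ind {0<..<r} (snd z)))"
have [measurable]: "f : bmeas borel" by fact
have "(\<integral>\<^sup>+z\<in>half_ball r. f (snd z) \<partial>(lborel :: 'n point measure)) <=
 (\<integral>\<^sup>+z. ind (cball 0 r) (fst z) * (f (snd z) * ind {0<..<r} (snd z)) \<partial>(lborel :: 'n point measure))"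
proof (rule nn_integral_mono)
 fix z :: "'n point"
 show "f (snd z) * ind (half_ball r) z
  <= ind (cball 0 r) (fst z) * (f (snd z) * ind {0<..<r} (snd z))"
  using norm_fst_le[of "fst z" "snd z"] norm_snd_le[of "snd z" "fst z"]
  by (auto simp: indicator_def half_ball_def)
qed
also have "... = (\<integral>\<^sup>+x. \<integral>\<^sup>+y. ind (cball 0 r) x * (f y * ind {0<..<r} y) \<partial>lborel \<partial>(lborel :: (real ^ 'n) measure))"
proof -
 have [measurable]: "cball (0::real ^ 'n) r : sets borel" "{0<..<r} : sets borel" by auto
 have "?A
   : bmeas (borel \<Otimes>\<^sub>M borel)" by measurable
 hence "?A
   : bmeas lborel2" by (simp cong: measurable_cong_sets sets_pair_measure_cong)
 thus ?thesis unfolding lborel_prod[symmetric] by (subst lborel.nn_integral_fst[symmetric]) auto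
qed
also have "... = emeasure (lborel :: (real ^ 'n) measure) (cball 0 r) * (\<integral>\<^sup>+y\<in>{0<..<r}. f y \<partial>lborel)"
 by (simp add: nn_integral_cmult) (subst nn_integral_multc; simp add: borel_measurable_indicator borel_closed)
finally show ?thesis .
qed

lemma finite_measure_wt:
assumes "-1 < a"
shows "finite_measure (wt a (half_ball r :: ('n::finite) point set))"
proof (rule finite_measureI)
let ?A = "(half_ball r :: 'n point set)"
have "emeasure (wt a ?A) (space (hwt a r)) =
  (\<integral>\<^sup>+z. 1 \<partial>wt a ?A)" by simp
also have "... = (\<integral>\<^sup>+z\<in>half_ball r. ennreal (snd z powr a) \<partial>(lborel :: 'n point measure))"
 by (subst nn_integral_wt) auto
also have "... <= (\<integral>\<^sup>+z\<in>half_ball \<bar>r\<bar>. ennreal (snd z powr a) \<partial>(lborel :: 'n point measure))"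
 by (intro nn_integral_mono mult_left_mono) (auto simp: indicator_def half_ball_def)
also have "... <= emeasure (lborel :: (real ^ 'n) measure) (cball 0 \<bar>r\<bar>) *
  (\<integral>\<^sup>+y\<in>{0<..<\<bar>r\<bar>}. ennreal (y powr a) \<partial>lborel)"
 by (rule nn_integral_half_ball_le[of "%y. ennreal (y powr a)"]) auto
also have "... < \<infinity>"
 using assms emeasure_bounded_finite[OF bounded_cball, of "0 :: real ^ 'n" "\<bar>r\<bar>"]
 by (auto simp: nn_integral_powr_finite ennreal_mult_less_top)
finally show "emeasure (hwt a r) (space (wt a ?A)) ~= \<infinity>" by auto
qed

text \<open>Cauchy-Schwarz applied to \<open>F n - f\<close> against \<open>w\<close>. This is the
  common device for passing to the limit in bilinear expressions; neither \<open>F n\<close> nor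
  \<open>f\<close> has to be square integrable by itself, only their difference tends to 0 in the
  mean square.\<close>

lemma L2_pairing:
fixes f :: "'a => 'b::euclidean_space"
assumes meas: "!!n. F n : bmeas M" "f : bmeas M" "w : bmeas M"
 and lim: "(%n. \<integral>\<^sup>+x. ennreal ((norm (F n x - f x))^2) \<partial>M) ----> 0"
 and fin: "(\<integral>\<^sup>+x. ennreal ((norm (w x))^2) \<partial>M) < \<infinity>"
 and int: "!!n. integrable M (%x. F n x \<bullet> w x)"
shows "integrable M (%x. f x \<bullet> w x)"
 and "(%n. \<integral>x. F n x \<bullet> w x \<partial>M) ----> (\<integral>x. f x \<bullet> w x \<partial>M)"
proof -
let ?A = "(\<integral>x. f x \<bullet> w x \<partial>M)"
let ?B = "%n. (\<integral>x. (F n x - f x) \<bullet> w x \<partial>M)"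
let ?C = "%n. (\<integral>\<^sup>+x. ennreal (norm (F n x - f x)) * ennreal (norm (w x)) \<partial>M)"
note [measurable] = meas
define A where "A n = (\<integral>\<^sup>+x. ennreal ((norm (F n x - f x))^2) \<partial>M)" for n
define W where "W = (\<integral>\<^sup>+x. ennreal ((norm (w x))^2) \<partial>M)"
define D where "D n = (\<integral>\<^sup>+x. ennreal (norm ((F n x - f x) \<bullet> w x)) \<partial>M)" for n
have D: "(D n)^2 <= A n * W" for n
proof -
 have "D n <= (?C n)"
  unfolding D_def using Cauchy_Schwarz_ineq2
  by (intro nn_integral_mono) (auto simp: ennreal_mult[symmetric])
 hence "(D n)^2 <= (?C n)^2"
  by (intro power_mono) auto
 also have "... <= (\<integral>\<^sup>+x. (ennreal (norm (F n x - f x)))^2 \<partial>M) * (\<integral>\<^sup>+x. (ennreal (norm (w x)))^2 \<partial>M)"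
  by (rule Cauchy_Schwarz_nn_integral) auto
 also have "... = A n * W" by (simp add: A_def W_def ennreal_power)
 finally show ?thesis .
qed
have A: "A ----> 0" using lim unfolding A_def .
have "W < top" using fin unfolding W_def by simp
hence "(%n. W * A n) ----> W * 0" using A by (rule ennreal_tendsto_cmult)
hence AW: "(%n. W * A n) ----> 0" by simp
have D2: "(%n. (D n)^2) ----> 0"
 by (rule tendsto_sandwich[OF _ _ tendsto_const AW]) (simp_all add: D mult.commute[of W])
have Dlim: "!!e. 0 < e ==> \<forall>\<^sub>F n in sequentially. D n < ennreal e"
proof -
 fix e :: real assume "0 < e"
 hence "\<forall>\<^sub>F n in sequentially. (D n)^2 < ennreal (e^2)"
  by (intro order_tendstoD(2)[OF D2]) auto
 thus "\<forall>\<^sub>F n in sequentially. D n < ennreal e"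
 proof eventually_elim
  case (elim n)
  show ?case
  proof (rule ccontr)
   assume "~ D n < ennreal e"
   hence "ennreal e ^ 2 <= (D n)^2" by (intro power_mono) auto
   thus False using elim \<open>0 < e\<close> by (simp add: ennreal_power)
  qed
 qed
qed
have intD: "integrable M (%x. (F n x - f x) \<bullet> w x)" if "D n < ennreal e" for n e
 using that unfolding D_def by (intro integrableI_bounded) (auto intro: order.strict_trans)
\<comment> \<open>One index at finite distance is enough for integrability:
  \<open>f \<bullet> w\<close> differs from \<open>F n0 \<bullet> w\<close> by an integrable
  function.\<close>
obtain n0 where "D n0 < ennreal 1" using Dlim[of 1] eventually_happens by force
from Bochner_Integration.integrable_diff[OF int[of n0] intD[OF this]] show i: "integrable M (%x. f x \<bullet> w x)"
 by (simp add: inner_diff_left)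
show "(%n. \<integral>x. F n x \<bullet> w x \<partial>M) ----> ?A"
proof (rule tendstoI)
 fix e :: real assume "0 < e"
 from Dlim[OF this] show "\<forall>\<^sub>F n in sequentially. dist (\<integral>x. F n x \<bullet> w x \<partial>M) ?A < e"
 proof eventually_elim
  case (elim n)
  have "ennreal (norm (?B n)) <= D n"
   unfolding D_def by (rule integral_norm_bound_ennreal) (rule intD[OF elim])
  hence "norm (?B n) < e"
   using elim \<open>0 < e\<close> by (metis ennreal_less_iff norm_ge_zero order.strict_trans1)
  moreover have "(?B n) = (\<integral>x. F n x \<bullet> w x \<partial>M) - ?A"
   using int i by (simp add: inner_diff_left)
  ultimately show ?case by (simp add: dist_norm)
 qed
qed
qed

section \<open>Weak derivatives and uniqueness of the gradient\<close>

lemma H1a_tendsto_iff: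
fixes u :: "('a::finite) point => real"
assumes "!!n. smooth (ph n)"
shows "H1a_tendsto a r ph u F \<longleftrightarrow>
 u : bmeas (hwt a r) & F : bmeas (hwt a r) &
 (%n. \<integral>\<^sup>+z. ennreal ((norm (grad (ph n) z - F z))^2 + (ph n z - u z)^2) \<partial>hwt a r) ----> 0"
proof -
let ?A = "(hwt a r)"
let ?B = "%n z. (norm (grad (ph n) z - F z))^2 + (ph n z - u z)^2"
have m: "grad (ph n) : bmeas ?A" "ph n : bmeas ?A" for n
 using assms by (auto intro!: continuous_on_measurable_wt continuous_grad smooth_continuous)
have eq: "(\<integral>\<^sup>+z. ennreal (?B n z) \<partial>hwt a r) =
  (\<integral>\<^sup>+z\<in>half_ball r. ennreal (snd z powr a * (?B n z)) \<partial>lborel)"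
 if "u : bmeas ?A" "F : bmeas ?A" for n
 using m that by (subst nn_integral_wt) (auto simp: ennreal_mult)
have iff: "set_borel_measurable lborel (half_ball r) h \<longleftrightarrow> h : bmeas ?A"
 for h :: "'a point => 'b::real_normed_vector"
 unfolding set_borel_measurable_def borel_measurable_wt_iff[OF half_ball_borel] by simp
show ?thesis
 unfolding H1a_tendsto_def iff using eq by (simp cong: conj_cong)
qed

lemma H1a_tendsto_L2:
assumes "!!n. smooth (ph n)" "H1a_tendsto a r ph u F"
shows "(%n. \<integral>\<^sup>+z. ennreal ((norm (grad (ph n) z - F z))^2) \<partial>hwt a r) ----> 0"
 and "(%n. \<integral>\<^sup>+z. ennreal ((norm (ph n z - u z))^2) \<partial>hwt a r) ----> 0"
proof -
have lim: "(%n. \<integral>\<^sup>+z. ennreal ((norm (grad (ph n) z - F z))^2 + (ph n z - u z)^2) \<partial>hwt a r) ----> 0"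
 using assms H1a_tendsto_iff by blast
show "(%n. \<integral>\<^sup>+z. ennreal ((norm (grad (ph n) z - F z))^2) \<partial>hwt a r) ----> 0"
 "(%n. \<integral>\<^sup>+z. ennreal ((norm (ph n z - u z))^2) \<partial>hwt a r) ----> 0"
 by ((rule tendsto_sandwich[OF _ _ tendsto_const lim];
   intro always_eventually allI; auto intro!: nn_integral_mono ennreal_leI)+)
qed

text \<open>Integration by parts holds for the smooth approximants and survives the limit, since the
  weighted L2 convergence may be paired with y^-a times a function supported in the compact set
  \<open>K\<close>, which stays away from y = 0.\<close>

lemma H1a_weak_derivative:
fixes u :: "('n::finite) point => real"
assumes a: "-1 < a" and "is_H1a_grad a r u F"
 and be: "smooth be" and K: "compact K" "K <= half_ball r" "!!z. z \<notin> K ==> be z = 0"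
shows "integrable lborel (%z. be z * (F z \<bullet> v))"
 and "(LINT z|lborel. be z * (F z \<bullet> v)) = - (LINT z|lborel. u z * (grad be z \<bullet> v))"
proof -
let ?M = "wt a (half_ball r :: 'n point set)"
let ?A = "%z R g. snd z powr - a *. g z"
let ?B = "%z. grad be z \<bullet> v"
let ?C = "%R g. (%z. snd z powr - a *. g z)"
let ?D = "%R g. (\<integral>\<^sup>+z. ennreal ((norm (?A z R g))^2) \<partial>?M)"
let ?E = "%z R. be z *. v"
interpret finite_measure ?M using a by (rule finite_measure_wt)
obtain ph where ph: "!!n. smooth (ph n)" and lim: "H1a_tendsto a r ph u F"
 using assms(2) unfolding is_H1a_grad_def by blast
have mu: "u : bmeas ?M" "F : bmeas ?M"
 using lim H1a_tendsto_iff[OF ph] by auto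
have gK: "grad be z = 0" if "z \<notin> K" for z
proof (rule grad_unique)
 have "open (- K)" using K by (simp add: compact_imp_closed open_Compl)
 hence "(be has_derivative (%h. 0)) (at z)"
  by (rule has_derivative_transform_within_open[OF has_derivative_const]) (use that K in auto)
 thus "(be has_derivative (%h. 0 \<bullet> h)) (at z)" by simp
qed
have pos: "0 < snd z" if "z : K" for z using K that half_ballD by blast
text \<open>Dividing by the weight is harmless, since the weight is bounded below on \<open>K\<close>.\<close>
have conv: "integrable lborel (%z. f z \<bullet> g z)"
  "(LINT z|lborel. f z \<bullet> g z) = (\<integral>z. f z \<bullet> (?A z R g) \<partial>?M)"
 if "!!n. smooth (ph n)" and gm: "continuous_on UNIV g" "!!z. z \<notin> K ==> g z = 0"
  and fm: "f : bmeas ?M"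
  and fi: "integrable ?M (%z. f z \<bullet> (?A z R g))"
 for f g :: "'n point => 'c::euclidean_space"
proof -
 have m: "(%z. f z \<bullet> (?A z R g)) : bmeas ?M"
  using fi by auto
 have eq: "ind (half_ball r) z *. (snd z powr a *. (f z \<bullet> (?A z R g))) = f z \<bullet> g z" for z
 proof (cases "z : K")
  case True
  hence "z : half_ball r" "snd z ~= 0" using pos[OF True] K by auto
  thus ?thesis by (simp add: mult.assoc[symmetric] powr_add[symmetric])
 next
  case False thus ?thesis using gm by simp
 qed
 show "integrable lborel (%z. f z \<bullet> g z)"
  using fi unfolding integrable_wt_iff[OF half_ball_borel m] set_integrable_def eq .
 show "(LINT z|lborel. f z \<bullet> g z) = (\<integral>z. f z \<bullet> (?A z R g) \<partial>?M)"
  unfolding integral_wt[OF half_ball_borel m] set_lebesgue_integral_def eq ..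
qed
have bnd: "EX C. ALL z. norm (?A z R g) <= C"
 if gm: "continuous_on UNIV g" "!!z. z \<notin> K ==> g z = 0" for g :: "'n point => 'c::euclidean_space"
proof -
 have "continuous_on K (?C R g)"
  using pos by (intro continuous_intros continuous_on_subset[OF gm(1)]) fastforce+
 hence "bounded ((?C R g) ` K)"
  using K by (intro compact_imp_bounded compact_continuous_image)
 then obtain C where C: "!!z. z : K ==> norm (?A z R g) <= C"
  unfolding bounded_iff by blast
 have "norm (?A z R g) <= \<bar>C\<bar>" for z
  using C[of z] gm(2)[of z] by (cases "z : K") auto
 thus ?thesis by blast
qed
have lim_gen: "integrable lborel (%z. f z \<bullet> g z) &
  (%n. LINT z|lborel. Fn n z \<bullet> g z) ----> (LINT z|lborel. f z \<bullet> g z)"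
 if gm: "continuous_on UNIV g" "!!z. z \<notin> K ==> g z = 0"
  and Fn: "!!n. continuous_on UNIV (Fn n)" and fm: "f : bmeas ?M"
  and L: "(%n. \<integral>\<^sup>+z. ennreal ((norm (Fn n z - f z))^2) \<partial>?M) ----> 0"
 for f g :: "'n point => 'c::euclidean_space" and Fn
proof -
 obtain C where C: "!!z. norm (?A z R g) <= C" using bnd[OF gm] by blast
 have Fm: "Fn n : bmeas ?M" for n
  by (rule borel_measurable_wtI) (rule borel_measurable_continuous_onI[OF Fn])
 have wm: "(?C R g) : bmeas ?M"
  by (rule borel_measurable_wtI) (use borel_measurable_continuous_onI[OF gm(1)] in measurable)
 have wf: "(?D R g) < \<infinity>"
 proof -
  have "(?D R g) <= (\<integral>\<^sup>+z. ennreal (C^2) \<partial>?M)"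
   using C by (intro nn_integral_mono ennreal_leI power_mono) auto
  also have "... = ennreal (C^2) * emeasure ?M (space ?M)" by (rule nn_integral_const)
  also have "... < \<infinity>"
   using emeasure_finite[of "space ?M"]
   by (simp add: ennreal_mult_eq_top_iff less_top[symmetric] del: space_wt)
  finally show ?thesis .
 qed
 have int: "integrable ?M (%z. Fn n z \<bullet> (?A z R g))" for n
 proof -
  have "bounded (Fn n ` K)"
   using K by (intro compact_imp_bounded compact_continuous_image continuous_on_subset[OF Fn]) auto
  then obtain B where B: "!!z. z : K ==> norm (Fn n z) <= B"
   unfolding bounded_iff by blast
  have "norm (Fn n z \<bullet> (?A z R g)) <= \<bar>B\<bar> * C" for z
  proof (cases "z : K")
   case True
   have "norm (Fn n z \<bullet> (?A z R g)) <= norm (Fn n z) * norm (?A z R g)"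
    using Cauchy_Schwarz_ineq2 by (metis real_norm_def)
   also have "... <= \<bar>B\<bar> * C"
    using B[OF True] C[of z] by (intro mult_mono) auto
   finally show ?thesis .
  next
   case False
   thus ?thesis using gm order_trans[OF norm_ge_zero C] by simp
  qed
  thus ?thesis
   by (intro integrable_const_bound[of _ "\<bar>B\<bar> * C"] borel_measurable_inner Fm wm) auto
 qed
 note P = L2_pairing[OF Fm fm wm L wf int]
 show ?thesis
  using P conv[OF ph gm fm P(1)] conv(2)[OF ph gm Fm int] by simp
qed
have g1: "continuous_on UNIV (%z. be z *. v)" "!!z. z \<notin> K ==> be z *. v = 0"
 using smooth_continuous[OF be] K by (auto intro!: continuous_intros)
have g2: "continuous_on UNIV (%z. grad be z \<bullet> v)" "!!z. z \<notin> K ==> grad be z \<bullet> v = 0"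
 using continuous_grad[OF be] gK by (auto intro!: continuous_intros)
have A: "integrable lborel (%z. F z \<bullet> (?E z R)) &
  (%n. LINT z|lborel. grad (ph n) z \<bullet> (?E z R)) ----> (LINT z|lborel. F z \<bullet> (?E z R))"
 by (rule lim_gen[OF g1 continuous_grad[OF ph] mu(2) H1a_tendsto_L2(1)[OF ph lim]])
have B: "(%n. LINT z|lborel. ph n z \<bullet> (?B z)) ----> (LINT z|lborel. u z \<bullet> (?B z))"
 using lim_gen[OF g2 smooth_continuous[OF ph] mu(1) H1a_tendsto_L2(2)[OF ph lim]] by blast
obtain R where R: "!!z. z : K ==> norm z < R"
 using compact_imp_bounded[OF K(1)] by (meson bounded_pos_less)
have z0: "be z = 0" if "R <= norm z" for z using R K(3)[of z] that by fastforce
have "(LINT z|lborel. grad (ph n) z \<bullet> (?E z R)) = - (LINT z|lborel. ph n z \<bullet> (?B z))" for n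
 using integral_by_parts[OF ph[of n] be z0] by simp
hence "(%n. - (LINT z|lborel. ph n z \<bullet> (?B z))) ----> (LINT z|lborel. F z \<bullet> (?E z R))"
 using A by simp
with tendsto_minus[OF B] show "(LINT z|lborel. be z * (F z \<bullet> v)) = - (LINT z|lborel. u z * (?B z))"
 using LIMSEQ_unique by fastforce
show "integrable lborel (%z. be z * (F z \<bullet> v))" using A by simp
qed

text \<open>Boxes form an intersection-stable generator of the Borel sets, so a Dynkin argument
  extends the vanishing of the integral from boxes to all Borel sets. The support condition reduces
  an arbitrary box to its intersection with \<open>box L U\<close>.\<close>

lemma AE_zero_of_box_integrals:
fixes g :: "'a::euclidean_space => real"
assumes g: "integrable lborel g" and supp: "!!z. z \<notin> box L U ==> g z = 0"
 and box: "!!l u. box l u <= box L U ==> (LINT z:box l u|lborel. g z) = 0"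
shows "AE z in lborel. g z = 0"
proof -
let ?A = "%A. (LINT z:A|lborel. g z)"
let ?B = "(LINT z|lborel. g z)"
let ?C = "(%(a, b). box a b :: 'a set)"
have gi: "set_integrable lborel A g" if "A : sets borel" for A
 using integrable_mult_indicator[of A lborel g] g that by (simp add: set_integrable_def)
have stable: "Int_stable (range ?C)"
 by (auto simp: Int_stable_def box_Int_box)
have sub_Pow: "range ?C <= Pow UNIV" by simp
have *: "(?A A) = 0" if "A : sigma_sets UNIV (range (%(a, b). box a b))" for A
 using stable sub_Pow that
proof (induction rule: sigma_sets_induct_disjoint)
 case (basic A)
 then obtain a b where A: "A = box a b" by (auto simp: image_iff)
 obtain c d where cd: "box a b \<inter> box L U = box c d" by (rule that[OF box_Int_box])
 have "box a b \<inter> box L U <= box L U" by (rule Int_lower2)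
 hence sub: "box c d <= box L U" unfolding cd .
 have "(?A A) = (LINT z:box c d|lborel. g z)"
  unfolding set_lebesgue_integral_def A cd[symmetric]
  by (intro Bochner_Integration.integral_cong) (auto simp: indicator_def supp)
 thus ?case using box[OF sub] by simp
next
 case empty
 show ?case by (simp add: set_lebesgue_integral_def)
next
 case (compl A)
 hence A: "A : sets borel" by (simp add: borel_eq_box)
 \<comment> \<open>The total integral is itself one of the given box integrals, hence 0; the
   complement follows by subtraction.\<close>
 have all: "?B = (LINT z:box L U|lborel. g z)"
  unfolding set_lebesgue_integral_def
  by (intro Bochner_Integration.integral_cong) (auto simp: indicator_def supp)
 have "(LINT z:(UNIV - A)|lborel. g z) = (LINT z|lborel. g z - ind A z *. g z)"
  unfolding set_lebesgue_integral_def
  by (intro Bochner_Integration.integral_cong) (auto simp: indicator_def)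
 also have "... = ?B - (?A A)"
  unfolding set_lebesgue_integral_def
  by (rule Bochner_Integration.integral_diff[OF g]) (use gi[OF A] in \<open>simp add: set_integrable_def\<close>)
 finally have "(LINT z:(UNIV - A)|lborel. g z) = ?B - (?A A)" .
 thus ?case using compl all box[of L U] by simp
next
 case (union A)
 hence A: "A i : sets borel" for i by (auto simp: borel_eq_box)
 have "(LINT z:(\<Union>i. A i)|lborel. g z) = (\<Sum>i. (LINT z:A i|lborel. g z))"
  using union A gi[of "\<Union>i. A i"]
  by (intro lebesgue_integral_countable_add) (auto simp: disjoint_family_on_def)
 thus ?case using union by simp
qed
have "AE z in lborel. g z = (%_. 0) z"
proof (rule density_unique_real[OF g])
 show "integrable lborel (%_::'a. 0::real)" by simp
 show "(?A A) = (LINT z:A|lborel. 0)" if "A : sets lborel" for A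
  using *[of A] that by (simp add: borel_eq_box)
qed
thus ?thesis by simp
qed

text \<open>The pairing with \<open>w = ind K * y^-a * v\<close> cancels the weight, and
  \<open>w\<close> is bounded on \<open>K\<close>.\<close>

lemma H1a_grad_integrable_compact:
fixes u :: "('n::finite) point => real"
assumes a: "-1 < a" and "is_H1a_grad a r u F" and K: "compact K" "K <= half_ball r"
shows "integrable lborel (%z. ind K z * (F z \<bullet> v))"
proof -
let ?M = "wt a (half_ball r :: 'n point set)"
let ?A = "%w. (\<integral>\<^sup>+z. ennreal ((norm (w z))^2) \<partial>?M)"
let ?B = "(%z. (snd z powr - a) *. v)"
interpret finite_measure ?M using a by (rule finite_measure_wt)
obtain ph where ph: "!!n. smooth (ph n)" and lim: "H1a_tendsto a r ph u F"
 using assms(2) unfolding is_H1a_grad_def by blast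
have mF: "F : bmeas ?M"
 using lim H1a_tendsto_iff[OF ph] by auto
have Kb[measurable]: "K : sets borel" using K by (simp add: compact_imp_closed)
have pos: "0 < snd z" if "z : K" for z using K that half_ballD by blast
define w where "w z = (ind K z * snd z powr - a) *. v" for z
have wm: "w : bmeas ?M"
 unfolding w_def by (rule borel_measurable_wtI) measurable
have "continuous_on K ?B"
 using pos by (intro continuous_intros) fastforce+
hence "bounded (?B ` K)"
 using K by (intro compact_imp_bounded compact_continuous_image)
then obtain C where C: "!!z. z : K ==> norm ((snd z powr - a) *. v) <= C"
 unfolding bounded_iff by blast
have wC: "norm (w z) <= \<bar>C\<bar>" for z
 using C[of z] by (cases "z : K") (auto simp: w_def)
have wf: "(?A w) < \<infinity>"
proof -
 have "(?A w) <= (\<integral>\<^sup>+z. ennreal (\<bar>C\<bar>^2) \<partial>?M)"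
  using wC by (intro nn_integral_mono ennreal_leI power_mono) auto
 also have "... = ennreal (\<bar>C\<bar>^2) * emeasure ?M (space ?M)" by (rule nn_integral_const)
 also have "... < \<infinity>"
  using emeasure_finite[of "space ?M"]
  by (simp add: ennreal_mult_eq_top_iff less_top[symmetric] del: space_wt)
 finally show ?thesis .
qed
have int: "integrable ?M (%z. grad (ph n) z \<bullet> w z)" for n
proof -
 have "bounded (grad (ph n) ` K)"
  using K by (intro compact_imp_bounded compact_continuous_image continuous_grad ph) auto
 then obtain B where B: "!!z. z : K ==> norm (grad (ph n) z) <= B"
  unfolding bounded_iff by blast
 have "norm (grad (ph n) z \<bullet> w z) <= \<bar>B\<bar> * \<bar>C\<bar>" for z
 proof (cases "z : K")
  case True
  have "norm (grad (ph n) z \<bullet> w z) <= norm (grad (ph n) z) * norm (w z)"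
   unfolding real_norm_def by (rule Cauchy_Schwarz_ineq2)
  also have "... <= \<bar>B\<bar> * \<bar>C\<bar>"
   using B[OF True] wC[of z] by (intro mult_mono) auto
  finally show ?thesis .
 next
  case False
  thus ?thesis by (simp add: w_def)
 qed
 moreover have "(%z. grad (ph n) z \<bullet> w z) : bmeas ?M"
  by (intro borel_measurable_inner wm continuous_on_measurable_wt continuous_grad ph)
 ultimately show ?thesis
  by (intro integrable_const_bound[of _ "\<bar>B\<bar> * \<bar>C\<bar>"]) auto
qed
have i: "integrable ?M (%z. F z \<bullet> w z)"
 by (rule L2_pairing(1)[OF _ mF wm H1a_tendsto_L2(1)[OF ph lim] wf int])
  (intro continuous_on_measurable_wt continuous_grad ph)
have m: "(%z. F z \<bullet> w z) : bmeas ?M" using i by auto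
have "ind (half_ball r) z *. (snd z powr a *. (F z \<bullet> w z)) = ind K z * (F z \<bullet> v)" for z
proof (cases "z : K")
 case True
 hence "z : half_ball r" "snd z ~= 0" using pos[OF True] K by auto
 thus ?thesis using True by (simp add: w_def mult.assoc[symmetric] powr_add[symmetric])
qed (simp add: w_def)
thus ?thesis
 using i unfolding integrable_wt_iff[OF half_ball_borel m] set_integrable_def by simp
qed

definition box_bump :: "'a::euclidean_space => 'a => real => 'a => real" where
"box_bump l u j z = (\<Prod>b\<in>Basis. ramp (j * (z \<bullet> b - l \<bullet> b)) * ramp (j * (u \<bullet> b - z \<bullet> b)))"

lemma smooth_box_bump: "smooth (box_bump l u j)"
unfolding box_bump_def
by (intro smooth_prod smooth_mult smooth_compose[OF smooth_ramp] smooth_const smooth_diff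
  smooth_bounded_linear bounded_linear_inner_left finite_Basis)

lemma box_bump_eq_0:
assumes "z \<notin> box l u" "0 <= j"
shows "box_bump l u j z = 0"
proof -
obtain b where "b : Basis" "z \<bullet> b <= l \<bullet> b | u \<bullet> b <= z \<bullet> b"
 using assms(1) by (force simp: mem_box not_less)
hence "ramp (j * (z \<bullet> b - l \<bullet> b)) * ramp (j * (u \<bullet> b - z \<bullet> b)) = 0" "b : Basis"
 using assms(2) by (auto simp: mult_nonneg_nonpos)
thus ?thesis unfolding box_bump_def by (subst prod_zero_iff) auto
qed

lemma box_bump_bounds: "0 <= box_bump l u j z" "box_bump l u j z <= 1"
unfolding box_bump_def
by (auto intro!: prod_nonneg prod_le_1 mult_nonneg_nonneg mult_le_one ramp_bounds)

lemma box_bump_tendsto: "(%n. box_bump l u (real (Suc n)) z) ----> ind (box l u) z"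
proof -
let ?A = "(\<Prod>b\<in>Basis. (if 0 < z \<bullet> b - l \<bullet> b then 1 else 0) * (if 0 < u \<bullet> b - z \<bullet> b then 1 else 0))"
have "(%n. box_bump l u (real (Suc n)) z) ---->
 ?A"
 unfolding box_bump_def by (intro tendsto_prod tendsto_mult ramp_tendsto)
also have "?A =
  (ind (box l u) z :: real)"
proof (cases "z : box l u")
 case True
 hence "?A =
  (\<Prod>b\<in>(Basis :: 'a set). 1::real)" by (intro prod.cong) (auto simp: mem_box)
 thus ?thesis using True by simp
next
 case False
 then obtain b where b: "b : Basis" "z \<bullet> b <= l \<bullet> b | u \<bullet> b <= z \<bullet> b"
  by (force simp: mem_box not_less)
 have "(\<Prod>b\<in>Basis. (if 0 < z \<bullet> b - l \<bullet> b then 1 else 0) * (if 0 < u \<bullet> b - z \<bullet> b then 1 else (0::real))) = 0"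
  using b by (subst prod_zero_iff) (auto intro!: bexI[of _ b])
 thus ?thesis using False by simp
qed
finally show ?thesis .
qed

text \<open>On a closed box inside the half ball both gradients have the same integrals against all
  smooth bumps of subboxes, hence over the subboxes themselves. Countably many such boxes cover the
  half ball, and their faces are null sets.\<close>

lemma H1a_grad_unique:
fixes u :: "('n::finite) point => real"
assumes a: "-1 < a" and F: "is_H1a_grad a r u F" and F': "is_H1a_grad a r u F'"
shows "AE z in lborel. z : half_ball r --> F z = F' z"
proof -
have cell: "AE z in lborel. z : cbox c d --> F z = F' z" if K: "cbox c d <= half_ball r" for c d :: "'n point"
proof -
 have comp: "AE z in lborel. z : box c d --> F z \<bullet> v = F' z \<bullet> v" for v
 proof -
  define g where "g z = ind (cbox c d) z * (F z \<bullet> v) - ind (cbox c d) z * (F' z \<bullet> v)" for z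
  have gi: "integrable lborel g"
   unfolding g_def
   by (intro Bochner_Integration.integrable_diff H1a_grad_integrable_compact[OF a F]
     H1a_grad_integrable_compact[OF a F'] K compact_cbox)
  have gib: "integrable lborel (%z. ind (box c d) z * g z)"
   using integrable_mult_indicator[OF _ gi, of "box c d"] by simp
  have "AE z in lborel. ind (box c d) z * g z = 0"
  proof (rule AE_zero_of_box_integrals[OF gib])
   show "ind (box c d) z * g z = 0" if "z \<notin> box c d" for z using that by simp
   fix l u assume sub: "box l u <= box c d"
   let ?be = "%n. box_bump l u (real (Suc n))"
   have zero: "(LINT z|lborel. ?be n z * g z) = 0" for n
   proof -
    have z0: "?be n z = 0" if "z \<notin> cbox c d" for z
     using that sub box_subset_cbox[of c d] by (intro box_bump_eq_0) auto
    note 1 = H1a_weak_derivative[OF a F smooth_box_bump compact_cbox K z0, where v = v]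
    note 2 = H1a_weak_derivative[OF a F' smooth_box_bump compact_cbox K z0, where v = v]
    have "?be n z * g z = ?be n z * (F z \<bullet> v) - ?be n z * (F' z \<bullet> v)" for z
     using z0[of z] by (cases "z : cbox c d") (auto simp: g_def algebra_simps)
    thus ?thesis using 1 2 by simp
   qed
   have "(%n. LINT z|lborel. ?be n z * g z) ----> (LINT z|lborel. ind (box l u) z * g z)"
   proof (rule integral_dominated_convergence[where w = "%z. norm (g z)"])
    have gm[measurable]: "g : bmeas borel" using gi by auto
    have bm[measurable]: "?be n : bmeas borel" for n
     by (intro borel_measurable_continuous_onI smooth_continuous smooth_box_bump)
    show "(%z. ?be n z * g z) : bmeas lborel" for n by measurable
    show "(%z. ind (box l u) z * g z) : bmeas lborel" by measurable
    show "integrable lborel (%z. norm (g z))" using gi by simp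
    show "AE z in lborel. (%n. ?be n z * g z) ----> ind (box l u) z * g z"
     by (intro AE_I2 tendsto_mult box_bump_tendsto tendsto_const)
    show "AE z in lborel. norm (?be n z * g z) <= norm (g z)" for n
     using box_bump_bounds[of l u "real (Suc n)"]
     by (intro AE_I2) (auto simp: abs_mult intro!: mult_left_le_one_le)
   qed
   hence "(LINT z|lborel. ind (box l u) z * g z) = 0"
    unfolding zero using LIMSEQ_unique[OF _ tendsto_const] by blast
   moreover have "ind (box l u) z * (ind (box c d) z * g z) = ind (box l u) z * g z" for z
    using sub by (auto simp: indicator_def)
   ultimately show "(LINT z:box l u|lborel. ind (box c d) z * g z) = 0"
    by (simp only: set_lebesgue_integral_def real_scaleR_def)
  qed
  thus ?thesis
  proof eventually_elim
   fix z assume z: "ind (box c d) z * g z = 0"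
   show "z : box c d --> F z \<bullet> v = F' z \<bullet> v"
   proof
    assume "z : box c d"
    moreover from this have "z : cbox c d" by (rule subsetD[OF box_subset_cbox])
    ultimately show "F z \<bullet> v = F' z \<bullet> v" using z by (simp add: g_def)
   qed
  qed
 qed
 have "AE z in lborel. ALL v:Basis. z : box c d --> F z \<bullet> v = F' z \<bullet> v"
  by (rule AE_finite_allI) (auto intro: comp)
 moreover have "AE z in lborel. z \<notin> cbox c d - box c d"
 proof -
  have "cbox c d - box c d : null_sets lborel"
   using negligible_frontier_interval[of c d] by (auto simp: null_sets_completion_iff negligible_iff_null_sets)
  thus ?thesis by (rule AE_not_in)
 qed
 ultimately show ?thesis
  by eventually_elim (auto intro: euclidean_eqI)
qed
obtain \<D> where D: "countable \<D>" "\<D> <= Pow (half_ball r)" "!!X. X : \<D> ==> EX c d. X = cbox c d"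
  "\<Union>\<D> = (half_ball r :: 'n point set)"
 using open_countable_Union_open_cbox[OF open_half_ball] by metis
have "AE z in lborel. ALL X:\<D>. z : X --> F z = F' z"
 unfolding AE_ball_countable[OF D(1)] using D(2,3) cell by blast
thus ?thesis
 by eventually_elim (use D(4) in blast)
qed

subsection \<open>Polar coordinates\<close>

text \<open>The weighted surface measure y^a dS on the unit half sphere. As for
  \<open>sphere_measure\<close>, a set is measured by the cone over it, with the dimension N + 1 as
  factor; the weight is evaluated at the projected point \<open>sgn z\<close>.\<close>

definition sph :: "real => ('n::finite) point measure" where
"sph a = distr (density (restrict_space lborel (half_ball 1))
  (%z. ennreal ((real CARD('n) + 1) * snd (sgn z) powr a)))
 (restrict_space borel (half_sphere 1)) sgn"

lemma half_sphere_borel [measurable, simp]: "half_sphere r : sets borel"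
proof -
have "half_sphere r = {z::'a point. 0 < snd z} \<inter> sphere 0 r" by (auto simp: half_sphere_def)
moreover have "open {z::'a point. 0 < snd z}" by (intro open_Collect_less continuous_intros)
ultimately show ?thesis by (simp add: borel_open borel_closed sets.Int)
qed

lemma borel_measurable_sgn_point [measurable]: "(sgn :: ('n::finite) point => _) : bmeas borel"
unfolding sgn_div_norm[abs_def] by measurable

lemma borel_measurable_snd_point [measurable]:
"f : bmeas M ==> (%x. snd (f x :: 'a::euclidean_space \<times> real)) : bmeas M"
by (rule measurable_compose[of f M borel snd])
 (auto intro!: borel_measurable_continuous_onI continuous_intros)

lemma sgn_half_ball: "z : half_ball r ==> sgn z : half_sphere 1"
by (auto simp: half_ball_def half_sphere_def sgn_div_norm norm_Pair field_simps
  intro!: divide_pos_pos)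

lemma sgn_measurable_half_sphere:
"sgn : measurable (density (restrict_space lborel (half_ball 1 :: ('n::finite) point set)) f)
 (restrict_space borel (half_sphere 1))"
proof -
have "sgn : measurable (restrict_space borel (half_ball 1 :: 'n point set)) (restrict_space borel (half_sphere 1))"
 by (rule measurable_restrict_space2)
  (auto simp: space_restrict_space sgn_half_ball intro!: measurable_restrict_space1)
thus ?thesis by (simp cong: measurable_cong_sets add: sets_restrict_space)
qed

lemma space_sph [simp]: "space (sph a) = half_sphere 1"
and sets_sph: "sets (sph a) = sets (restrict_space borel (half_sphere 1))"
by (auto simp: sph_def space_restrict_space)

lemma measurable_sph: "measurable (sph a) M = measurable (restrict_space borel (half_sphere 1)) M"
by (rule measurable_cong_sets) (auto simp: sets_sph)

lemma continuous_on_measurable_sph: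
"continuous_on (half_sphere 1) f ==> f : bmeas (sph a)"
for f :: "_ => 'b::topological_space"
unfolding measurable_sph by (rule borel_measurable_continuous_on_restrict)

lemma nn_integral_sph:
fixes f :: "('n::finite) point => ennreal"
assumes "f : bmeas (sph a)"
shows "(\<integral>\<^sup>+th. f th \<partial>sph a) = (\<integral>\<^sup>+z\<in>half_ball 1.
  (ennreal ((real CARD('n) + 1) * snd (sgn z) powr a) * f (sgn z)) \<partial>lborel)"
proof -
let ?w = "%z::'n point. ennreal ((real CARD('n) + 1) * snd (sgn z) powr a)"
let ?R = "restrict_space lborel (half_ball 1 :: 'n point set)"
have m: "(%z. f (sgn z)) : bmeas ?R"
 using measurable_compose[OF sgn_measurable_half_sphere[of "%_. 1"], of f borel] assms
 by (simp add: measurable_sph cong: measurable_cong_sets)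
have "(\<integral>\<^sup>+th. f th \<partial>sph a) = (\<integral>\<^sup>+z. f (sgn z) \<partial>density ?R ?w)"
 unfolding sph_def using assms
 by (intro nn_integral_distr sgn_measurable_half_sphere) (simp add: measurable_sph)
also have "... = (\<integral>\<^sup>+z. ?w z * f (sgn z) \<partial>?R)"
 by (rule nn_integral_density[OF _ m]) (intro measurable_restrict_space1, measurable)
also have "... = (\<integral>\<^sup>+z\<in>half_ball 1. (?w z * f (sgn z)) \<partial>lborel)"
 by (subst nn_integral_restrict_space) auto
finally show ?thesis .
qed

lemma integral_sph:
fixes f :: "('n::finite) point => real"
assumes "f : bmeas (sph a)"
shows "(\<integral>th. f th \<partial>sph a) = (LINT z:half_ball 1|lborel.
  (real CARD('n) + 1) * snd (sgn z) powr a * f (sgn z))"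
proof -
let ?w = "%z::'n point. (real CARD('n) + 1) * snd (sgn z) powr a"
let ?R = "restrict_space lborel (half_ball 1 :: 'n point set)"
have m: "(%z. f (sgn z)) : bmeas ?R"
 using measurable_compose[OF sgn_measurable_half_sphere[of "%_. 1"], of f borel] assms
 by (simp add: measurable_sph cong: measurable_cong_sets)
have "(\<integral>th. f th \<partial>sph a) = (\<integral>z. f (sgn z) \<partial>density ?R ?w)"
 unfolding sph_def using assms
 by (intro integral_distr sgn_measurable_half_sphere) (simp add: measurable_sph)
also have "... = (\<integral>z. ?w z *. f (sgn z) \<partial>?R)"
proof (rule integral_density[OF m])
 show "?w : bmeas ?R" by (intro measurable_restrict_space1) measurable
qed auto
also have "... = (LINT z:half_ball 1|lborel. ?w z * f (sgn z))"
 unfolding set_lebesgue_integral_def by (subst integral_restrict_space) auto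
finally show ?thesis .
qed

text \<open>Normalising a point of the unit half ball increases its height, so for
  \<open>a < 0\<close> the weight at \<open>sgn z\<close> is at most the weight at \<open>z\<close>,
  and for \<open>a >= 0\<close> it is at most 1. The total mass is thus controlled by the integral
  of 1 + y^a.\<close>

lemma finite_measure_sph:
assumes "-1 < a"
shows "finite_measure (sph a :: ('n::finite) point measure)"
proof (rule finite_measureI)
let ?D = "real CARD('n) + 1"
let ?A = "(\<integral>\<^sup>+y\<in>{0<..<1}. ennreal (?D * (1 + y powr a)) \<partial>lborel)"
let ?B = "(sph a :: 'n point measure)"
have *: "snd (sgn z) powr a <= 1 + snd z powr a" if "z : half_ball 1" for z :: "'n point"
proof (cases "0 <= a")
 case True
 have "snd (sgn z) powr a <= 1 powr a"
  using sgn_half_ball[OF that] True norm_snd_le[of "snd (sgn z)" "fst (sgn z)"]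
  by (intro powr_mono2) (auto simp: half_sphere_def)
 thus ?thesis by (simp add: add_increasing2)
next
 case False
 have z: "0 < snd z" "norm z < 1" using that by (auto simp: half_ball_def)
 hence nz: "norm z ~= 0" by auto
 have "snd z <= snd (sgn z)"
  using z nz by (auto simp: sgn_div_norm field_simps mult_left_le)
 hence "snd (sgn z) powr a <= snd z powr a"
  using False z by (intro powr_mono2') auto
 thus ?thesis by simp
qed
have "emeasure ?B (space (sph a)) = (\<integral>\<^sup>+th. 1 \<partial>?B)"
 by simp
also have "... = (\<integral>\<^sup>+z\<in>half_ball 1. (ennreal (?D * snd (sgn z) powr a)) \<partial>(lborel :: 'n point measure))"
 by (subst nn_integral_sph) auto
also have "... <= (\<integral>\<^sup>+z\<in>half_ball 1. (ennreal (?D * (1 + snd z powr a))) \<partial>(lborel :: 'n point measure))"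
 by (intro nn_integral_mono) (auto simp: indicator_def intro!: ennreal_leI mult_left_mono *)
also have "... <= emeasure (lborel :: (real ^ 'n) measure) (cball 0 1) *
  ?A"
 by (rule nn_integral_half_ball_le[of "%y. ennreal (?D * (1 + y powr a))"]) auto
also have "?A =
  (NN y. ennreal ?D * (ennreal 1 * ind {0<..<1} y + ennreal (y powr a) * ind {0<..<1} y))"
 by (intro nn_integral_cong) (auto simp: indicator_def ennreal_mult ennreal_plus)
also have "... = ennreal ?D * (1 + ennreal (1 / (a + 1)))"
 using nn_integral_powr_finite[of a 1] assms by (simp add: nn_integral_cmult nn_integral_add)
also have "emeasure (lborel :: (real ^ 'n) measure) (cball 0 1) * (ennreal ?D * (1 + ennreal (1 / (a + 1)))) < \<infinity>"
 using emeasure_bounded_finite[OF bounded_cball, of "0 :: real ^ 'n" 1]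
 by (auto simp: ennreal_mult_less_top)
finally show "emeasure (sph a) (space ?B) ~= \<infinity>" by auto
qed

lemma nn_integral_lborel_scale:
fixes f :: "'a::euclidean_space => ennreal"
assumes [measurable]: "f : bmeas borel" and c: "0 < c"
shows "(NN z. f z) = ennreal (c ^ DIM('a)) * (NN z. f (c *. z))"
using c by (subst lborel_affine[of c 0])
 (simp_all add: nn_integral_density nn_integral_distr nn_integral_cmult)

lemma nn_integral_inverse_power:
assumes c: "0 < c" and d: "0 < d"
shows "(NN t. ennreal (real d / t ^ (d + 1)) * ind {c<..} t) = ennreal (1 / c ^ d)"
proof -
have "(NN t. ennreal (real d / t ^ (d + 1)) * ind {c<..} t) =
  (NN t. ennreal (real d / t ^ (d + 1)) * ind {c..} t)"
 using AE_lborel_singleton[of c] by (intro nn_integral_cong_AE) (auto simp: indicator_def elim!: eventually_mono)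
also have "... = ennreal (0 - (- (1 / c ^ d)))"
proof (rule nn_integral_FTC_atLeast)
 fix t assume t: "c <= t"
 hence "0 < t" using c by simp
 obtain m where m: "d = Suc m" using d by (cases d) auto
 have "((%t. t ^ d) has_real_derivative real d * t ^ m) (at t)"
  using DERIV_power[OF DERIV_ident, of d t UNIV] by (simp add: m)
 hence "((%t. - inverse (t ^ d)) has_real_derivative
   - (- (inverse (t ^ d) * (real d * t ^ m) * inverse (t ^ d)))) (at t)"
  using \<open>0 < t\<close> by (intro DERIV_minus DERIV_inverse') auto
 moreover have "- (- (inverse (t ^ d) * (real d * t ^ m) * inverse (t ^ d))) = real d / t ^ (d + 1)"
  using \<open>0 < t\<close> by (simp add: m field_simps)
 ultimately show "((%t. - (1 / t ^ d)) has_real_derivative real d / t ^ (d + 1)) (at t)"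
  by (simp only: inverse_eq_divide)
 show "0 <= real d / t ^ (d + 1)" using \<open>0 < t\<close> by simp
next
 have "((%t::real. inverse (t ^ d)) ---> 0) at_top"
  using d by (intro tendsto_inverse_0_at_top filterlim_pow_at_top filterlim_ident) auto
 from tendsto_minus[OF this] show "((%t::real. - (1 / t ^ d)) ---> 0) at_top"
  by (simp add: inverse_eq_divide)
qed measurable
finally show ?thesis by simp
qed

text \<open>
Polar coordinates. Fubini, the substitution \<open>s = t \<bar>z\<bar>\<close> for fixed \<open>z\<close> and the dilation
\<open>w = t z\<close> for fixed \<open>t\<close> reduce the integral over cones to
\<open>D \<bar>w\<bar>\<^sup>D \<integral>\<^bsub>t > \<bar>w\<bar>\<^esub> t\<^sup>-\<^sup>D\<^sup>-\<^sup>1 dt = 1\<close>.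
\<close>

lemma nn_integral_polar_cone:
fixes g :: "('n::finite) point => ennreal"
assumes [measurable]: "g : bmeas borel" and supp: "!!z. snd z <= 0 ==> g z = 0"
shows "(NN z. g z) = (\<integral>\<^sup>+s\<in>{0<..}. (\<integral>\<^sup>+z\<in>half_ball 1.
  (ennreal ((real CARD('n) + 1) * s ^ CARD('n)) * g (s *. sgn z)) \<partial>lborel) \<partial>lborel)"
proof -
let ?A = "(lborel \<Otimes>\<^sub>M (lborel :: 'n point measure))"
let ?B = "(borel \<Otimes>\<^sub>M borel)"
let ?C = "%z N. norm z ^ (N + 1)"
let ?E = "%s z. s *. sgn z"
let ?F = "%z t. (norm z * t) *. sgn z"
let ?G = "%t z N. norm (t *. z) ^ (N + 1)"
define N where "N = CARD('n)"
let ?D = "real N + 1"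
have [measurable]: "half_ball 1 : sets (borel :: 'n point measure)" by simp
have pm: "(%x::real \<times> 'n point. fst x *. sgn (snd x)) : bmeas ?B"
  "(%x::real \<times> 'n point. fst x *. snd x) : bmeas ?B" by measurable
have m1: "(%(s, z). ennreal (?D * s ^ N) * g (?E s z) * ind (half_ball 1) z * ind {0<..} s)
  : bmeas ?A"
 using measurable_compose[OF pm(1), of g borel]
 unfolding split_beta' by (simp cong: measurable_cong_sets sets_pair_measure_cong) measurable
have m2: "(%(t, z). ennreal (?D * norm z ^ (N + 1) * t ^ N) * g (t *. z) * ind (half_ball 1) z * ind {0<..} t)
  : bmeas ?A"
 using measurable_compose[OF pm(2), of g borel]
 unfolding split_beta' by (simp cong: measurable_cong_sets sets_pair_measure_cong) measurable
have m3: "(%(t, z). g z * (ennreal (?C z N) * (ennreal (?D / t ^ (N + 2)) * ind {norm z<..} t)))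
  : bmeas ?A"
proof -
 have "(%x::real \<times> 'n point. ind {norm (snd x)<..} (fst x) :: ennreal) : bmeas ?B"
 proof -
  have "(%x::real \<times> 'n point. ind {x. norm (snd x) < fst x} x :: ennreal) : bmeas ?B"
   by measurable
  thus ?thesis by (simp add: indicator_def)
 qed
 thus ?thesis unfolding split_beta'
  by (simp cong: measurable_cong_sets sets_pair_measure_cong) measurable
qed
have "(\<integral>\<^sup>+s\<in>{0<..}. (\<integral>\<^sup>+z\<in>half_ball 1. (ennreal (?D * s ^ N) * g (?E s z)) \<partial>lborel) \<partial>lborel) =
  (NN s. NN z. (ennreal (?D * s ^ N) * g (?E s z) * ind (half_ball 1) z * ind {0<..} s))"
 by (intro nn_integral_cong) (auto simp: nn_integral_multc indicator_def)
also have "... = (NN z. NN s. (ennreal (?D * s ^ N) * g (?E s z) * ind (half_ball 1) z * ind {0<..} s))"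
 by (rule lborel_pair.Fubini'[OF m1, symmetric])
also have "... = (NN z. NN t. (ennreal (?D * norm z ^ (N + 1) * t ^ N) * g (t *. z) * ind (half_ball 1) z * ind {0<..} t))"
proof (rule nn_integral_cong)
 fix z :: "'n point"
 show "(NN s. (ennreal (?D * s ^ N) * g (?E s z) * ind (half_ball 1) z * ind {0<..} s)) =
  (NN t. (ennreal (?D * norm z ^ (N + 1) * t ^ N) * g (t *. z) * ind (half_ball 1) z * ind {0<..} t))"
 proof (cases "z : half_ball 1")
  case True
  hence nz: "0 < norm z" by (auto simp: half_ball_def)
  have "(%s. s *. sgn z) : bmeas borel" by measurable
  note [measurable] = measurable_compose[OF this, of g borel]
  have m: "(%s. ennreal (?D * s ^ N) * g (?E s z) * ind (half_ball 1) z * ind {0<..} s) : bmeas borel"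
   by measurable
  have "(%t. t *. z) : bmeas borel" by measurable
  note [measurable] = measurable_compose[OF this, of g borel]
  have "(NN s. (ennreal (?D * s ^ N) * g (?E s z) * ind (half_ball 1) z * ind {0<..} s))
   = ennreal (norm z) * (NN t. (ennreal (?D * (norm z * t) ^ N) * g (?F z t) * ind (half_ball 1) z * ind {0<..} (norm z * t)))"
   using nn_integral_real_affine[OF m, of "norm z" 0] nz by simp
  also have "... = (NN t. ennreal (norm z) * (ennreal (?D * (norm z * t) ^ N) * g (?F z t) * ind (half_ball 1) z * ind {0<..} (norm z * t)))"
  proof (rule nn_integral_cmult[symmetric])
   have "(%t. (norm z * t) *. sgn z) : bmeas borel" by measurable
   note [measurable] = measurable_compose[OF this, of g borel]
   show "(%t. ennreal (?D * (norm z * t) ^ N) * g (?F z t) * ind (half_ball 1) z * ind {0<..} (norm z * t))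
     : bmeas lborel" by measurable
  qed
  also have "... = (NN t. (ennreal (?D * norm z ^ (N + 1) * t ^ N) * g (t *. z) * ind (half_ball 1) z * ind {0<..} t))"
  proof (rule nn_integral_cong)
   fix t :: real
   have "(norm z * t) *. sgn z = t *. z" using nz by (simp add: sgn_div_norm)
   moreover have "ind {0<..} (norm z * t) = (ind {0<..} t :: ennreal)"
    using nz by (auto simp: indicator_def zero_less_mult_iff)
   moreover have "ennreal (norm z) * ennreal (?D * (norm z * t) ^ N) = ennreal (?D * norm z ^ (N + 1) * t ^ N)" if "0 < t"
    using that nz by (subst ennreal_mult[symmetric]) (auto simp: power_mult_distrib algebra_simps)
   ultimately show "ennreal (norm z) * (ennreal (?D * (norm z * t) ^ N) * g (?F z t) * ind (half_ball 1) z * ind {0<..} (norm z * t))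
    = ennreal (?D * norm z ^ (N + 1) * t ^ N) * g (t *. z) * ind (half_ball 1) z * ind {0<..} t"
    by (cases "0 < t") (auto simp: mult.assoc[symmetric])
  qed
  finally show ?thesis .
 qed simp
qed
also have "... = (NN t. NN z. (ennreal (?D * norm z ^ (N + 1) * t ^ N) * g (t *. z) * ind (half_ball 1) z * ind {0<..} t))"
 by (rule lborel_pair.Fubini'[OF m2])
also have "... = (NN t. NN z. g z * (ennreal (?C z N) * (ennreal (?D / t ^ (N + 2)) * ind {norm z<..} t)))"
proof (rule nn_integral_cong)
 fix t :: real
 show "(NN z. (ennreal (?D * norm z ^ (N + 1) * t ^ N) * g (t *. z) * ind (half_ball 1) z * ind {0<..} t)) =
  (NN z. g z * (ennreal (?C z N) * (ennreal (?D / t ^ (N + 2)) * ind {norm z<..} t)))"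
 proof (cases "0 < t")
  case True
  have "(%z::'n point. t *. z) : bmeas borel" by measurable
  note [measurable] = measurable_compose[OF this, of g borel]
  have mm: "(%z. g z * (ennreal (?C z N) * (ennreal (?D / t ^ (N + 2)) * ind {norm z<..} t))) : bmeas borel"
  proof -
   have "(%z::'n point. ind {z. norm z < t} z :: ennreal) : bmeas borel" by measurable
   hence [measurable]: "(%z::'n point. ind {norm z<..} t :: ennreal) : bmeas borel" by (simp add: indicator_def)
   show ?thesis by measurable
  qed
  have "(NN z. g z * (ennreal (?C z N) * (ennreal (?D / t ^ (N + 2)) * ind {norm z<..} t))) =
   (NN z. ennreal (t ^ (N + 1)) * (g (t *. z) * (ennreal (?G t z N) * (ennreal (?D / t ^ (N + 2)) * ind {norm (t *. z)<..} t))))"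
  proof -
   have "DIM('n point) = N + 1" by (simp add: N_def)
   moreover have "(%z. g (t *. z) * (ennreal (?G t z N) * (ennreal (?D / t ^ (N + 2)) * ind {norm (t *. z)<..} t))) : bmeas lborel"
    using measurable_compose[of "%z. t *. z" lborel borel, OF _ mm] by measurable
   ultimately show ?thesis
    using nn_integral_lborel_scale[OF mm True] by (simp only: nn_integral_cmult)
  qed
  also have "... = (NN z. (ennreal (?D * norm z ^ (N + 1) * t ^ N) * g (t *. z) * ind (half_ball 1) z * ind {0<..} t))"
  proof (rule nn_integral_cong)
   fix z :: "'n point"
   have e: "ennreal (t ^ (N + 1)) * (ennreal (?G t z N) * ennreal (?D / t ^ (N + 2))) = ennreal (?D * norm z ^ (N + 1) * t ^ N)"
   proof -
    have "t ^ (N + 1) * (norm (t *. z) ^ (N + 1) * (?D / t ^ (N + 2))) = ?D * norm z ^ (N + 1) * t ^ N"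
    proof -
     have "t ^ (N + 1) * (t ^ (N + 1) / t ^ (N + 2)) = t ^ N"
      using True by (simp add: field_simps)
     hence "?D * norm z ^ (N + 1) * (t ^ (N + 1) * (t ^ (N + 1) / t ^ (N + 2))) = ?D * norm z ^ (N + 1) * t ^ N"
      by (simp only:)
     thus ?thesis using True by (simp add: power_mult_distrib mult_ac del: power_Suc)
    qed
    thus ?thesis using True by (simp add: ennreal_mult[symmetric])
   qed
   show "ennreal (t ^ (N + 1)) * (g (t *. z) * (ennreal (?G t z N) * (ennreal (?D / t ^ (N + 2)) * ind {norm (t *. z)<..} t)))
    = ennreal (?D * norm z ^ (N + 1) * t ^ N) * g (t *. z) * ind (half_ball 1) z * ind {0<..} t"
   proof (cases "0 < snd z")
    case pos: True
    have "ind {norm (t *. z)<..} t = (ind (half_ball 1) z :: ennreal)"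
     using True pos by (auto simp: indicator_def half_ball_def)
    thus ?thesis unfolding e[symmetric] using True by (simp add: ac_simps)
   next
    case False
    hence "g (t *. z) = 0" using True by (intro supp) (auto simp: mult_nonneg_nonpos)
    thus ?thesis by simp
   qed
  qed
  finally show ?thesis by simp
 next
  case False
  hence "ind {norm z<..} t = (0 :: ennreal)" for z :: "'n point"
   using order_trans[OF _ norm_ge_zero[of z]] by (auto simp: indicator_def not_less)
  thus ?thesis using False by simp
 qed
qed
also have "... = (NN z. NN t. g z * (ennreal (?C z N) * (ennreal (?D / t ^ (N + 2)) * ind {norm z<..} t)))"
 by (rule lborel_pair.Fubini'[OF m3, symmetric])
also have "... = (NN z. g z)"
proof (rule nn_integral_cong)
 fix z :: "'n point"
 show "(NN t. g z * (ennreal (?C z N) * (ennreal (?D / t ^ (N + 2)) * ind {norm z<..} t))) = g z"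
 proof (cases "0 < snd z")
  case True
  hence nz: "0 < norm z" by auto
  have "(NN t. g z * (ennreal (?C z N) * (ennreal (?D / t ^ (N + 2)) * ind {norm z<..} t)))
   = g z * (ennreal (?C z N) * (NN t. ennreal (real (N + 1) / t ^ ((N + 1) + 1)) * ind {norm z<..} t))"
   by (simp add: nn_integral_cmult add.commute)
  also have "... = g z"
   unfolding nn_integral_inverse_power[OF nz, of "N + 1", simplified]
   using nz by (subst nn_integral_inverse_power) (auto simp: ennreal_mult[symmetric])
  finally show ?thesis .
 qed (simp add: supp)
qed
finally show ?thesis unfolding N_def by simp
qed

text \<open>With \<open>b = N + a\<close> this is the radial factor of the weighted measure y^a dz
  in polar coordinates.\<close>

definition rad :: "real => real => real measure" where
"rad b rh = density (restrict_space lborel {0<..<rh}) (%s. ennreal (s powr b))"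

lemma space_rad [simp]: "space (rad b rh) = {0<..<rh}"
and sets_rad: "sets (rad b rh) = sets (restrict_space borel {0<..<rh})"
by (auto simp: rad_def space_restrict_space sets_restrict_space)

lemma measurable_rad: "measurable (rad b rh) M = measurable (restrict_space borel {0<..<rh}) M"
by (rule measurable_cong_sets) (auto simp: sets_rad)

lemma nn_integral_rad:
assumes "f : bmeas (rad b rh)"
shows "(\<integral>\<^sup>+s. f s \<partial>rad b rh) = (\<integral>\<^sup>+s\<in>{0<..<rh}. (ennreal (s powr b) * f s) \<partial>lborel)"
proof -
have "(\<integral>\<^sup>+s. f s \<partial>rad b rh) = (\<integral>\<^sup>+s. ennreal (s powr b) * f s \<partial>restrict_space lborel {0<..<rh})"
 unfolding rad_def using assms
 by (intro nn_integral_density) (auto simp: measurable_rad cong: measurable_cong_sets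
   intro!: measurable_restrict_space1)
also have "... = (\<integral>\<^sup>+s\<in>{0<..<rh}. (ennreal (s powr b) * f s) \<partial>lborel)"
 by (subst nn_integral_restrict_space) auto
finally show ?thesis .
qed

lemma integral_rad:
fixes f :: "real => real"
assumes "f : bmeas (rad b rh)"
shows "(\<integral>s. f s \<partial>rad b rh) = (LINT s:{0<..<rh}|lborel. s powr b * f s)"
proof -
have "(\<integral>s. f s \<partial>rad b rh) = (\<integral>s. s powr b *. f s \<partial>restrict_space lborel {0<..<rh})"
 unfolding rad_def using assms
 by (intro integral_density) (auto simp: measurable_rad cong: measurable_cong_sets
   intro!: measurable_restrict_space1)
also have "... = (LINT s:{0<..<rh}|lborel. s powr b * f s)"
 unfolding set_lebesgue_integral_def by (subst integral_restrict_space) auto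
finally show ?thesis .
qed

lemma finite_measure_rad: "-1 < b ==> 0 <= rh ==> finite_measure (rad b rh)"
proof (rule finite_measureI)
assume "-1 < b" "0 <= rh"
hence "(\<integral>\<^sup>+s. 1 \<partial>rad b rh) = ennreal (rh powr (b + 1) / (b + 1))"
 by (subst nn_integral_rad) (auto simp: nn_integral_powr_finite)
thus "emeasure (rad b rh) (space (rad b rh)) ~= \<infinity>" by (simp del: space_rad)
qed

lemma scaled_half_sphere: "th : half_sphere 1 ==> 0 < s ==> s < rh ==> s *. th : half_ball rh"
by (auto simp: half_sphere_def half_ball_def)

lemma scaled_half_sphere_eq: "0 < s ==> (%th. s *. th) ` half_sphere 1 <= half_sphere s"
by (rule image_subsetI) (simp add: half_sphere_def)

lemma polar_map_measurable:
"(%(s, th). s *. th) : measurable (rad b rh \<Otimes>\<^sub>M (sph a :: ('n::finite) point measure)) (hwt a rh)"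
proof -
let ?A = "(rad b rh \<Otimes>\<^sub>M (sph a :: 'n point measure))"
let ?B = "(%x. fst x *. snd x)"
have "(%x. x) : measurable (rad b rh) borel"
 unfolding measurable_rad by (rule measurable_restrict_space1) simp
moreover have "(%x. x) : measurable (sph a :: 'n point measure) borel"
 unfolding measurable_sph by (rule measurable_restrict_space1) simp
ultimately have "?B : bmeas ?A"
 by (intro borel_measurable_scaleR measurable_compose[OF measurable_fst] measurable_compose[OF measurable_snd])
hence "?B : measurable ?A (restrict_space borel (half_ball rh))"
proof (intro measurable_restrict_space2 Pi_I)
 fix x assume "x : space ?A"
 hence "snd x : half_sphere 1" "0 < fst x" "fst x < rh"
  by (auto simp: space_pair_measure)
 thus "fst x *. snd x : half_ball rh" by (rule scaled_half_sphere)
qed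
thus ?thesis
 unfolding split_beta' by (subst measurable_cong_sets[OF refl sets_wt])
qed

text \<open>The unweighted polar formula is applied to \<open>ind A z * y^a\<close>. The weight at
  \<open>s *. th\<close> splits into s^a, which joins the Jacobian s^N in \<open>rad\<close>, and
  the weight at \<open>th\<close>, which belongs to \<open>sph\<close>.\<close>

lemma distr_polar:
assumes a: "-1 < a" and rh: "0 <= rh"
shows "distr (rad (real CARD('n) + a) rh \<Otimes>\<^sub>M (sph a :: ('n::finite) point measure))
 (hwt a rh) (%(s, th). s *. th) = hwt a rh" (is "distr ?P ?W ?T = _")
proof (rule measure_eqI)
let ?A = "%s g. (\<integral>\<^sup>+z\<in>half_ball 1. (ennreal ((real CARD('n) + 1) * s ^ CARD('n)) * g (s *. sgn z)) \<partial>lborel)"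
let ?B = "%A s. (\<integral>\<^sup>+th. ind A (s *. th) \<partial>sph a)"
let ?C = "(real CARD('n) + 1)"
let ?D = "%z A s. ennreal (?C * snd (sgn z) powr a) * ind A (s *. sgn z) * ind (half_ball 1) z"
let ?E = "%s z. s *. sgn z"
define N where "N = CARD('n)"
let ?b = "real CARD('n) + a"
interpret S: finite_measure "sph a :: 'n point measure" by (rule finite_measure_sph[OF a])
fix A assume "A : sets (distr ?P ?W ?T)"
hence A: "A : sets ?W" by simp
hence Ab: "A : sets borel" "A <= half_ball rh"
 by (auto simp: sets_wt sets_restrict_space)
have [measurable]: "A : sets borel" by fact
define g :: "'n point => ennreal" where "g z = ind A z * ennreal (snd z powr a)" for z
have gm[measurable]: "g : bmeas borel" unfolding g_def by measurable
have g0: "g z = 0" if "snd z <= 0" for z using that Ab(2) by (auto simp: g_def half_ball_def indicator_def)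
have iA: "(%z. ind A z :: ennreal) : bmeas ?W"
 using A by (rule borel_measurable_indicator)
have "emeasure (distr ?P ?W ?T) A = (\<integral>\<^sup>+z. ind A z \<partial>distr ?P ?W ?T)"
 using A by simp
also have "... = (\<integral>\<^sup>+x. ind A (?T x) \<partial>?P)"
 by (rule nn_integral_distr[OF polar_map_measurable]) (use iA in simp)
also have "... = (\<integral>\<^sup>+s. \<integral>\<^sup>+th. ind A (s *. th) \<partial>sph a \<partial>rad ?b rh)"
 using S.nn_integral_fst[of "%x. ind A (?T x)"] measurable_compose[OF polar_map_measurable iA]
 by simp
also have "... = (\<integral>\<^sup>+s\<in>{0<..<rh}. (ennreal (s powr ?b) * (?B A s)) \<partial>lborel)"
 using S.borel_measurable_nn_integral_fst[of "%x. ind A (?T x)"] measurable_compose[OF polar_map_measurable iA]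
 by (intro nn_integral_rad) simp
also have "... = (\<integral>\<^sup>+s\<in>{0<..}. (\<integral>\<^sup>+z\<in>half_ball 1.
  (ennreal (?C * s ^ CARD('n)) * g (?E s z)) \<partial>lborel) \<partial>lborel)"
proof (rule nn_integral_cong)
 fix s :: real
 show "ennreal (s powr ?b) * (?B A s) * ind {0<..<rh} s =
  (?A s g) * ind {0<..} s"
 proof (cases "0 < s")
  case True
  have "(%th::'n point. s *. th) : bmeas borel" by measurable
  note [measurable] = measurable_compose[OF this, of "ind A :: _ => ennreal" borel]
  have 1: "(%th. ind A (s *. th) :: ennreal) : bmeas (sph a)"
   unfolding measurable_sph by (rule measurable_restrict_space1) measurable
  have "(%z::'n point. s *. sgn z) : bmeas borel" by measurable
  note [measurable] = measurable_compose[OF this, of "ind A :: _ => ennreal" borel]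
  have "ennreal (s powr ?b) * (?B A s) =
   ennreal (s powr ?b) * (\<integral>\<^sup>+z\<in>half_ball 1. (ennreal (?C * snd (sgn z) powr a) * ind A (?E s z)) \<partial>lborel)"
   by (simp only: nn_integral_sph[OF 1])
  also have "... = (NN z. ennreal (s powr ?b) * (?D z A s))"
   by (rule nn_integral_cmult[symmetric]) measurable
  also have "... = (?A s g)"
  proof (rule nn_integral_cong)
   fix z :: "'n point"
   show "ennreal (s powr ?b) * (?D z A s) =
    ennreal (?C * s ^ CARD('n)) * g (?E s z) * ind (half_ball 1) z"
   proof (cases "z : half_ball 1")
    case z: True
    hence "0 < snd (sgn z)" using sgn_half_ball[OF z] by (simp add: half_sphere_def)
    hence "s powr ?b * (?C * snd (sgn z) powr a) =
      (?C * s ^ CARD('n)) * (snd (?E s z) powr a)"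
     using True by (simp add: powr_add powr_realpow powr_mult)
    hence "ennreal (s powr ?b) * ennreal (?C * snd (sgn z) powr a) =
      ennreal (?C * s ^ CARD('n)) * ennreal (snd (?E s z) powr a)"
     using True by (simp add: ennreal_mult[symmetric])
    thus ?thesis using z unfolding g_def by (simp add: mult_ac)
   qed simp
  qed
  finally have eq: "ennreal (s powr ?b) * (?B A s) =
   (?A s g)" .
  show ?thesis
  proof (cases "s < rh")
   case True thus ?thesis unfolding eq using \<open>0 < s\<close> by simp
  next
   case False
   have z0: "g (?E s z) * ind (half_ball 1) z = 0" for z
    using False Ab(2) \<open>0 < s\<close>
    by (auto simp: g_def indicator_def half_ball_def norm_sgn dest!: subsetD split: if_splits)
   show ?thesis using False by (simp add: mult.assoc z0 del: mult_eq_0_iff)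
  qed
 qed simp
qed
also have "... = (NN z. g z)"
 by (rule nn_integral_polar_cone[OF gm g0, symmetric])
also have "... = (\<integral>\<^sup>+z\<in>half_ball rh. (ennreal (snd z powr a) * ind A z) \<partial>lborel)"
 unfolding g_def using Ab(2) by (intro nn_integral_cong) (auto simp: indicator_def)
also have "... = (\<integral>\<^sup>+z. ind A z \<partial>?W)"
 by (rule nn_integral_wt[symmetric]) (auto simp: iA)
also have "... = emeasure ?W A" using A by simp
finally show "emeasure (distr ?P ?W ?T) A = emeasure ?W A" .
qed simp

lemma polar_integral:
fixes f :: "('n::finite) point => real"
assumes a: "-1 < a" and rh: "0 <= rh" and f: "integrable (hwt a rh) f"
shows "integrable (rad (real CARD('n) + a) rh) (%s. \<integral>th. f (s *. th) \<partial>sph a)"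
 and "(\<integral>z. f z \<partial>hwt a rh) = (\<integral>s. (\<integral>th. f (s *. th) \<partial>sph a) \<partial>rad (real CARD('n) + a) rh)"
proof -
let ?R = "rad (real CARD('n) + a) rh" and ?S = "sph a :: 'n point measure"
let ?T = "%(s, th::'n point). s *. th"
let ?A = "(?R \<Otimes>\<^sub>M ?S)"
let ?B = "(\<integral>z. f z \<partial>hwt a rh)"
let ?C = "(\<integral>s. (\<integral>th. f (s *. th) \<partial>?S) \<partial>?R)"
let ?D = "(hwt a rh)"
let ?E = "(\<integral>x. f (?T x) \<partial>?A)"
interpret S: finite_measure ?S by (rule finite_measure_sph[OF a])
interpret R: finite_measure ?R by (rule finite_measure_rad) (use a rh in auto)
interpret P: pair_sigma_finite ?R ?S ..
have fm: "f : bmeas ?D" using f by auto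
have i: "integrable ?A (%x. f (?T x))"
proof (rule integrable_distr[OF polar_map_measurable])
 show "integrable (distr ?A ?D ?T) f"
  using f by (simp only: distr_polar[OF a rh])
qed
hence i': "integrable ?A (%(s, th). f (s *. th))" by (simp add: split_beta')
show "integrable ?R (%s. \<integral>th. f (s *. th) \<partial>?S)"
 using P.integrable_fst'[OF i] by simp
have "?B = ?E"
proof -
 have "?B = (\<integral>z. f z \<partial>distr ?A ?D ?T)"
  by (simp only: distr_polar[OF a rh])
 also have "... = ?E"
  by (rule integral_distr[OF polar_map_measurable fm])
 finally show ?thesis .
qed
also have "... = ?C"
 using P.integral_fst'[OF i] by simp
finally show "?B = ?C" .
qed

text \<open>The normalising power of \<open>r\<close> cancels r^N from the surface measure and r^a
  from the weight. What remains is an integral against a measure independent of \<open>r\<close>,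
  which can be differentiated under the integral sign.\<close>

lemma height_H_sph:
fixes v :: "('n::finite) point => real"
assumes r: "0 < r" and v: "continuous_on (half_sphere r) v"
shows "height_H a v r = (\<integral>th. (v (r *. th))^2 \<partial>sph a)"
proof -
let ?g = "%z. ind (half_sphere r) z *. (snd z powr a * (v z)^2)"
let ?B = "restrict_space lborel (ball 0 1) :: 'n point measure"
let ?d = "distr ?B borel (%z. r *. sgn z)"
let ?c = "(real CARD('n) + 1) * r ^ CARD('n)"
let ?A = "(LINT z:half_ball 1|lborel. (real CARD('n) + 1) * snd (sgn z) powr a * (v (r *. sgn z))^2)"
let ?C = "%z. ind (half_ball 1) z *. ((real CARD('n) + 1) * snd (sgn z) powr a * (v (r *. sgn z))^2)"
let ?D = "(%th. (v (r *. th))^2)"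
let ?E = "(restrict_space borel (half_sphere r))"
let ?F = "(real CARD('n) + a)"
have vm: "v : bmeas ?E"
 using v by (rule borel_measurable_continuous_on_restrict)
have "(%z. snd z powr a * (v z)^2) : bmeas ?E"
 by (intro borel_measurable_times borel_measurable_power vm measurable_restrict_space1) measurable
hence gm[measurable]: "?g : bmeas borel"
 by (subst (asm) borel_measurable_restrict_space_iff) auto
have sm: "sphere_measure r = density ?d (%_. ennreal ?c)"
 unfolding sphere_measure_def by (rule measure_eqI) (auto simp: emeasure_density add.commute nn_integral_cmult_indicator)
have dm: "(%z. r *. sgn z) : measurable ?B borel"
 by (rule measurable_restrict_space1) measurable
have "(LINT z:half_sphere r|sphere_measure r. snd z powr a * (v z)^2) = (\<integral>z. ?g z \<partial>density ?d (%_. ennreal ?c))"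
 unfolding set_lebesgue_integral_def sm ..
also have "... = (\<integral>z. ?c *. ?g z \<partial>?d)"
 by (rule integral_density) (use r gm in auto)
also have "... = (\<integral>z. ?c *. ?g (r *. sgn z) \<partial>?B)"
 by (rule integral_distr[OF dm]) measurable
also have "... = (\<integral>z. ind (ball 0 1) z *. (?c *. ?g (r *. sgn z)) \<partial>lborel)"
 by (subst integral_restrict_space) auto
also have "... = (\<integral>z. (r powr ?F) * (?C z) \<partial>lborel)"
proof (rule Bochner_Integration.integral_cong)
 fix z :: "'n point"
 show "ind (ball 0 1) z *. (?c *. ?g (r *. sgn z)) =
  (r powr ?F) * (?C z)"
 proof (cases "z : half_ball 1")
  case True
  hence "0 < snd (sgn z)" "norm (sgn z) = 1" using sgn_half_ball[OF True] by (auto simp: half_sphere_def)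
  moreover from this have "r *. sgn z : half_sphere r" using r by (simp add: half_sphere_def)
  moreover have "z : ball 0 1" using True by (auto simp: half_ball_def)
  ultimately show ?thesis
   using True r by (simp add: powr_add powr_realpow powr_mult)
 next
  case False
  have "z : ball 0 1 ==> r *. sgn z \<notin> half_sphere r"
   using False r by (auto simp: half_ball_def half_sphere_def sgn_div_norm zero_less_mult_iff mult_less_0_iff zero_less_divide_iff)
  thus ?thesis using False by (cases "z : ball 0 1") auto
 qed
qed simp
also have "... = r powr ?F * ?A"
 unfolding set_lebesgue_integral_def by (rule integral_mult_right_zero)
also have "?A = (\<integral>th. (v (r *. th))^2 \<partial>sph a)"
proof (rule integral_sph[symmetric])
 have "continuous_on (half_sphere 1) ?D"
  by (intro continuous_intros continuous_on_compose2[OF v] scaled_half_sphere_eq r)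
 thus "?D : bmeas (sph a)"
  by (rule continuous_on_measurable_sph)
qed
finally show ?thesis
 unfolding height_H_def using r by (simp add: mult.assoc[symmetric] powr_add[symmetric])
qed

subsection \<open>Traces\<close>

text \<open>
Traces are controlled along the rays \<open>ta \<mapsto> ((1 - ta) x, ta r)\<close> from the points of the thin ball
towards the top of the half ball: unlike those of the vertical segments, their lengths are bounded
below uniformly up to the edge.
\<close>

definition ray :: "real => (real ^ 'n) => real => ('n::finite) point" where
"ray r x ta = ((1 - ta) *. x, ta * r)"

lemma norm_Pair_le_add: "norm (x, y) <= norm x + norm y"
unfolding norm_Pair by (rule sqrt_sum_squares_le_sum) auto

lemma ennreal_mult_assoc:
"0 <= A ==> 0 <= B ==> ennreal A * (ennreal B * X) = ennreal (A * B) * X"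
by (simp add: ennreal_mult mult.assoc)

lemma ennreal_two_plus: "0 <= A ==> 0 <= B ==> ennreal (2 * A + 2 * B) = 2 * ennreal A + 2 * ennreal B"
by (simp add: ennreal_mult)

lemma ennreal_two_half: "2 * (ennreal (1 / 2) * X) = X"
proof -
have "ennreal 2 * (ennreal (1 / 2) * X) = ennreal (2 * (1 / 2)) * X"
 by (rule ennreal_mult_assoc) auto
thus ?thesis by (simp only: ennreal_numeral) simp
qed

lemma ray_in_half_ball:
assumes "norm x < r" "0 < ta" "ta < 1"
shows "ray r x ta : half_ball r"
proof -
have r: "0 < r" using assms(1) norm_ge_zero[of x] by linarith
have "norm (ray r x ta) <= norm ((1 - ta) *. x) + norm (ta * r)"
 unfolding ray_def by (rule norm_Pair_le_add)
also have "... = (1 - ta) * norm x + ta * r" using assms r by simp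
also have "(1 - ta) * norm x < (1 - ta) * r" using assms by (intro mult_strict_left_mono) auto
finally have "norm (ray r x ta) < r" by (simp add: algebra_simps)
moreover have "0 < snd (ray r x ta)" using assms r by (simp add: ray_def)
ultimately show ?thesis by (simp add: half_ball_def)
qed

lemma borel_measurable_pair_iff:
"f : bmeas (borel :: ('a::euclidean_space \<times> 'b::euclidean_space) measure) \<longleftrightarrow>
 f : bmeas lborel2"
unfolding lborel_prod by simp

lemma ray_measurable:
"(%(x, ta). ray r x (de * ta)) : bmeas (borel :: ('n::finite) point measure)"
unfolding ray_def split_beta' by (intro borel_measurable_continuous_onI continuous_intros)

text \<open>For fixed \<open>ta < 1/2\<close> the map x -> (1 - ta) x has Jacobian at least 2^-N,
  which costs the factor 2^N. The height on the ray is y = r ta, and this substitution produces the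
  power -a-1 of \<open>r\<close>.\<close>

lemma ray_integral_le:
fixes f :: "('n::finite) point => ennreal"
assumes f[measurable]: "f : bmeas borel" and r: "0 < r"
shows "(NN x. NN ta. ind (ball 0 r) x * (ind {0<..<1/2} ta * (ennreal (ta powr a) * f (ray r x ta))))
 <= ennreal (2 ^ CARD('n) * r powr (- a - 1)) * (\<integral>\<^sup>+z\<in>half_ball r. (ennreal (snd z powr a) * f z) \<partial>lborel)"
proof -
let ?A = "%h. (NN y. ind {0<..} y * ennreal (y powr a) * h y)"
let ?B = "%h. (NN ta. ind {0<..} ta * ennreal (ta powr a) * h (r * ta))"
let ?C = "%ta x. ind {0<..<1/2} ta * (ennreal (ta powr a) * f (ray r x ta))"
let ?D = "lborel2"
let ?E = "%h. (NN ta. ind {0<..} (r * ta) * ennreal ((r * ta) powr a) * h (r * ta))"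
let ?F = "%y x. ennreal (y powr a) * f (x, y) * ind (half_ball r) (x, y)"
let ?G = "(\<integral>\<^sup>+z\<in>half_ball r. (ennreal (snd z powr a) * f z) \<partial>lborel)"
let ?H = "%g ta. (NN x. g ((1 - ta) *. x))"
let ?I = "%ta h. ind {0<..} ta * ennreal (ta powr a) * h (r * ta)"
let ?J = "%ta. (NN x. ind (ball 0 r) x * (?C ta x))"
define h where "h y = (NN x. ind (half_ball r) (x, y) * f (x, y))" for y
have pm: "(%z. ind (half_ball r) z * f z) : bmeas ?D"
 unfolding borel_measurable_pair_iff[symmetric] by measurable
have hm[measurable]: "h : bmeas borel"
proof -
 have "(%x::real \<times> (real ^ 'n). (snd x, fst x)) : measurable ?D ?D" by measurable
 from measurable_compose[OF this pm]
 have "(%x. ind (half_ball r) (snd x, fst x) * f (snd x, fst x)) : bmeas ((lborel :: real measure) \<Otimes>\<^sub>M lborel)" .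
 from lborel.borel_measurable_nn_integral_fst[OF this] show ?thesis by (simp add: h_def[abs_def])
qed
have rm: "(%z::(real ^ 'n) \<times> real. f (ray r (fst z) (snd z))) : bmeas borel"
 using measurable_compose[OF ray_measurable[of r 1] f] by (simp add: split_beta')
have m: "(%(x, ta). ind (ball 0 r) x * (?C ta x))
 : bmeas ?D"
proof -
 have 1: "fst : measurable (borel :: ((real ^ 'n) \<times> real) measure) borel"
  by (intro borel_measurable_continuous_onI continuous_intros)
 have 2: "(ind (ball 0 r) :: real ^ 'n => ennreal) : bmeas borel"
  by (intro borel_measurable_indicator borel_open open_ball)
 note [measurable] = measurable_compose[OF 1 2]
 have [measurable]: "(snd :: (real ^ 'n) \<times> real => real) : bmeas borel"
  by (intro borel_measurable_continuous_onI continuous_intros)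
 note [measurable] = rm
 show ?thesis unfolding borel_measurable_pair_iff[symmetric] split_beta' by measurable
qed
have "(NN x. NN ta. ind (ball 0 r) x * (?C ta x))
 = (NN ta. NN x. ind (ball 0 r) x * (?C ta x))"
 by (rule lborel_pair.Fubini'[OF m, symmetric])
also have "... <= (NN ta. ennreal (2 ^ CARD('n)) * (?I ta h))"
proof (rule nn_integral_mono)
 fix ta :: real
 show "(?J ta)
  <= ennreal (2 ^ CARD('n)) * (?I ta h)"
 proof (cases "ta : {0<..<1/2}")
  case True
  hence t: "0 < 1 - ta" "1 / 2 <= 1 - ta" "ta < 1" "0 < ta" by auto
  define g where "g x = ind (half_ball r) (x, r * ta) * f (x, r * ta)" for x
  have "(%x::real ^ 'n. (x, r * ta)) : bmeas borel"
   by (intro borel_measurable_continuous_onI continuous_intros)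
  from measurable_compose[OF this, of "%z. ind (half_ball r) z * f z" borel]
  have gm[measurable]: "g : bmeas borel" unfolding g_def by simp
  have "(%x::real ^ 'n. (1 - ta) *. x) : bmeas borel" by measurable
  from measurable_compose[OF this gm]
  have gm2[measurable]: "(%x. g ((1 - ta) *. x)) : bmeas borel" .
  have "(?J ta)
   <= (NN x. ennreal (ta powr a) * g ((1 - ta) *. x))"
  proof (rule nn_integral_mono)
   fix x :: "real ^ 'n"
   have "ray r x ta : half_ball r" if "norm x < r" using ray_in_half_ball[OF that] t by simp
   thus "ind (ball 0 r) x * (?C ta x)
    <= ennreal (ta powr a) * g ((1 - ta) *. x)"
    using True by (auto simp: g_def ray_def indicator_def mult.commute[of r])
  qed
  also have "... = ennreal (ta powr a) * (?H g ta)"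
   by (rule nn_integral_cmult) simp
  also have "... <= ennreal (ta powr a) * (ennreal (2 ^ CARD('n)) * h (r * ta))"
  proof (rule mult_left_mono)
   have "h (r * ta) = ennreal ((1 - ta) ^ CARD('n)) * (?H g ta)"
    using nn_integral_lborel_scale[OF gm t(1)] by (simp add: h_def g_def)
   moreover have "ennreal (2 ^ CARD('n)) * (ennreal ((1 - ta) ^ CARD('n)) * X) >= X" for X
   proof -
    have "1 ^ CARD('n) <= (2 * (1 - ta)) ^ CARD('n)" using t by (intro power_mono) auto
    hence "1 <= 2 ^ CARD('n) * (1 - ta) ^ CARD('n)" by (simp only: power_mult_distrib power_one)
    hence "ennreal 1 <= ennreal (2 ^ CARD('n)) * ennreal ((1 - ta) ^ CARD('n))"
     using t by (simp add: ennreal_mult[symmetric])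
    from mult_right_mono[OF this, of X] show ?thesis by (simp add: mult.assoc)
   qed
   ultimately show "(?H g ta) <= ennreal (2 ^ CARD('n)) * h (r * ta)" by simp
  qed simp
  finally show ?thesis using t by (simp add: mult_ac)
 qed simp
qed
also have "... = ennreal (2 ^ CARD('n)) * (?B h)"
 by (rule nn_integral_cmult) measurable
also have "(?B h) =
  ennreal (r powr (- a - 1)) * (?A h)"
proof -
 have "(?A h) =
  ennreal r * (?E h)"
  using nn_integral_real_affine[of "%y. ind {0<..} y * ennreal (y powr a) * h y" r 0] r by simp
 also have "(?E h) =
  (NN ta. ennreal (r powr a) * (?I ta h))"
  using r by (intro nn_integral_cong) (auto simp: indicator_def zero_less_mult_iff powr_mult ennreal_mult mult.assoc)
 also have "... = ennreal (r powr a) * (?B h)"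
  by (rule nn_integral_cmult) measurable
 finally have 1: "(?A h) =
  ennreal r * (ennreal (r powr a) * (?B h))" .
 have "r powr (- a - 1) * (r * r powr a) = 1" using r by (simp add: powr_diff powr_minus)
 hence "ennreal (r powr (- a - 1)) * (ennreal r * ennreal (r powr a)) = 1"
  using r by (simp add: ennreal_mult[symmetric])
 thus ?thesis unfolding 1 by (simp add: mult.assoc[symmetric])
qed
also have "(?A h) =
  ?G"
proof -
 have pm2: "(%z. ennreal (snd z powr a) * f z * ind (half_ball r) z) : bmeas ?D"
  unfolding borel_measurable_pair_iff[symmetric] by measurable
 have "?G =
  (NN y. NN x. (?F y x))"
  unfolding lborel_prod[symmetric] using lborel_pair.nn_integral_snd[OF pm2] by simp
 also have "... = (?A h)"
 proof (rule nn_integral_cong)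
  fix y :: real
  have "(%x::real ^ 'n. (x, y)) : bmeas borel"
   by (intro borel_measurable_continuous_onI continuous_intros)
  from measurable_compose[OF this, of "%z. ind (half_ball r) z * f z" borel]
  have gm: "(%x. ind (half_ball r) (x, y) * f (x, y)) : bmeas lborel" by simp
  have "(NN x. (?F y x)) =
   (NN x. ennreal (y powr a) * (ind (half_ball r) (x, y) * f (x, y)))"
   by (simp add: mult_ac)
  also have "... = ennreal (y powr a) * h y"
   unfolding h_def by (rule nn_integral_cmult[OF gm])
  also have "... = ind {0<..} y * ennreal (y powr a) * h y"
  proof (cases "0 < y")
   case False
   hence "h y = 0" unfolding h_def by (auto simp: half_ball_def indicator_def)
   thus ?thesis by simp
  qed simp
  finally show "(NN x. (?F y x)) =
    ind {0<..} y * ennreal (y powr a) * h y" .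
 qed
 finally show ?thesis by simp
qed
finally show ?thesis using r by (simp add: ennreal_mult mult.assoc)
qed

text \<open>The increment is the integral of the derivative along the ray, whose velocity (-x, r)
  has norm at most 2r. Cauchy-Schwarz with the splitting 1 = ta^(-a/2) ta^(a/2) leaves the integral
  of ta^-a over (0, 1/2), which converges because \<open>a < 1\<close>.\<close>

lemma ray_increment_le:
fixes ps :: "('n::finite) point => real"
assumes ps: "smooth ps" and a: "a < 1" and x: "norm x < r" and si: "0 < si" "si <= 1 / 2"
shows "ennreal ((ps (ray r x si) - ps (x, 0))^2) <=
 ennreal (4 * r^2 * ((1 / 2) powr (1 - a) / (1 - a))) *
  (NN ta. ind {0<..<1/2} ta * (ennreal (ta powr a) * ennreal ((norm (grad ps (ray r x ta)))^2)))"
proof -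
let ?A = "%k. (NN ta. (ind {0<..<1/2} ta * ennreal (ta powr (- a / 2))) * (ind {0<..<1/2} ta * ennreal (ta powr (a / 2) * k ta)))"
let ?B = "%ta r. ennreal (ta powr a) * ennreal ((norm (grad ps (ray r x ta)))^2)"
let ?C = "%r. (NN ta. ind {0<..<1/2} ta * (?B ta r))"
let ?D = "%ta k. ind {0<..<1/2} ta * ennreal (ta powr (a / 2) * k ta)"
let ?E = "(NN ta. (ind {0<..<1/2} ta * ennreal (ta powr (- a / 2)))^2)"
let ?F = "((1 / 2) powr (1 - a) / (1 - a))"
let ?G = "%k. (NN ta. (?D ta k)^2)"
let ?H = "%r. (%ta. grad ps (ray r x ta) \<bullet> (- x, r))"
let ?I = "%r. ray r x si"
have r: "0 < r" using x norm_ge_zero[of x] by linarith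
define k where "k ta = 2 * r * norm (grad ps (ray r x ta))" for ta
have rc: "continuous_on UNIV (ray r x)" unfolding ray_def by (intro continuous_intros)
have gc: "continuous_on UNIV (%ta. grad ps (ray r x ta))"
 by (rule continuous_on_compose2[OF continuous_grad[OF ps, of UNIV] rc]) auto
have kc: "continuous_on UNIV k" unfolding k_def by (intro continuous_intros gc)
have km[measurable]: "k : bmeas borel" using kc by (rule borel_measurable_continuous_onI)
have k0: "0 <= k ta" for ta using r by (simp add: k_def)
have int: "((?H r) has_integral (ps (?I r) - ps (ray r x 0))) {0..si}"
proof (rule fundamental_theorem_of_calculus)
 fix ta :: real
 have "((%ta. ray r x ta) has_derivative (%h. h *. (- x, r))) (at ta within {0..si})"
  unfolding ray_def by (auto intro!: derivative_eq_intros simp: algebra_simps)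
 from has_derivative_compose[OF this smooth_has_derivative[OF ps]]
 have "((%ta. ps (ray r x ta)) has_derivative (%h. grad ps (ray r x ta) \<bullet> (h *. (- x, r)))) (at ta within {0..si})" .
 thus "((%ta. ps (ray r x ta)) has_vector_derivative grad ps (ray r x ta) \<bullet> (- x, r)) (at ta within {0..si})"
  unfolding has_vector_derivative_def inner_scaleR_right real_scaleR_def .
qed (use si in auto)
have kint: "(k has_integral integral {0..si} k) {0..si}"
 by (intro integrable_integral integrable_continuous_real continuous_on_subset[OF kc]) auto
have le_k: "norm (grad ps (ray r x ta) \<bullet> (- x, r)) <= k ta" for ta
proof -
 have "norm (- x, r) <= 2 * r"
  using norm_Pair_le_add[of "- x" r] x r by simp
 hence "norm (grad ps (ray r x ta)) * norm (- x, r) <= norm (grad ps (ray r x ta)) * (2 * r)"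
  by (intro mult_left_mono) auto
 thus ?thesis
  using Cauchy_Schwarz_ineq2[of "grad ps (ray r x ta)" "(- x, r)"] by (simp add: k_def mult_ac)
qed
have "norm (ps (?I r) - ps (ray r x 0)) <= integral {0..si} k"
proof -
 have "norm (integral {0..si} (?H r)) <= integral {0..si} k"
  using int kint by (intro integral_norm_bound_integral le_k has_integral_integrable)
 thus ?thesis using integral_unique[OF int] by simp
qed
hence "ennreal \<bar>ps (?I r) - ps (x, 0)\<bar> <= ennreal (integral {0..si} k)"
 by (intro ennreal_leI) (simp add: ray_def)
also have "... = (\<integral>\<^sup>+ta\<in>{0..si}. ennreal (k ta) \<partial>lborel)"
 using kint k0 by (intro nn_integral_has_integral_lebesgue'[symmetric]) auto
also have "... <= (?A k)"
proof (rule nn_integral_mono_AE)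
 have "AE ta in lborel. ta ~= 0 & ta ~= 1/2"
  using AE_lborel_singleton[of 0] AE_lborel_singleton[of "1/2"] by eventually_elim auto
 thus "AE ta in lborel. ennreal (k ta) * ind {0..si} ta <=
  (ind {0<..<1/2} ta * ennreal (ta powr (- a / 2))) * (?D ta k)"
 proof eventually_elim
  case (elim ta)
  show ?case
  proof (cases "ta : {0..si}")
   case True
   hence t: "0 < ta" "ta < 1/2" using elim si by auto
   have "ta powr (- a / 2) * (ta powr (a / 2) * k ta) = k ta"
    using t by (simp add: mult.assoc[symmetric] powr_add[symmetric])
   hence "ennreal (ta powr (- a / 2)) * ennreal (ta powr (a / 2) * k ta) = ennreal (k ta)"
    using k0 by (simp add: ennreal_mult[symmetric])
   thus ?thesis using t True by simp
  qed simp
 qed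
qed
finally have 1: "ennreal \<bar>ps (?I r) - ps (x, 0)\<bar> <= (?A k)" .
have "ennreal ((ps (?I r) - ps (x, 0))^2) = (ennreal \<bar>ps (?I r) - ps (x, 0)\<bar>)^2"
 by (simp add: ennreal_power)
also have "... <= (?A k)^2"
 using 1 by (intro power_mono) auto
also have "... <= ?E *
  (?G k)"
 by (rule Cauchy_Schwarz_nn_integral) measurable
also have "?E = (\<integral>\<^sup>+ta\<in>{0<..<1/2}. ennreal (ta powr - a) \<partial>lborel)"
 by (intro nn_integral_cong) (auto simp: indicator_def ennreal_power power2_eq_square ennreal_mult[symmetric] powr_add[symmetric])
also have "... = ennreal ?F"
 using nn_integral_powr_finite[of "- a" "1/2"] a by (simp add: add.commute)
also have "(?G k) =
  (NN ta. ennreal (4 * r^2) * (ind {0<..<1/2} ta * (?B ta r)))"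
proof (rule nn_integral_cong)
 fix ta :: real
 show "(?D ta k)^2 =
  ennreal (4 * r^2) * (ind {0<..<1/2} ta * (?B ta r))"
 proof (cases "ta : {0<..<1/2}")
  case True
  have "(ta powr (a / 2) * k ta)^2 = 4 * r^2 * (ta powr a * (norm (grad ps (ray r x ta)))^2)"
   using True by (simp add: k_def power_mult_distrib powr_power)
  thus ?thesis using True k0 by (simp add: ennreal_power ennreal_mult[symmetric])
 qed simp
qed
also have "... = ennreal (4 * r^2) * (?C r)"
proof (rule nn_integral_cmult)
 have [measurable]: "(%ta. grad ps (ray r x ta)) : bmeas borel"
  using gc by (rule borel_measurable_continuous_onI)
 show "(%ta. ind {0<..<1/2} ta * (?B ta r)) : bmeas lborel"
  by measurable
qed
also have "ennreal ?F * (ennreal (4 * r^2) *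
  (?C r)) =
 ennreal (4 * r^2 * ?F) *
  (?C r)"
 using a by (subst ennreal_mult) (auto simp only: mult_ac, auto)
finally show ?thesis .
qed

lemma ennreal_sq_add_le: "ennreal ((x + y)^2) <= 2 * ennreal (x^2) + 2 * ennreal (y^2)"
proof -
have "(x + y)^2 <= 2 * x^2 + 2 * y^2"
 using sum_squares_bound[of x y] by (simp add: power2_sum)
hence "ennreal ((x + y)^2) <= ennreal (2 * x^2 + 2 * y^2)" by (rule ennreal_leI)
thus ?thesis by (simp add: ennreal_plus ennreal_mult)
qed

lemma nn_integral_const_mult_add_le:
assumes [measurable]: "f : bmeas M" "g : bmeas M"
 and "!!x. x : space M ==> h x <= c * f x + d * g x"
shows "(\<integral>\<^sup>+x. h x \<partial>M) <= c * (\<integral>\<^sup>+x. f x \<partial>M) + d * (\<integral>\<^sup>+x. g x \<partial>M)"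
proof -
have "(\<integral>\<^sup>+x. h x \<partial>M) <= (\<integral>\<^sup>+x. c * f x + d * g x \<partial>M)"
 using assms(3) by (rule nn_integral_mono)
also have "... = c * (\<integral>\<^sup>+x. f x \<partial>M) + d * (\<integral>\<^sup>+x. g x \<partial>M)"
 by (simp add: nn_integral_add nn_integral_cmult)
finally show ?thesis .
qed

text \<open>The mean of \<open>v\<^sup>2\<close> over the slab swept out by the parameters \<open>de/2 < ta < de\<close> of the rays.\<close>

definition slab :: "real => real => (('n::finite) point => real) => ennreal" where
"slab r de v = (NN x. NN t. ind (ball 0 r) x * (ind {1/2<..<1::real} t * ennreal ((v (ray r x (de * t)))^2)))"

lemma slab_measurable:
fixes v :: "('n::finite) point => real"
assumes v: "v : bmeas borel"
shows "(%(x, t). ind (ball 0 r) x * (ind {c<..<d} t * ennreal ((v (ray r x (de * t)))^2)))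
  : bmeas lborel2"
proof -
have 1: "fst : measurable (borel :: 'n point measure) borel"
 by (intro borel_measurable_continuous_onI continuous_intros)
have 2: "(ind (ball 0 r) :: real ^ 'n => ennreal) : bmeas borel"
 by (intro borel_measurable_indicator borel_open open_ball)
note [measurable] = measurable_compose[OF 1 2]
have [measurable]: "(snd :: 'n point => real) : bmeas borel"
 by (intro borel_measurable_continuous_onI continuous_intros)
have [measurable]: "(%z::'n point. v (ray r (fst z) (de * snd z))) : bmeas borel"
 using measurable_compose[OF ray_measurable[of r de] v] by (simp add: split_beta')
show ?thesis unfolding borel_measurable_pair_iff[symmetric] split_beta' by measurable
qed

text \<open>On a slab at fixed height the weight is bounded below, so no gradient is involved. The
  constant degenerates as \<open>de\<close> tends to 0; the estimate is used to control
  approximation errors at fixed \<open>de\<close>.\<close>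

lemma slab_le:
fixes v :: "('n::finite) point => real"
assumes v: "v : bmeas borel" and r: "0 < r" and de: "0 < de" "de <= 1 / 2"
shows "slab r de v <= ennreal ((1 / de) * (2 / de) powr \<bar>a\<bar> * (2 ^ CARD('n) * r powr (- a - 1))) *
 (\<integral>\<^sup>+z\<in>half_ball r. (ennreal (snd z powr a) * ennreal ((v z)^2)) \<partial>lborel)"
proof -
let ?c = "(2 / de) powr \<bar>a\<bar>"
let ?g = "%x ta. ind (ball 0 r) x * (ind {0<..<1/2} ta * (ennreal (ta powr a) * ennreal ((v (ray r x ta))^2)))"
let ?A = "%x. (NN ta. ?g x ta)"
let ?B = "%x. (NN t. ind (ball 0 r) x * (ind {1/2<..<1::real} t * ennreal ((v (ray r x (de * t)))^2)))"
let ?C = "(\<integral>\<^sup>+z\<in>half_ball r. (ennreal (snd z powr a) * ennreal ((v z)^2)) \<partial>lborel)"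
let ?D = "(1 / de * ?c)"
let ?E = "%x. (NN ta. ennreal ?c * ?g x ta)"
let ?F = "lborel2"
let ?G = "(2 ^ CARD('n) * r powr (- a - 1))"
have pw: "1 <= ?c * ta powr a" if "de / 2 < ta" "ta < de" for ta
proof (cases "0 <= a")
 case True
 have "1 powr a <= (2 / de * ta) powr a" using True that de by (intro powr_mono2) (auto simp: field_simps)
 thus ?thesis using True that de by (simp add: powr_mult[symmetric])
next
 case False
 have "1 <= ?c" using de by (intro ge_one_powr_ge_zero) auto
 moreover have "1 <= ta powr a"
  using False that de powr_mono2'[of a ta 1] by auto
 ultimately show ?thesis using mult_mono[of 1 ?c 1 "ta powr a"] by simp
qed
have vm: "(%t. v (ray r x t)) : bmeas borel" for x
proof -
 have "ray r x : bmeas borel"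
  unfolding ray_def by (intro borel_measurable_continuous_onI continuous_intros)
 from measurable_compose[OF this v] show ?thesis .
qed
have one: "(?B x)
 <= ennreal ?D * (?A x)" for x
proof -
 note [measurable] = vm[of x]
 define k where "k ta = ind (ball 0 r) x * (ind {de/2<..<de} ta * ennreal ((v (ray r x ta))^2))" for ta
 have km: "k : bmeas borel" unfolding k_def by measurable
 have "(?B x)
  = (NN t. k (de * t))"
  using de by (intro nn_integral_cong) (auto simp: k_def indicator_def field_simps)
 also have "... = ennreal (1 / de) * (NN ta. k ta)"
 proof -
  have "ennreal (1 / de) * ennreal de = 1" using de by (simp add: ennreal_mult[symmetric])
  thus ?thesis
   using nn_integral_real_affine[OF km, of de 0] de by (simp add: mult.assoc[symmetric])
 qed
 also have "... <= ennreal (1 / de) * (?E x)"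
 proof (intro mult_left_mono nn_integral_mono)
  fix ta :: real
  show "k ta <= ennreal ?c * ?g x ta"
  proof (cases "ta : {de/2<..<de}")
   case True
   hence "ennreal 1 <= ennreal ?c * ennreal (ta powr a)" using pw by (simp add: ennreal_mult[symmetric])
   from mult_right_mono[OF this, of "ennreal ((v (ray r x ta))^2)"] True de
   show ?thesis by (auto simp: k_def indicator_def mult.assoc)
  qed (simp add: k_def)
 qed simp
 also have "(?E x) = ennreal ?c * (?A x)"
  by (rule nn_integral_cmult) measurable
 also have "ennreal (1 / de) * (ennreal ?c * (?A x)) = ennreal ?D * (?A x)"
  by (rule ennreal_mult_assoc) (use de in auto)
 finally show ?thesis .
qed
have gm: "(%x. \<integral>\<^sup>+ta. ?g x ta \<partial>lborel) : bmeas lborel"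
proof -
 have "(%z::'n point. ennreal (snd z powr a)) : bmeas ?F"
  unfolding borel_measurable_pair_iff[symmetric] by measurable
 hence "(%(x, ta). ?g x ta) : bmeas ?F"
  using borel_measurable_times_ennreal[OF _ slab_measurable[OF v, of r 0 "1/2" 1]]
  by (fastforce simp: split_beta' mult_ac)
 from lborel.borel_measurable_nn_integral_fst[OF this] show ?thesis by simp
qed
have "slab r de v <= (NN x. ennreal ?D * (?A x))"
 unfolding slab_def by (intro nn_integral_mono one)
also have "... = ennreal ?D * (NN x. NN ta. ?g x ta)"
 by (rule nn_integral_cmult[OF gm])
also have "... <= ennreal ?D * (ennreal ?G *
  ?C)"
 using v by (intro mult_left_mono ray_integral_le r) auto
also have "... = ennreal ((1 / de) * ?c * ?G) *
  ?C"
 by (rule ennreal_mult_assoc) (use de in auto)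
finally show ?thesis .
qed

definition energy :: "real => real => (('n::finite) point => real) => ('n point => 'n point) => ennreal" where
"energy a r v G = (\<integral>\<^sup>+z. ennreal ((norm (G z))^2 + (v z)^2) \<partial>hwt a r)"

lemma ray_increment_int_le:
fixes ps :: "('n::finite) point => real"
assumes ps: "smooth ps" and r: "0 < r"
shows "(NN x. NN ta. ind (ball 0 r) x * (ind {0<..<1/2} ta * (ennreal (ta powr a) * ennreal ((norm (grad ps (ray r x ta)))^2))))
 <= ennreal (2 ^ CARD('n) * r powr (- a - 1)) * energy a r ps (grad ps)"
proof -
have m[measurable]: "grad ps : bmeas borel"
 by (intro borel_measurable_continuous_onI continuous_grad ps)
have m2[measurable]: "ps : bmeas borel"
 by (intro borel_measurable_continuous_onI smooth_continuous ps)
have "(\<integral>\<^sup>+z\<in>half_ball r. (ennreal (snd z powr a) * ennreal ((norm (grad ps z))^2)) \<partial>lborel) =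
 (\<integral>\<^sup>+z. ennreal ((norm (grad ps z))^2) \<partial>hwt a r)"
 by (rule nn_integral_wt[symmetric]) (auto intro!: borel_measurable_wtI)
also have "... <= energy a r ps (grad ps)"
 unfolding energy_def by (intro nn_integral_mono ennreal_leI) auto
finally show ?thesis
 by (intro order_trans[OF ray_integral_le[OF _ r]] mult_left_mono) auto
qed

text \<open>In contrast to \<open>slab_le\<close>, the constant is uniform in \<open>de\<close>; the
  price is the gradient part of the energy. A single slab at height 1/2 serves as the reference for
  all lower ones.\<close>

lemma smooth_slab_le:
assumes a: "-1 < a" "a < 1" and r: "0 < r"
obtains C where "0 <= C"
 "!!(ps :: ('n::finite) point => real) de. smooth ps ==> 0 < de ==> de <= 1 / 2 ==>
  slab r de ps <= ennreal C * energy a r ps (grad ps)"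
proof -
let ?A = "%ennreal ps. (\<integral>\<^sup>+z\<in>half_ball r. (ennreal (snd z powr a) * ennreal ((ps z)^2)) \<partial>lborel)"
let ?B = "lborel2"
define c where "c = 4 * r^2 * ((1 / 2) powr (1 - a) / (1 - a))"
define d where "d = 2 ^ CARD('n) * r powr (- a - 1)"
define e where "e = (1 / (1/2)) * (2 / (1/2)) powr \<bar>a\<bar> * d"
have nn: "0 <= c" "0 <= d" "0 <= e" using a r by (auto simp: c_def d_def e_def)
have main: "slab r de ps <= ennreal (4 * e + 3 * c * d) * energy a r ps (grad ps)"
 if ps: "smooth ps" and de: "0 < de" "de <= 1 / 2" for ps :: "'n point => real" and de
proof -
 have m2[measurable]: "ps : bmeas borel"
  by (intro borel_measurable_continuous_onI smooth_continuous ps)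
 have m[measurable]: "grad ps : bmeas borel"
  by (intro borel_measurable_continuous_onI continuous_grad ps)
 let ?E = "energy a r ps (grad ps)"
 let ?b = "%x::real ^ 'n. ind (ball 0 r) x :: ennreal"
 define J where "J x = (NN ta. ?b x * (ind {0<..<1/2} ta * (ennreal (ta powr a) * ennreal ((norm (grad ps (ray r x ta)))^2))))" for x
 have J: "(NN x. J x) <= ennreal d * ?E"
  unfolding J_def d_def by (rule ray_increment_int_le[OF ps r])
 have bm[measurable]: "?b : bmeas borel"
  by (intro borel_measurable_indicator borel_open open_ball)
 have Jm[measurable]: "J : bmeas borel"
 proof -
  have "(%z. norm (grad ps z)) : bmeas borel" by measurable
  note s = slab_measurable[OF this, of r 0 "1/2" 1]
  have "(%z::'n point. ennreal (snd z powr a)) : bmeas ?B"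
   unfolding borel_measurable_pair_iff[symmetric] by measurable
  from borel_measurable_times_ennreal[OF this s]
  have "(%(x, ta). ?b x * (ind {0<..<1/2} ta * (ennreal (ta powr a) * ennreal ((norm (grad ps (ray r x ta)))^2))))
    : bmeas ?B"
   by (simp add: split_beta' mult_ac)
  from lborel.borel_measurable_nn_integral_fst[OF this] show ?thesis by (simp add: J_def[abs_def])
 qed
 have rm[measurable]: "(%t. ps (ray r x (de * t))) : bmeas borel" for x de
  unfolding ray_def
  by (intro borel_measurable_continuous_onI continuous_on_compose2[OF smooth_continuous[OF ps, of UNIV]] continuous_intros) auto
 have inc: "?b x * ennreal ((ps (ray r x si) - ps (x, 0))^2) <= ennreal c * J x" if "0 < si" "si <= 1/2" for x si
 proof (cases "norm x < r")
  case True
  thus ?thesis using ray_increment_le[OF ps a(2) True that] by (simp add: J_def c_def)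
 qed simp
 define Q where "Q de x = (NN t. ?b x * (ind {1/2<..<1::real} t * ennreal ((ps (ray r x (de * t)))^2)))" for de x
 have Qm[measurable]: "Q de : bmeas borel" for de
  using lborel.borel_measurable_nn_integral_fst[OF slab_measurable[OF m2]] by (simp add: Q_def[abs_def])
 have half: "(NN t. ind {1/2<..<1::real} t * X) = ennreal (1/2) * X" for X :: ennreal
  by (simp add: nn_integral_multc)
 text \<open>The values on a ray at the heights \<open>de t\<close> and \<open>t / 2\<close> are compared through its foot.\<close>
 have Q: "Q de x <= 4 * Q (1/2) x + 3 * ennreal c * J x" for x
 proof -
  let ?i = "%t. ind {1/2<..<1::real} t"
  \<comment> \<open>Two quadratic triangle inequalities, through the foot \<open>?w\<close>, give
    u^2 <= 4 v^2 + (4 + 2) times the increment bound; integration over t in (1/2, 1) then halves the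
    6.\<close>
  have "Q de x <= 4 * Q (1/2) x + 6 * (NN t. ?i t * (ennreal c * J x))"
   unfolding Q_def
  proof (rule nn_integral_const_mult_add_le)
   fix t :: real
   let ?u = "ps (ray r x (de * t))" and ?v = "ps (ray r x (1/2 * t))" and ?w = "ps (x, 0)"
   show "?b x * (?i t * ennreal (?u^2)) <= 4 * (?b x * (?i t * ennreal (?v^2))) + 6 * (?i t * (ennreal c * J x))"
   proof (cases "t : {1/2<..<1}")
    case True
    have dt: "0 < de * t" "de * t <= 1/2" using True de mult_mono[of de "1/2" t 1] by auto
    have i1: "?b x * ennreal ((?u - ?w)^2) <= ennreal c * J x" by (rule inc[OF dt])
    have i2: "?b x * ennreal ((?v - ?w)^2) <= ennreal c * J x" by (rule inc) (use True in auto)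
    have "?b x * ennreal (?u^2) <= ?b x * (2 * ennreal (?w^2) + 2 * ennreal ((?u - ?w)^2))"
     using ennreal_sq_add_le[of ?w "?u - ?w"] by (intro mult_left_mono) auto
    also have "... = 2 * (?b x * ennreal (?w^2)) + 2 * (?b x * ennreal ((?u - ?w)^2))" by (simp add: distrib_left mult_ac)
    also have "... <= 2 * (2 * (?b x * ennreal (?v^2)) + 2 * (ennreal c * J x)) + 2 * (ennreal c * J x)"
    proof (intro add_mono mult_left_mono i1)
     have "?b x * ennreal (?w^2) <= ?b x * (2 * ennreal (?v^2) + 2 * ennreal ((?v - ?w)^2))"
      using ennreal_sq_add_le[of ?v "?w - ?v"] by (intro mult_left_mono) (auto simp: power2_commute)
     also have "... = 2 * (?b x * ennreal (?v^2)) + 2 * (?b x * ennreal ((?v - ?w)^2))" by (simp add: distrib_left mult_ac)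
     also have "... <= 2 * (?b x * ennreal (?v^2)) + 2 * (ennreal c * J x)" by (intro add_left_mono mult_left_mono i2) simp
     finally show "?b x * ennreal (?w^2) <= 2 * (?b x * ennreal (?v^2)) + 2 * (ennreal c * J x)" .
    qed auto
    also have "2 * (2 * A + 2 * B) + 2 * B = 4 * A + 6 * B" for A B :: ennreal
    proof -
     have "2 * (2 * A + 2 * B) + 2 * B = (2 * 2) * A + (2 * 2 + 2) * B"
      by (simp only: distrib_left distrib_right mult.assoc add.assoc)
     thus ?thesis by simp
    qed
    finally show ?thesis using True by simp
   qed simp
  qed measurable
  also have "(NN t. ?i t * (ennreal c * J x)) = ennreal (1/2) * (ennreal c * J x)" by (rule half)
  also have "6 * (ennreal (1/2) * X) = 3 * X" for X
  proof -
   have "6 * (ennreal (1/2) * X) = 3 * (2 * (ennreal (1/2) * X))" by (simp only: mult.assoc[symmetric]) simp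
   thus ?thesis by (simp only: ennreal_two_half)
  qed
  finally show ?thesis by (simp only: mult.assoc)
 qed
 have slab_half: "slab r (1/2) ps <= ennreal e * ?E"
 proof -
  have "slab r (1/2) ps <= ennreal e * (?A ennreal ps)"
   unfolding e_def d_def by (rule slab_le[OF m2 r]) auto
  also have "(?A ennreal ps) = (\<integral>\<^sup>+z. ennreal ((ps z)^2) \<partial>hwt a r)"
   by (rule nn_integral_wt[symmetric]) (auto intro!: borel_measurable_wtI)
  also have "ennreal e * ... <= ennreal e * ?E"
   unfolding energy_def by (intro mult_left_mono nn_integral_mono ennreal_leI) auto
  finally show ?thesis .
 qed
 have Qslab: "(NN x. Q de x) = slab r de ps" for de by (simp add: Q_def slab_def)
 have "slab r de ps <= 4 * (NN x. Q (1/2) x) + 3 * ennreal c * (NN x. J x)"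
  unfolding Qslab[symmetric] by (rule nn_integral_const_mult_add_le[OF _ _ Q]) (use Qm Jm in simp_all)
 also have "... <= 4 * (ennreal e * ?E) + 3 * ennreal c * (ennreal d * ?E)"
  unfolding Qslab by (intro add_mono mult_left_mono slab_half J) auto
 also have "... = ennreal (4 * e + 3 * c * d) * ?E"
  using nn by (simp add: ennreal_mult ennreal_plus algebra_simps)
 finally show ?thesis .
qed
show ?thesis by (rule that[of "4 * e + 3 * c * d"]) (use nn main in auto)
qed

lemma slab_pair:
fixes v :: "('n::finite) point => real"
assumes v: "v : bmeas borel"
shows "slab r de v = (\<integral>\<^sup>+z. ind (ball 0 r) (fst z) * (ind {1/2<..<1} (snd z) *
 ennreal ((v (ray r (fst z) (de * snd z)))^2)) \<partial>lborel2)"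
unfolding slab_def
using lborel.nn_integral_fst[OF slab_measurable[OF v, of r "1/2" 1 de]] by (simp add: split_beta')

text \<open>The order of limits matters. For fixed \<open>de\<close> the uniform slab estimate
  passes from the smooth approximants to \<open>v\<close>, as \<open>slab_le\<close> makes the error
  tend to 0. Only then \<open>de\<close> tends to 0: \<open>v\<close> converges pointwise along the
  rays by continuity, and Fatou's lemma yields the bound on the thin ball.\<close>

lemma trace_le:
assumes a: "-1 < a" "a < 1" and r: "0 < r"
shows "EX C>=0. ALL ph (v :: ('n::finite) point => real) G. (ALL n. smooth (ph n)) & H1a_tendsto a r ph v G &
  continuous_on (half_ball r \<union> thin_ball r) v -->
  (\<integral>\<^sup>+x\<in>ball 0 r. ennreal ((v (x, 0))^2) \<partial>lborel) <= ennreal C * energy a r v G"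
proof -
let ?A = "lborel2"
let ?B = "%z de. ray r (fst z) (de * snd z)"
let ?C = "%v. (\<integral>\<^sup>+x\<in>ball 0 r. ennreal ((v (x, 0))^2) \<partial>lborel)"
let ?D = "%z v' de j. ind {1/2<..<1} (snd z) *
   ennreal ((v' (ray r (fst z) (de j * snd z)))^2)"
let ?E = "%G z v. (norm (G z))^2 + (v z)^2"
let ?F = "%C D. ennreal (4 * C) + 2 * ennreal D"
let ?G = "%ph n z G. norm (grad (ph n) z - G z)"
let ?H = "(half_ball r \<union> thin_ball r)"
obtain C where C: "0 <= C" "!!(ps :: 'n point => real) de. smooth ps ==> 0 < de ==> de <= 1 / 2 ==>
  slab r de ps <= ennreal C * energy a r ps (grad ps)"
 using smooth_slab_le[OF a r] by metis
show ?thesis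
proof (intro exI[of _ "8 * C"] conjI allI impI)
 show "0 <= 8 * C" using C by simp
 fix ph and v :: "'n point => real" and G
 assume "(ALL n. smooth (ph n)) & H1a_tendsto a r ph v G & continuous_on ?H v"
 hence ph: "!!n. smooth (ph n)" and lim: "H1a_tendsto a r ph v G"
  and cont: "continuous_on ?H v" by auto
 let ?W = "wt a (half_ball r :: 'n point set)"
 have vm: "v : bmeas ?W" and Gm: "G : bmeas ?W"
  using lim H1a_tendsto_iff[OF ph] by auto
 define e where "e n = (\<integral>\<^sup>+z. ennreal ((?G ph n z G)^2 + (ph n z - v z)^2) \<partial>?W)" for n
 have e: "e ----> 0" using lim H1a_tendsto_iff[OF ph] unfolding e_def by auto
 define v' where "v' z = ind (half_ball r) z * v z" for z
 have v'm[measurable]: "v' : bmeas borel"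
  using vm borel_measurable_wt_iff[OF half_ball_borel, of v a] by (simp add: v'_def[abs_def])
 have pm[measurable]: "ph n : bmeas borel" for n
  by (intro borel_measurable_continuous_onI smooth_continuous ph)
 have gm: "grad (ph n) : bmeas ?W" "ph n : bmeas ?W" for n
  by (auto intro!: continuous_on_measurable_wt continuous_grad smooth_continuous ph)
 have En: "energy a r (ph n) (grad (ph n)) <= 2 * e n + 2 * energy a r v G" for n
  unfolding energy_def e_def
 proof (rule nn_integral_const_mult_add_le)
  fix z
  have "(norm (grad (ph n) z))^2 <= 2 * (?G ph n z G)^2 + 2 * (norm (G z))^2"
  proof -
   have "norm (grad (ph n) z) <= norm (grad (ph n) z - G z) + norm (G z)"
    using norm_triangle_ineq[of "grad (ph n) z - G z" "G z"] by simp
   hence "(norm (grad (ph n) z))^2 <= (norm (grad (ph n) z - G z) + norm (G z))^2"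
    by (intro power_mono) auto
   also have "... <= 2 * (?G ph n z G)^2 + 2 * (norm (G z))^2"
    using sum_squares_bound[of "norm (grad (ph n) z - G z)" "norm (G z)"] by (simp add: power2_sum)
   finally show ?thesis .
  qed
  moreover have "(ph n z)^2 <= 2 * (ph n z - v z)^2 + 2 * (v z)^2"
   using sum_squares_bound[of "ph n z - v z" "v z"] power2_sum[of "ph n z - v z" "v z"] by simp
  ultimately have "(norm (grad (ph n) z))^2 + (ph n z)^2 <=
   2 * ((?G ph n z G)^2 + (ph n z - v z)^2) + 2 * (?E G z v)" by simp
  hence "ennreal ((norm (grad (ph n) z))^2 + (ph n z)^2) <=
   ennreal (2 * ((?G ph n z G)^2 + (ph n z - v z)^2) + 2 * (?E G z v))"
   by (rule ennreal_leI)
  also have "... = 2 * ennreal ((?G ph n z G)^2 + (ph n z - v z)^2) + 2 * ennreal (?E G z v)"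
   by (rule ennreal_two_plus) auto
  finally show "ennreal ((norm (grad (ph n) z))^2 + (ph n z)^2) <=
    2 * ennreal ((?G ph n z G)^2 + (ph n z - v z)^2) + 2 * ennreal (?E G z v)" .
 qed (use gm vm Gm in measurable)
 have slab_v: "slab r de v' <= ennreal (4 * C) * energy a r v G" if de: "0 < de" "de <= 1 / 2" for de
 proof -
  define D where "D = (1 / de) * (2 / de) powr \<bar>a\<bar> * (2 ^ CARD('n) * r powr (- a - 1))"
  have D: "!!w :: 'n point => real. w : bmeas borel ==>
    slab r de w <= ennreal D * (\<integral>\<^sup>+z\<in>half_ball r. (ennreal (snd z powr a) * ennreal ((w z)^2)) \<partial>lborel)"
   unfolding D_def by (rule slab_le[OF _ r de])
  \<comment> \<open>Here \<open>D\<close> depends on \<open>de\<close>, but it multiplies only the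
    error \<open>e n\<close>, which vanishes in the limit.\<close>
  have 1: "slab r de v' <= (?F C D) * e n + ennreal (4 * C) * energy a r v G" for n
  proof -
   have w: "(%z. v' z - ph n z) : bmeas borel" by measurable
   have "slab r de v' <= 2 * slab r de (ph n) + 2 * slab r de (%z. v' z - ph n z)"
    unfolding slab_pair[OF v'm] slab_pair[OF pm] slab_pair[OF w]
   proof (rule nn_integral_const_mult_add_le)
    show "(%z. ind (ball 0 r) (fst z) * (ind {1/2<..<1} (snd z) *
     ennreal ((ph n (?B z de))^2))) : bmeas ?A"
     using slab_measurable[OF pm[of n], of r "1/2" 1 de] by (simp add: split_beta')
    show "(%z. ind (ball 0 r) (fst z) * (ind {1/2<..<1} (snd z) *
     ennreal ((v' (?B z de) - ph n (?B z de))^2))) : bmeas ?A"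
     using slab_measurable[OF w, of r "1/2" 1 de] by (simp add: split_beta')
    fix z :: "(real ^ 'n) \<times> real"
    show "ind (ball 0 r) (fst z) * (ind {1/2<..<1} (snd z) * ennreal ((v' (?B z de))^2))
     <= 2 * (ind (ball 0 r) (fst z) * (ind {1/2<..<1} (snd z) * ennreal ((ph n (?B z de))^2)))
     + 2 * (ind (ball 0 r) (fst z) * (ind {1/2<..<1} (snd z) * ennreal ((v' (?B z de) - ph n (?B z de))^2)))"
     using ennreal_sq_add_le[of "ph n (?B z de)" "v' (?B z de) - ph n (?B z de)"]
     by (simp add: indicator_def)
   qed
   also have "... <= 2 * (ennreal C * (2 * e n + 2 * energy a r v G)) + 2 * (ennreal D * e n)"
   proof (intro add_mono mult_left_mono)
    have "ennreal C * energy a r (ph n) (grad (ph n)) <= ennreal C * (2 * e n + 2 * energy a r v G)"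
     by (rule mult_left_mono[OF En]) simp
    with C(2)[of "ph n" de, OF ph[of n] that] show "slab r de (ph n) <= ennreal C * (2 * e n + 2 * energy a r v G)"
     by (rule order_trans)
    have "(\<integral>\<^sup>+z\<in>half_ball r. (ennreal (snd z powr a) * ennreal ((v' z - ph n z)^2)) \<partial>lborel) = (\<integral>\<^sup>+z. ennreal ((v' z - ph n z)^2) \<partial>?W)"
     by (rule nn_integral_wt[symmetric]) (auto intro!: borel_measurable_wtI)
    also have "... <= e n"
     unfolding e_def by (intro nn_integral_mono ennreal_leI) (auto simp: v'_def power2_commute)
    finally show "slab r de (%z. v' z - ph n z) <= ennreal D * e n"
     using order_trans[OF D[OF w] mult_left_mono] by simp
   qed auto
   also have "... = (?F C D) * e n + ennreal (4 * C) * energy a r v G"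
    using C by (simp add: ennreal_mult algebra_simps)
   finally show ?thesis .
  qed
  have "(%n. (?F C D) * e n + ennreal (4 * C) * energy a r v G) ---->
    (?F C D) * 0 + ennreal (4 * C) * energy a r v G"
   by (intro tendsto_add tendsto_const ennreal_tendsto_cmult e) (auto simp: ennreal_mult_less_top)
  from LIMSEQ_le_const[OF this, of "slab r de v'"] show ?thesis using 1 by auto
 qed
 define de where "de j = inverse (real (Suc (Suc j)))" for j
 have de: "0 < de j" "de j <= 1/2" for j by (auto simp: de_def field_simps)
 have de0: "de ----> 0"
  unfolding de_def using LIMSEQ_Suc[OF LIMSEQ_inverse_real_of_nat] by simp
 have Dm: "(%z. ind (ball 0 r) (fst z) * (?D z v' de j)) : bmeas ?A" for j
  using slab_measurable[OF v'm, of r "1/2" 1 "de j"] by (simp add: split_beta')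
 define w where "w x = ind (ball 0 r) x * v (x, 0)" for x :: "real ^ 'n"
 have wm: "w : bmeas borel"
 proof -
  have "continuous_on (ball 0 r) (%x. v (x, 0))"
   by (rule continuous_on_compose2[OF cont]) (auto intro!: continuous_intros simp: thin_ball_def)
  thus ?thesis unfolding w_def
   using borel_measurable_continuous_on_indicator[of "ball 0 r" "%x. v (x, 0)"] by simp
 qed
 have "ennreal (1/2) * (?C v) = (NN x. NN t. ennreal ((w x)^2) * ind {1/2<..<1::real} t)"
 proof -
  have "(NN t. ennreal ((w x)^2) * ind {1/2<..<1::real} t) = ennreal (1/2) * (ennreal ((v (x, 0))^2) * ind (ball 0 r) x)" for x
   by (subst nn_integral_cmult) (auto simp: w_def indicator_def mult.commute)
  moreover have "(%x. ennreal ((v (x, 0))^2) * ind (ball 0 r) x) : bmeas lborel"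
  proof -
   have "(%x. ennreal ((w x)^2)) : bmeas lborel" using wm by measurable
   moreover have "ennreal ((w x)^2) = ennreal ((v (x, 0))^2) * ind (ball 0 r) x" for x by (simp add: w_def indicator_def)
   ultimately show ?thesis by simp
  qed
  ultimately show ?thesis by (simp only: nn_integral_cmult)
 qed
 also have "... = (\<integral>\<^sup>+z. ennreal ((w (fst z))^2) * ind {1/2<..<1::real} (snd z) \<partial>?A)"
 proof -
  have "(%z. ennreal ((w (fst z))^2) * ind {1/2<..<1::real} (snd z)) : bmeas ?A"
   using wm by measurable
  from lborel.nn_integral_fst[OF this] show ?thesis by simp
 qed
 also have "... <= (\<integral>\<^sup>+z. liminf (%j. ind (ball 0 r) (fst z) * (?D z v' de j)) \<partial>?A)"
 proof (rule nn_integral_mono)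
  fix z :: "(real ^ 'n) \<times> real"
  show "ennreal ((w (fst z))^2) * ind {1/2<..<1::real} (snd z) <= liminf (%j. ind (ball 0 r) (fst z) * (?D z v' de j))"
  proof (cases "norm (fst z) < r & snd z : {1/2<..<1}")
   case True
   let ?rh = "%j. ray r (fst z) (de j * snd z)"
   have dt: "0 < de j * snd z" "de j * snd z < 1" for j
    using de[of j] True mult_mono[of "de j" "1/2" "snd z" 1] by auto
   have in_hb: "?rh j : half_ball r" for j using True dt by (intro ray_in_half_ball) auto
   have "(%j. ray r (fst z) (de j * snd z)) ----> ((1 - 0 * snd z) *. fst z, (0 * snd z) * r)"
    unfolding ray_def by (intro tendsto_intros de0)
   hence "?rh ----> (fst z, 0)" by simp
   moreover have "(fst z, 0) : half_ball r \<union> thin_ball r" using True by (auto simp: thin_ball_def)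
   ultimately have "(%j. v (?rh j)) ----> v (fst z, 0)"
    using in_hb by (intro continuous_on_tendsto_compose[OF cont]) (auto intro: always_eventually)
   hence "(%j. ennreal ((v (?rh j))^2)) ----> ennreal ((v (fst z, 0))^2)"
    by (intro tendsto_ennrealI tendsto_power)
   hence "liminf (%j. ennreal ((v (?rh j))^2)) = ennreal ((v (fst z, 0))^2)"
    by (intro lim_imp_Liminf) auto
   thus ?thesis using True in_hb by (simp add: v'_def w_def)
  next
   case False
   hence "ennreal ((w (fst z))^2) * ind {1/2<..<1::real} (snd z) = 0"
    by (auto simp: w_def indicator_def)
   thus ?thesis by (simp only: zero_le)
  qed
 qed
 also have "... <= liminf (%j. slab r (de j) v')"
  unfolding slab_pair[OF v'm] by (rule nn_integral_liminf[OF Dm])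
 also have "... <= ennreal (4 * C) * energy a r v G"
 proof -
  have "liminf (%j. slab r (de j) v') <= liminf (%j. ennreal (4 * C) * energy a r v G)"
   using slab_v[OF de] by (intro Liminf_mono always_eventually) auto
  thus ?thesis by (simp add: Liminf_const)
 qed
 finally have "2 * (ennreal (1/2) * (?C v)) <= 2 * (ennreal (4 * C) * energy a r v G)"
  by (rule mult_left_mono) simp
 also have "2 * (ennreal (4 * C) * energy a r v G) = ennreal (8 * C) * energy a r v G"
  using C ennreal_mult_assoc[of 2 "4 * C"] by (simp add: mult.assoc[symmetric])
 finally show "(?C v) <= ennreal (8 * C) * energy a r v G"
  by (simp only: ennreal_two_half)
qed
qed

section \<open>Identification of traces and gradients with pointwise ones\<close>

lemma H1a_tendsto_sub:
assumes "!!n. smooth (ph n)" and lim: "H1a_tendsto a r ph u F" and ps: "smooth ps"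
shows "H1a_tendsto a r (%n z. ph n z - ps z) (%z. u z - ps z) (%z. F z - grad ps z)"
proof -
let ?A = "(hwt a r)"
have m: "grad ps : bmeas ?A" "ps : bmeas ?A"
 using ps by (auto intro!: continuous_on_measurable_wt continuous_grad smooth_continuous)
have 1: "u : bmeas ?A" "F : bmeas ?A"
 "(%n. \<integral>\<^sup>+z. ennreal ((norm (grad (ph n) z - F z))^2 + (ph n z - u z)^2) \<partial>hwt a r) ----> 0"
 using lim H1a_tendsto_iff[OF assms(1)] by auto
have eq: "(norm (grad (%z. ph n z - ps z) z - (F z - grad ps z)))^2 + ((ph n z - ps z) - (u z - ps z))^2 =
  (norm (grad (ph n) z - F z))^2 + (ph n z - u z)^2" for n z
proof -
 have "grad (%z. ph n z - ps z) z - (F z - grad ps z) = grad (ph n) z - F z"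
  unfolding grad_diff[OF assms(1) ps] by simp
 moreover have "(ph n z - ps z) - (u z - ps z) = ph n z - u z" by simp
 ultimately show ?thesis by (simp only:)
qed
show ?thesis
 unfolding H1a_tendsto_iff[of "%n z. ph n z - ps z", OF smooth_diff[OF assms(1) ps]] eq
proof (intro conjI)
 show "(%z. u z - ps z) : bmeas ?A"
  by (rule borel_measurable_diff[OF 1(1) m(2)])
 show "(%z. F z - grad ps z) : bmeas ?A"
  by (rule borel_measurable_diff[OF 1(2) m(1)])
qed (rule 1(3))
qed

text \<open>The trace inequality is applied to \<open>u - ph n\<close>, which is approximated by
  \<open>ph m - ph n\<close> as m grows and whose energy is the approximation error of
  \<open>ph n\<close>.\<close>

lemma trace_tendsto:
fixes u :: "('n::finite) point => real"
assumes a: "-1 < a" "a < 1" and r: "0 < r" and ph: "!!n. smooth (ph n)" and lim: "H1a_tendsto a r ph u F"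
 and cont: "continuous_on (half_ball r \<union> thin_ball r) u"
shows "(%n. \<integral>\<^sup>+x\<in>ball 0 r. ennreal ((ph n (x, 0) - u (x, 0))^2) \<partial>lborel) ----> 0"
proof -
let ?A = "%ph n. (\<integral>\<^sup>+z. ennreal ((norm (grad (ph n) z - F z))^2 + (ph n z - u z)^2) \<partial>hwt a r)"
let ?B = "%ph n. (\<integral>\<^sup>+x\<in>ball 0 r. ennreal ((ph n (x, 0) - u (x, 0))^2) \<partial>lborel)"
let ?C = "(half_ball r \<union> thin_ball r)"
obtain C where C: "0 <= C"
 "!!ph (v :: 'n point => real) G. (ALL n. smooth (ph n)) & H1a_tendsto a r ph v G &
  continuous_on ?C v ==>
  (\<integral>\<^sup>+x\<in>ball 0 r. ennreal ((v (x, 0))^2) \<partial>lborel) <= ennreal C * energy a r v G"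
 using trace_le[OF a r] by blast
have e: "(%n. \<integral>\<^sup>+z. ennreal ((norm (grad (ph n) z - F z))^2 + (ph n z - u z)^2) \<partial>hwt a r) ----> 0"
 using lim H1a_tendsto_iff[OF ph] by auto
have "(%n. ennreal C * (?A ph n)) ----> ennreal C * 0"
 by (rule ennreal_tendsto_cmult[OF _ e]) simp
hence lim0: "(%n. ennreal C * (?A ph n)) ----> 0"
 by simp
have le: "(?B ph n) <=
 ennreal C * (?A ph n)" for n
proof -
 have "continuous_on ?C (%z. u z - ph n z)"
  by (intro continuous_intros cont smooth_continuous ph)
 with H1a_tendsto_sub[OF ph lim ph[of n]] smooth_diff[OF ph ph]
 have "(\<integral>\<^sup>+x\<in>ball 0 r. ennreal ((u (x, 0) - ph n (x, 0))^2) \<partial>lborel)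
  <= ennreal C * energy a r (%z. u z - ph n z) (%z. F z - grad (ph n) z)"
  by (intro C(2)[of "%m z. ph m z - ph n z"]) simp
 thus ?thesis
  unfolding energy_def by (simp only: norm_minus_commute[of "F _"] power2_commute[of "u _"])
qed
show ?thesis
proof (rule tendsto_sandwich[OF _ _ tendsto_const lim0])
 show "\<forall>\<^sub>F n in sequentially. 0 <= (?B ph n)"
  by (intro always_eventually allI zero_le)
qed (intro always_eventually allI le)
qed

text \<open>The pointwise values form a trace, so the choice operator does return some trace. Its
  own approximating sequence converges on the thin ball both to it and, by
  \<open>trace_tendsto\<close>, to the pointwise values.\<close>

lemma H1a_trace_AE:
fixes u :: "('n::finite) point => real"
assumes a: "-1 < a" "a < 1" and r: "0 < r" and u: "u : H1a a r"
 and cont: "continuous_on (half_ball r \<union> thin_ball r) u"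
shows "AE x in lborel. x : ball 0 r --> H1a_trace a r u x = u (x, 0)"
 and "set_borel_measurable lborel (ball 0 r) (H1a_trace a r u)"
proof -
let ?A = "%ps n w. (NN x. ennreal ((ps n (x, 0) - w x)^2) * ind (ball 0 r) x)"
let ?B = "%ps n. (\<integral>\<^sup>+x\<in>ball 0 r. ennreal ((ps n (x, 0) - u (x, 0))^2) \<partial>lborel)"
let ?C = "%ps n T'. (NN x. ennreal ((ps n (x, 0) - T' x)^2) * ind (ball 0 r) x)"
let ?D = "%ps n T. (\<integral>\<^sup>+x\<in>ball 0 r. ennreal ((ps n (x, 0) - T x)^2) \<partial>lborel)"
let ?E = "(%x. u (x, 0))"
define w where "w x = ind (ball 0 r) x * u (x, 0)" for x :: "real ^ 'n"
have "continuous_on (ball 0 r) ?E"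
 by (rule continuous_on_compose2[OF cont]) (auto intro!: continuous_intros simp: thin_ball_def)
hence wm[measurable]: "w : bmeas borel"
 unfolding w_def using borel_measurable_continuous_on_indicator[of "ball 0 r" "%x. u (x, 0)"] by simp
obtain ph F where ph: "!!n. smooth (ph n)" and lim: "H1a_tendsto a r ph u F"
 using u unfolding H1a_def is_H1a_grad_def by blast
have "is_H1a_trace a r u ?E"
 unfolding is_H1a_trace_def
proof (intro conjI exI)
 show "set_borel_measurable lborel (ball 0 r) ?E"
  using wm by (simp add: set_borel_measurable_def w_def[abs_def])
qed (use ph lim trace_tendsto[OF a r ph lim cont] in auto)
hence T: "is_H1a_trace a r u (H1a_trace a r u)"
 unfolding H1a_trace_def by (rule someI[of "is_H1a_trace a r u"])
define T where "T = H1a_trace a r u"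
from T obtain ps G where ps: "!!n. smooth (ps n)" "H1a_tendsto a r ps u G"
 and Tm: "set_borel_measurable lborel (ball 0 r) T"
 and T0: "(%n. \<integral>\<^sup>+x\<in>ball 0 r. ennreal ((ps n (x, 0) - T x)^2) \<partial>lborel) ----> 0"
 unfolding is_H1a_trace_def T_def by blast
show "set_borel_measurable lborel (ball 0 r) (H1a_trace a r u)" using Tm by (simp add: T_def)
define T' where "T' x = ind (ball 0 r) x * T x" for x
have T'm[measurable]: "T' : bmeas borel" using Tm by (simp add: T'_def[abs_def] set_borel_measurable_def)
have [measurable]: "(%x. ind (ball (0 :: real ^ 'n) r) x :: ennreal) : bmeas borel"
 by (intro borel_measurable_indicator borel_open open_ball)
have pm[measurable]: "(%x. ps n (x, 0)) : bmeas borel" for n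
 by (intro borel_measurable_continuous_onI continuous_on_compose2[OF smooth_continuous[OF ps(1), of UNIV]] continuous_intros) auto
define X where "X = (NN x. ennreal ((T' x - w x)^2))"
have le: "X <= 2 * (?C ps n T')
 + 2 * (?A ps n w)" for n
 unfolding X_def
proof (rule nn_integral_const_mult_add_le)
 fix x :: "real ^ 'n"
 show "ennreal ((T' x - w x)^2) <= 2 * (ennreal ((ps n (x, 0) - T' x)^2) * ind (ball 0 r) x) +
  2 * (ennreal ((ps n (x, 0) - w x)^2) * ind (ball 0 r) x)"
 proof (cases "x : ball 0 r")
  case True
  thus ?thesis
   using ennreal_sq_add_le[of "T' x - ps n (x, 0)" "ps n (x, 0) - w x"]
   by (simp add: power2_commute[of "ps n (x, 0)" "T' x"])
 qed (simp add: T'_def w_def)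
qed measurable
have "(?C ps n T') = (?D ps n T)"
  "(?A ps n w) = (?B ps n)" for n
 by (intro nn_integral_cong; simp add: T'_def w_def indicator_def)+
note eqs = this
have "(%n. 2 * (?D ps n T) +
  2 * (?B ps n)) ----> 2 * 0 + 2 * 0"
 by (intro tendsto_add ennreal_tendsto_cmult T0 trace_tendsto[OF a r ps cont]) auto
from LIMSEQ_le_const[OF this, of X] have "X <= 0" using le unfolding eqs by auto
hence "AE x in lborel. ennreal ((T' x - w x)^2) = 0"
 unfolding X_def by (subst (asm) le_zero_eq, subst (asm) nn_integral_0_iff_AE) measurable
thus "AE x in lborel. x : ball 0 r --> H1a_trace a r u x = u (x, 0)"
 by eventually_elim (auto simp: T'_def w_def T_def)
qed

lemma continuous_AE_zero_ball:
fixes D :: "'a::euclidean_space => real"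
assumes D: "continuous_on (ball z0 e) D" and AE: "AE z in lborel. z : ball z0 e --> D z = 0" and "0 < e"
shows "D z0 = 0"
proof (rule ccontr)
assume "D z0 ~= 0"
moreover have "isCont D z0"
 using D \<open>0 < e\<close> by (simp add: continuous_on_eq_continuous_at)
ultimately obtain d where d0: "d > 0" "!!z. dist z z0 < d ==> dist (D z) (D z0) < \<bar>D z0\<bar>"
 unfolding continuous_at_eps_delta by (metis zero_less_abs_iff)
have d: "d > 0" "!!z. dist z z0 < d ==> D z ~= 0"
 using d0 by (force simp: dist_real_def)+
define c where "c = min d e"
have c: "c > 0" using d \<open>0 < e\<close> by (simp add: c_def)
have "AE z in lborel. z \<notin> ball z0 c"
 using AE by eventually_elim (use d in \<open>auto simp: c_def dist_commute\<close>)
hence "ball z0 c : null_sets lborel"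
 by (subst AE_iff_null_sets) (auto simp: borel_open)
hence "emeasure lborel (ball z0 c) = 0" by (rule null_setsD1)
moreover have "0 < unit_ball_vol (real DIM('a)) * c ^ DIM('a)" using c by simp
ultimately show False using c emeasure_ball[of c z0] by simp
qed

text \<open>On a compact subset of the open half ball the weight is bounded below, and
  Cauchy-Schwarz passes from L2 to L1. Without the weight, translations become available.\<close>

lemma H1a_L1_local:
fixes u :: "('n::finite) point => real"
assumes ph: "!!n. smooth (ph n)" and lim: "H1a_tendsto a r ph u F" and K: "compact K" "K <= half_ball r"
shows "(%n. \<integral>\<^sup>+z\<in>K. ennreal (norm (grad (ph n) z - F z)) \<partial>lborel) ----> 0"
 and "(%n. \<integral>\<^sup>+z\<in>K. ennreal (norm (ph n z - u z)) \<partial>lborel) ----> 0"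
proof -
let ?W = "wt a (half_ball r :: 'n point set)"
let ?A = "%P n z p. norm (P n z - p z)"
let ?B = "%K. (\<integral>\<^sup>+z. (ind K z)^2 \<partial>(lborel :: 'n point measure))"
have Kb[measurable]: "K : sets borel" using K by (simp add: compact_imp_closed)
have pos: "0 < snd z" if "z : K" for z using K that half_ballD by blast
have "continuous_on K (%z. snd z powr - a)"
 using pos by (intro continuous_intros) fastforce+
hence "bounded ((%z. snd z powr - a) ` K)"
 using K by (intro compact_imp_bounded compact_continuous_image)
then obtain C0 where C0: "!!z. z : K ==> norm (snd z powr - a) <= C0"
 unfolding bounded_iff by blast
define C where "C = \<bar>C0\<bar> + 1"
have C: "1 <= C * snd z powr a" if "z : K" for z
proof -
 have "snd z powr - a <= C" using C0[OF that] by (simp add: C_def)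
 from mult_right_mono[OF this, of "snd z powr a"] show ?thesis
  using pos[OF that] by (simp add: powr_add[symmetric])
qed
have gen: "(%n. \<integral>\<^sup>+z\<in>K. ennreal (?A P n z p) \<partial>lborel) ----> 0"
 if Pm: "!!n. P n : bmeas ?W" and pm: "p : bmeas ?W"
  and L: "(%n. \<integral>\<^sup>+z. ennreal ((?A P n z p)^2) \<partial>?W) ----> 0"
 for P and p :: "'n point => 'c::euclidean_space"
proof -
 define A where "A n = (\<integral>\<^sup>+z. ennreal ((?A P n z p)^2) \<partial>?W)" for n
 define X where "X n = (\<integral>\<^sup>+z\<in>K. ennreal (?A P n z p) \<partial>lborel)" for n
 have km: "(%z. ennreal (?A P n z p) * ind K z) : bmeas lborel" for n
 proof -
  have "(%z. norm (P n z - p z)) : bmeas ?W" using Pm pm by measurable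
  hence "(%z. ind (half_ball r) z *. norm (P n z - p z)) : bmeas borel"
   by (simp only: borel_measurable_wt_iff[OF half_ball_borel])
  hence "(%z. ennreal (ind (half_ball r) z *. norm (P n z - p z)) * ind K z) : bmeas lborel"
   by simp
  moreover have "ennreal (ind (half_ball r) z *. norm (P n z - p z)) * ind K z = ennreal (?A P n z p) * ind K z" for z
   using K by (auto simp: indicator_def)
  ultimately show ?thesis by simp
 qed
 have "(X n)^2 <= ennreal C * emeasure lborel K * A n" for n
 proof -
  have "X n = (NN z. (ennreal (?A P n z p) * ind K z) * ind K z)"
   unfolding X_def by (intro nn_integral_cong) (auto simp: indicator_def)
  hence "(X n)^2 <= (NN z. (ennreal (?A P n z p) * ind K z)^2) * (NN z. (ind K z)^2)"
   using Cauchy_Schwarz_nn_integral[OF km, of "ind K" n] by simp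
  also have "(?B K) = emeasure lborel K"
  proof -
   have "(?B K) = (NN z. ind K z)"
    by (intro nn_integral_cong) (auto simp: indicator_def)
   thus ?thesis by simp
  qed
  also have "(NN z. (ennreal (?A P n z p) * ind K z)^2) <= (\<integral>\<^sup>+z\<in>half_ball r. (ennreal (snd z powr a) * (ennreal C * ennreal ((?A P n z p)^2))) \<partial>lborel)"
  proof (rule nn_integral_mono)
   fix z :: "'n point"
   show "(ennreal (?A P n z p) * ind K z)^2 <= ennreal (snd z powr a) * (ennreal C * ennreal ((?A P n z p)^2)) * ind (half_ball r) z"
   proof (cases "z : K")
    case True
    have "ennreal 1 <= ennreal (C * snd z powr a)" using C[OF True] by (intro ennreal_leI)
    hence "1 <= ennreal (snd z powr a) * ennreal C" by (simp add: ennreal_mult C_def mult.commute)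
    from mult_right_mono[OF this, of "ennreal ((?A P n z p)^2)"]
    show ?thesis using True K by (auto simp: ennreal_power mult.assoc indicator_def)
   qed simp
  qed
  also have "... = (\<integral>\<^sup>+z. ennreal C * ennreal ((?A P n z p)^2) \<partial>?W)"
   by (rule nn_integral_wt[symmetric]) (use Pm pm in measurable)
  also have "... = ennreal C * A n"
   unfolding A_def by (rule nn_integral_cmult) (use Pm pm in measurable)
  finally show ?thesis by (simp add: mult_ac mult_right_mono)
 qed
 note XA = this
 have fin: "ennreal C * emeasure lborel K < top"
  using emeasure_bounded_finite[OF compact_imp_bounded[OF K(1)]] by (simp add: ennreal_mult_less_top)
 have "(%n. ennreal C * emeasure lborel K * A n) ----> ennreal C * emeasure lborel K * 0"
  using L fin unfolding A_def by (intro ennreal_tendsto_cmult)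
 hence lim0: "(%n. ennreal C * emeasure lborel K * A n) ----> 0" by simp
 have X2: "(%n. (X n)^2) ----> 0"
  by (rule tendsto_sandwich[OF _ _ tendsto_const lim0]) (simp_all add: XA)
 have "X ----> 0"
  unfolding order_tendsto_iff
 proof (intro conjI allI impI)
  fix e :: ennreal assume "0 < e"
  have "0 < e^2" using \<open>0 < e\<close> by (simp add: zero_less_iff_neq_zero)
  from order_tendstoD(2)[OF X2 this] show "\<forall>\<^sub>F n in sequentially. X n < e"
   by eventually_elim (meson not_less power_mono zero_le)
 qed simp
 thus ?thesis unfolding X_def .
qed
have mu: "u : bmeas ?W" "F : bmeas ?W" using lim H1a_tendsto_iff[OF ph] by auto
show "(%n. \<integral>\<^sup>+z\<in>K. ennreal (norm (grad (ph n) z - F z)) \<partial>lborel) ----> 0"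
 by (rule gen[OF _ mu(2) H1a_tendsto_L2(1)[OF ph lim]])
  (intro continuous_on_measurable_wt continuous_grad ph)
show "(%n. \<integral>\<^sup>+z\<in>K. ennreal (norm (ph n z - u z)) \<partial>lborel) ----> 0"
 by (rule gen[OF _ mu(1) H1a_tendsto_L2(2)[OF ph lim]])
  (intro continuous_on_measurable_wt smooth_continuous ph)
qed

text \<open>The defect in the fundamental theorem along a fixed increment \<open>h\<close> vanishes
  for smooth functions; integrated over a small ball it is bounded by local L1 distances to the
  approximants, hence is 0 almost everywhere, and everywhere by continuity. Differentiability then
  follows from the continuity of \<open>F\<close>.\<close>

lemma H1a_has_derivative:
fixes u :: "('n::finite) point => real"
assumes F: "is_H1a_grad a r u F" and uc: "continuous_on (half_ball r) u" and Fc: "continuous_on (half_ball r) F"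
 and z0: "z0 : half_ball r"
shows "(u has_derivative (%h. F z0 \<bullet> h)) (at z0)"
proof -
let ?A = "%z t h. z + t *. h"
let ?B = "%v n. (NN z. v n z)"
let ?C = "%h. (%t. F (z0 + t *. h) \<bullet> h - F z0 \<bullet> h)"
let ?D = "%w n. (NN z. w n z)"
let ?E = "%D B. (NN z. ennreal (norm (D z)) * ind B z)"
let ?F = "%ph n z h. (%t. grad (ph n) (?A z t h) \<bullet> h - F (?A z t h) \<bullet> h)"
let ?G = "%z h. (%t. F (?A z t h) \<bullet> h)"
let ?H = "%D B. (%z. ennreal (norm (D z)) * ind B z)"
let ?J = "%h w n z. (NN t. ennreal (norm h) * (w n (?A z t h) * ind {0..1} t))"
let ?K = "%t h. z0 + t *. h"
let ?L = "(lborel :: real measure)"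
obtain ph where ph: "!!n. smooth (ph n)" and lim: "H1a_tendsto a r ph u F"
 using F unfolding is_H1a_grad_def by blast
obtain d0 where d0: "d0 > 0" "cball z0 d0 <= half_ball r"
 using open_half_ball z0 unfolding open_contains_cball by blast
define e where "e = d0 / 2"
have e: "0 < e" "cball z0 (2 * e) <= half_ball r" using d0 by (auto simp: e_def)
define K where "K = cball z0 (2 * e)"
have K: "compact K" "K <= half_ball r" using e by (auto simp: K_def)
have ft: "u (z0 + h) - u z0 = integral {0..1} (%t. F (?K t h) \<bullet> h)" if h: "norm h < e" for h
proof -
 have inK: "z + t *. h : K" if "z : ball z0 e" "t : {0..1}" for z t
 proof -
  have "norm (t *. h) <= norm h" using that by (simp add: mult_left_le_one_le)
  hence "dist z0 (?A z t h) <= dist z0 z + norm h"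
   using norm_triangle_ineq4[of "z0 - z" "t *. h"] by (simp add: dist_norm algebra_simps)
  thus ?thesis using that h by (simp add: K_def)
 qed
 define D where "D z = u (z + h) - u z - integral {0..1} (?G z h)" for z
 have seg: "continuous_on (ball z0 e \<times> {0..1}) (%p. F (fst p + snd p *. h) \<bullet> h)"
  using inK K(2) by (intro continuous_intros continuous_on_compose2[OF Fc]) auto
 have Dc: "continuous_on (ball z0 e) D"
 proof -
  have "continuous_on (ball z0 e) (%z. integral (cbox 0 1) (?G z h))"
   by (rule integral_continuous_on_param) (use seg in \<open>simp add: split_beta'\<close>)
  moreover have "continuous_on (ball z0 e) (%z. u (z + h))"
   using inK[of _ 1] K(2) by (intro continuous_on_compose2[OF uc] continuous_intros) auto
  moreover have "continuous_on (ball z0 e) u"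
   using inK[of _ 0] K(2) by (intro continuous_on_subset[OF uc]) auto
  ultimately show ?thesis unfolding D_def by (intro continuous_intros) auto
 qed
 define w where "w n z = ennreal (norm (grad (ph n) z - F z)) * ind K z" for n z
 define v where "v n z = ennreal (norm (ph n z - u z)) * ind K z" for n z
 have Kb: "K : sets borel" using K by (simp add: compact_imp_closed)
 have wm[measurable]: "w n : bmeas borel" for n
 proof -
  have "continuous_on K (%z. norm (grad (ph n) z - F z))"
   by (intro continuous_intros continuous_grad ph continuous_on_subset[OF Fc K(2)])
  from borel_measurable_continuous_on_indicator[OF Kb this]
  have "(%z. ennreal (ind K z *. norm (grad (ph n) z - F z))) : bmeas borel" by measurable
  moreover have "(%z. ennreal (ind K z *. norm (grad (ph n) z - F z))) = w n"
   by (rule ext) (simp add: w_def indicator_def)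
  ultimately show ?thesis by (simp only:)
 qed
 have vm[measurable]: "v n : bmeas borel" for n
 proof -
  have "continuous_on K (%z. norm (ph n z - u z))"
   by (intro continuous_intros smooth_continuous ph continuous_on_subset[OF uc K(2)])
  from borel_measurable_continuous_on_indicator[OF Kb this]
  have "(%z. ennreal (ind K z *. norm (ph n z - u z))) : bmeas borel" by measurable
  moreover have "(%z. ennreal (ind K z *. norm (ph n z - u z))) = v n"
   by (rule ext) (simp add: v_def indicator_def)
  ultimately show ?thesis by (simp only:)
 qed
 have sm: "(%z. f (z + c)) : bmeas borel" if "f : bmeas borel" for f :: "'n point => ennreal" and c
  by (rule measurable_compose[OF _ that]) measurable
 have tr: "(NN z. f (z + c)) = (NN z. f z)" if "f : bmeas borel" for f :: "'n point => ennreal" and c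
 proof -
  have "(NN z. f z) = (\<integral>\<^sup>+z. f z \<partial>distr lborel borel ((+) c))" by (simp only: lborel_distr_plus)
  also have "... = (NN z. f (c + z))" using that by (subst nn_integral_distr) auto
  finally show ?thesis by (simp add: add.commute)
 qed
 define B where "B = ball z0 e"
 have Bb[measurable]: "B : sets borel" by (simp add: B_def borel_open)
 have ptw: "ennreal (norm (D z)) * ind B z <= v n (z + h) + (v n z + (?J h w n z))" for n z
 proof (cases "z : B")
  case True
  hence zb: "z : ball z0 e" by (simp add: B_def)
  have line: "continuous_on {0..1} (%t. F (?A z t h))"
   using inK[OF zb] K(2) by (intro continuous_intros continuous_on_compose2[OF Fc]) auto
  have gline: "continuous_on {0..1} (%t. grad (ph n) (?A z t h))"
   by (rule continuous_on_compose2[OF continuous_grad[OF ph, of UNIV]]) (auto intro!: continuous_intros)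
  have 1: "((%t. grad (ph n) (?A z t h) \<bullet> h) has_integral (ph n (z + 1 *. h) - ph n (z + 0 *. h))) {0..1}"
  proof (rule fundamental_theorem_of_calculus)
   fix t :: real
   have "((%t. z + t *. h) has_derivative (%s. s *. h)) (at t within {0..1})"
    by (auto intro!: derivative_eq_intros)
   from has_derivative_compose[OF this smooth_has_derivative[OF ph[of n]]]
   show "((%t. ph n (?A z t h)) has_vector_derivative grad (ph n) (?A z t h) \<bullet> h) (at t within {0..1})"
    unfolding has_vector_derivative_def inner_scaleR_right real_scaleR_def .
  qed simp
  have 2: "((?G z h) has_integral integral {0..1} (?G z h)) {0..1}"
   by (intro integrable_integral integrable_continuous_real continuous_intros line)
  define k where "k t = norm h * norm (grad (ph n) (?A z t h) - F (?A z t h))" for t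
  have "continuous_on {0..1} k"
   unfolding k_def[abs_def] by (intro continuous_intros line gline)
  hence 3: "(k has_integral integral {0..1} k) {0..1}"
   by (intro integrable_integral integrable_continuous_real)
  have Deq: "D z = (u (z + h) - ph n (z + h)) - (u z - ph n z) + integral {0..1} (?F ph n z h)"
   using integral_unique[OF has_integral_diff[OF 1 2]] by (simp add: D_def)
  have "norm (integral {0..1} (?F ph n z h)) <= integral {0..1} k"
  proof (rule integral_norm_bound_integral)
   show "(?F ph n z h) integrable_on {0..1}"
    using has_integral_diff[OF 1 2] by (rule has_integral_integrable)
   show "k integrable_on {0..1}" using 3 by (rule has_integral_integrable)
   show "norm (grad (ph n) (?A z t h) \<bullet> h - F (?A z t h) \<bullet> h) <= k t" for t
    using Cauchy_Schwarz_ineq2[of "grad (ph n) (?A z t h) - F (?A z t h)" h]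
    by (simp add: k_def inner_diff_left mult.commute)
  qed
  hence "norm (D z) <= norm (ph n (z + h) - u (z + h)) + (norm (ph n z - u z) + integral {0..1} k)"
   unfolding Deq real_norm_def by linarith
  hence "ennreal (norm (D z)) <= ennreal (norm (ph n (z + h) - u (z + h)) + (norm (ph n z - u z) + integral {0..1} k))"
   by (rule ennreal_leI)
  also have "... = ennreal (norm (ph n (z + h) - u (z + h))) + (ennreal (norm (ph n z - u z)) + ennreal (integral {0..1} k))"
   by (intro ennreal_plus[THEN trans] arg_cong2[where f = "(+)"] refl ennreal_plus add_nonneg_nonneg norm_ge_zero)
    (auto intro!: integral_nonneg has_integral_integrable[OF 3] add_nonneg_nonneg simp: k_def)
  also have "ennreal (integral {0..1} k) = (\<integral>\<^sup>+t\<in>{0..1}. ennreal (k t) \<partial>lborel)"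
   by (rule nn_integral_has_integral_lebesgue'[OF _ 3, symmetric]) (simp add: k_def)
  also have "... = (?J h w n z)"
   using inK[OF zb] by (intro nn_integral_cong) (auto simp: k_def w_def indicator_def ennreal_mult)
  also have "ennreal (norm (ph n (z + h) - u (z + h))) = v n (z + h)" using inK[OF zb, of 1] by (simp add: v_def)
  also have "ennreal (norm (ph n z - u z)) = v n z" using inK[OF zb, of 0] by (simp add: v_def)
  finally show ?thesis using True by simp
 qed simp
 have pm: "(%(z, t). ennreal (norm h) * (w n (?A z t h) * ind {0..1} t)) : bmeas (lborel \<Otimes>\<^sub>M ?L)" for n
 proof -
  have "(%x::'n point \<times> real. fst x + snd x *. h) : bmeas (borel \<Otimes>\<^sub>M borel)" by measurable
  from measurable_compose[OF this wm[of n]]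
  have "(%x. ennreal (norm h) * (w n (fst x + snd x *. h) * ind {0..1} (snd x))) : bmeas (borel \<Otimes>\<^sub>M borel)"
   by measurable
  thus ?thesis by (simp add: split_beta' cong: measurable_cong_sets sets_pair_measure_cong)
 qed
 have bound: "(?E D B) <=
  (?B v n) + ((?B v n) + ennreal (norm h) * (?D w n))" for n
 proof -
  let ?I = "%z. \<integral>\<^sup>+t. ennreal (norm h) * (w n (?A z t h) * ind {0..1} t) \<partial>lborel"
  have Im[measurable]: "?I : bmeas borel"
   using lborel.borel_measurable_nn_integral_fst[OF pm[of n]] by simp
  have "(?E D B) <= (NN z. v n (z + h) + (v n z + ?I z))"
   by (intro nn_integral_mono ptw)
  also have "... = (NN z. v n (z + h)) + ((?B v n) + (NN z. ?I z))"
   using sm[OF vm[of n], of h] by (simp add: nn_integral_add)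
  also have "(NN z. v n (z + h)) = (?B v n)" by (rule tr[OF vm])
  also have "(NN z. ?I z) = (\<integral>\<^sup>+t. \<integral>\<^sup>+z. ennreal (norm h) * (w n (?A z t h) * ind {0..1} t) \<partial>lborel \<partial>?L)"
   by (rule lborel_pair.Fubini'[OF pm, symmetric])
  also have "... = (\<integral>\<^sup>+t. (ennreal (norm h) * (?D w n)) * ind {0..1} t \<partial>?L)"
  proof (rule nn_integral_cong)
   fix t :: real
   show "(NN z. ennreal (norm h) * (w n (?A z t h) * ind {0..1} t)) = (ennreal (norm h) * (?D w n)) * ind {0..1} t"
    using sm[OF wm[of n], of "t *. h"] tr[OF wm[of n], of "t *. h"]
    by (simp add: nn_integral_cmult nn_integral_multc mult.assoc)
  qed
  also have "... = ennreal (norm h) * (?D w n)" by (simp add: nn_integral_cmult)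
  finally show ?thesis .
 qed
 have "(%n. (?B v n) + ((?B v n) + ennreal (norm h) * (?D w n))) ----> 0 + (0 + ennreal (norm h) * 0)"
  using H1a_L1_local[OF ph lim K] unfolding v_def w_def
  by (intro tendsto_add ennreal_tendsto_cmult) auto
 from LIMSEQ_le_const[OF this, of "\<integral>\<^sup>+z. ennreal (norm (D z)) * ind B z \<partial>lborel"] bound
 have "(?E D B) = 0" by auto
 moreover have "(?H D B) : bmeas lborel"
 proof -
  have "continuous_on B (%z. norm (D z))" unfolding B_def by (intro continuous_intros Dc)
  from borel_measurable_continuous_on_indicator[OF Bb this]
  have "(%z. ennreal (ind B z *. norm (D z))) : bmeas borel" by measurable
  moreover have "(%z. ennreal (ind B z *. norm (D z))) = (?H D B)"
   by (rule ext) (simp add: indicator_def)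
  ultimately have "(?H D B) : bmeas borel" by (simp only:)
  thus ?thesis by (subst measurable_cong_sets[OF sets_lborel refl])
 qed
 ultimately have "AE z in lborel. ennreal (norm (D z)) * ind B z = 0"
  by (subst (asm) nn_integral_0_iff_AE)
 hence "AE z in lborel. z : ball z0 e --> D z = 0"
  by eventually_elim (auto simp: B_def indicator_def)
 from continuous_AE_zero_ball[OF Dc this e(1)] show ?thesis by (simp add: D_def)
qed
show ?thesis
 unfolding has_derivative_at_alt
proof (intro conjI allI impI)
 show "bounded_linear (%h. F z0 \<bullet> h)" by (rule bounded_linear_inner_right)
 fix ep :: real assume ep: "0 < ep"
 have "isCont F z0" using Fc z0 continuous_on_eq_continuous_at[OF open_half_ball] by blast
 then obtain d where d: "0 < d" "!!z. dist z z0 < d ==> dist (F z) (F z0) < ep"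
  using ep unfolding continuous_at_eps_delta by blast
 show "EX d>0. ALL y. norm (y - z0) < d --> norm (u y - u z0 - F z0 \<bullet> (y - z0)) <= ep * norm (y - z0)"
 proof (intro exI[of _ "min d e"] conjI allI impI)
  show "0 < min d e" using d e by simp
  fix y assume y: "norm (y - z0) < min d e"
  define h where "h = y - z0"
  have h: "norm h < d" "norm h < e" using y by (auto simp: h_def)
  have small: "norm (t *. h) <= norm h" if "t : {0..1}" for t using that by (simp add: mult_left_le_one_le)
  have inH: "z0 + t *. h : half_ball r" if "t : {0..1}" for t
  proof -
   have "z0 + t *. h : cball z0 (2 * e)" using small[OF that] h e(1) by (simp add: dist_norm)
   thus ?thesis using e(2) by blast
  qed
  have line: "continuous_on {0..1} (%t. F (?K t h))"
   using inH by (intro continuous_intros continuous_on_compose2[OF Fc]) auto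
  have "u y - u z0 - F z0 \<bullet> h = integral {0..1} (%t. F (?K t h) \<bullet> h) - integral {0..1} (%t::real. F z0 \<bullet> h)"
   using ft[OF h(2)] by (simp add: h_def)
  also have "... = integral {0..1} (?C h)"
   by (intro Henstock_Kurzweil_Integration.integral_diff[symmetric] integrable_continuous_real continuous_intros line)
  finally have eq: "u y - u z0 - F z0 \<bullet> h = integral {0..1} (?C h)" .
  have "norm (integral {0..1} (?C h)) <= integral {0..1} (%t::real. ep * norm h)"
  proof (rule integral_norm_bound_integral)
   show "(?C h) integrable_on {0..1}"
    by (intro integrable_continuous_real continuous_intros line)
   fix t :: real assume t: "t : {0..1}"
   have "norm (F (?K t h) - F z0) <= ep"
    using d(2)[of "z0 + t *. h"] small[OF t] h(1) by (simp add: dist_norm)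
   hence "norm (F (?K t h) - F z0) * norm h <= ep * norm h" by (rule mult_right_mono) simp
   thus "norm (F (?K t h) \<bullet> h - F z0 \<bullet> h) <= ep * norm h"
    using Cauchy_Schwarz_ineq2[of "F (?K t h) - F z0" h] by (simp add: inner_diff_left)
  qed (rule integrable_const_ivl)
  thus "norm (u y - u z0 - F z0 \<bullet> (y - z0)) <= ep * norm (y - z0)"
   using eq by (simp add: h_def)
 qed
qed
qed

section \<open>Integrals depending on a parameter, and the radial kernel\<close>

lemma integral_param_continuous:
fixes f :: "real => 'a => real"
assumes "finite_measure M"
 and meas: "!!s. s : {al<..<be} ==> f s : bmeas M"
 and cont: "!!x. x : space M ==> continuous_on {al<..<be} (%s. f s x)"
 and bnd: "!!c d. al < c ==> d < be ==> EX B. ALL s:{c..d}. ALL x:space M. \<bar>f s x\<bar> <= B"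
shows "continuous_on {al<..<be} (%s. \<integral>x. f s x \<partial>M)"
unfolding continuous_on_sequentially
proof (intro allI ballI impI, elim conjE)
interpret finite_measure M by fact
fix X s assume s: "s : {al<..<be}" and X: "ALL n. X n : {al<..<be}" "X ----> s"
define c where "c = (al + s) / 2"
define d where "d = (s + be) / 2"
have cd: "al < c" "c < s" "s < d" "d < be" using s by (auto simp: c_def d_def)
obtain B where B: "!!s x. s : {c..d} ==> x : space M ==> \<bar>f s x\<bar> <= B" using bnd[OF cd(1,4)] by blast
have "eventually (%n. X n : {c<..<d}) sequentially"
 using X(2) cd by (intro topological_tendstoD) auto
then obtain N where N: "!!n. N <= n ==> X n : {c<..<d}" by (auto simp: eventually_sequentially)
have "(%n. \<integral>x. f (X (n + N)) x \<partial>M) ----> (\<integral>x. f s x \<partial>M)"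
proof (rule integral_dominated_convergence[where w = "%_. B"])
 show "f s : bmeas M" using meas s by blast
 show "f (X (n + N)) : bmeas M" for n using meas X by blast
 show "integrable M (%_. B)" by simp
 show "AE x in M. (%n. f (X (n + N)) x) ----> f s x"
 proof (rule AE_I2)
  fix x assume "x : space M"
  have "(%n. f (X n) x) ----> f s x"
   using cont[OF \<open>x : space M\<close>] s X unfolding continuous_on_sequentially comp_def by blast
  thus "(%n. f (X (n + N)) x) ----> f s x" by (rule LIMSEQ_ignore_initial_segment)
 qed
 show "AE x in M. norm (f (X (n + N)) x) <= B" for n
  using B[of "X (n + N)"] N[of "n + N"] by (intro AE_I2) auto
qed
thus "((%s. \<integral>x. f s x \<partial>M) \<circ> X) ----> (\<integral>x. f s x \<partial>M)"
 unfolding comp_def by (rule LIMSEQ_offset)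
qed

text \<open>The difference quotients are dominated, by the mean value inequality, by the bound of
  \<open>f'\<close> on a compact interval around \<open>s\<close>; since the measure is finite, a
  constant is an integrable majorant.\<close>

lemma integral_param_has_derivative:
fixes f f' :: "real => 'a => real"
assumes "finite_measure M"
 and meas: "!!s. s : {al<..<be} ==> f s : bmeas M"
 and meas': "!!s. s : {al<..<be} ==> f' s : bmeas M"
 and deriv: "!!x s. x : space M ==> s : {al<..<be} ==> ((%s. f s x) has_real_derivative f' s x) (at s)"
 and bnd: "!!c d. al < c ==> d < be ==> EX B. ALL s:{c..d}. ALL x:space M. \<bar>f s x\<bar> <= B"
 and bnd': "!!c d. al < c ==> d < be ==> EX B. ALL s:{c..d}. ALL x:space M. \<bar>f' s x\<bar> <= B"
 and s: "s : {al<..<be}"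
shows "((%s. \<integral>x. f s x \<partial>M) has_real_derivative (\<integral>x. f' s x \<partial>M)) (at s)"
proof -
let ?A = "%s. (\<integral>x. f' s x \<partial>M)"
let ?B = "%s. (\<integral>x. f s x \<partial>M)"
interpret finite_measure M by fact
define c where "c = (al + s) / 2"
define d where "d = (s + be) / 2"
have cd: "al < c" "c < s" "s < d" "d < be" using s by (auto simp: c_def d_def)
obtain B where B: "!!s x. s : {c..d} ==> x : space M ==> \<bar>f' s x\<bar> <= B" using bnd'[OF cd(1,4)] by blast
have int: "integrable M (f t)" if t: "t : {al<..<be}" for t
proof -
 obtain B where "ALL s:{t..t}. ALL x:space M. \<bar>f s x\<bar> <= B" using bnd[of t t] t by auto
 thus ?thesis by (intro integrable_const_bound[of _ B] meas t) (auto intro: AE_I2)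
qed
have "((%t. ((\<integral>x. f t x \<partial>M) - (?B s)) / (t - s)) ---> (?A s)) (at s)"
 unfolding tendsto_at_iff_sequentially comp_def
proof (intro allI impI)
 fix X assume X: "ALL i. X i : UNIV - {s}" "X ----> s"
 have "eventually (%n. X n : {c<..<d}) sequentially"
  using X(2) cd by (intro topological_tendstoD) auto
 then obtain N where N: "!!n. N <= n ==> X n : {c<..<d}" by (auto simp: eventually_sequentially)
 have Xin: "X (n + N) : {al<..<be}" for n using N[of "n + N"] cd by auto
 have "(%n. \<integral>x. (f (X (n + N)) x - f s x) / (X (n + N) - s) \<partial>M) ----> (?A s)"
 proof (rule integral_dominated_convergence[where w = "%_. B"])
  show "f' s : bmeas M" using meas' s by blast
  show "(%x. (f (X (n + N)) x - f s x) / (X (n + N) - s)) : bmeas M" for n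
   using meas[OF Xin] meas[OF s] by (intro borel_measurable_divide borel_measurable_diff) auto
  show "integrable M (%_. B)" by simp
  show "AE x in M. (%n. (f (X (n + N)) x - f s x) / (X (n + N) - s)) ----> f' s x"
  proof (rule AE_I2)
   fix x assume "x : space M"
   have "((%t. (f t x - f s x) / (t - s)) ---> f' s x) (at s)"
    using deriv[OF \<open>x : space M\<close> s] by (simp add: has_field_derivative_iff)
   hence "(%n. (f (X n) x - f s x) / (X n - s)) ----> f' s x"
    using X unfolding tendsto_at_iff_sequentially comp_def by blast
   thus "(%n. (f (X (n + N)) x - f s x) / (X (n + N) - s)) ----> f' s x"
    by (rule LIMSEQ_ignore_initial_segment)
  qed
  show "AE x in M. norm ((f (X (n + N)) x - f s x) / (X (n + N) - s)) <= B" for n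
  proof (rule AE_I2)
   fix x assume x: "x : space M"
   let ?t = "X (n + N)"
   have t: "?t : {c..d}" "?t ~= s" using N[of "n + N"] X(1) by auto
   have "norm (f ?t x - f s x) <= B * norm (?t - s)"
   proof (rule field_differentiable_bound[of "{c..d}" "%s. f s x" "%s. f' s x"])
    show "((%s. f s x) has_field_derivative f' y x) (at y within {c..d})" if "y : {c..d}" for y
     by (rule has_field_derivative_at_within[OF deriv[OF x]]) (use that cd in auto)
    show "norm (f' y x) <= B" if "y : {c..d}" for y using B[OF that x] by simp
   qed (use t cd in auto)
   thus "norm ((f ?t x - f s x) / (?t - s)) <= B"
    using t by (simp add: abs_divide divide_le_eq)
  qed
 qed
 moreover have "(\<integral>x. (f (X (n + N)) x - f s x) / (X (n + N) - s) \<partial>M) = ((\<integral>x. f (X (n + N)) x \<partial>M) - (?B s)) / (X (n + N) - s)" for n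
  using int[OF Xin] int[OF s] by (simp add: Bochner_Integration.integral_diff)
 ultimately have "(%n. ((\<integral>x. f (X (n + N)) x \<partial>M) - (?B s)) / (X (n + N) - s)) ----> (?A s)" by (simp only:)
 thus "(%n. ((\<integral>x. f (X n) x \<partial>M) - (?B s)) / (X n - s)) ----> (?A s)"
  by (rule LIMSEQ_offset)
qed
thus ?thesis by (simp add: has_field_derivative_iff)
qed

text \<open>The kernels are the radial derivatives of the cutoffs \<open>ramp (j (r\<^sup>2 - s\<^sup>2))\<close>.\<close>

lemma ramp_kernel_integral:
assumes "0 <= c"
shows "integrable lborel (%s. ind {0..c} s * (2 * j * s * ramp' (j * (r^2 - s^2))))"
 and "(LINT s|lborel. ind {0..c} s * (2 * j * s * ramp' (j * (r^2 - s^2)))) = ramp (j * r^2) - ramp (j * (r^2 - c^2))"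
proof -
let ?A = "%s. j * (r^2 - s^2)"
have cont: "continuous_on {0..c} (%s. 2 * j * s * ramp' (?A s))"
 by (intro continuous_intros continuous_on_compose2[OF continuous_ramp'[of UNIV]]) auto
have d: "((%s. - ramp (?A s)) has_real_derivative 2 * j * s * ramp' (?A s)) (at s within {0..c})" for s
 by (auto intro!: derivative_eq_intros DERIV_chain2[OF ramp_deriv])
have "has_bochner_integral lborel (%s. ind {0..c} s *. (2 * j * s * ramp' (?A s)))
  (- ramp (j * (r^2 - c^2)) - - ramp (j * (r^2 - 0^2)))"
 by (rule has_bochner_integral_FTC_Icc[OF assms _ cont])
  (use d in \<open>simp add: has_real_derivative_iff_has_vector_derivative\<close>)
thus "integrable lborel (%s. ind {0..c} s * (2 * j * s * ramp' (?A s)))"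
 and "(LINT s|lborel. ind {0..c} s * (2 * j * s * ramp' (?A s))) = ramp (j * r^2) - ramp (j * (r^2 - c^2))"
 by (auto simp: has_bochner_integral_iff)
qed

text \<open>The kernels are nonnegative, vanish for s >= r and have masses tending to 1; on [0, c]
  with c < r their mass tends to 0. Hence they concentrate at r from below and evaluate a continuous
  function there.\<close>

lemma ramp_kernel_tendsto:
fixes A :: "real => real"
assumes r: "0 < r" "r < R" and Ac: "continuous_on {0<..<R} A" and Ab: "!!s. s : {0<..<R} ==> \<bar>A s\<bar> <= C"
shows "(%n. LINT s|lborel. ind {0<..<R} s * (2 * real (Suc n) * s * ramp' (real (Suc n) * (r^2 - s^2)) * A s)) ----> A r"
proof -
let ?A = "%s ww n. ind {0..r} s * ww n s"
let ?B = "%n c. real (Suc n) * (r^2 - c^2)"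
let ?C = "%ww n. (LINT s|lborel. ind {0<..<R} s * (ww n s * A s))"
define ww where "ww n s = 2 * real (Suc n) * s * ramp' (real (Suc n) * (r^2 - s^2))" for n s
have C0: "0 <= C" using Ab[of r] r by (auto intro: order_trans[OF abs_ge_zero])
have ww0: "0 <= ww n s" if "0 <= s" for n s using that ramp_bounds(3) by (simp add: ww_def)
have wwr: "ww n s = 0" if "r <= s" for n s
proof -
 have "r^2 <= s^2" using that r by (intro power_mono) auto
 hence "real (Suc n) * (r^2 - s^2) <= 0" by (intro mult_nonneg_nonpos) auto
 thus ?thesis by (simp add: ww_def del: of_nat_Suc)
qed
have wwi: "integrable lborel (%s. ind {0..c} s * ww n s)"
 "(LINT s|lborel. ind {0..c} s * ww n s) = ramp (real (Suc n) * r^2) - ramp (?B n c)" if "0 <= c" for c n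
 unfolding ww_def using ramp_kernel_integral[OF that, of "real (Suc n)" r] by simp_all
have wwm[measurable]: "ww n : bmeas borel" for n
 unfolding ww_def by (intro borel_measurable_continuous_onI continuous_intros continuous_on_compose2[OF continuous_ramp'[of UNIV]]) auto
have Am[measurable]: "(%s. ind {0<..<R} s * A s) : bmeas borel"
 using borel_measurable_continuous_on_indicator[OF _ Ac] by simp
define k where "k n = ramp (real (Suc n) * r^2)" for n
have k1: "k ----> 1" using ramp_tendsto[of "r^2"] r unfolding k_def by simp
have k_int: "(LINT s|lborel. ind {0..r} s * ww n s) = k n" for n
 using wwi(2)[of r n] r by (simp add: k_def)
have Ai: "integrable lborel (%s. ind {0<..<R} s * (ww n s * A s))" for n
proof (rule Bochner_Integration.integrable_bound[OF integrable_mult_right[OF wwi(1)[of r n], of C]])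
 show "(%s. ind {0<..<R} s * (ww n s * A s)) : bmeas lborel"
 proof -
  have "(%s. ww n s * (ind {0<..<R} s * A s)) : bmeas lborel" by measurable
  thus ?thesis by (simp add: mult.left_commute)
 qed
 show "AE s in lborel. norm (ind {0<..<R} s * (ww n s * A s)) <= norm (C * (?A s ww n))"
 proof (rule AE_I2)
  fix s :: real
  show "norm (ind {0<..<R} s * (ww n s * A s)) <= norm (C * (?A s ww n))"
  proof (cases "s : {0<..<R} & s <= r")
   case True
   hence "\<bar>ww n s\<bar> * \<bar>A s\<bar> <= \<bar>ww n s\<bar> * C" using Ab by (intro mult_left_mono) auto
   thus ?thesis using True C0 by (simp add: abs_mult mult.commute)
  next
   case False
   thus ?thesis using wwr[of s n] by (auto simp: indicator_def)
  qed
 qed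
qed (use r in auto)
show ?thesis
proof (rule LIMSEQ_I)
 fix e :: real assume e: "0 < e"
 define ep where "ep = e / 4"
 have ep: "0 < ep" using e by (simp add: ep_def)
 have "isCont A r" using Ac r by (simp add: continuous_on_eq_continuous_at)
 then obtain d where d: "0 < d" "!!s. dist s r < d ==> dist (A s) (A r) < ep"
  using ep unfolding continuous_at_eps_delta by blast
 \<comment> \<open>On [c, r] the function \<open>A\<close> is within \<open>ep\<close> of
   \<open>A r\<close>; on [0, c] it is only bounded, but the mass of the kernel vanishes there. The
   maximum keeps \<open>c\<close> positive.\<close>
 define c where "c = max (r - d / 2) (r / 2)"
 have c: "0 < c" "c < r" "r - d < c" using d r by (auto simp: c_def)
 have c2: "c^2 < r^2" using c by (intro power_strict_mono) auto
 have "(%n. ramp (?B n c)) ----> 1" using ramp_tendsto[of "r^2 - c^2"] c2 by simp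
 from tendsto_diff[OF k1 this] have t0: "(%n. 2 * C * (k n - ramp (?B n c))) ----> 2 * C * (1 - 1)"
  by (intro tendsto_mult tendsto_const)
 have t1: "(%n. \<bar>A r\<bar> * \<bar>k n - 1\<bar>) ----> \<bar>A r\<bar> * \<bar>1 - 1\<bar>"
  by (intro tendsto_intros k1)
 have ev: "eventually (%n. 2 * C * (k n - ramp (?B n c)) < ep) sequentially"
  "eventually (%n. \<bar>A r\<bar> * \<bar>k n - 1\<bar> < ep) sequentially"
  using order_tendstoD(2)[OF t0, of ep] order_tendstoD(2)[OF t1, of ep] ep by auto
 have main: "\<bar>(?C ww n) - A r * k n\<bar> <= ep + 2 * C * (k n - ramp (?B n c))" for n
 proof -
  have i1: "integrable lborel (%s. A r * (?A s ww n))"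
   using wwi(1)[of r n] r by simp
  define W where "W = (?C ww n) - A r * k n"
  define V where "V = (LINT s|lborel. ep * (?A s ww n) + 2 * C * (ind {0..c} s * ww n s))"
  have W: "W = (LINT s|lborel. ind {0<..<R} s * (ww n s * A s) - A r * (?A s ww n))"
   unfolding W_def using Ai[of n] i1 k_int[of n] by (simp add: Bochner_Integration.integral_diff)
  have WV: "\<bar>W\<bar> <= V"
   unfolding W V_def
  proof (rule order_trans[OF integral_abs_bound], rule integral_mono_AE)
   show "integrable lborel (%s. \<bar>ind {0<..<R} s * (ww n s * A s) - A r * (?A s ww n)\<bar>)"
    using Ai[of n] i1 by simp
   show "integrable lborel (%s. ep * (?A s ww n) + 2 * C * (ind {0..c} s * ww n s))"
    using wwi(1)[of r n] wwi(1)[of c n] r c by simp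
   have "AE s in lborel. s ~= (0::real)" by (rule AE_lborel_singleton)
   thus "AE s in lborel. \<bar>ind {0<..<R} s * (ww n s * A s) - A r * (?A s ww n)\<bar>
    <= ep * (?A s ww n) + 2 * C * (ind {0..c} s * ww n s)"
   proof eventually_elim
    case (elim s)
    show ?case
    proof (cases "0 < s & s < r")
     case False
     hence "s < 0 | r <= s" using elim by auto
     thus ?thesis using wwr[of s n] r c by (auto simp: indicator_def)
    next
     case True
     hence "ind {0<..<R} s * (ww n s * A s) - A r * (?A s ww n) = ww n s * (A s - A r)"
      using r by (simp add: algebra_simps)
     moreover have "\<bar>ww n s * (A s - A r)\<bar> <= ep * ww n s + 2 * C * (ind {0..c} s * ww n s)"
     proof (cases "s <= c")
      case le: True
      have "\<bar>A s - A r\<bar> <= 2 * C" using Ab[of s] Ab[of r] True r by auto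
      hence "\<bar>ww n s * (A s - A r)\<bar> <= ww n s * (2 * C)"
       using ww0[of s n] True by (simp add: abs_mult mult_left_mono)
      moreover have "0 <= ep * ww n s" using ep ww0[of s n] True by simp
      ultimately show ?thesis using le True by (simp add: mult.commute)
     next
      case gt: False
      hence "dist s r < d" using True c by (auto simp: dist_real_def)
      hence "\<bar>A s - A r\<bar> <= ep" using d(2)[of s] by (simp add: dist_real_def)
      hence "\<bar>ww n s * (A s - A r)\<bar> <= ww n s * ep"
       using ww0[of s n] True by (simp add: abs_mult mult_left_mono)
      thus ?thesis using gt by (simp add: mult.commute)
     qed
     ultimately show ?thesis using True by simp
    qed
   qed
  qed
  have "V = ep * (LINT s|lborel. ind {0..r} s * ww n s) + 2 * C * (LINT s|lborel. ind {0..c} s * ww n s)"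
  proof -
   have "integrable lborel (%s. ep * (?A s ww n))" "integrable lborel (%s. 2 * C * (ind {0..c} s * ww n s))"
    using r c by (intro integrable_mult_right wwi(1); linarith)+
   from Bochner_Integration.integral_add[OF this] show ?thesis unfolding V_def by (simp only: integral_mult_right_zero)
  qed
  also have "... = ep * k n + 2 * C * (k n - ramp (?B n c))"
   using wwi(2)[of c n] c unfolding k_int by (simp only: k_def less_imp_le)
  also have "ep * k n <= ep" using ep ramp_bounds(2) by (simp add: k_def mult_left_le)
  finally show ?thesis using WV unfolding W_def by linarith
 qed
 from ev have "eventually (%n. norm ((?C ww n) - A r) < e) sequentially"
 proof eventually_elim
  case (elim n)
  have "\<bar>A r * k n - A r\<bar> < ep"
   using elim(2) by (simp add: abs_mult[symmetric] algebra_simps)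
  thus ?case using main[of n] elim(1) ep unfolding real_norm_def ep_def by linarith
 qed
 thus "EX no. ALL n>=no. norm ((LINT s|lborel. ind {0<..<R} s * (2 * real (Suc n) * s * ramp' (real (Suc n) * (r^2 - s^2)) * A s)) - A r) < e"
  by (simp add: eventually_sequentially ww_def)
qed
qed

subsection \<open>The divergence theorem on half balls\<close>

text \<open>The regularity estimates bound the horizontal part and the weighted vertical part of the gradient.\<close>

definition bdd_field :: "real => real => (('n::finite) point => 'n point) => bool" where
"bdd_field a R V \<longleftrightarrow> continuous_on (half_ball R) V &
  (EX C. ALL z:half_ball R. norm (fst (V z)) <= C & \<bar>snd z powr a * snd (V z)\<bar> <= C)"

text \<open>\<open>G\<close> is at once the Sobolev gradient, which governs limits in the weak
  formulation, and the classical gradient, which is differentiated along rays.\<close>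

definition admissible :: "real => real => (('n::finite) point => real) => ('n point => 'n point) => bool" where
"admissible a R ps G \<longleftrightarrow> is_H1a_grad a R ps G & continuous_on (half_ball R \<union> thin_ball R) ps &
  (EX C. ALL z:half_ball R \<union> thin_ball R. \<bar>ps z\<bar> <= C) & bdd_field a R G &
  (ALL z:half_ball R. (ps has_derivative (%h. G z \<bullet> h)) (at z))"

text \<open>\<open>V\<close> solves \<open>div (y\<^sup>a V) = 0\<close> with conormal boundary values \<open>- y\<^sup>a V\<^sub>y = b\<close>.\<close>

definition conormal :: "real => real => (('n::finite) point => 'n point) => (real ^ 'n => real) => bool" where
"conormal a R V b \<longleftrightarrow> bdd_field a R V & continuous_on (ball 0 R) b & (EX C. ALL x:ball 0 R. \<bar>b x\<bar> <= C) &
  (ALL ph rh. smooth ph & rh < R & (ALL z. rh <= norm z --> ph z = 0) -->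
   (\<integral>z. V z \<bullet> grad ph z \<partial>hwt a R) = (LINT x:ball 0 R|lborel. b x * ph (x, 0)))"

lemma bdd_fieldE:
fixes V :: "('n::finite) point => 'n point"
assumes "bdd_field a R V"
obtains C where "0 <= C" "!!z. z : half_ball R ==> norm (fst (V z)) <= C"
 "!!z. z : half_ball R ==> \<bar>snd (V z)\<bar> <= C * snd z powr - a"
proof -
obtain C where C: "!!z. z : half_ball R ==> norm (fst (V z)) <= C & \<bar>snd z powr a * snd (V z)\<bar> <= C"
 using assms unfolding bdd_field_def by blast
show ?thesis
proof (rule that[of "\<bar>C\<bar>"])
 fix z :: "'n point" assume z: "z : half_ball R"
 hence y: "0 < snd z" by (rule half_ballD)
 have c: "norm (fst (V z)) <= C" "snd z powr a * \<bar>snd (V z)\<bar> <= C" using C[OF z] by (auto simp: abs_mult)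
 thus "norm (fst (V z)) <= \<bar>C\<bar>" by linarith
 have "snd z powr a * \<bar>snd (V z)\<bar> <= \<bar>C\<bar>" using c by linarith
 from mult_left_mono[OF this, of "snd z powr - a"]
 have "snd z powr - a * (snd z powr a * \<bar>snd (V z)\<bar>) <= \<bar>C\<bar> * snd z powr - a" by (simp add: mult.commute)
 thus "\<bar>snd (V z)\<bar> <= \<bar>C\<bar> * snd z powr - a"
  using y by (simp add: mult.assoc[symmetric] powr_add[symmetric])
qed simp
qed

text \<open>The bounds give y^a |V|^2 <= C^2 (y^a + y^-a), and both powers are integrable because
  \<open>\<bar>a\<bar> < 1\<close>.\<close>

lemma bdd_field_L2:
fixes V :: "('n::finite) point => 'n point"
assumes a: "-1 < a" "a < 1" and V: "bdd_field a R V"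
shows "V : bmeas (hwt a R)"
 and "(\<integral>\<^sup>+z. ennreal ((norm (V z))^2) \<partial>hwt a R) < \<infinity>"
 and "integrable (hwt a R) (%z. (norm (V z))^2)"
 and "integrable (hwt a R) (%z. norm (V z))"
proof -
let ?W = "wt a (half_ball R :: 'n point set)"
let ?A = "(\<integral>\<^sup>+z. ennreal ((norm (V z))^2) \<partial>?W)"
let ?B = "(half_ball R :: 'n point set)"
let ?C = "%z. ennreal (snd z powr - a) * 1 * ind (half_ball R) z"
let ?D = "%z. ennreal (snd z powr a) * 1 * ind (half_ball R) z"
interpret W: finite_measure ?W using a by (intro finite_measure_wt)
interpret W': finite_measure "wt (- a) ?B" using a by (intro finite_measure_wt) auto
show m: "V : bmeas ?W"
 using V unfolding bdd_field_def by (intro continuous_on_measurable_wt) auto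
obtain C where C: "0 <= C" "!!z. z : half_ball R ==> norm (fst (V z)) <= C"
 "!!z. z : half_ball R ==> \<bar>snd (V z)\<bar> <= C * snd z powr - a"
 using bdd_fieldE[OF V] by metis
have sq: "snd z powr a * (norm (V z))^2 <= C^2 * snd z powr a + C^2 * snd z powr - a" if z: "z : half_ball R" for z
proof -
 have y: "0 < snd z" using z by (rule half_ballD)
 have "(norm (V z))^2 = (norm (fst (V z)))^2 + \<bar>snd (V z)\<bar>^2"
  by (simp add: norm_prod_def)
 also have "... <= C^2 + (C * snd z powr - a)^2"
  using C z by (intro add_mono power_mono) auto
 also have "... = C^2 + C^2 * snd z powr (- 2 * a)"
  using y by (simp add: power_mult_distrib powr_power mult.commute)
 finally have "snd z powr a * (norm (V z))^2 <= snd z powr a * (C^2 + C^2 * snd z powr (- 2 * a))"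
  by (rule mult_left_mono) simp
 also have "... = C^2 * snd z powr a + C^2 * (snd z powr a * snd z powr (- 2 * a))" by (simp add: algebra_simps)
 also have "snd z powr a * snd z powr (- 2 * a) = snd z powr - a" using y by (simp add: powr_add[symmetric])
 finally show ?thesis .
qed
have "?A = (\<integral>\<^sup>+z\<in>half_ball R. (ennreal (snd z powr a) * ennreal ((norm (V z))^2)) \<partial>lborel)"
 using m by (intro nn_integral_wt) auto
also have "... <= (\<integral>\<^sup>+z. ennreal (C^2) * (?D z) + ennreal (C^2) * (?C z) \<partial>(lborel :: 'n point measure))"
proof (rule nn_integral_mono)
 fix z :: "'n point"
 show "ennreal (snd z powr a) * ennreal ((norm (V z))^2) * ind (half_ball R) z
  <= ennreal (C^2) * (?D z) + ennreal (C^2) * (?C z)"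
 proof (cases "z : half_ball R")
  case True
  from ennreal_leI[OF sq[OF True]] show ?thesis using True C(1) by (simp add: ennreal_mult)
 qed simp
qed
also have "... = ennreal (C^2) * (\<integral>\<^sup>+z. 1 \<partial>?W) + ennreal (C^2) * (\<integral>\<^sup>+z. 1 \<partial>wt (- a) ?B)"
proof -
 have e: "(\<integral>\<^sup>+z. 1 \<partial>wt c ?B) = (\<integral>\<^sup>+z. ennreal (snd z powr c) * 1 * ind (half_ball R) z \<partial>(lborel :: 'n point measure))" for c
  by (rule nn_integral_wt) auto
 show ?thesis unfolding e by (subst nn_integral_add) (auto simp: nn_integral_cmult)
qed
also have "... < \<infinity>"
 using W.emeasure_finite[of "half_ball R"] W'.emeasure_finite[of "half_ball R"]
 by (simp add: ennreal_mult_eq_top_iff less_top[symmetric])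
finally show fin: "?A < \<infinity>" .
show i2: "integrable ?W (%z. (norm (V z))^2)"
 using fin m by (intro integrableI_bounded) auto
show "integrable ?W (%z. norm (V z))"
proof (rule Bochner_Integration.integrable_bound[of _ "%z. 1 + (norm (V z))^2"])
 show "integrable ?W (%z. 1 + (norm (V z))^2)" using i2 by simp
 show "AE z in ?W. norm (norm (V z)) <= norm (1 + (norm (V z))^2)"
 proof (rule AE_I2)
  fix z
  have "2 * norm (V z) <= 1 + (norm (V z))^2"
   using zero_le_power2[of "norm (V z) - 1"] by (simp add: power2_diff)
  hence "norm (V z) <= 1 + (norm (V z))^2" using norm_ge_zero[of "V z"] by linarith
  thus "norm (norm (V z)) <= norm (1 + (norm (V z))^2)" by simp
 qed
qed (use m in measurable)
qed

lemma bdd_field_inner_integrable: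
fixes V :: "('n::finite) point => 'n point"
assumes a: "-1 < a" "a < 1" and V: "bdd_field a R V" and G: "bdd_field a R G"
shows "integrable (hwt a R) (%z. V z \<bullet> G z)"
proof (rule Bochner_Integration.integrable_bound[of _ "%z. (norm (V z))^2 + (norm (G z))^2"])
show "integrable (hwt a R) (%z. (norm (V z))^2 + (norm (G z))^2)"
 using bdd_field_L2(3)[OF a V] bdd_field_L2(3)[OF a G] by simp
show "(%z. V z \<bullet> G z) : bmeas (hwt a R)"
 using bdd_field_L2(1)[OF a V] bdd_field_L2(1)[OF a G] by measurable
show "AE z in hwt a R. norm (V z \<bullet> G z) <= norm ((norm (V z))^2 + (norm (G z))^2)"
proof (rule AE_I2)
 fix z
 have "\<bar>V z \<bullet> G z\<bar> <= norm (V z) * norm (G z)" by (rule Cauchy_Schwarz_ineq2)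
 also have "... <= (norm (V z))^2 + (norm (G z))^2"
  using sum_squares_bound[of "norm (V z)" "norm (G z)"] mult_nonneg_nonneg[OF norm_ge_zero norm_ge_zero, of "V z" "G z"] by linarith
 finally show "norm (V z \<bullet> G z) <= norm ((norm (V z))^2 + (norm (G z))^2)" by simp
qed
qed

lemma half_sphereD: "th : half_sphere 1 ==> 0 < snd th" "th : half_sphere 1 ==> norm th = 1"
"th : half_sphere 1 ==> snd th <= 1" "th : half_sphere 1 ==> norm (fst th) <= 1"
using norm_snd_le[of "snd th" "fst th"] norm_fst_le[of "fst th" "snd th"] by (auto simp: half_sphere_def)

text \<open>The radial component of the gradient is bounded on spheres, since \<open>y\<^sup>1\<^sup>-\<^sup>a \<le> 1\<close> there.\<close>

lemma radial_bound:
fixes v th :: "('n::finite) point"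
assumes a: "a < 1" and C: "0 <= C" "norm (fst v) <= C" "\<bar>snd v\<bar> <= C * (s * snd th) powr - a"
 and th: "th : half_sphere 1" and s: "0 < s"
shows "\<bar>v \<bullet> th\<bar> <= C * (1 + s powr - a)"
proof -
note t = half_sphereD[OF th]
have "\<bar>v \<bullet> th\<bar> <= \<bar>fst v \<bullet> fst th\<bar> + \<bar>snd v\<bar> * snd th"
 using t abs_triangle_ineq[of "fst v \<bullet> fst th" "snd v * snd th"] by (simp add: inner_prod_def abs_mult)
also have "\<bar>fst v \<bullet> fst th\<bar> <= C"
 using order_trans[OF Cauchy_Schwarz_ineq2 mult_mono[OF C(2) t(4)]] C(1) by simp
also have "\<bar>snd v\<bar> * snd th <= C * (s * snd th) powr - a * snd th"
 using C(3) t by (intro mult_right_mono) auto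
also have "... = C * s powr - a * (snd th powr - a * snd th powr 1)"
 using t s by (simp add: powr_mult)
also have "snd th powr - a * snd th powr 1 = snd th powr (1 - a)"
 by (simp only: powr_add[symmetric]) (simp add: add.commute)
also have "C * s powr - a * snd th powr (1 - a) <= C * s powr - a * 1"
proof (rule mult_left_mono)
 have "snd th powr (1 - a) <= 1 powr (1 - a)" using a t by (intro powr_mono2) auto
 thus "snd th powr (1 - a) <= 1" by simp
qed (use C in simp)
finally show ?thesis by (simp add: algebra_simps)
qed

lemma powr_interval_bound:
fixes b c d s :: real
assumes "0 < c" "c <= s" "s <= d"
shows "s powr b <= c powr b + d powr b"
proof (cases "0 <= b")
case True
hence "s powr b <= d powr b" using assms by (intro powr_mono2) auto
thus ?thesis by (simp add: add_increasing)
next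
case False
hence "s powr b <= c powr b" using assms by (intro powr_mono2') auto
thus ?thesis by (simp add: add_increasing2)
qed

text \<open>The pointwise bound of the radial component behaves like 1 + s^-a, which is locally
  bounded in s > 0 and, multiplied by the Jacobian s^(N+a), bounded up to s = 0. The last three
  conclusions are the ingredients for differentiating averages in s.\<close>

lemma sphere_average_continuous:
fixes V :: "('n::finite) point => 'n point"
assumes a: "-1 < a" "a < 1" and V: "bdd_field a R V" and psc: "continuous_on (half_ball R) ps"
 and psb: "!!z. z : half_ball R ==> \<bar>ps z\<bar> <= B"
shows "continuous_on {0<..<R} (%s. \<integral>th. ps (s *. th) * (V (s *. th) \<bullet> th) \<partial>sph a)"
 and "EX C. ALL s:{0<..<R}. \<bar>s powr (real CARD('n) + a) * (\<integral>th. ps (s *. th) * (V (s *. th) \<bullet> th) \<partial>sph a)\<bar> <= C"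
 and "!!s. s : {0<..<R} ==> (%th. ps (s *. th) * (V (s *. th) \<bullet> th)) : bmeas (sph a)"
 and "!!s th. s : {0<..<R} ==> th : half_sphere 1 ==> isCont (%s. ps (s *. th) * (V (s *. th) \<bullet> th)) s"
 and "!!c d. 0 < c ==> d < R ==> EX B. ALL s:{c..d}. ALL th:half_sphere 1. \<bar>ps (s *. th) * (V (s *. th) \<bullet> th)\<bar> <= B"
proof -
let ?A = "%s th. V (s *. th) \<bullet> th"
let ?B = "(real CARD('n) + a)"
let ?C = "%s th. s *. th"
let ?D = "%s. (\<integral>th. ps (?C s th) * (?A s th) \<partial>sph a)"
let ?E = "%C s. C * (1 + s powr - a)"
let ?F = "%s. (%th. ps (?C s th) * (?A s th))"
let ?G = "(R powr ?B + R powr real CARD('n))"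
interpret S: finite_measure "sph a :: 'n point measure" using a by (intro finite_measure_sph)
obtain C where C: "0 <= C" "!!z. z : half_ball R ==> norm (fst (V z)) <= C"
 "!!z. z : half_ball R ==> \<bar>snd (V z)\<bar> <= C * snd z powr - a"
 using bdd_fieldE[OF V] by metis
have Vc: "continuous_on (half_ball R) V" using V by (simp add: bdd_field_def)
have inR: "s *. th : half_ball R" if "s : {0<..<R}" "th : half_sphere 1" for s th
 using that by (intro scaled_half_sphere) auto
have ptw: "\<bar>ps (?C s th) * (?A s th)\<bar> <= \<bar>B\<bar> * (?E C s)"
 if s: "s : {0<..<R}" and th: "th : half_sphere 1" for s th
proof -
 have "\<bar>V (?C s th) \<bullet> th\<bar> <= C * (1 + s powr - a)"
  using C(2)[OF inR[OF s th]] C(3)[OF inR[OF s th]] s by (intro radial_bound[OF a(2) C(1) _ _ th]) auto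
 moreover have "\<bar>ps (?C s th)\<bar> <= \<bar>B\<bar>" using psb[OF inR[OF s th]] by simp
 ultimately show ?thesis unfolding abs_mult by (intro mult_mono) auto
qed
show meas: "(?F s) : bmeas (sph a)" if s: "s : {0<..<R}" for s
proof (rule continuous_on_measurable_sph)
 have im: "(%th. s *. th) ` half_sphere 1 <= half_ball R" using inR[OF s] by blast
 show "continuous_on (half_sphere 1) (?F s)"
  by (intro continuous_on_mult continuous_on_inner continuous_on_id continuous_on_compose2[OF psc _ im]
    continuous_on_compose2[OF Vc _ im] continuous_on_scaleR continuous_on_const)
qed
show cont: "isCont (%s. ps (?C s th) * (?A s th)) s" if s: "s : {0<..<R}" and th: "th : half_sphere 1" for s th
proof -
 have im: "(%s. s *. th) ` {0<..<R} <= half_ball R" using inR[OF _ th] by blast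
 have "continuous_on {0<..<R} (%s. ps (?C s th) * (?A s th))"
  by (intro continuous_on_mult continuous_on_inner continuous_on_id continuous_on_compose2[OF psc _ im]
    continuous_on_compose2[OF Vc _ im] continuous_on_scaleR continuous_on_const)
 thus ?thesis using s by (simp add: continuous_on_eq_continuous_at)
qed
show bnd: "EX B. ALL s:{c..d}. ALL th:half_sphere 1. \<bar>ps (?C s th) * (?A s th)\<bar> <= B" if cd: "0 < c" "d < R" for c d
proof (intro exI ballI)
 fix s th assume s: "s : {c..d}" and th: "(th :: 'n point) : half_sphere 1"
 have "\<bar>ps (?C s th) * (?A s th)\<bar> <= \<bar>B\<bar> * (?E C s)"
  using s cd by (intro ptw th) auto
 also have "... <= \<bar>B\<bar> * (C * (1 + (c powr - a + d powr - a)))"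
  using s cd C(1) by (intro mult_left_mono add_left_mono powr_interval_bound) auto
 finally show "\<bar>ps (?C s th) * (?A s th)\<bar> <= \<bar>B\<bar> * (C * (1 + (c powr - a + d powr - a)))" .
qed
show "continuous_on {0<..<R} (%s. \<integral>th. ps (?C s th) * (?A s th) \<partial>sph a)"
 by (rule integral_param_continuous[OF S.finite_measure_axioms])
  (use meas bnd cont in \<open>auto simp: continuous_at_imp_continuous_on\<close>)
show "EX C. ALL s:{0<..<R}. \<bar>s powr ?B * (?D s)\<bar> <= C"
proof (intro exI ballI)
 fix s assume s: "s : {0<..<R}"
 let ?m = "measure (sph a :: 'n point measure) (space (sph a))"
 \<comment> \<open>\<open>N >= 1\<close> and \<open>a > -1\<close> keep the exponent N + a
   nonnegative, so that the flux stays bounded down to s = 0.\<close>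
 have "1 <= CARD('n)" using zero_less_card_finite[where 'a = 'n] by linarith
 hence N1: "0 <= real CARD('n) + a" using a by linarith
 have "\<bar>\<integral>th. ps (?C s th) * (?A s th) \<partial>sph a\<bar> <= (\<integral>th. \<bar>B\<bar> * (?E C s) \<partial>(sph a :: 'n point measure))"
 proof (rule order_trans[OF integral_abs_bound], rule integral_mono_AE)
  show "integrable (sph a) (%th. \<bar>ps (?C s th) * (?A s th)\<bar>)"
   using meas[OF s] ptw[OF s] by (intro S.integrable_const_bound[of _ "\<bar>B\<bar> * (?E C s)"]) (auto intro!: AE_I2)
  show "AE th in sph a. \<bar>ps (?C s th) * (?A s th)\<bar> <= \<bar>B\<bar> * (?E C s)"
   using ptw[OF s] by (intro AE_I2) simp
 qed simp
 hence "s powr ?B * \<bar>\<integral>th. ps (?C s th) * (?A s th) \<partial>sph a\<bar> <=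
   s powr ?B * (\<bar>B\<bar> * (?E C s) * ?m)"
  by (intro mult_left_mono) (auto simp: mult_ac)
 also have "... = \<bar>B\<bar> * C * ?m * (s powr ?B + s powr real CARD('n))"
 proof -
  have "s powr ?B * s powr - a = s powr real CARD('n)" by (simp add: powr_add[symmetric])
  thus ?thesis by (simp add: algebra_simps)
 qed
 also have "... <= \<bar>B\<bar> * C * ?m * ?G"
  using s C(1) a N1 by (intro mult_left_mono add_mono powr_mono2) auto
 finally show "\<bar>s powr ?B * (?D s)\<bar> <= \<bar>B\<bar> * C * ?m * ?G"
  by (simp add: abs_mult)
qed
qed

lemma bounded_on_half_ball:
fixes f :: "('n::finite) point => 'c::euclidean_space"
assumes "continuous_on UNIV f"
obtains B where "0 <= B" "!!z. norm z < R ==> norm (f z) <= B"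
proof -
have "bounded (f ` cball 0 R)"
 by (intro compact_imp_bounded compact_continuous_image continuous_on_subset[OF assms]) auto
then obtain B where "!!z. z : cball 0 R ==> norm (f z) <= B" unfolding bounded_iff by blast
hence "norm (f z) <= \<bar>B\<bar>" if "norm z < R" for z
 using that by (meson abs_ge_self less_imp_le mem_cball_0 order_trans)
thus ?thesis by (rule that[of "\<bar>B\<bar>", OF abs_ge_zero])
qed

text \<open>The product \<open>et * ps\<close> need not be smooth. The equation is tested with
  \<open>et * ph n\<close> instead, and the limit is taken by \<open>L2_pairing\<close>, inside with
  the Sobolev convergence and on the thin ball with \<open>trace_tendsto\<close>.\<close>

lemma conormal_cutoff:
fixes V :: "('n::finite) point => 'n point"
assumes a: "-1 < a" "a < 1" and R: "0 < R" and V: "conormal a R V b" and ps: "admissible a R ps G"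
 and et: "smooth et" "rh < R" "!!z. rh <= norm z ==> et z = 0"
shows "(\<integral>z. et z * (V z \<bullet> G z) \<partial>hwt a R) + (\<integral>z. ps z * (V z \<bullet> grad et z) \<partial>hwt a R) =
  (LINT x:ball 0 R|lborel. b x * (et (x, 0) * ps (x, 0)))"
 and "integrable (hwt a R) (%z. ps z * (V z \<bullet> grad et z))"
proof -
let ?W = "wt a (half_ball R :: 'n point set)"
let ?A = "(LINT x:ball 0 R|lborel. b x * (et (x, 0) * ps (x, 0)))"
let ?B = "%z. V z \<bullet> grad et z"
let ?C = "(\<integral>z. G z \<bullet> (et z *. V z) \<partial>?W)"
let ?D = "(\<integral>z. ps z \<bullet> (?B z) \<partial>?W)"
let ?E = "%w. (\<integral>\<^sup>+z. ennreal ((norm (w z))^2) \<partial>?W)"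
let ?F = "%ph n. (\<integral>z. V z \<bullet> grad (%z. et z * ph n z) z \<partial>?W)"
let ?G = "%ph. (%n. LINT x:ball 0 R|lborel. b x * (et (x, 0) * ph n (x, 0)))"
interpret W: finite_measure ?W using a by (intro finite_measure_wt)
have Vb: "bdd_field a R V" using V by (simp add: conormal_def)
note Vm = bdd_field_L2(1)[OF a Vb] and V2 = bdd_field_L2(2)[OF a Vb] and V1 = bdd_field_L2(4)[OF a Vb]
obtain ph where ph: "!!n. smooth (ph n)" and lim: "H1a_tendsto a R ph ps G"
 using ps unfolding admissible_def is_H1a_grad_def by blast
have mu: "ps : bmeas ?W" "G : bmeas ?W" using lim H1a_tendsto_iff[OF ph] by auto
obtain B1 where B1: "0 <= B1" "!!z. norm z < R ==> norm (et z) <= B1"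
 using bounded_on_half_ball[OF smooth_continuous[OF et(1)]] by metis
obtain B2 where B2: "0 <= B2" "!!z. norm z < R ==> norm (grad et z) <= B2"
 using bounded_on_half_ball[OF continuous_grad[OF et(1)]] by metis
have etm: "et : bmeas ?W" "grad et : bmeas ?W"
 by (auto intro!: continuous_on_measurable_wt continuous_grad smooth_continuous et)
have pm: "grad (ph n) : bmeas ?W" "ph n : bmeas ?W" for n
 by (auto intro!: continuous_on_measurable_wt continuous_grad smooth_continuous ph)
have fin: "(?E w) < \<infinity>"
 if "!!z. z : half_ball R ==> norm (w z) <= B * norm (V z)" "0 <= B" for w :: "'n point => 'c::euclidean_space" and B
proof -
 have "(?E w) <= (\<integral>\<^sup>+z. ennreal (B^2) * ennreal ((norm (V z))^2) \<partial>?W)"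
 proof (rule nn_integral_mono)
  fix z assume "z : space ?W"
  hence "(norm (w z))^2 <= (B * norm (V z))^2" using that by (intro power_mono) auto
  hence "ennreal ((norm (w z))^2) <= ennreal (B^2 * (norm (V z))^2)" by (intro ennreal_leI) (simp add: power_mult_distrib)
  thus "ennreal ((norm (w z))^2) <= ennreal (B^2) * ennreal ((norm (V z))^2)" by (simp add: ennreal_mult)
 qed
 also have "... = ennreal (B^2) * (\<integral>\<^sup>+z. ennreal ((norm (V z))^2) \<partial>?W)"
  by (rule nn_integral_cmult) (use Vm in measurable)
 also have "... < \<infinity>" using V2 by (auto simp: ennreal_mult_less_top)
 finally show ?thesis .
qed
have int: "integrable ?W (%z. F z \<bullet> w z)"
 if F: "continuous_on UNIV F" and w: "!!z. z : half_ball R ==> norm (w z) <= B * norm (V z)" "0 <= B" and wm: "w : bmeas ?W"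
 for F w :: "'n point => 'c::euclidean_space" and B
proof -
 obtain B' where B': "0 <= B'" "!!z. norm z < R ==> norm (F z) <= B'" using bounded_on_half_ball[OF F] by metis
 have Fm: "F : bmeas ?W" by (rule borel_measurable_wtI) (rule borel_measurable_continuous_onI[OF F])
 show ?thesis
 proof (rule Bochner_Integration.integrable_bound[OF integrable_mult_right[OF V1, of "B' * B"]])
  show "(%z. F z \<bullet> w z) : bmeas ?W" using Fm wm by measurable
  show "AE z in ?W. norm (F z \<bullet> w z) <= norm (B' * B * norm (V z))"
  proof (rule AE_I2)
   fix z assume z: "z : space ?W"
   hence "norm z < R" by (simp add: half_ball_def)
   have "\<bar>F z \<bullet> w z\<bar> <= norm (F z) * norm (w z)" by (rule Cauchy_Schwarz_ineq2)
   also have "... <= B' * (B * norm (V z))" using B'(2)[OF \<open>norm z < R\<close>] B'(1) w(1)[of z] z by (intro mult_mono) auto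
   finally show "norm (F z \<bullet> w z) <= norm (B' * B * norm (V z))" using B' w(2) by (simp add: mult.assoc)
  qed
 qed
qed
have w1: "norm (et z *. V z) <= B1 * norm (V z)" if "z : half_ball R" for z
 using B1(2)[of z] half_ballD(2)[OF that] by (simp add: mult_right_mono)
have w2: "norm (?B z) <= B2 * norm (V z)" if "z : half_ball R" for z
proof -
 have "norm (?B z) <= norm (V z) * norm (grad et z)"
  unfolding real_norm_def by (rule Cauchy_Schwarz_ineq2)
 also have "... <= norm (V z) * B2" using B2(2)[of z] half_ballD(2)[OF that] by (intro mult_left_mono) auto
 finally show ?thesis by (simp add: mult.commute)
qed
have w1m: "(%z. et z *. V z) : bmeas ?W" and w2m: "(%z. V z \<bullet> grad et z) : bmeas ?W"
 using Vm etm by measurable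
note i1 = int[OF continuous_grad[OF ph] w1 B1(1) w1m] and i2 = int[OF smooth_continuous[OF ph] w2 B2(1) w2m]
note P1 = L2_pairing[OF pm(1) mu(2) w1m H1a_tendsto_L2(1)[OF ph lim] fin[OF w1 B1(1)] i1]
note P2 = L2_pairing[OF pm(2) mu(1) w2m H1a_tendsto_L2(2)[OF ph lim] fin[OF w2 B2(1)] i2]
have lhs: "(?F ph n) = (\<integral>z. grad (ph n) z \<bullet> (et z *. V z) \<partial>?W) + (\<integral>z. ph n z \<bullet> (?B z) \<partial>?W)" for n
 using Bochner_Integration.integral_add[OF i1[of n] i2[of n]]
 by (simp add: grad_mult[OF et(1) ph] inner_add_right inner_commute)
let ?T = "restrict_space lborel (ball (0 :: real ^ 'n) R)"
interpret T: finite_measure ?T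
 by (rule finite_measureI) (use emeasure_lborel_ball_finite[of "0 :: real ^ 'n" R] in \<open>simp add: emeasure_restrict_space space_restrict_space less_top[symmetric] borel_open\<close>)
have sT: "space ?T = ball 0 R" by (simp add: space_restrict_space)
have bc: "continuous_on (ball 0 R) b" using V by (simp add: conormal_def)
obtain Cb where Cb: "!!x. x : ball 0 R ==> \<bar>b x\<bar> <= Cb" using V unfolding conormal_def by blast
have tmeas: "f : bmeas ?T" if "continuous_on (ball 0 R) f" for f :: "real ^ 'n => real"
 using borel_measurable_continuous_on_restrict[OF that] by (simp cong: measurable_cong_sets add: sets_restrict_space)
have psc: "continuous_on (half_ball R \<union> thin_ball R) ps" using ps by (simp add: admissible_def)
have thin: "continuous_on (ball 0 R) (%x. f (x, 0))" if "continuous_on UNIV f" for f :: "'n point => real"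
 by (rule continuous_on_compose2[OF that]) (auto intro!: continuous_intros)
have pst: "continuous_on (ball 0 R) (%x. ps (x, 0))"
 by (rule continuous_on_compose2[OF psc]) (auto intro!: continuous_intros simp: thin_ball_def)
define w where "w x = b x * et (x, 0)" for x
have wc: "continuous_on (ball 0 R) w"
 unfolding w_def by (intro continuous_intros bc thin smooth_continuous et)
have wb: "\<bar>w x\<bar> <= \<bar>Cb\<bar> * B1" if "x : ball 0 R" for x
proof -
 have "norm (x, 0 :: real) < R" using that by simp
 thus ?thesis
  unfolding w_def abs_mult using Cb[OF that] B1(1) B1(2)[of "(x, 0)"] by (intro mult_mono) auto
qed
have P3: "(%n. \<integral>x. ph n (x, 0) \<bullet> w x \<partial>?T) ----> (\<integral>x. ps (x, 0) \<bullet> w x \<partial>?T)"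
proof (rule L2_pairing(2))
 show "(%x. ph n (x, 0)) : bmeas ?T" for n by (intro tmeas thin smooth_continuous ph)
 show "(%x. ps (x, 0)) : bmeas ?T" by (rule tmeas[OF pst])
 show "w : bmeas ?T" by (rule tmeas[OF wc])
 show "(%n. \<integral>\<^sup>+x. ennreal ((norm (ph n (x, 0) - ps (x, 0)))^2) \<partial>?T) ----> 0"
  using trace_tendsto[OF a R ph lim psc] by (subst nn_integral_restrict_space) (auto simp: borel_open)
 have "(\<integral>\<^sup>+x. ennreal ((norm (w x))^2) \<partial>?T) <= (\<integral>\<^sup>+x. ennreal ((\<bar>Cb\<bar> * B1)^2) \<partial>?T)"
  using wb by (intro nn_integral_mono ennreal_leI power_mono) (auto simp: sT)
 also have "... = ennreal ((\<bar>Cb\<bar> * B1)^2) * emeasure ?T (space ?T)" by (rule nn_integral_const)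
 also have "... < \<infinity>" using T.emeasure_finite[of "space ?T"] by (simp add: ennreal_mult_eq_top_iff less_top[symmetric])
 finally show "(\<integral>\<^sup>+x. ennreal ((norm (w x))^2) \<partial>?T) < \<infinity>" .
 fix n
 obtain B' where B': "0 <= B'" "!!z. norm z < R ==> norm (ph n z) <= B'"
  using bounded_on_half_ball[OF smooth_continuous[OF ph]] by metis
 show "integrable ?T (%x. ph n (x, 0) \<bullet> w x)"
 proof (rule T.integrable_const_bound[of _ "B' * (\<bar>Cb\<bar> * B1)"])
  show "(%x. ph n (x, 0) \<bullet> w x) : bmeas ?T"
   by (intro borel_measurable_inner tmeas thin smooth_continuous ph wc)
  show "AE x in ?T. norm (ph n (x, 0) \<bullet> w x) <= B' * (\<bar>Cb\<bar> * B1)"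
  proof (rule AE_I2)
   fix x assume x: "x : space ?T"
   hence "norm (x, 0 :: real) < R" by (simp add: sT)
   with B' wb[of x] x show "norm (ph n (x, 0) \<bullet> w x) <= B' * (\<bar>Cb\<bar> * B1)"
    by (auto simp: sT abs_mult intro!: mult_mono)
  qed
 qed
qed
have toT: "(LINT x:ball 0 R|lborel. b x * (et (x, 0) * f x)) = (\<integral>x. f x \<bullet> w x \<partial>?T)" for f
 unfolding set_lebesgue_integral_def w_def
 by (subst integral_restrict_space) (auto simp: borel_open mult_ac)
have WF: "(?F ph n) = (LINT x:ball 0 R|lborel. b x * (et (x, 0) * ph n (x, 0)))" for n
proof -
 have "smooth (%z. et z * ph n z) & rh < R & (ALL z. rh <= norm z --> et z * ph n z = 0)"
  using smooth_mult[OF et(1) ph[of n]] et by auto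
 thus ?thesis using V unfolding conormal_def by blast
qed
have "(?G ph) ---->
  ?C + ?D"
 using tendsto_add[OF P1(2) P2(2)] unfolding lhs[symmetric] WF .
moreover have "(?G ph) ----> ?A"
 using P3 unfolding toT .
ultimately have "?C + ?D = ?A"
 by (rule LIMSEQ_unique)
thus "(\<integral>z. et z * (V z \<bullet> G z) \<partial>?W) + (\<integral>z. ps z * (?B z) \<partial>?W) = ?A"
 by (simp add: inner_commute[of "G _"])
show "integrable ?W (%z. ps z * (?B z))" using P2(1) by simp
qed

lemma integral_wt_subset:
fixes f :: "('n::finite) point => real"
assumes f: "f : bmeas (hwt a R)" and r: "r <= R"
shows "(\<integral>z. f z \<partial>hwt a r) = (\<integral>z. ind (half_ball r) z * f z \<partial>hwt a R)"
proof -
have sub: "half_ball r <= (half_ball R :: 'n point set)" using r by (rule half_ball_mono)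
have "(%z. ind (half_ball R) z *. f z) : bmeas borel" using f borel_measurable_wt_iff[OF half_ball_borel] by blast
hence "(%z. ind (half_ball r) z *. (ind (half_ball R) z *. f z)) : bmeas borel" by measurable
moreover have "ind (half_ball r) z *. (ind (half_ball R) z *. f z) = ind (half_ball r) z *. f z" for z
 using sub by (auto simp: indicator_def)
ultimately have m: "f : bmeas (hwt a r)"
 unfolding borel_measurable_wt_iff[OF half_ball_borel] by (simp only:)
have m2: "(%z. ind (half_ball r) z * f z) : bmeas (hwt a R)"
 by (intro borel_measurable_times f borel_measurable_wtI) simp
show ?thesis
 unfolding integral_wt[OF half_ball_borel m] integral_wt[OF half_ball_borel m2] set_lebesgue_integral_def
 using sub by (intro Bochner_Integration.integral_cong) (auto simp: indicator_def)
qed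

text \<open>The cutoffs ramp(j (r^2 - |z|^2)) increase to the indicator function of the ball. The
  volume terms converge by dominated convergence, while the term with the gradient of the cutoff
  becomes a one-dimensional integral of the flux against a concentrating kernel, and the flux is
  continuous in the radius.\<close>

lemma conormal_divergence:
fixes V :: "('n::finite) point => 'n point"
assumes a: "-1 < a" "a < 1" and V: "conormal a R V b" and ps: "admissible a R ps G" and r: "0 < r" "r < R"
shows "(\<integral>z. V z \<bullet> G z \<partial>hwt a r) - (LINT x:ball 0 r|lborel. b x * ps (x, 0)) =
 r powr (real CARD('n) + a) * (\<integral>th. ps (r *. th) * (V (r *. th) \<bullet> th) \<partial>sph a)"
proof -
let ?W = "wt a (half_ball R :: 'n point set)" and ?N = "real CARD('n)"
let ?A = "%s et n. (\<integral>th. - (ps (s *. th) * (V (s *. th) \<bullet> grad (et n) (s *. th))) \<partial>sph a)"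
let ?B = "%s. (\<integral>th. ps (s *. th) * (V (s *. th) \<bullet> th) \<partial>sph a)"
let ?C = "%j n A. (LINT s|lborel. ind {0<..<R} s * (2 * j n * s * ramp' (j n * (r^2 - s^2)) * A s))"
let ?D = "(\<integral>z. ind (half_ball r) z * (V z \<bullet> G z) \<partial>?W)"
let ?E = "(LINT x:ball 0 r|lborel. b x * ps (x, 0))"
let ?F = "%z. V z \<bullet> G z"
let ?G = "%et n. (LINT x:ball 0 R|lborel. b x * (et n (x, 0) * ps (x, 0)))"
let ?H = "%Cb B. \<bar>Cb\<bar> * \<bar>B\<bar>"
let ?I = "%z. r^2 - z \<bullet> z"
let ?J = "%j n s. j n * (r^2 - s^2)"
have R: "0 < R" using r by simp
interpret W: finite_measure ?W using a by (intro finite_measure_wt)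
have Vb: "bdd_field a R V" using V by (simp add: conormal_def)
have Gb: "bdd_field a R G" using ps by (simp add: admissible_def)
have VG: "integrable ?W (%z. V z \<bullet> G z)" by (rule bdd_field_inner_integrable[OF a Vb Gb])
have VGm: "(%z. V z \<bullet> G z) : bmeas ?W" using VG by auto
have psc: "continuous_on (half_ball R \<union> thin_ball R) ps" using ps by (simp add: admissible_def)
obtain B where B: "!!z. z : half_ball R \<union> thin_ball R ==> \<bar>ps z\<bar> <= B" using ps unfolding admissible_def by blast
define j where "j n = real (Suc n)" for n :: nat
define et where "et n z = ramp (j n * (r^2 - (norm z)^2))" for n and z :: "'n point"
have ets: "smooth (et n)" for n
 unfolding et_def by (intro smooth_compose[OF smooth_ramp] smooth_mult smooth_const smooth_diff smooth_norm2)
have et0: "et n z = 0" if "r <= norm z" for n z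
proof -
 have "r^2 <= (norm z)^2" using that r by (intro power_mono) auto
 thus ?thesis by (simp add: et_def j_def mult_nonneg_nonpos)
qed
have etgrad: "grad (et n) z = (- (2 * j n * ramp' (j n * (r^2 - (norm z)^2)))) *. z" for n z
proof (rule grad_unique)
 have "((%z. j n * (?I z)) has_derivative (%h. j n * (- (2 * (z \<bullet> h))))) (at z)"
  by (auto intro!: derivative_eq_intros simp: inner_commute)
 moreover have "(ramp has_derivative (%h. ramp' (j n * (?I z)) * h)) (at (j n * (?I z)))"
  using ramp_deriv unfolding has_field_derivative_def .
 ultimately have "((%z. ramp (j n * (?I z))) has_derivative (%h. ramp' (j n * (?I z)) * (j n * (- (2 * (z \<bullet> h)))))) (at z)"
  by (rule has_derivative_compose)
 thus "(et n has_derivative (%h. ((- (2 * j n * ramp' (j n * (r^2 - (norm z)^2)))) *. z) \<bullet> h)) (at z)"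
  by (simp add: et_def[abs_def] power2_norm_eq_inner mult_ac)
qed
have etb: "0 <= et n z" "et n z <= 1" for n z unfolding et_def using ramp_bounds by auto
have etlim: "(%n. et n z) ----> (if norm z < r then 1 else 0)" for z
proof -
 have "(0 < r^2 - (norm z)^2) = (norm z < r)"
 proof (cases "norm z < r")
  case True
  thus ?thesis using power_strict_mono[of "norm z" r 2] by simp
 next
  case False
  hence "r^2 <= (norm z)^2" using r by (intro power_mono) auto
  thus ?thesis using False by simp
 qed
 thus ?thesis using ramp_tendsto[of "r^2 - (norm z)^2"] unfolding et_def j_def by simp
qed
note C = conormal_cutoff[OF a R V ps ets r(2) et0]
define A where "A s = s powr (?N + a) * (?B s)" for s
have psc1: "continuous_on (half_ball R) ps" using psc by (rule continuous_on_subset) auto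
note SA = sphere_average_continuous[OF a Vb psc1, of B]
have Acont: "continuous_on {0<..<R} A"
 unfolding A_def using B by (intro continuous_on_mult SA(1) continuous_on_powr continuous_on_id continuous_on_const) auto
obtain CA where CA: "!!s. s : {0<..<R} ==> \<bar>A s\<bar> <= CA" using SA(2) B unfolding A_def by blast
\<comment> \<open>The gradient of the cutoff is parallel to \<open>z\<close>; in polar coordinates
  only \<open>V \<bullet> th\<close> survives, multiplied by the kernel of
  \<open>ramp_kernel_tendsto\<close>.\<close>
have polar: "- (\<integral>z. ps z * (V z \<bullet> grad (et n) z) \<partial>?W) = (?C j n A)" for n
proof -
 have i: "integrable ?W (%z. - (ps z * (V z \<bullet> grad (et n) z)))" using C(2)[of n] by simp
 have eq: "(?A s et n) =
   2 * j n * s * ramp' (?J j n s) * (?B s)" if "0 < s" for s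
 proof -
  have "(?A s et n) =
   (\<integral>th. (2 * j n * s * ramp' (?J j n s)) * (ps (s *. th) * (V (s *. th) \<bullet> th)) \<partial>sph a)"
  proof (rule Bochner_Integration.integral_cong[OF refl])
   fix th :: "'n point" assume "th : space (sph a)"
   hence "norm th = 1" by (simp add: half_sphereD)
   thus "- (ps (s *. th) * (V (s *. th) \<bullet> grad (et n) (s *. th))) =
    (2 * j n * s * ramp' (?J j n s)) * (ps (s *. th) * (V (s *. th) \<bullet> th))"
    using that by (simp add: etgrad)
  qed
  thus ?thesis by simp
 qed
 note P = polar_integral[OF a(1) less_imp_le[OF R] i]
 have "- (\<integral>z. ps z * (V z \<bullet> grad (et n) z) \<partial>?W) = (\<integral>s. (?A s et n) \<partial>rad (?N + a) R)"
  using P(2) by simp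
 also have "... = (LINT s:{0<..<R}|lborel. s powr (?N + a) * (?A s et n))"
  by (rule integral_rad) (rule borel_measurable_integrable[OF P(1)])
 also have "... = (?C j n A)"
  unfolding set_lebesgue_integral_def A_def
 proof (rule Bochner_Integration.integral_cong[OF refl])
  fix s
  show "ind {0<..<R} s *. (s powr (?N + a) * (?A s et n)) =
   ind {0<..<R} s * (2 * j n * s * ramp' (?J j n s) * (s powr (?N + a) * (?B s)))"
  proof (cases "s : {0<..<R}")
   case True
   hence "0 < s" by simp
   show ?thesis unfolding eq[OF \<open>0 < s\<close>] by simp
  qed simp
 qed
 finally show ?thesis .
qed
have "(%n. LINT s|lborel. ind {0<..<R} s * (2 * j n * s * ramp' (?J j n s) * A s)) ----> A r"
 unfolding j_def by (rule ramp_kernel_tendsto[OF r Acont CA])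
moreover have "(%n. (\<integral>z. et n z * (?F z) \<partial>?W) - (?G et n)) ---->
  ?D - ?E"
proof (rule tendsto_diff)
 have etm: "et n : bmeas ?W" for n by (intro continuous_on_measurable_wt smooth_continuous ets)
 show "(%n. \<integral>z. et n z * (?F z) \<partial>?W) ----> ?D"
 proof (rule integral_dominated_convergence[where w = "%z. \<bar>V z \<bullet> G z\<bar>"])
  show "(%z. ind (half_ball r) z * (?F z)) : bmeas ?W"
   by (intro borel_measurable_times VGm borel_measurable_wtI) simp
  show "(%z. et n z * (?F z)) : bmeas ?W" for n by (intro borel_measurable_times VGm etm)
  show "integrable ?W (%z. \<bar>V z \<bullet> G z\<bar>)" using VG by simp
  show "AE z in ?W. (%n. et n z * (?F z)) ----> ind (half_ball r) z * (?F z)"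
  proof (rule AE_I2)
   fix z assume "z : space ?W"
   hence "ind (half_ball r) z = (if norm z < r then 1 else (0::real))" by (auto simp: half_ball_def)
   thus "(%n. et n z * (?F z)) ----> ind (half_ball r) z * (?F z)"
    using etlim[of z] by (intro tendsto_mult tendsto_const) simp
  qed
  show "AE z in ?W. norm (et n z * (?F z)) <= \<bar>V z \<bullet> G z\<bar>" for n
   using etb by (intro AE_I2) (auto simp: abs_mult intro!: mult_left_le_one_le)
 qed
 have bc: "continuous_on (ball 0 R) b" using V by (simp add: conormal_def)
 obtain Cb where Cb: "!!x. x : ball 0 R ==> \<bar>b x\<bar> <= Cb" using V unfolding conormal_def by blast
 have pst: "continuous_on (ball 0 R) (%x. ps (x, 0))"
  by (rule continuous_on_compose2[OF psc]) (auto intro!: continuous_intros simp: thin_ball_def)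
 define h where "h x = ind (ball 0 R) x * (b x * ps (x, 0))" for x
 have hm[measurable]: "h : bmeas borel"
  using borel_measurable_continuous_on_indicator[OF _ continuous_on_mult[OF bc pst]] by (simp add: h_def[abs_def] borel_open)
 have ettm[measurable]: "(%x. et n (x, 0)) : bmeas borel" for n
  by (intro borel_measurable_continuous_onI continuous_on_compose2[OF smooth_continuous[OF ets, of UNIV]] continuous_intros) auto
 have [measurable]: "(ind (ball 0 r) :: real ^ 'n => real) : bmeas borel"
  by (intro borel_measurable_indicator borel_open open_ball)
 have hb: "\<bar>h x\<bar> <= ind (ball 0 R) x * (?H Cb B)" for x
 proof (cases "x : ball 0 R")
  case True
  have "\<bar>ps (x, 0)\<bar> <= \<bar>B\<bar>" using B[of "(x, 0)"] True by (auto simp: thin_ball_def)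
  moreover have "\<bar>b x\<bar> <= \<bar>Cb\<bar>" using Cb[OF True] by simp
  ultimately show ?thesis using True by (simp add: h_def abs_mult mult_mono)
 qed (simp add: h_def)
 have "(%n. LINT x|lborel. et n (x, 0) * h x) ----> (LINT x|lborel. ind (ball 0 r) x * h x)"
 proof (rule integral_dominated_convergence[where w = "%x. ind (ball 0 R) x * (?H Cb B)"])
  show "(%x. ind (ball 0 r) x * h x) : bmeas lborel" by measurable
  show "(%x. et n (x, 0) * h x) : bmeas lborel" for n by measurable
  show "integrable lborel (%x::real ^ 'n. ind (ball 0 R) x * (?H Cb B))"
   using emeasure_lborel_ball_finite[of "0 :: real ^ 'n" R] by (intro integrable_mult_left integrable_real_indicator) (auto simp: borel_open)
  show "AE x in lborel. (%n. et n (x, 0) * h x) ----> ind (ball 0 r) x * h x"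
  proof (rule AE_I2)
   fix x :: "real ^ 'n"
   have "ind (ball 0 r) x = (if norm (x, 0 :: real) < r then 1 else (0::real))" by simp
   thus "(%n. et n (x, 0) * h x) ----> ind (ball 0 r) x * h x"
    using etlim[of "(x, 0)"] by (intro tendsto_mult tendsto_const) simp
  qed
  show "AE x in lborel. norm (et n (x, 0) * h x) <= ind (ball 0 R) x * (?H Cb B)" for n
  proof (rule AE_I2)
   fix x :: "real ^ 'n"
   have "norm (et n (x, 0) * h x) <= \<bar>h x\<bar>" using etb by (auto simp: abs_mult intro!: mult_left_le_one_le)
   thus "norm (et n (x, 0) * h x) <= ind (ball 0 R) x * (?H Cb B)" using hb[of x] by linarith
  qed
 qed
 moreover have "(LINT x|lborel. et n (x, 0) * h x) = (?G et n)" for n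
  unfolding set_lebesgue_integral_def h_def by (intro Bochner_Integration.integral_cong) auto
 moreover have "(LINT x|lborel. ind (ball 0 r) x * h x) = ?E"
  unfolding set_lebesgue_integral_def h_def using r
  by (intro Bochner_Integration.integral_cong) (auto simp: indicator_def)
 ultimately show "(%n. LINT x:ball 0 R|lborel. b x * (et n (x, 0) * ps (x, 0))) ----> ?E"
  by (simp only:)
qed
moreover have "(\<integral>z. et n z * (?F z) \<partial>?W) - (?G et n) =
  (?C j n A)" for n
 unfolding polar[symmetric] using C(1)[of n] by linarith
ultimately have "A r = ?D - ?E"
 by (simp only:) (rule LIMSEQ_unique)
thus ?thesis
 using integral_wt_subset[OF VGm less_imp_le[OF r(2)]] by (simp add: A_def)
qed

subsection \<open>Affine changes of variables and convexity\<close>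

lemma lborel_integral_affine:
fixes f :: "'a::euclidean_space => real"
assumes [measurable]: "f : bmeas borel" and c: "0 < c"
shows "(LINT z|lborel. f z) = c ^ DIM('a) * (LINT z|lborel. f (c *. z + w))"
proof -
have "(LINT z|lborel. f z) = integral\<^sup>L (density (distr lborel borel (%z. w + c *. z)) (%_. \<bar>c\<bar> ^ DIM('a))) f"
 using lborel_affine[of c w] c by simp
also have "... = (LINT z|lborel. c ^ DIM('a) * f (w + c *. z))"
 using c by (simp add: integral_density integral_distr)
finally show ?thesis by (simp add: add.commute)
qed

lemma nn_integral_lborel_affine:
fixes f :: "'a::euclidean_space => ennreal"
assumes [measurable]: "f : bmeas borel" and c: "0 < c"
shows "(NN z. f z) = ennreal (c ^ DIM('a)) * (NN z. f (c *. z + w))"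
using c by (subst lborel_affine[of c w])
 (simp_all add: nn_integral_density nn_integral_distr nn_integral_cmult add.commute)

context
fixes c :: real and x0 :: "real ^ 'n::finite" and rh R :: real
assumes c: "0 < c" and sub: "c * rh + norm x0 <= R"
begin

lemma affine_half_ball:
assumes "z : half_ball rh"
shows "c *. z + (x0, 0) : half_ball R"
proof -
have "norm (c *. z + (x0, 0)) <= c * norm z + norm x0"
 using norm_triangle_ineq[of "c *. z" "(x0, 0)"] c by simp
also have "c * norm z < c * rh" using half_ballD(2)[OF assms] c by simp
finally show ?thesis using sub half_ballD(1)[OF assms] c by (simp add: half_ball_def)
qed

lemma affine_thin_ball:
assumes "z : thin_ball rh"
shows "c *. z + (x0, 0) : thin_ball R"
proof -
obtain x where z: "z = (x, 0)" "norm x < rh" using assms by (auto simp: thin_ball_def)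
have "norm (c *. x + x0) <= c * norm x + norm x0"
 using norm_triangle_ineq[of "c *. x" x0] c by simp
also have "c * norm x < c * rh" using z c by simp
finally show ?thesis using sub z by (simp add: thin_ball_def)
qed

lemma affine_image:
"(%z. c *. z + (x0, 0)) ` half_ball rh <= half_ball R"
"(%z. c *. z + (x0, 0)) ` (half_ball rh \<union> thin_ball rh) <= half_ball R \<union> thin_ball R"
using affine_half_ball affine_thin_ball by blast+

lemma affine_measurable:
assumes f: "f : measurable (hwt a R) M"
shows "(%z. f (c *. z + (x0, 0))) : measurable (hwt a rh) M"
proof -
let ?A = "(%z. c *. z + (x0, 0))"
let ?B = "(restrict_space borel (half_ball rh))"
have "?A : bmeas ?B"
 by (rule measurable_restrict_space1) measurable
hence "?A : measurable ?B (restrict_space borel (half_ball R))"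
 using affine_image(1) by (intro measurable_restrict_space2) (auto simp: space_restrict_space)
hence T: "?A : measurable (hwt a rh) (hwt a R)"
 unfolding measurable_wt by (subst measurable_cong_sets[OF refl sets_wt])
show ?thesis by (rule measurable_compose[OF T f])
qed

text \<open>An inequality, since the image of the small half ball may be a proper part of the large
  one. The exponent collects -a from the weight and -(N+1) from the Jacobian.\<close>

lemma nn_integral_wt_affine_le:
assumes h: "h : bmeas (hwt a R)"
shows "(\<integral>\<^sup>+z. h (c *. z + (x0, 0)) \<partial>hwt a rh) <=
 ennreal (c powr (- a - real (CARD('n) + 1))) * (\<integral>\<^sup>+z. h z \<partial>hwt a R)"
proof -
let ?D = "CARD('n) + 1"
let ?A = "%z. c *. z + (x0, 0)"
let ?B = "%g. (NN z. g z)"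
let ?C = "(c powr - real ?D)"
define g where "g z = ennreal (snd z powr a) * h z * ind (half_ball R) z" for z
have gm: "g : bmeas borel"
proof -
 have "h : bmeas (restrict_space borel (half_ball R))" using h by (simp add: measurable_wt)
 hence "(%z. h z * ind (half_ball R) z) : bmeas borel"
  by (subst (asm) borel_measurable_restrict_space_iff_ennreal) auto
 hence "(%z. ennreal (snd z powr a) * (h z * ind (half_ball R) z)) : bmeas borel" by measurable
 thus ?thesis by (simp add: g_def[abs_def] mult.assoc)
qed
have gm2: "(%z. g (?A z)) : bmeas borel"
 by (rule measurable_compose[OF _ gm]) measurable
have "(\<integral>\<^sup>+z. h (?A z) \<partial>hwt a rh) =
 (\<integral>\<^sup>+z\<in>half_ball rh. (ennreal (snd z powr a) * h (?A z)) \<partial>lborel)"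
 by (rule nn_integral_wt[OF half_ball_borel affine_measurable[OF h]])
also have "... <= (NN z. ennreal (c powr - a) * g (?A z))"
proof (rule nn_integral_mono)
 fix z :: "'n point"
 show "ennreal (snd z powr a) * h (?A z) * ind (half_ball rh) z <= ennreal (c powr - a) * g (?A z)"
 proof (cases "z : half_ball rh")
  case True
  have "c powr - a * (c * snd z) powr a = snd z powr a"
   using c half_ballD(1)[OF True] by (simp add: powr_mult mult.assoc[symmetric] powr_add[symmetric])
  hence "ennreal (c powr - a) * ennreal (snd (?A z) powr a) = ennreal (snd z powr a)"
   by (simp add: ennreal_mult[symmetric])
  thus ?thesis using True affine_half_ball[OF True] by (simp add: g_def mult.assoc[symmetric])
 qed simp
qed
also have "... = ennreal (c powr - a) * (NN z. g (?A z))"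
 using gm2 by (intro nn_integral_cmult) simp
also have "(NN z. g (?A z)) = ennreal ?C * (?B g)"
proof -
 have "c powr - real ?D * c ^ ?D = 1" using c by (simp only: powr_realpow[symmetric] powr_add[symmetric]) simp
 hence "ennreal ?C * (ennreal (c ^ ?D) * X) = X" for X
  using c by (subst ennreal_mult_assoc) auto
 thus ?thesis using nn_integral_lborel_affine[OF gm c, of "(x0, 0)"] by simp
qed
also have "ennreal (c powr - a) * (ennreal ?C * (?B g)) = ennreal (c powr (- a - real ?D)) * (?B g)"
proof -
 have e: "c powr - a * c powr - real ?D = c powr (- a - real ?D)"
  by (simp only: powr_add[symmetric] add_uminus_conv_diff)
 show ?thesis by (subst ennreal_mult_assoc) (simp_all only: e powr_ge_zero)
qed
also have "(?B g) = (\<integral>\<^sup>+z. h z \<partial>hwt a R)"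
 unfolding g_def by (rule nn_integral_wt[OF half_ball_borel h, symmetric])
finally show ?thesis .
qed

lemma is_H1a_grad_affine:
assumes "is_H1a_grad a R ps G"
shows "is_H1a_grad a rh (%z. k * ps (c *. z + (x0, 0))) (%z. (k * c) *. G (c *. z + (x0, 0)))"
proof -
let ?T = "%z::'n point. c *. z + (x0, 0)"
let ?C = "%ph' n z. (norm (grad (ph' n) z - (k * c) *. G (?T z)))^2 + (ph' n z - k * ps (?T z))^2"
let ?D = "%e n. (\<integral>\<^sup>+z. e n z \<partial>hwt a R)"
let ?E = "(half_ball rh)"
let ?F = "(hwt a R)"
let ?G = "(%z. (k * c) *. G (?T z))"
obtain ph where ph: "!!n. smooth (ph n)" and lim: "H1a_tendsto a R ph ps G"
 using assms unfolding is_H1a_grad_def by blast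
have m: "ps : bmeas ?F" "G : bmeas ?F"
 and L: "(%n. \<integral>\<^sup>+z. ennreal ((norm (grad (ph n) z - G z))^2 + (ph n z - ps z)^2) \<partial>hwt a R) ----> 0"
 using lim H1a_tendsto_iff[OF ph] by auto
define ph' where "ph' n z = k * ph n (?T z)" for n z
have s: "smooth (ph' n)" for n
 unfolding ph'_def by (intro smooth_mult smooth_const smooth_affine ph)
have g: "grad (ph' n) z = (k * c) *. grad (ph n) (?T z)" for n z
proof (rule grad_unique)
 have "(?T has_derivative (%h. c *. h)) (at z)" by (auto intro!: derivative_eq_intros)
 from has_derivative_compose[OF this smooth_has_derivative[OF ph]]
 have "((%z. ph n (?T z)) has_derivative (%h. grad (ph n) (?T z) \<bullet> (c *. h))) (at z)" .
 from has_derivative_mult_right[OF this, of k]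
 show "(ph' n has_derivative (%h. ((k * c) *. grad (ph n) (?T z)) \<bullet> h)) (at z)"
  by (simp add: ph'_def[abs_def] mult_ac)
qed
define e where "e n z = ennreal ((norm (grad (ph n) z - G z))^2 + (ph n z - ps z)^2)" for n z
have em: "e n : bmeas ?F" for n
proof -
 have "grad (ph n) : bmeas ?F" "ph n : bmeas ?F"
  by (auto intro!: continuous_on_measurable_wt continuous_grad smooth_continuous ph)
 thus ?thesis using m unfolding e_def by measurable
qed
define C where "C = (k * c)^2 + k^2"
have C0: "0 <= C" by (simp add: C_def)
define c' where "c' = c powr (- a - real (CARD('n) + 1))"
have le: "(\<integral>\<^sup>+z. ennreal (?C ph' n z) \<partial>wt a ?E)
  <= ennreal C * ennreal c' * (?D e n)" for n
proof -
 have "(\<integral>\<^sup>+z. ennreal (?C ph' n z) \<partial>wt a ?E)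
  <= (\<integral>\<^sup>+z. ennreal C * e n (?T z) \<partial>wt a ?E)"
 proof (rule nn_integral_mono)
  fix z
  let ?A = "(norm (grad (ph n) (?T z) - G (?T z)))^2" and ?B = "(ph n (?T z) - ps (?T z))^2"
  have "grad (ph' n) z - (k * c) *. G (?T z) = (k * c) *. (grad (ph n) (?T z) - G (?T z))"
   unfolding g by (simp add: scaleR_diff_right)
  hence 1: "(norm (grad (ph' n) z - (k * c) *. G (?T z)))^2 = (k * c)^2 * ?A"
   by (simp add: power_mult_distrib)
  have 2: "(ph' n z - k * ps (?T z))^2 = k^2 * ?B"
   by (simp add: ph'_def right_diff_distrib[symmetric] power_mult_distrib)
  have "(k * c)^2 * ?A + k^2 * ?B <= C * (?A + ?B)"
   unfolding C_def by (simp add: distrib_left distrib_right)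
  hence "ennreal ((k * c)^2 * ?A + k^2 * ?B) <= ennreal (C * (?A + ?B))" by (rule ennreal_leI)
  also have "... = ennreal C * ennreal (?A + ?B)" using C0 by (intro ennreal_mult) auto
  finally show "ennreal (?C ph' n z) <= ennreal C * e n (?T z)"
   unfolding 1 2 e_def .
 qed
 also have "... = ennreal C * (\<integral>\<^sup>+z. e n (?T z) \<partial>wt a ?E)"
  by (rule nn_integral_cmult[OF affine_measurable[OF em]])
 also have "... <= ennreal C * (ennreal c' * (?D e n))"
  unfolding c'_def by (intro mult_left_mono nn_integral_wt_affine_le[OF em]) auto
 finally show ?thesis by (simp only: mult.assoc)
qed
have "(%n. ennreal C * ennreal c' * (?D e n)) ----> ennreal C * ennreal c' * 0"
 using L unfolding e_def by (intro ennreal_tendsto_cmult) (auto simp: ennreal_mult_less_top)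
hence l0: "(%n. ennreal C * ennreal c' * (?D e n)) ----> 0" by simp
have "H1a_tendsto a rh ph' (%z. k * ps (?T z)) ?G"
 unfolding H1a_tendsto_iff[of ph', OF s]
proof (intro conjI)
 show "(%z. k * ps (?T z)) : bmeas (wt a ?E)"
  by (intro borel_measurable_times affine_measurable m) simp
 show "?G : bmeas (wt a ?E)"
  by (intro borel_measurable_scaleR affine_measurable m) simp
 show "(%n. \<integral>\<^sup>+z. ennreal (?C ph' n z) \<partial>wt a ?E) ----> 0"
  by (rule tendsto_sandwich[OF _ _ tendsto_const l0]) (intro always_eventually allI zero_le le)+
qed
thus ?thesis using s unfolding is_H1a_grad_def by blast
qed

lemma bdd_field_affine:
assumes "bdd_field a R G"
shows "bdd_field a rh (%z. k *. G (c *. z + (x0, 0)))"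
proof -
let ?T = "%z::'n point. c *. z + (x0, 0)"
obtain C where C: "!!z. z : half_ball R ==> norm (fst (G z)) <= C & \<bar>snd z powr a * snd (G z)\<bar> <= C"
 and Gc: "continuous_on (half_ball R) G"
 using assms unfolding bdd_field_def by blast
show ?thesis
 unfolding bdd_field_def
proof (intro conjI exI ballI)
 show "continuous_on (half_ball rh) (%z. k *. G (?T z))"
  by (intro continuous_on_scaleR continuous_on_const continuous_on_compose2[OF Gc _ affine_image(1)]
    continuous_on_add continuous_on_id)
 fix z :: "'n point" assume z: "z : half_ball rh"
 note Cz = C[OF affine_half_ball[OF z]]
 have y: "0 < snd z" using z by (rule half_ballD)
 have C0: "0 <= C" using Cz norm_ge_zero order_trans by blast
 have b1: "\<bar>k\<bar> * norm (fst (G (?T z))) <= \<bar>k\<bar> * C" using Cz by (intro mult_left_mono) auto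
 have "\<bar>snd z powr a * (k * snd (G (?T z)))\<bar> = \<bar>k\<bar> * c powr - a * \<bar>snd (?T z) powr a * snd (G (?T z))\<bar>"
 proof -
  have "c powr - a * (c * snd z) powr a = snd z powr a"
   using c y by (simp add: powr_mult mult.assoc[symmetric] powr_add[symmetric])
  thus ?thesis by (simp add: abs_mult mult.assoc[symmetric])
 qed
 also have "... <= \<bar>k\<bar> * c powr - a * C" using Cz by (intro mult_left_mono) auto
 finally have b2: "\<bar>snd z powr a * (k * snd (G (?T z)))\<bar> <= \<bar>k\<bar> * c powr - a * C" .
 show "norm (fst (k *. G (?T z))) <= \<bar>k\<bar> * C + \<bar>k\<bar> * c powr - a * C"
  using b1 C0 by (simp add: add_increasing2)
 show "\<bar>snd z powr a * snd (k *. G (?T z))\<bar> <= \<bar>k\<bar> * C + \<bar>k\<bar> * c powr - a * C"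
  using b2 C0 by (simp add: add_increasing)
qed
qed

text \<open>It covers restriction to a smaller half ball (\<open>c = 1\<close>,
  \<open>x0 = 0\<close>), horizontal translation (\<open>c = 1\<close>) and the homogeneous
  rescaling of \<open>u\<close>, where \<open>k\<close> is a negative power of
  \<open>c\<close>.\<close>

lemma admissible_affine:
assumes ps: "admissible a R ps G"
shows "admissible a rh (%z. k * ps (c *. z + (x0, 0))) (%z. (k * c) *. G (c *. z + (x0, 0)))"
proof -
let ?T = "%z::'n point. c *. z + (x0, 0)"
let ?A = "(%z. k * ps (?T z))"
let ?B = "(%z. (k * c) *. G (?T z))"
have psc: "continuous_on (half_ball R \<union> thin_ball R) ps" using ps by (simp add: admissible_def)
obtain C where C: "!!z. z : half_ball R \<union> thin_ball R ==> \<bar>ps z\<bar> <= C" using ps unfolding admissible_def by blast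
show ?thesis
 unfolding admissible_def
proof (intro conjI ballI exI)
 show "is_H1a_grad a rh ?A ?B"
  by (rule is_H1a_grad_affine) (use ps in \<open>simp add: admissible_def\<close>)
 show "continuous_on (half_ball rh \<union> thin_ball rh) ?A"
  by (intro continuous_on_mult continuous_on_const continuous_on_compose2[OF psc _ affine_image(2)]
    continuous_on_add continuous_on_scaleR continuous_on_id)
 show "bdd_field a rh ?B"
  by (rule bdd_field_affine) (use ps in \<open>simp add: admissible_def\<close>)
 fix z :: "'n point"
 show "\<bar>k * ps (?T z)\<bar> <= \<bar>k\<bar> * C" if "z : half_ball rh \<union> thin_ball rh"
 proof -
  have "?T z : half_ball R \<union> thin_ball R" using affine_image(2) that by blast
  from C[OF this] show ?thesis by (simp add: abs_mult mult_left_mono)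
 qed
 show "(?A has_derivative (%h. ((k * c) *. G (?T z)) \<bullet> h)) (at z)" if "z : half_ball rh"
 proof -
  have d: "(ps has_derivative (%h. G (?T z) \<bullet> h)) (at (?T z))"
   using ps affine_half_ball[OF that] by (simp add: admissible_def)
  have "(?T has_derivative (%h. c *. h)) (at z)" by (auto intro!: derivative_eq_intros)
  from has_derivative_compose[OF this d]
  have "((%z. ps (?T z)) has_derivative (%h. G (?T z) \<bullet> (c *. h))) (at z)" .
  from has_derivative_mult_right[OF this, of k] show ?thesis by (simp add: mult_ac)
 qed
qed
qed

end

text \<open>Horizontal translations preserve the weight, and a test function supported well inside
  the small ball stays supported inside the large one after being moved back.\<close>

lemma conormal_translate:
fixes x0 :: "real ^ 'n::finite"
assumes V: "conormal a R V b" and sub: "rh + norm x0 <= R"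
shows "conormal a rh (%z. V (z + (x0, 0))) (%x. b (x + x0))"
proof -
let ?w = "(x0, 0) :: 'n point"
let ?A = "%ph. (\<integral>z. V (z + ?w) \<bullet> grad ph z \<partial>hwt a rh)"
let ?B = "%ph'. (\<integral>z. V z \<bullet> grad ph' z \<partial>hwt a R)"
let ?C = "(half_ball rh)"
let ?D = "(hwt a R)"
have sub': "1 * rh + norm x0 <= R" using sub by simp
have Vb: "bdd_field a R V" and bc: "continuous_on (ball 0 R) b" using V by (auto simp: conormal_def)
obtain Cb where Cb: "!!x. x : ball 0 R ==> \<bar>b x\<bar> <= Cb" using V unfolding conormal_def by blast
have shift: "x + x0 : ball 0 R" if "x : ball 0 rh" for x
 using that sub norm_triangle_ineq[of x x0] by simp
have Vm: "V : bmeas ?D"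
 using Vb unfolding bdd_field_def by (intro continuous_on_measurable_wt) auto
show ?thesis
 unfolding conormal_def
proof (intro conjI allI impI)
 show bT: "bdd_field a rh (%z. V (z + ?w))" using bdd_field_affine[OF _ sub' Vb, of 1] by simp
 show "continuous_on (ball 0 rh) (%x. b (x + x0))"
  using shift by (intro continuous_on_compose2[OF bc] continuous_intros) auto
 show "EX C. ALL x:ball 0 rh. \<bar>b (x + x0)\<bar> <= C" using Cb shift by blast
 fix ph :: "'n point => real" and rh' assume "smooth ph & rh' < rh & (ALL z. rh' <= norm z --> ph z = 0)"
 hence ph: "smooth ph" "rh' < rh" "!!z. rh' <= norm z ==> ph z = 0" by auto
 define ph' where "ph' z = ph (z - ?w)" for z
 have s: "smooth ph'" using smooth_affine[OF ph(1), of 1 "- ?w"] by (simp only: ph'_def[abs_def] scaleR_one add_uminus_conv_diff)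
 have z0: "ph' z = 0" if "rh' + norm x0 <= norm z" for z
 proof -
  have "norm z <= norm (z - ?w) + norm x0" using norm_triangle_ineq[of "z - ?w" ?w] by simp
  thus ?thesis unfolding ph'_def using that by (intro ph(3)) linarith
 qed
 have g: "grad ph' z = grad ph (z - ?w)" for z
 proof (rule grad_unique)
  have "((%z. z - ?w) has_derivative (%h. h)) (at z)" by (auto intro!: derivative_eq_intros)
  from has_derivative_compose[OF this smooth_has_derivative[OF ph(1)]]
  show "(ph' has_derivative (%h. grad ph (z - ?w) \<bullet> h)) (at z)" by (simp add: ph'_def[abs_def])
 qed
 have gm: "grad ph' : bmeas ?D" "grad ph : bmeas (wt a ?C)"
  by (auto intro!: continuous_on_measurable_wt continuous_grad s ph)
 have WF: "(?B ph') = (LINT x:ball 0 R|lborel. b x * ph' (x, 0))"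
 proof -
  have "smooth ph' & rh' + norm x0 < R & (ALL z. rh' + norm x0 <= norm z --> ph' z = 0)" using s z0 ph(2) sub by auto
  thus ?thesis using V unfolding conormal_def by blast
 qed
 have m1: "(%z. V z \<bullet> grad ph' z) : bmeas ?D" using Vm gm by measurable
 have "(%z. V (z + ?w)) : bmeas (wt a ?C)"
  using bT unfolding bdd_field_def by (intro continuous_on_measurable_wt) auto
 hence m2: "(%z. V (z + ?w) \<bullet> grad ph z) : bmeas (wt a ?C)" using gm(2) by measurable
 define f where "f z = ind (half_ball R) z *. (snd z powr a *. (V z \<bullet> grad ph' z))" for z
 have fm: "f : bmeas borel"
 proof -
  have "(%z. snd z powr a *. (V z \<bullet> grad ph' z)) : bmeas ?D"
   by (intro borel_measurable_scaleR m1 borel_measurable_wtI) measurable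
  thus ?thesis unfolding f_def borel_measurable_wt_iff[OF half_ball_borel] .
 qed
 have "(?B ph') = (LINT z|lborel. f z)"
  unfolding integral_wt[OF half_ball_borel m1] set_lebesgue_integral_def f_def ..
 also have "... = (LINT z|lborel. f (z + ?w))"
  using lborel_integral_affine[OF fm, of 1 ?w] by simp
 also have "... = (LINT z|lborel. ind ?C z *. (snd z powr a *. (V (z + ?w) \<bullet> grad ph z)))"
 proof (rule Bochner_Integration.integral_cong[OF refl])
  fix z :: "'n point"
  show "f (z + ?w) = ind ?C z *. (snd z powr a *. (V (z + ?w) \<bullet> grad ph z))"
  proof (cases "norm z < rh'")
   case True
   hence "z + ?w : half_ball R \<longleftrightarrow> z : half_ball rh"
    using affine_half_ball[OF _ sub', of z] ph(2) by (auto simp: half_ball_def)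
   thus ?thesis by (simp add: f_def g indicator_def)
  next
   case False
   hence "grad ph z = 0" by (intro smooth_grad_eq_0[OF ph(1,3)]) auto
   thus ?thesis by (simp add: f_def g)
  qed
 qed
 also have "... = (?A ph)"
  unfolding integral_wt[OF half_ball_borel m2] set_lebesgue_integral_def ..
 finally have 1: "(?B ph') = (?A ph)" .
 define h where "h x = ind (ball 0 R) x *. (b x * ph' (x, 0))" for x
 have hm: "h : bmeas borel"
  unfolding h_def
  by (rule borel_measurable_continuous_on_indicator)
   (auto simp: borel_open intro!: continuous_intros bc continuous_on_compose2[OF smooth_continuous[OF s, of UNIV]])
 have "(LINT x:ball 0 R|lborel. b x * ph' (x, 0)) = (LINT x|lborel. h x)" by (simp add: set_lebesgue_integral_def h_def)
 also have "... = (LINT x|lborel. h (x + x0))" using lborel_integral_affine[OF hm, of 1 x0] by simp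
 also have "... = (LINT x:ball 0 rh|lborel. b (x + x0) * ph (x, 0))"
  unfolding set_lebesgue_integral_def
 proof (rule Bochner_Integration.integral_cong[OF refl])
  fix x :: "real ^ 'n"
  have eq: "ph' (x + x0, 0) = ph (x, 0)" by (simp add: ph'_def)
  show "h (x + x0) = ind (ball 0 rh) x *. (b (x + x0) * ph (x, 0))"
  proof (cases "norm x < rh'")
   case True
   hence "x : ball 0 rh" using ph(2) by simp
   thus ?thesis using shift[of x] by (simp add: h_def eq)
  next
   case False
   hence "ph (x, 0) = 0" by (intro ph(3)) simp
   thus ?thesis by (simp add: h_def eq)
  qed
 qed
 finally show "(?A ph) = (LINT x:ball 0 rh|lborel. b (x + x0) * ph (x, 0))"
  using 1 WF by simp
qed
qed

text \<open>Evenness in \<open>y\<close> makes \<open>y\<^sup>a \<partial>\<^sub>y ps = O(y\<^sup>1\<^sup>+\<^sup>a)\<close> bounded, which fails for general smooth functions if \<open>a < 0\<close>.\<close>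

lemma admissible_even:
fixes ps :: "('n::finite) point => real"
assumes a: "-1 < a" and R: "0 < R" and ps: "smooth ps" and even: "!!x y. ps (x, - y) = ps (x, y)"
shows "admissible a R ps (grad ps)"
proof -
define d where "d z = grad ps z \<bullet> (0, 1)" for z
have d: "snd (grad ps z) = d z" for z by (simp add: d_def inner_prod_def)
have ds: "smooth d" unfolding d_def by (rule smooth_grad_inner[OF ps])
\<comment> \<open>Evenness makes y -> ps(x, y) and y -> ps(x, -y) the same function, with opposite
  derivatives at 0.\<close>
have d0: "d (x, 0) = 0" for x
proof -
 have "((%y. ps (x, c * y)) has_real_derivative c * d (x, 0)) (at 0)" for c
 proof -
  have "((%y. (x, c * y)) has_derivative (%h. (0, c * h))) (at 0)" by (auto intro!: derivative_eq_intros)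
  from has_derivative_compose[OF this smooth_has_derivative[OF ps]]
  have "((%y. ps (x, c * y)) has_derivative (%h. grad ps (x, c * 0) \<bullet> (0, c * h))) (at 0)" .
  moreover have "grad ps (x, c * 0) \<bullet> (0, c * h) = c * d (x, 0) * h" for h
   by (simp add: d_def inner_prod_def)
  ultimately show ?thesis unfolding has_field_derivative_def by simp
 qed
 from this[of 1] this[of "-1"] have "1 * d (x, 0) = -1 * d (x, 0)"
  by (intro DERIV_unique[of "%y. ps (x, y)" _ 0]) (simp_all add: even)
 thus ?thesis by simp
qed
obtain L where L: "0 <= L" "!!z. norm z < R ==> norm (grad d z) <= L"
 using bounded_on_half_ball[OF continuous_grad[OF ds]] by metis
obtain B where B: "0 <= B" "!!z. norm z < R ==> norm (grad ps z) <= B"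
 using bounded_on_half_ball[OF continuous_grad[OF ps]] by metis
obtain B0 where B0: "0 <= B0" "!!z. norm z < R ==> norm (ps z) <= B0"
 using bounded_on_half_ball[OF smooth_continuous[OF ps]] by metis
\<comment> \<open>The mean value inequality along the vertical segment from (x, 0), where
  \<open>d\<close> vanishes.\<close>
have dy: "\<bar>d z\<bar> <= L * snd z" if z: "z : half_ball R" for z
proof -
 have "norm (d z - d (fst z, 0)) <= L * norm (z - (fst z, 0))"
 proof (rule differentiable_bound[where S = "ball 0 R" and f' = "%x h. grad d x \<bullet> h"])
  show "(d has_derivative (%h. grad d x \<bullet> h)) (at x within ball 0 R)" for x
   using smooth_has_derivative[OF ds] has_derivative_at_withinI by blast
  show "onorm (%h. grad d x \<bullet> h) <= L" if "x : ball 0 R" for x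
  proof (rule onorm_le)
   fix h :: "'n point"
   have "norm (grad d x) * norm h <= L * norm h" using L(2)[of x] that by (intro mult_right_mono) auto
   thus "norm (grad d x \<bullet> h) <= L * norm h" using Cauchy_Schwarz_ineq2[of "grad d x" h] by simp
  qed
  show "(fst z, 0 :: real) : ball 0 R" unfolding mem_ball_0
   using norm_fst_le[of "fst z" "snd z"] half_ballD(2)[OF z] by (simp add: norm_Pair)
 qed (use half_ballD(2)[OF z] in auto)
 moreover have "norm (z - (fst z, 0)) = \<bar>snd z\<bar>" by (cases z) simp
 ultimately show ?thesis using half_ballD(1)[OF z] by (simp add: d0)
qed
show ?thesis
 unfolding admissible_def bdd_field_def
proof (intro conjI ballI exI)
 have "H1a_tendsto a R (%_. ps) ps (grad ps)"
  using ps by (subst H1a_tendsto_iff) (auto intro!: continuous_on_measurable_wt continuous_grad smooth_continuous)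
 thus "is_H1a_grad a R ps (grad ps)" unfolding is_H1a_grad_def using ps by (intro exI[of _ "%_. ps"]) simp
 show "continuous_on (half_ball R \<union> thin_ball R) ps" by (rule smooth_continuous[OF ps])
 show "continuous_on (half_ball R) (grad ps)" by (rule continuous_grad[OF ps])
 fix z :: "'n point"
 show "\<bar>ps z\<bar> <= B0" if "z : half_ball R \<union> thin_ball R"
  using B0(2)[of z] that by (auto simp: half_ball_def thin_ball_def)
 assume z: "z : half_ball R"
 show "(ps has_derivative (%h. grad ps z \<bullet> h)) (at z)" by (rule smooth_has_derivative[OF ps])
 have "norm (fst (grad ps z)) <= B"
  using order_trans[OF _ B(2)[OF half_ballD(2)[OF z]]] norm_fst_le[of "fst (grad ps z)" "snd (grad ps z)"] by simp
 thus "norm (fst (grad ps z)) <= B + L * R powr (a + 1)" using L(1) by (simp add: add_increasing2)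
 have y: "0 < snd z" "snd z <= R" using half_ballD[OF z] norm_snd_le[of "snd z" "fst z"] by auto
 have "\<bar>snd z powr a * snd (grad ps z)\<bar> <= snd z powr a * (L * snd z)"
  unfolding d abs_mult using dy[OF z] by (intro mult_mono) auto
 also have "... = L * snd z powr (a + 1)" using y by (simp add: powr_add)
 also have "... <= L * R powr (a + 1)" using a y L by (intro mult_left_mono powr_mono2) auto
 finally show "\<bar>snd z powr a * snd (grad ps z)\<bar> <= B + L * R powr (a + 1)" using B(1) by simp
qed
qed

text \<open>The hypothesis says that the lower right Dini derivative is nonnegative. For each slope
  \<open>- e\<close> the points up to which the graph stays above the line through its left end form
  an interval; continuity closes it on the right, and the local condition prolongs it, so it reaches
  \<open>b\<close>.\<close>

lemma dini_nondecreasing: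
fixes f :: "real => real"
assumes cont: "continuous_on {a..b} f" and ab: "a <= b"
 and dini: "!!x e. a <= x ==> x < b ==> 0 < e ==> EX h>0. x + h <= b & (ALL t:{0<..<h}. f (x + t) >= f x - e * t)"
shows "f a <= f b"
proof -
have "f a - e * (b - a) <= f b" if e: "0 < e" for e
proof -
 define S where "S = {x : {a..b}. f x - (f a - e * (x - a)) >= 0}"
 have Sc: "closed S"
 proof -
  have "closed ({a..b} \<inter> (%x. f x - (f a - e * (x - a))) -` {0..})"
   by (intro continuous_closed_preimage continuous_intros cont)
  moreover have "{a..b} \<inter> (%x. f x - (f a - e * (x - a))) -` {0..} = S" by (auto simp: S_def)
  ultimately show ?thesis by simp
 qed
 define T where "T = {x : {a..b}. {a..x} <= S}"
 have aT: "a : T" using ab e by (auto simp: T_def S_def)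
 have Tb: "bdd_above T" by (auto simp: T_def intro: bdd_aboveI[of _ b])
 define s where "s = Sup T"
 have s: "a <= s" unfolding s_def by (rule cSup_upper[OF aT Tb])
 have "s <= b" unfolding s_def using aT by (intro cSup_least) (auto simp: T_def)
 note s = s this
 have below: "x : S" if "a <= x" "x < s" for x
 proof -
  have "T ~= {}" "x < Sup T" using aT that(2) by (auto simp: s_def)
  then obtain t where "t : T" "x < t" by (metis less_cSupD)
  thus ?thesis using that by (auto simp: T_def subset_iff)
 qed
 have sS: "s : S"
 proof (cases "s = a")
  case True thus ?thesis using aT by (auto simp: T_def)
 next
  case False
  hence "a < s" using s by simp
  have "s : closure {a..<s}" using \<open>a < s\<close> by (simp add: closure_atLeastLessThan)
  moreover have "{a..<s} <= S" using below by auto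
  ultimately show ?thesis using closure_minimal[OF _ Sc] by blast
 qed
 have "s = b"
 proof (rule ccontr)
  assume "s ~= b"
  hence "s < b" using s by simp
  obtain h where h: "0 < h" "s + h <= b" "!!t. t : {0<..<h} ==> f (s + t) >= f s - e * t"
   using dini[OF s(1) \<open>s < b\<close> e] by blast
  have "s + h / 2 : T"
  proof -
   have "x : S" if x: "a <= x" "x <= s + h / 2" for x
   proof (cases "x <= s")
    case True
    thus ?thesis using below[OF x(1)] sS by (cases "x = s") auto
   next
    case False
    hence "f (s + (x - s)) >= f s - e * (x - s)" using x h by (intro h(3)) auto
    moreover have "f s >= f a - e * (s - a)" using sS by (simp add: S_def)
    ultimately have "f x - (f a - e * (x - a)) >= 0" by (simp add: algebra_simps)
    thus ?thesis using x h s by (simp add: S_def)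
   qed
   thus ?thesis using h s by (auto simp: T_def)
  qed
  hence "s + h / 2 <= s" unfolding s_def by (intro cSup_upper Tb)
  thus False using h by simp
 qed
 thus ?thesis using sS by (simp add: S_def)
qed
hence "f a - d <= f b" if "0 < d" for d
proof (cases "a = b")
 case False
 hence "d / (b - a) * (b - a) = d" "0 < d / (b - a)" using ab that by auto
 with \<open>!!e. 0 < e ==> f a - e * (b - a) <= f b\<close>[of "d / (b - a)"] show ?thesis by simp
qed (use that in simp)
note le = this
show ?thesis
proof (rule field_le_epsilon)
 fix d :: real assume "0 < d"
 thus "f a <= f b + d" using le[of d] by linarith
qed
qed

text \<open>The potential of which \<open>boundary_term\<close> is \<open>-1/p\<close> times the derivative.\<close>

definition potential :: "real => real => real => real => real" where
"potential p lm lp t = lm * neg_part t powr p + lp * pos_part t powr p"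

text \<open>Convexity of the power through the mean value theorem and the monotonicity of its
  derivative. Zero arguments are treated apart because the derivative rule for \<open>powr\<close>
  is applied at positive bases.\<close>

lemma powr_tangent:
assumes p: "2 <= (p::real)" and "0 <= s" "0 <= t"
shows "s powr p >= t powr p + p * t powr (p - 1) * (s - t)"
proof -
consider "t = 0" | "s = t" | "0 < t" "s ~= t" using assms by linarith
thus ?thesis
proof cases
 case 1
 thus ?thesis using p by simp
next
 case 2
 thus ?thesis by simp
next
 case 3
 have d: "((%x. x powr p) has_real_derivative p * x powr (p - 1)) (at x)" if "0 < x" for x
  using that by (auto intro!: derivative_eq_intros simp: powr_diff)
 show ?thesis
 proof (cases "t < s")
  case True
  obtain z where z: "t < z" "z < s" "s powr p - t powr p = (s - t) * (p * z powr (p - 1))"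
   using MVT2[OF True, of "%x. x powr p" "%x. p * x powr (p - 1)"] d 3 by force
  have "t powr (p - 1) <= z powr (p - 1)" using z 3 p by (intro powr_mono2) auto
  hence "(s - t) * (p * t powr (p - 1)) <= (s - t) * (p * z powr (p - 1))" using True p by (intro mult_left_mono) auto
  thus ?thesis using z(3) by (simp add: mult_ac)
 next
  case False
  hence st: "s < t" using 3 by simp
  show ?thesis
  proof (cases "s = 0")
   case True
   have "t powr (p - 1) * t = t powr p" using 3 by (simp add: powr_diff)
   hence "p * t powr (p - 1) * (s - t) = - p * t powr p" using True by (simp add: mult.assoc)
   moreover have "1 * t powr p <= p * t powr p" using p by (intro mult_right_mono) auto
   moreover have "s powr p = 0" using True p by simp
   ultimately show ?thesis by linarith
  next
   case False
   hence "0 < s" using assms by simp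
   obtain z where z: "s < z" "z < t" "t powr p - s powr p = (t - s) * (p * z powr (p - 1))"
    using MVT2[OF st, of "%x. x powr p" "%x. p * x powr (p - 1)"] d \<open>0 < s\<close> by force
   have "z powr (p - 1) <= t powr (p - 1)" using z \<open>0 < s\<close> p by (intro powr_mono2) auto
   hence "(t - s) * (p * z powr (p - 1)) <= (t - s) * (p * t powr (p - 1))" using st p by (intro mult_left_mono) auto
   thus ?thesis using z(3) by (simp add: algebra_simps)
  qed
 qed
qed
qed

text \<open>The tangent inequality at \<open>t\<close>, \<open>- p * boundary_term\<close> being the
  derivative of the potential. The two one-sided powers are convex separately, and the signs of
  \<open>lm\<close> and \<open>lp\<close> let them be added.\<close>

lemma potential_convex:
assumes p: "2 <= p" and l: "0 <= lm" "0 <= lp"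
shows "potential p lm lp s >= potential p lm lp t - p * boundary_term p lm lp t * (s - t)"
proof -
have 1: "pos_part s powr p >= pos_part t powr p + p * pos_part t powr (p - 1) * (s - t)"
proof (cases "0 < t")
 case True
 have "pos_part s powr p >= pos_part t powr p + p * pos_part t powr (p - 1) * (pos_part s - pos_part t)"
  by (rule powr_tangent[OF p]) (auto simp: pos_part_def)
 moreover have "p * pos_part t powr (p - 1) * (s - t) <= p * pos_part t powr (p - 1) * (pos_part s - pos_part t)"
  using True p by (intro mult_left_mono) (auto simp: pos_part_def)
 ultimately show ?thesis by linarith
qed (use p in \<open>simp add: pos_part_def\<close>)
have 2: "neg_part s powr p >= neg_part t powr p - p * neg_part t powr (p - 1) * (s - t)"
proof (cases "t < 0")
 case True
 have "neg_part s powr p >= neg_part t powr p + p * neg_part t powr (p - 1) * (neg_part s - neg_part t)"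
  by (rule powr_tangent[OF p]) (auto simp: neg_part_def)
 moreover have "p * neg_part t powr (p - 1) * (- (s - t)) <= p * neg_part t powr (p - 1) * (neg_part s - neg_part t)"
  using True p by (intro mult_left_mono) (auto simp: neg_part_def)
 moreover have "p * neg_part t powr (p - 1) * (- (s - t)) = - (p * neg_part t powr (p - 1) * (s - t))"
  by (simp only: mult_minus_right)
 ultimately show ?thesis by linarith
qed (use p in \<open>simp add: neg_part_def\<close>)
from mult_left_mono[OF 1 l(2)] mult_left_mono[OF 2 l(1)]
show ?thesis by (simp add: potential_def boundary_term_def algebra_simps)
qed

text \<open>Euler's identity for a positively homogeneous function of degree \<open>p\<close>, whose
  derivative is \<open>- p * boundary_term\<close>.\<close>

lemma potential_eq: "potential p lm lp t = - (boundary_term p lm lp t * t)"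
proof -
have "x * x powr (p - 1) = x powr p" if "0 <= x" for x :: real
 using that by (cases "x = 0") (auto simp: powr_diff)
note x = this
consider "0 < t" | "t = 0" | "t < 0" by linarith
thus ?thesis
proof cases
 case 1
 thus ?thesis using x[of t] by (simp add: potential_def boundary_term_def pos_part_def neg_part_def mult_ac)
next
 case 3
 hence m: "neg_part t = - t" "pos_part t = 0" by (auto simp: pos_part_def neg_part_def)
 have "- t * (- t) powr (p - 1) = (- t) powr p" using x[of "- t"] 3 by simp
 hence "lm * (- t) powr p = lm * (- t * (- t) powr (p - 1))" by simp
 thus ?thesis unfolding potential_def boundary_term_def m by (simp add: mult_ac)
qed (simp add: potential_def boundary_term_def pos_part_def neg_part_def)
qed

lemma potential_nonneg: "0 <= lm ==> 0 <= lp ==> 0 <= potential p lm lp t"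
by (simp add: potential_def)

lemma potential_scale:
assumes "0 < c"
shows "potential p lm lp (c * t) = c powr p * potential p lm lp t"
proof -
have "pos_part (c * t) = c * pos_part t" "neg_part (c * t) = c * neg_part t"
 using assms by (auto simp: pos_part_def neg_part_def max_def zero_le_mult_iff mult_le_0_iff)
thus ?thesis by (simp add: potential_def powr_mult algebra_simps)
qed

lemma continuous_boundary_term: "2 <= p ==> continuous_on UNIV (boundary_term p lm lp)"
and continuous_potential: "2 <= p ==> continuous_on UNIV (potential p lm lp)"
unfolding boundary_term_def[abs_def] potential_def[abs_def] pos_part_def neg_part_def
by (intro continuous_intros continuous_on_powr'; simp)+

subsection \<open>The weak formulation\<close>

text \<open>The exponent is kept general because each differentiation lowers it by one; the exponent
  1/2 gives the smoothed absolute value.\<close>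

lemma smooth_quadratic_powr:
assumes e: "0 < e"
shows "smooth (%y::real. (y * y + e) powr s)"
proof -
have pos: "0 < y * y + e" for y :: real using e by (simp add: add_nonneg_pos)
have "Ck m (%y::real. (y * y + e) powr s)" for m
proof (induction m arbitrary: s)
 case 0
 have "continuous_on UNIV (%y::real. (y * y + e) powr s)"
  by (intro continuous_on_powr continuous_on_add continuous_on_mult continuous_on_id continuous_on_const ballI)
   (use pos in \<open>simp add: less_imp_neq[symmetric]\<close>)
 thus ?case by simp
next
 case (Suc m)
 show ?case
 proof (rule Ck_SucI)
  fix y :: real
  have "((%y. (y * y + e) powr s) has_real_derivative (2 * s) * y * (y * y + e) powr (s - 1)) (at y)"
   using pos[of y] by (auto intro!: derivative_eq_intros simp: powr_diff field_simps)
  thus "((%y. (y * y + e) powr s) has_derivative (%v. (2 * s) * y * (y * y + e) powr (s - 1) * v)) (at y)"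
   by (simp only: has_field_derivative_def)
 next
  fix v :: real
  show "Ck m (%y. (2 * s) * y * (y * y + e) powr (s - 1) * v)"
   by (intro Ck_mult Ck_const Suc.IH Ck_bounded_linear bounded_linear_ident)
 qed
qed
thus ?thesis by (simp add: smooth_def)
qed

definition reflect :: "('n::finite) point => 'n point" where "reflect z = (fst z, - snd z)"

lemma reflect_measurable [measurable]: "reflect : bmeas borel"
unfolding reflect_def[abs_def]
by (intro borel_measurable_continuous_onI continuous_on_Pair continuous_on_fst continuous_on_minus continuous_on_snd continuous_on_id)

lemma lborel_reflect: "lborel = distr lborel borel (reflect :: ('n::finite) point => _)"
proof -
\<comment> \<open>On basis vectors this is -1 for the vertical direction and 1 for the horizontal
  ones.\<close>
let ?c = "%j::'n point. 1 - 2 * \<bar>snd j\<bar>"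
let ?A = "%z. \<Sum>j\<in>Basis. (?c j * (z \<bullet> j)) *. j"
let ?B = "(\<Prod>j\<in>Basis. \<bar>?c j\<bar>)"
have c: "\<bar>?c j\<bar> = 1" if "j : Basis" for j using that by (auto simp: Basis_prod_def)
have r: "0 + (?A z) = reflect z" for z
proof (rule euclidean_eqI)
 fix b :: "'n point" assume b: "b : Basis"
 thus "(0 + (?A z)) \<bullet> b = reflect z \<bullet> b"
  by (simp add: inner_sum_left_Basis) (auto simp: Basis_prod_def reflect_def inner_prod_def)
qed
have "lborel = density (distr lborel borel (%z. 0 + (?A z))) (%_. ennreal ?B)"
 by (rule lborel_affine_euclidean) (use c in fastforce)
also have "?B = 1" by (rule prod.neutral) (use c in blast)
finally show ?thesis unfolding r by (simp add: density_1)
qed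

lemma integral_reflect:
fixes f :: "('n::finite) point => real"
assumes "integrable lborel f"
shows "integrable lborel (%z. f (reflect z))" "(LINT z|lborel. f (reflect z)) = (LINT z|lborel. f z)"
proof -
have m: "f : bmeas borel" using borel_measurable_integrable[OF assms] by simp
have "integrable (distr lborel borel reflect) f" using assms lborel_reflect by metis
thus "integrable lborel (%z. f (reflect z))" by (subst (asm) integrable_distr_eq) (use m in auto)
have "(LINT z|lborel. f z) = (LINT z|distr lborel borel reflect. f z)" using lborel_reflect by metis
also have "... = (LINT z|lborel. f (reflect z))" by (rule integral_distr) (use m in auto)
finally show "(LINT z|lborel. f (reflect z)) = (LINT z|lborel. f z)" ..
qed

lemma grad_reflect:
assumes f: "smooth f" and ev: "!!z. f (reflect z) = f z"
shows "grad f (reflect z) = reflect (grad f z)"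
proof -
have "bounded_linear (reflect :: ('n::finite) point => _)"
 unfolding reflect_def[abs_def] by (intro bounded_linear_Pair bounded_linear_fst bounded_linear_minus bounded_linear_snd)
hence "(reflect has_derivative (reflect :: 'a point => _)) (at z)"
 unfolding reflect_def[abs_def] by (intro has_derivative_Pair has_derivative_fst has_derivative_minus has_derivative_snd has_derivative_ident)
from has_derivative_compose[OF this smooth_has_derivative[OF f]]
have "((%z. f (reflect z)) has_derivative (%h. grad f (reflect z) \<bullet> reflect h)) (at z)" .
moreover have "grad f (reflect z) \<bullet> reflect h = reflect (grad f (reflect z)) \<bullet> h" for h
 by (simp add: reflect_def inner_prod_def)
ultimately have "(f has_derivative (%h. reflect (grad f (reflect z)) \<bullet> h)) (at z)" by (simp add: ev)
from grad_unique[OF this] show ?thesis by (simp add: reflect_def)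
qed

text \<open>
Weak \<open>a\<close>-harmonicity in the whole space is tested with the even functions
\<open>ph (x, sqrt (y^2 + ep))\<close>, which converge to \<open>ph (x, \<bar>y\<bar>)\<close>.
\<close>

lemma a_harmonic_conormal:
fixes q :: "('n::finite) point => real"
assumes a: "-1 < a" "a < 1" and q: "smooth q" and ev: "!!x y. q (x, - y) = q (x, y)" and ah: "a_harmonic a q"
 and bq: "bdd_field a R (grad q)"
shows "conormal a R (grad q) (%_. 0)"
proof -
let ?W = "wt a (half_ball R :: 'n point set)"
let ?A = "%z ph' n. grad q z \<bullet> grad (ph' n) z"
let ?B = "%ph' n. (%z. grad q z \<bullet> grad (ph' n) z)"
let ?C = "%z ta n. (fst z, ta n (snd z))"
interpret W: finite_measure ?W by (rule finite_measure_wt[OF a(1)])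
have evq: "q (reflect z) = q z" for z using ev[of "fst z" "snd z"] by (simp add: reflect_def)
have "(\<integral>z. grad q z \<bullet> grad ph z \<partial>?W) = 0"
 if ph: "smooth ph" "rh < R" "!!z. rh <= norm z ==> ph z = 0" for ph :: "'n point => real" and rh
proof -
 define ta where "ta n y = (y * y + inverse (real (Suc n))) powr (1 / 2)" for n and y :: real
 have tas: "smooth (ta n)" for n unfolding ta_def by (rule smooth_quadratic_powr) simp
 have tasq: "ta n y = sqrt (y * y + inverse (real (Suc n)))" for n y
  unfolding ta_def by (subst powr_half_sqrt) auto
 have tage: "\<bar>y\<bar> <= ta n y" for n y
 proof -
  have "sqrt (y * y) <= ta n y" unfolding tasq by (rule real_sqrt_le_mono) simp
  thus ?thesis by simp
 qed
 define ph' where "ph' n z = ph (?C z ta n)" for n z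
 have ph's: "smooth (ph' n)" for n unfolding ph'_def by (rule smooth_graph[OF ph(1) tas])
 have ph'0: "ph' n z = 0" if "rh <= norm z" for n z
 proof -
  have "norm z <= norm (?C z ta n)"
   using tage[of "snd z" n] power_mono[of "\<bar>snd z\<bar>" "ta n (snd z)" 2] by (cases z) (simp add: norm_Pair)
  thus ?thesis unfolding ph'_def using that by (intro ph(3)) simp
 qed
 have ph'ev: "ph' n (reflect z) = ph' n z" for n z by (simp add: ph'_def reflect_def ta_def)
 define ta' where "ta' n y = y / ta n y" for n and y :: real
 have tad: "(ta n has_real_derivative ta' n y) (at y)" for n y
 proof -
  have "((%y. sqrt (y * y + e)) has_real_derivative y / sqrt (y * y + e)) (at y)" if "0 < e" for e
  proof -
   have "0 < y * y + e" using that by (simp add: add_nonneg_pos)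
   thus ?thesis by (auto intro!: derivative_eq_intros simp: field_simps)
  qed
  from this[of "inverse (real (Suc n))"] show ?thesis unfolding ta'_def tasq[abs_def] by simp
 qed
 have g: "grad (ph' n) z = (fst (grad ph (?C z ta n)), snd (grad ph (?C z ta n)) * ta' n (snd z))" for n z
 proof (rule grad_unique)
  have "((%z::'n point. ta n (snd z)) has_derivative (%h. ta' n (snd z) * snd h)) (at z)"
   using has_derivative_compose[OF has_derivative_snd[OF has_derivative_ident] tad[unfolded has_field_derivative_def]] .
  from has_derivative_compose[OF has_derivative_Pair[OF has_derivative_fst[OF has_derivative_ident] this] smooth_has_derivative[OF ph(1)]]
  show "(ph' n has_derivative (%h. (fst (grad ph (?C z ta n)), snd (grad ph (?C z ta n)) * ta' n (snd z)) \<bullet> h)) (at z)"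
   by (simp add: ph'_def[abs_def] inner_prod_def mult_ac)
 qed
 obtain B where B: "0 <= B" "!!z. norm z < R ==> norm (grad q z) <= B"
  using bounded_on_half_ball[OF continuous_grad[OF q]] by metis
 obtain B' where B': "0 <= B'" "!!z. norm (z :: 'n point) < R ==> norm (grad ph z) <= B'"
  using bounded_on_half_ball[OF continuous_grad[OF ph(1)]] by metis
 \<comment> \<open>Smoothing the absolute value moves points away from y = 0, possibly out of the
   ball of radius \<open>R\<close>, so the gradient of \<open>ph\<close> has to be bounded
   everywhere.\<close>
 have B'': "norm (grad ph z) <= B'" for z
 proof (cases "norm z < R")
  case False
  hence "grad ph z = 0" using ph(2) by (intro smooth_grad_eq_0[OF ph(1,3)]) auto
  thus ?thesis using B' by simp
 qed (rule B'(2))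
 have gb: "norm (grad (ph' n) z) <= B'" for n z
 proof -
  have "\<bar>ta' n (snd z)\<bar> <= 1"
   unfolding ta'_def abs_divide using tage[of "snd z" n] by (intro divide_le_eq_1[THEN iffD2]) (auto simp: abs_le_iff)
  hence "\<bar>t * ta' n (snd z)\<bar> <= \<bar>t\<bar>" for t using mult_left_mono[of "\<bar>ta' n (snd z)\<bar>" 1 "\<bar>t\<bar>"] by (simp add: abs_mult)
  hence sq: "(t * ta' n (snd z))^2 <= t^2" for t by (simp only: abs_le_square_iff)
  have "norm (grad (ph' n) z) <= norm (grad ph (?C z ta n))"
   unfolding g using sq[of "snd (grad ph (?C z ta n))"] by (cases "grad ph (?C z ta n)") (simp add: norm_Pair)
  thus ?thesis using B'' order_trans by blast
 qed
 have z: "(\<integral>z. grad q z \<bullet> grad (ph' n) z \<partial>?W) = 0" for n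
 proof -
  define h where "h z = \<bar>snd z\<bar> powr a * (?A z ph' n)" for z
  define k where "k z = ind (half_ball R) z * h z" for z
  have c: "continuous_on UNIV (?B ph' n)"
   by (intro continuous_on_inner continuous_grad q ph's)
  have m: "(?B ph' n) : bmeas ?W"
   by (intro continuous_on_measurable_wt continuous_on_subset[OF c]) auto
  have "norm (?A z ph' n) <= B * B'" if "z : half_ball R" for z
  proof -
   have "norm (grad q z) * norm (grad (ph' n) z) <= B * B'"
    using B(2)[OF half_ballD(2)[OF that]] gb B by (intro mult_mono) auto
   thus ?thesis using Cauchy_Schwarz_ineq2[of "grad q z" "grad (ph' n) z"] by simp
  qed
  hence "integrable ?W (?B ph' n)"
   by (intro W.integrable_const_bound[where B = "B * B'", OF _ m] AE_I2) simp
  hence "set_integrable lborel (half_ball R) (%z. snd z powr a *. (?A z ph' n))"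
   using integrable_wt_iff[OF half_ball_borel m] by simp
  moreover have k: "ind (half_ball R) z *. (snd z powr a *. (?A z ph' n)) = k z" for z
   by (auto simp: k_def h_def indicator_def dest: half_ballD)
  ultimately have ki: "integrable lborel k" unfolding set_integrable_def by simp
  have iso: "reflect v \<bullet> reflect w = v \<bullet> w" for v w :: "'n point" by (simp add: reflect_def inner_prod_def)
  have hr: "h (reflect z) = h z" for z
   unfolding h_def grad_reflect[OF q evq] grad_reflect[OF ph's ph'ev] iso by (simp add: reflect_def)
  \<comment> \<open>The integrand is even, so the whole-space integral is twice the one over the
    half ball. On the plane y = 0 both sides are 0, since \<open>0 powr a = 0\<close> also for
    negative \<open>a\<close>.\<close>
  have "h z = k z + k (reflect z)" for z
  proof (cases "norm z < R & snd z ~= 0")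
   case True
   have "norm (reflect z) = norm z" by (cases z) (simp add: reflect_def norm_Pair)
   thus ?thesis using True hr[of z] by (auto simp: k_def half_ball_def indicator_def reflect_def)
  next
   case outside: False
   have "h z = 0"
   proof (cases "snd z = 0")
    case False
    with outside have "grad (ph' n) z = 0" using ph(2) by (intro smooth_grad_eq_0[OF ph's ph'0]) auto
    thus ?thesis by (simp add: h_def)
   qed (simp add: h_def)
   thus ?thesis using hr[of z] by (simp add: k_def)
  qed
  hence "(LINT z|lborel. h z) = (LINT z|lborel. k z + k (reflect z))" by simp
  also have "... = 2 * (LINT z|lborel. k z)"
   using integral_reflect[OF ki] ki by simp
  finally have "(LINT z|lborel. h z) = 2 * (LINT z|lborel. k z)" .
  moreover have "(LINT z|lborel. h z) = 0"
  proof -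
   have "smooth (ph' n) & compact (cball (0 :: 'n point) rh) & (ALL z:- cball 0 rh. ph' n z = 0)"
    using ph's ph'0 by (intro conjI ballI compact_cball) auto
   thus ?thesis unfolding h_def using ah unfolding a_harmonic_def by blast
  qed
  moreover have "(\<integral>z. grad q z \<bullet> grad (ph' n) z \<partial>?W) = (LINT z|lborel. k z)"
   unfolding integral_wt[OF half_ball_borel m] set_lebesgue_integral_def k ..
  ultimately show ?thesis by simp
 qed
 have "(%n. \<integral>z. grad q z \<bullet> grad (ph' n) z \<partial>?W) ----> (\<integral>z. grad q z \<bullet> grad ph z \<partial>?W)"
 proof (rule integral_dominated_convergence[where w = "%_. B * B'"])
  show "(%z. grad q z \<bullet> grad ph z) : bmeas ?W"
   by (intro continuous_on_measurable_wt continuous_on_inner continuous_grad q ph)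
  show "(?B ph' n) : bmeas ?W" for n
   by (intro continuous_on_measurable_wt continuous_on_inner continuous_grad q ph's)
  show "integrable ?W (%_. B * B')" by simp
  show "AE z in ?W. norm (?A z ph' n) <= B * B'" for n
  proof (rule AE_I2)
   fix z assume "z : space ?W"
   hence "norm (grad q z) * norm (grad (ph' n) z) <= B * B'"
    using B(2)[OF half_ballD(2)] gb B by (intro mult_mono) auto
   thus "norm (?A z ph' n) <= B * B'"
    using Cauchy_Schwarz_ineq2[of "grad q z" "grad (ph' n) z"] by simp
  qed
  show "AE z in ?W. (%n. grad q z \<bullet> grad (ph' n) z) ----> grad q z \<bullet> grad ph z"
  proof (rule AE_I2)
   fix z assume "z : space ?W"
   hence y: "0 < snd z" by (simp add: half_ballD)
   have "(%n. sqrt (snd z * snd z + inverse (real (Suc n)))) ----> sqrt (snd z * snd z + 0)"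
    by (intro tendsto_real_sqrt tendsto_add tendsto_const LIMSEQ_inverse_real_of_nat)
   hence t: "(%n. ta n (snd z)) ----> snd z" using y unfolding tasq by simp
   have t': "(%n. ta' n (snd z)) ----> 1"
    unfolding ta'_def using tendsto_divide[OF tendsto_const t, of "snd z"] y by simp
   have "(%n. (?C z ta n)) ----> (fst z, snd z)" by (intro tendsto_Pair tendsto_const t)
   hence "(%n. grad ph (?C z ta n)) ----> grad ph (fst z, snd z)"
    by (rule continuous_on_tendsto_compose[OF continuous_grad[OF ph(1), of UNIV]]) auto
   hence G: "(%n. grad ph (?C z ta n)) ----> grad ph z" by (simp only: prod.collapse)
   have "(%n. grad (ph' n) z) ----> (fst (grad ph z), snd (grad ph z) * 1)"
    unfolding g by (intro tendsto_Pair tendsto_mult tendsto_fst tendsto_snd G t')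
   thus "(%n. grad q z \<bullet> grad (ph' n) z) ----> grad q z \<bullet> grad ph z"
    by (intro tendsto_inner tendsto_const) simp
  qed
 qed
 thus ?thesis unfolding z by (simp add: LIMSEQ_const_iff)
qed
thus ?thesis unfolding conormal_def using bq by (auto simp: set_lebesgue_integral_def)
qed

lemma homogeneous_euler:
assumes q: "smooth q" and hom: "!!mw z. 0 <= mw ==> q (mw *. z) = mw ^ k * q z"
shows "grad q z \<bullet> z = real k * q z"
proof -
let ?A = "%z. (%t. q (t *. z))"
have "((%t. t *. z) has_derivative (%h. h *. z)) (at (1::real))" by (auto intro!: derivative_eq_intros)
from has_derivative_compose[OF this smooth_has_derivative[OF q]]
have "((?A z) has_derivative (%h. grad q z \<bullet> (h *. z))) (at (1::real))" by simp
hence 1: "((?A z) has_real_derivative grad q z \<bullet> z) (at 1)"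
 by (rule has_derivative_imp_has_field_derivative) simp
have "((%t. t ^ k * q z) has_real_derivative real k * q z) (at 1)"
 by (auto intro!: derivative_eq_intros)
hence "((?A z) has_real_derivative real k * q z) (at 1)"
 by (rule has_field_derivative_transform_within[where d = 1]) (auto simp: dist_real_def hom)
with 1 show ?thesis by (rule DERIV_unique)
qed

section \<open>From the weak solution and its regularity to a field with conormal data\<close>

lemma holder_norm_le:
fixes f :: "'a::metric_space => 'b::real_normed_vector"
assumes le: "holder_norm al S f <= ennreal C" and al: "0 < al"
shows "!!z. z : S ==> norm (f z) <= max 0 C" and "continuous_on S f"
proof -
let ?A = "%z w. SUP z\<in>S. SUP w\<in>S - {z}. ennreal (norm (f z - f w) / dist z w powr al)"
\<comment> \<open>\<open>ennreal\<close> truncates negative numbers to 0, whence the maximum in the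
  conclusion.\<close>
have C: "ennreal C <= ennreal (max 0 C)" by (rule ennreal_leI) simp
have "(SUP z\<in>S. ennreal (norm (f z))) <= holder_norm al S f" unfolding holder_norm_def by simp
hence 1: "(SUP z\<in>S. ennreal (norm (f z))) <= ennreal (max 0 C)" using le C order_trans by blast
show "norm (f z) <= max 0 C" if "z : S" for z
 using order_trans[OF SUP_upper[OF that] 1] by (subst (asm) ennreal_le_iff) auto
have "(?A z w) <= holder_norm al S f"
 unfolding holder_norm_def by simp
hence 2: "(?A z w) <= ennreal (max 0 C)"
 using le C order_trans by blast
have b: "norm (f w - f z) <= max 0 C * dist w z powr al" if z: "z : S" and w: "w : S" "w ~= z" for z w
proof -
 have "ennreal (norm (f w - f z) / dist w z powr al) <= (?A z w)"
  by (rule SUP_upper2[OF w(1)], rule SUP_upper2[of z]) (use z w in auto)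
 from order_trans[OF this 2] have "norm (f w - f z) / dist w z powr al <= max 0 C" by (subst (asm) ennreal_le_iff) auto
 moreover have "0 < dist w z powr al" using w by simp
 ultimately show ?thesis by (simp add: pos_divide_le_eq)
qed
show "continuous_on S f"
 unfolding continuous_on_def
proof (intro ballI)
 fix z assume z: "z : S"
 have "((%w. dist w z powr al) ---> 0) (at z within S)"
  using al by (intro tendsto_zero_powrI[where b = al] tendsto_const tendsto_dist_iff[THEN iffD1] tendsto_ident_at) auto
 hence t: "((%w. max 0 C * dist w z powr al) ---> 0) (at z within S)" by (rule tendsto_mult_right_zero)
 have "((%w. f w - f z) ---> 0) (at z within S)"
  by (rule Lim_null_comparison[OF _ t]) (use b[OF z] in \<open>auto simp: eventually_at_filter\<close>)
 thus "(f ---> f z) (at z within S)" by (simp only: LIM_zero_iff)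
qed
qed

lemma smooth_is_H1a_grad:
assumes "smooth ph"
shows "is_H1a_grad a r ph (grad ph)" "H1a_tendsto a r (%_. ph) ph (grad ph)"
proof -
show 1: "H1a_tendsto a r (%_. ph) ph (grad ph)"
 using assms by (subst H1a_tendsto_iff) (auto intro!: continuous_on_measurable_wt continuous_grad smooth_continuous)
thus "is_H1a_grad a r ph (grad ph)" unfolding is_H1a_grad_def using assms by (intro exI[of _ "%_. ph"]) simp
qed

lemma is_H1a_grad_measurable: "is_H1a_grad a r u F ==> F : bmeas (hwt a r)"
unfolding is_H1a_grad_def using H1a_tendsto_iff by blast

lemma H1a_grad_AE:
assumes a: "-1 < a" and F: "is_H1a_grad a r u F"
shows "AE z in hwt a r. H1a_grad a r u z = F z" "H1a_grad a r u : bmeas (hwt a r)"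
proof -
have G: "is_H1a_grad a r u (H1a_grad a r u)" unfolding H1a_grad_def by (rule someI[where P = "is_H1a_grad a r u", OF F])
show "AE z in hwt a r. H1a_grad a r u z = F z"
 using H1a_grad_unique[OF a G F] by (subst AE_wt_iff) (auto dest: half_ballD)
show "H1a_grad a r u : bmeas (hwt a r)" by (rule is_H1a_grad_measurable[OF G])
qed

text \<open>A smooth function vanishing for \<open>norm z >= rh\<close> with \<open>rh < 1\<close>
  is an admissible test function off the sphere. In the weak formulation the chosen gradients and
  traces are then replaced, almost everywhere, by \<open>F\<close>, by the classical gradient and by
  the pointwise boundary values.\<close>

lemma weak_solution_conormal:
fixes u :: "('n::finite) point => real"
assumes a: "-1 < a" "a < 1" and p: "2 <= p" and ws: "weak_solution a p lm lp g u"
 and uc: "continuous_on (half_ball 1 \<union> thin_ball 1) u" and F: "is_H1a_grad a 1 u F"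
 and R: "R < 1" and Fb: "bdd_field a R F"
shows "conormal a R F (%x. boundary_term p lm lp (u (x, 0)))"
proof -
let ?b = "%x. boundary_term p lm lp (u (x, 0))"
let ?W = "wt a (half_ball 1 :: 'n point set)"
let ?A = "%ph. (LINT x:ball 0 1|lborel. boundary_term p lm lp (H1a_trace a 1 u x) * H1a_trace a 1 ph x)"
let ?B = "%ph. (\<integral>z. F z \<bullet> grad ph z \<partial>hwt a R)"
have uH: "u : H1a a 1" using F by (auto simp: H1a_def)
have u0: "continuous_on (ball 0 1) (%x. u (x, 0))"
 by (rule continuous_on_compose2[OF uc]) (auto simp: thin_ball_def intro!: continuous_on_Pair continuous_on_id continuous_on_const)
have bc: "continuous_on (ball 0 1) ?b"
 using continuous_on_compose2[OF continuous_boundary_term[OF p] u0] by auto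
show ?thesis
 unfolding conormal_def
proof (intro conjI allI impI)
 show "bdd_field a R F" by (rule Fb)
 show "continuous_on (ball 0 R) ?b" using continuous_on_subset[OF bc] R by (meson subset_ball less_imp_le)
 have "compact (?b ` cball 0 R)"
  using R by (intro compact_continuous_image continuous_on_subset[OF bc] compact_cball) auto
 hence "bounded (?b ` cball 0 R)" by (rule compact_imp_bounded)
 thus "EX C. ALL x:ball 0 R. \<bar>?b x\<bar> <= C" unfolding bounded_iff by (metis ball_subset_cball imageI real_norm_def subsetD)
 fix ph :: "'n point => real" and rh assume "smooth ph & rh < R & (ALL z. rh <= norm z --> ph z = 0)"
 hence ph: "smooth ph" "rh < R" "!!z. rh <= norm z ==> ph z = 0" by auto
 note phF = smooth_is_H1a_grad[OF ph(1), of a 1]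
 have "ph : Cc_off_sphere 1"
  unfolding Cc_off_sphere_def mem_Collect_eq
 proof (intro conjI exI[of _ "closure (half_ball 1) \<inter> cball 0 rh"] ballI)
  show "compact (closure (half_ball 1) \<inter> cball (0 :: 'n point) rh)" by (intro closed_Int_compact closed_closure compact_cball)
  have "closure (half_sphere 1) <= sphere (0 :: 'n point) 1"
   by (rule closure_minimal) (auto simp: half_sphere_def)
  moreover have "sphere (0 :: 'n point) 1 \<inter> cball 0 rh = {}" using ph(2) R by auto
  ultimately show "closure (half_ball 1) \<inter> cball 0 rh <= closure (half_ball 1) - closure (half_sphere 1 :: 'n point set)" by blast
 qed (use ph in auto)
 hence ph0: "ph : H1a0 a 1" unfolding H1a0_def
  by (intro CollectI exI[of _ "%_. ph"] exI[of _ "grad ph"]) (simp add: phF(2))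
 have phH: "ph : H1a a 1" using phF by (auto simp: H1a_def)
 have si: "set_integrable lborel (ball 0 1) (%x. boundary_term p lm lp (H1a_trace a 1 u x) * H1a_trace a 1 ph x)"
  and eq: "(LINT z:half_ball 1|lborel. snd z powr a * (H1a_grad a 1 u z \<bullet> H1a_grad a 1 ph z)) =
   (?A ph)"
  using ws ph0 unfolding weak_solution_def by blast+
 have m: "(%z. H1a_grad a 1 u z \<bullet> H1a_grad a 1 ph z) : bmeas ?W"
  by (intro borel_measurable_inner H1a_grad_AE(2)[OF a(1) F] H1a_grad_AE(2)[OF a(1) phF(1)])
 have m': "(%z. F z \<bullet> grad ph z) : bmeas ?W"
  by (intro borel_measurable_inner is_H1a_grad_measurable[OF F] is_H1a_grad_measurable[OF phF(1)])
 have "(?B ph) = (\<integral>z. ind (half_ball R) z * (F z \<bullet> grad ph z) \<partial>?W)"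
  by (rule integral_wt_subset[OF m']) (use R in simp)
 also have "... = (\<integral>z. F z \<bullet> grad ph z \<partial>?W)"
 proof (rule Bochner_Integration.integral_cong[OF refl])
  fix z assume z: "z : space ?W"
  show "ind (half_ball R) z * (F z \<bullet> grad ph z) = F z \<bullet> grad ph z"
  proof (cases "norm z < R")
   case False
   hence "grad ph z = 0" using ph(2) by (intro smooth_grad_eq_0[OF ph(1,3)]) auto
   thus ?thesis by simp
  qed (use z in \<open>simp add: half_ball_def\<close>)
 qed
 also have "... = (\<integral>z. H1a_grad a 1 u z \<bullet> H1a_grad a 1 ph z \<partial>?W)"
 proof (rule integral_cong_AE[OF m' m])
  show "AE z in ?W. F z \<bullet> grad ph z = H1a_grad a 1 u z \<bullet> H1a_grad a 1 ph z"
   using H1a_grad_AE(1)[OF a(1) F] H1a_grad_AE(1)[OF a(1) phF(1)] by eventually_elim simp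
 qed
 also have "... = (?A ph)"
  unfolding integral_wt[OF half_ball_borel m] using eq by simp
 also have "... = (LINT x:ball 0 1|lborel. ?b x * ph (x, 0))"
  unfolding set_lebesgue_integral_def
 proof (rule integral_cong_AE)
  show "(%x. ind (ball 0 1) x *. (boundary_term p lm lp (H1a_trace a 1 u x) * H1a_trace a 1 ph x)) : bmeas lborel"
   using si unfolding set_integrable_def by (rule borel_measurable_integrable)
  have "continuous_on (ball 0 1) (%x. ?b x * ph (x, 0))"
   by (intro continuous_on_mult bc continuous_on_compose2[OF smooth_continuous[OF ph(1), of UNIV]]
     continuous_on_Pair continuous_on_id continuous_on_const) auto
  hence "(%x. ind (ball 0 1) x *. (?b x * ph (x, 0))) : bmeas borel"
   by (intro borel_measurable_continuous_on_indicator) (auto simp: borel_open)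
  thus "(%x. ind (ball 0 1) x *. (?b x * ph (x, 0))) : bmeas lborel" by simp
  have "AE x in lborel. x : ball 0 1 --> H1a_trace a 1 u x = u (x, 0)" by (rule H1a_trace_AE(1)[OF a _ uH uc]) simp
  moreover have "AE x in lborel. x : ball 0 1 --> H1a_trace a 1 ph x = ph (x, 0)"
   by (rule H1a_trace_AE(1)[OF a _ phH smooth_continuous[OF ph(1)]]) simp
  ultimately show "AE x in lborel. ind (ball 0 1) x *. (boundary_term p lm lp (H1a_trace a 1 u x) * H1a_trace a 1 ph x) =
    ind (ball 0 1) x *. (?b x * ph (x, 0))" by eventually_elim (auto simp: indicator_def)
 qed
 also have "... = (LINT x:ball 0 R|lborel. ?b x * ph (x, 0))"
  unfolding set_lebesgue_integral_def
 proof (rule Bochner_Integration.integral_cong[OF refl])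
  fix x :: "real ^ 'n"
  show "ind (ball 0 1) x *. (?b x * ph (x, 0)) = ind (ball 0 R) x *. (?b x * ph (x, 0))"
  proof (cases "norm x < R")
   case False
   hence "ph (x, 0) = 0" using ph(2) by (intro ph(3)) (simp add: norm_Pair)
   thus ?thesis by simp
  qed (use R in \<open>simp add: indicator_def\<close>)
 qed
 finally show "(?B ph) = (LINT x:ball 0 R|lborel. ?b x * ph (x, 0))" .
qed
qed

lemma energy_D_eq:
fixes u :: "('n::finite) point => real"
assumes a: "-1 < a" and F: "is_H1a_grad a r u F"
shows "energy_D a u r = r powr (- (real CARD('n) + a - 1)) * (\<integral>z. (norm (F z))^2 \<partial>hwt a r)"
proof -
have m: "(%z. (norm (H1a_grad a r u z))^2) : bmeas (hwt a r)"
 "(%z. (norm (F z))^2) : bmeas (hwt a r)"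
 using H1a_grad_AE(2)[OF a F] is_H1a_grad_measurable[OF F] by measurable
have "(LINT z:half_ball r|lborel. snd z powr a * (norm (H1a_grad a r u z))^2) = (\<integral>z. (norm (H1a_grad a r u z))^2 \<partial>hwt a r)"
 unfolding integral_wt[OF half_ball_borel m(1)] by simp
also have "... = (\<integral>z. (norm (F z))^2 \<partial>hwt a r)"
 by (rule integral_cong_AE[OF m]) (use H1a_grad_AE(1)[OF a F] in \<open>eventually_elim; simp\<close>)
finally show ?thesis by (simp add: energy_D_def)
qed

lemma boundary_G_eq:
fixes u :: "('n::finite) point => real"
assumes a: "-1 < a" "a < 1" and r: "0 < r" and p: "2 <= p" and u: "u : H1a a r"
 and uc: "continuous_on (half_ball r \<union> thin_ball r) u"
shows "boundary_G a p lm lp u r = r powr (- (real CARD('n) + a - 1)) * (LINT x:ball 0 r|lborel. potential p lm lp (u (x, 0)))"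
proof -
let ?A = "%x. ind (ball 0 r) x *. H1a_trace a r u x"
let ?B = "%x. ind (ball 0 r) x *. u (x, 0)"
let ?C = "(%x. ind (ball 0 r) x *. u (x, 0))"
have P0: "potential p lm lp 0 = 0" by (simp add: potential_def pos_part_def neg_part_def)
have Pm: "potential p lm lp : bmeas borel" by (rule borel_measurable_continuous_onI[OF continuous_potential[OF p]])
\<comment> \<open>The trace is measurable only on the ball. As the potential vanishes at 0, the
  indicator can be moved inside, where it makes the argument globally measurable.\<close>
have i: "ind (ball 0 r) x *. potential p lm lp (T x) = potential p lm lp (ind (ball 0 r) x *. T x)" for x :: "real ^ 'n" and T
 by (simp add: indicator_def P0)
have "(LINT x|lborel. potential p lm lp (?A x)) =
  (LINT x|lborel. potential p lm lp (?B x))"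
proof (rule integral_cong_AE)
 have "(%x. ind (ball 0 r) x *. H1a_trace a r u x) : bmeas lborel"
  using H1a_trace_AE(2)[OF a r u uc] unfolding set_borel_measurable_def .
 thus "(%x. potential p lm lp (?A x)) : bmeas lborel"
  by (rule measurable_compose[OF _ Pm])
 have "continuous_on (ball 0 r) (%x. u (x, 0))"
  by (rule continuous_on_compose2[OF uc]) (auto simp: thin_ball_def intro!: continuous_on_Pair continuous_on_id continuous_on_const)
 hence "?C : bmeas borel"
  by (intro borel_measurable_continuous_on_indicator) (auto simp: borel_open)
 hence "?C : bmeas lborel" by simp
 thus "(%x. potential p lm lp (?B x)) : bmeas lborel"
  by (rule measurable_compose[OF _ Pm])
 show "AE x in lborel. potential p lm lp (?A x) =
   potential p lm lp (?B x)"
  using H1a_trace_AE(1)[OF a r u uc] by eventually_elim (auto simp: indicator_def)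
qed
hence "(LINT x:ball 0 r|lborel. potential p lm lp (H1a_trace a r u x)) = (LINT x:ball 0 r|lborel. potential p lm lp (u (x, 0)))"
 unfolding set_lebesgue_integral_def i[of _ "H1a_trace a r u"] i[of _ "%x. u (x, 0)"] .
thus ?thesis by (simp add: boundary_G_def potential_def)
qed

lemma nn_integral_lborel_product:
fixes f :: "'a::euclidean_space => ennreal" and g :: "'b::euclidean_space => ennreal"
assumes [measurable]: "f : bmeas borel" "g : bmeas borel"
shows "(NN z. f (fst z) * g (snd z)) = (NN x. f x) * (NN y. g y)"
proof -
let ?A = "(NN y. g y)"
have "(NN z. f (fst z) * g (snd z)) = (\<integral>\<^sup>+z. f (fst z) * g (snd z) \<partial>lborel2)"
 by (simp only: lborel_prod)
also have "... = (NN x. NN y. f (fst (x, y)) * g (snd (x, y)))"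
 by (rule lborel.nn_integral_fst[symmetric]) measurable
also have "... = (NN x. f x * ?A)"
 by (simp add: nn_integral_cmult)
also have "... = (NN x. f x) * ?A"
 by (rule nn_integral_multc) simp
finally show ?thesis .
qed

text \<open>
The conormal boundary values inherit the bound of \<open>y\<^sup>a V\<^sub>y\<close>: the equation is tested with
\<open>be x * h (j y)\<close>, where \<open>h\<close> decreases to \<open>0\<close>, as \<open>j --> \<infinity>\<close>.
\<close>

lemma conormal_bounded:
fixes V :: "('n::finite) point => 'n point"
assumes a: "-1 < a" "a < 1" and con: "conormal a R V b"
 and C0: "!!z. z : half_ball R ==> \<bar>snd z powr a * snd (V z)\<bar> <= C0" and x0: "x0 : ball 0 R"
shows "\<bar>b x0\<bar> <= C0"
proof -
let ?W = "wt a (half_ball R :: 'n point set)"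
let ?A = "%be. (%x. ind (ball 0 R) x *. (b x * be x))"
let ?B = "%j n y. j n * j n * ((1 / j n)^2 - y^2)"
let ?C = "%x be. ind (ball 0 R) x *. (b x * be x)"
let ?D = "%z. norm (1 *. z + (- x0, 0))"
interpret W: finite_measure ?W by (rule finite_measure_wt[OF a(1)])
have x0R: "norm x0 < R" using x0 by simp
hence R: "0 < R" using norm_ge_zero order.strict_trans1 by blast
have bc: "continuous_on (ball 0 R) b" and Vb: "bdd_field a R V" using con by (auto simp: conormal_def)
obtain Cb where Cb: "!!x. x : ball 0 R ==> \<bar>b x\<bar> <= Cb" using con unfolding conormal_def by blast
have Vc: "continuous_on (half_ball R) V" using Vb by (simp add: bdd_field_def)
obtain CV where CV: "0 <= CV" "!!z. z : half_ball R ==> norm (fst (V z)) <= CV" using bdd_fieldE[OF Vb] by metis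
have C00: "0 <= C0"
proof -
 have "(0, R / 2) : (half_ball R :: 'n point set)" using R by (simp add: half_ball_def norm_Pair)
 from C0[OF this] show ?thesis by linarith
qed
have "s * b x0 <= C0" if s: "\<bar>s\<bar> = 1" for s
proof (rule ccontr)
 assume "~ s * b x0 <= C0"
 define D where "D x = s * b x - C0" for x
 have Dc: "continuous_on (ball 0 R) D" unfolding D_def by (intro continuous_on_diff continuous_on_mult continuous_on_const bc)
 have "open (ball 0 R \<inter> D -` {0<..})" by (rule continuous_open_preimage[OF Dc open_ball open_greaterThan])
 moreover have "x0 : ball 0 R \<inter> D -` {0<..}" using \<open>~ s * b x0 <= C0\<close> x0 by (simp add: D_def)
 ultimately obtain de0 where de0: "0 < de0" "ball x0 de0 <= ball 0 R \<inter> D -` {0<..}" by (meson open_contains_ball)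
 \<comment> \<open>One share for the horizontal and one for the vertical extent of the test
   function; the third keeps its support at a positive distance from the sphere.\<close>
 define d where "d = (R - norm x0) / 3"
 have d: "0 < d" using x0R by (simp add: d_def)
 define de where "de = min de0 d"
 have de: "0 < de" "de <= d" "de <= de0" using de0 d by (auto simp: de_def)
 have sub: "ball x0 de <= ball 0 R" and Dpos: "!!x. x : ball x0 de ==> 0 < D x"
  using de0 subset_ball[OF de(3), of x0] by auto
 define be where "be x = ramp (de^2 - (x - x0) \<bullet> (x - x0))" for x
 have be0: "be x = 0" if "x \<notin> ball x0 de" for x
 proof -
  have "de^2 <= (norm (x - x0))^2" using that de(1) by (intro power_mono) (auto simp: dist_norm norm_minus_commute)
  thus ?thesis unfolding be_def by (intro ramp_zero) (simp add: power2_norm_eq_inner)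
 qed
 have beb: "0 <= be x" "be x <= 1" for x unfolding be_def by (rule ramp_bounds)+
 have bec: "continuous_on A be" for A
  unfolding be_def by (intro continuous_on_compose2[OF smooth_continuous[OF smooth_ramp, of UNIV]] continuous_intros) auto
 have bem: "be : bmeas borel" by (rule borel_measurable_continuous_onI[OF bec])
 have bei: "integrable lborel be"
 proof (rule integrable_continuous_compact_support[OF bec])
  fix x :: "real ^ 'n" assume "norm x0 + de <= norm x"
  hence "x \<notin> ball x0 de" using norm_triangle_sub[of x x0] by (auto simp: dist_norm norm_minus_commute)
  thus "be x = 0" by (rule be0)
 qed
 define j where "j n = real (Suc n) / d" for n
 have j: "0 < j n" "1 / j n <= d" for n using d by (auto simp: j_def field_simps)
 \<comment> \<open>This is ramp(1 - (j y)^2): its value at 0 is \<open>ramp 1\<close> for every n,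
   while its support shrinks to y = 0.\<close>
 define h where "h n y = ramp (?B j n y)" for n y
 define h' where "h' n y = 2 * (j n * j n) * y * ramp' (?B j n y)" for n y
 have hd: "(h n has_real_derivative - h' n y) (at y)" for n y
 proof -
  have "((%y. j n * j n * ((1 / j n)^2 - y^2)) has_real_derivative - (2 * (j n * j n) * y)) (at y)"
   by (auto intro!: derivative_eq_intros)
  from DERIV_chain2[OF ramp_deriv this] show ?thesis unfolding h_def[abs_def] h'_def by (simp add: mult_ac)
 qed
 have h0: "h n 0 = ramp 1" for n using j[of n] by (simp add: h_def power2_eq_square)
 have hb: "0 <= h n y" "h n y <= 1" for n y unfolding h_def by (rule ramp_bounds)+
 have hz: "h n y = 0" if "1 / j n <= \<bar>y\<bar>" for n y
 proof -
  have "(1 / j n)^2 <= \<bar>y\<bar>^2" using that j[of n] by (intro power_mono) auto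
  thus ?thesis unfolding h_def using j[of n] by (intro ramp_zero) (simp add: mult_nonneg_nonpos)
 qed
 have hs: "smooth (h n)" for n
  unfolding h_def power2_eq_square
  by (intro smooth_compose[OF smooth_ramp] smooth_mult smooth_diff smooth_const smooth_bounded_linear bounded_linear_ident)
 define g where "g x = (- 2 * ramp' (de^2 - (x - x0) \<bullet> (x - x0))) *. (x - x0)" for x
 have gc: "continuous_on A g" for A
  unfolding g_def by (intro continuous_on_scaleR continuous_on_mult continuous_on_const
    continuous_on_compose2[OF continuous_ramp'[of UNIV]] continuous_intros) auto
 define ph where "ph n z = be (fst z) * h n (snd z)" for n z
 have gr: "grad (ph n) z = (h n (snd z) *. g (fst z), - (be (fst z) * h' n (snd z)))" for n z
 proof (rule grad_unique)
  have "((%z::'n point. de^2 - (fst z - x0) \<bullet> (fst z - x0)) has_derivative (%v. - (2 * ((fst z - x0) \<bullet> fst v)))) (at z)"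
   by (auto intro!: derivative_eq_intros simp: inner_commute)
  from has_derivative_compose[OF this ramp_deriv[unfolded has_field_derivative_def]]
  have 1: "((%z::'n point. be (fst z)) has_derivative (%v. g (fst z) \<bullet> fst v)) (at z)"
   unfolding be_def g_def by (simp add: mult_ac)
  have 2: "((%z::'n point. h n (snd z)) has_derivative (%v. - h' n (snd z) * snd v)) (at z)"
   using has_derivative_compose[OF has_derivative_snd[OF has_derivative_ident] hd[unfolded has_field_derivative_def]] .
  from has_derivative_mult[OF 1 2]
  show "(ph n has_derivative (%v. (h n (snd z) *. g (fst z), - (be (fst z) * h' n (snd z))) \<bullet> v)) (at z)"
   by (simp add: ph_def[abs_def] inner_prod_def algebra_simps)
 qed
 have phs: "smooth (ph n)" for n
 proof -
  have "(fst z - x0) \<bullet> (fst z - x0) = (?D z)^2 - snd z * snd z" for z :: "'n point"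
   by (cases z) (simp add: norm_Pair power2_norm_eq_inner[symmetric] power2_eq_square)
  hence "ph n = (%z. ramp (de^2 - ((?D z)^2 - snd z * snd z)) * h n (snd z))"
   by (simp add: ph_def[abs_def] be_def)
  moreover have "smooth (%z::'n point. ramp (de^2 - ((?D z)^2 - snd z * snd z)) * h n (snd z))"
   by (intro smooth_mult smooth_compose[OF smooth_ramp] smooth_compose[OF hs] smooth_diff smooth_const
     smooth_affine[OF smooth_norm2] smooth_bounded_linear bounded_linear_snd)
  ultimately show ?thesis by simp
 qed
 have ph0: "ph n z = 0" if "norm x0 + 2 * d <= norm z" for n z
 proof (cases "fst z : ball x0 de")
  case True
  have "norm z <= norm (fst z) + \<bar>snd z\<bar>" using norm_Pair_le_add[of "fst z" "snd z"] by simp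
  moreover have "norm (fst z) < norm x0 + d"
   using True de(2) norm_triangle_sub[of "fst z" x0] by (simp add: dist_norm norm_minus_commute)
  ultimately have "d <= \<bar>snd z\<bar>" using that by linarith
  thus ?thesis unfolding ph_def using hz j(2) order_trans by (metis mult_zero_right)
 qed (simp add: ph_def be0)
 define I where "I = (LINT x:ball 0 R|lborel. b x * be x)"
 have WF: "(\<integral>z. V z \<bullet> grad (ph n) z \<partial>?W) = ramp 1 * I" for n
 proof -
  have "smooth (ph n) & norm x0 + 2 * d < R & (ALL z. norm x0 + 2 * d <= norm z --> ph n z = 0)"
   using phs ph0 d by (auto simp: d_def field_simps)
  hence "(\<integral>z. V z \<bullet> grad (ph n) z \<partial>?W) = (LINT x:ball 0 R|lborel. b x * ph n (x, 0))"
   using con unfolding conormal_def by blast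
  also have "... = (LINT x:ball 0 R|lborel. ramp 1 * (b x * be x))" by (simp add: ph_def h0 mult_ac)
  also have "... = ramp 1 * I" unfolding I_def by (rule set_integral_mult_right)
  finally show ?thesis .
 qed
 obtain Bg where Bg: "0 <= Bg" "!!x. norm x < R ==> norm (g x) <= Bg"
 proof -
  have "bounded (g ` cball 0 R)" by (intro compact_imp_bounded compact_continuous_image gc compact_cball)
  then obtain B where "!!x. x : cball 0 R ==> norm (g x) <= B" unfolding bounded_iff by blast
  thus ?thesis by (intro that[of "max 0 B"]) (auto simp: le_max_iff_disj)
 qed
 define f1 where "f1 n z = h n (snd z) * (fst (V z) \<bullet> g (fst z))" for n z
 define f2 where "f2 n z = snd (V z) * (be (fst z) * h' n (snd z))" for n z
 have split: "V z \<bullet> grad (ph n) z = f1 n z - f2 n z" for n z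
  by (simp add: gr f1_def f2_def inner_prod_def)
 have f1m: "f1 n : bmeas ?W" for n
  unfolding f1_def
  by (intro continuous_on_measurable_wt continuous_on_mult continuous_on_inner continuous_on_fst continuous_on_snd Vc
    continuous_on_compose2[OF gc[of UNIV]] continuous_on_compose2[OF smooth_continuous[OF hs, of UNIV]] continuous_on_id) auto
 have h'c: "continuous_on A (h' n)" for A n
  unfolding h'_def by (intro continuous_on_mult continuous_on_const continuous_on_id
    continuous_on_compose2[OF continuous_ramp'[of UNIV]] continuous_intros) auto
 have f2m: "f2 n : bmeas ?W" for n
  unfolding f2_def
  by (intro continuous_on_measurable_wt continuous_on_mult continuous_on_fst continuous_on_snd Vc
    continuous_on_compose2[OF bec[of UNIV]] continuous_on_compose2[OF h'c[of UNIV]] continuous_on_id) auto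
 have f1b: "norm (f1 n z) <= CV * Bg" if z: "z : half_ball R" for n z
 proof -
  have "norm (fst z) < R" using norm_fst_le[of "fst z" "snd z"] half_ballD(2)[OF z] by simp
  hence "norm (fst (V z)) * norm (g (fst z)) <= CV * Bg" using CV Bg z by (intro mult_mono) auto
  hence "\<bar>fst (V z) \<bullet> g (fst z)\<bar> <= CV * Bg" using Cauchy_Schwarz_ineq2[of "fst (V z)" "g (fst z)"] by linarith
  thus ?thesis unfolding f1_def using hb[of n "snd z"] mult_mono[of "h n (snd z)" 1 "\<bar>fst (V z) \<bullet> g (fst z)\<bar>" "CV * Bg"]
   by (simp add: abs_mult)
 qed
 have f1i: "integrable ?W (f1 n)" for n
  by (rule W.integrable_const_bound[where B = "CV * Bg", OF _ f1m]) (rule AE_I2, use f1b in simp)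
 \<comment> \<open>The horizontal contribution is bounded and lives on the shrinking support of
   \<open>h n\<close>.\<close>
 have f1lim: "(%n. \<integral>z. f1 n z \<partial>?W) ----> (\<integral>z. 0 \<partial>?W)"
 proof (rule integral_dominated_convergence[where w = "%_. CV * Bg"])
  show "AE z in ?W. (%n. f1 n z) ----> 0"
  proof (rule AE_I2)
   fix z assume "z : space ?W"
   hence y: "0 < snd z" by (simp add: half_ballD)
   obtain m where m: "d / snd z < real m" using reals_Archimedean2 by blast
   have "f1 n z = 0" if "m <= n" for n
   proof -
    have "d / snd z <= real (Suc n)" using m that by simp
    hence "1 / j n <= \<bar>snd z\<bar>" using y d by (simp add: j_def field_simps)
    thus ?thesis by (simp add: f1_def hz)
   qed
   thus "(%n. f1 n z) ----> 0" by (intro tendsto_eventually eventually_sequentiallyI[of m])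
  qed
 qed (use f1m f1b in auto)
 define Q where "Q = (LINT x|lborel. be x)"
 have Q0: "0 <= Q" unfolding Q_def by (rule integral_nonneg_AE) (use beb in simp)
 \<comment> \<open>The function \<open>h n\<close> decreases from \<open>ramp 1\<close> to 0 on
   [0, R], so its total variation is at most \<open>ramp 1\<close>. The vertical contribution is
   therefore at most the supremum of y^a V_y times the mass of \<open>be\<close> times
   \<open>ramp 1\<close>, whatever n is.\<close>
 have f2n: "(\<integral>\<^sup>+z. ennreal (norm (f2 n z)) \<partial>?W) <= ennreal (C0 * Q * ramp 1)" for n
 proof -
  let ?k = "%y. ind {0..R} y * h' n y"
  have hn: "0 <= h' n y" if "0 <= y" for y unfolding h'_def using that j[of n] ramp_bounds(3) by (intro mult_nonneg_nonneg) auto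
  have km: "?k : bmeas borel"
   by (intro borel_measurable_times borel_measurable_indicator borel_measurable_continuous_onI h'c) simp
  have "(\<integral>\<^sup>+z. ennreal (norm (f2 n z)) \<partial>?W) = (\<integral>\<^sup>+z\<in>half_ball R. (ennreal (snd z powr a) * ennreal (norm (f2 n z))) \<partial>lborel)"
   by (rule nn_integral_wt[OF half_ball_borel]) (use f2m[of n] in measurable)
  also have "... <= (NN z. ennreal (C0 * be (fst z)) * ennreal (?k (snd z)))"
  proof (rule nn_integral_mono)
   fix z :: "'n point"
   show "ennreal (snd z powr a) * ennreal (norm (f2 n z)) * ind (half_ball R) z <= ennreal (C0 * be (fst z)) * ennreal (?k (snd z))"
   proof (cases "z : half_ball R")
    case True
    have y: "0 < snd z" "snd z <= R" using half_ballD[OF True] norm_snd_le[of "snd z" "fst z"] by auto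
    have "snd z powr a * norm (f2 n z) = \<bar>snd z powr a * snd (V z)\<bar> * (be (fst z) * h' n (snd z))"
     using beb hn[of "snd z"] y by (simp add: f2_def abs_mult)
    also have "... <= C0 * (be (fst z) * h' n (snd z))"
     using beb hn[of "snd z"] y by (intro mult_right_mono C0 True mult_nonneg_nonneg) auto
    finally have "snd z powr a * norm (f2 n z) <= C0 * be (fst z) * ?k (snd z)" using y by (simp add: mult_ac)
    hence "ennreal (snd z powr a * norm (f2 n z)) <= ennreal (C0 * be (fst z) * ?k (snd z))" by (rule ennreal_leI)
    thus ?thesis using True C00 beb hn[of "snd z"] y by (simp add: ennreal_mult)
   qed simp
  qed
  also have "... = (NN x. ennreal (C0 * be x)) * (NN y. ennreal (?k y))"
   by (rule nn_integral_lborel_product) (use bem km in measurable)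
  also have "(NN x. ennreal (C0 * be x)) = ennreal (C0 * Q)"
   unfolding Q_def using bei beb C00 by (subst nn_integral_eq_integral) auto
  also have "(NN y. ennreal (?k y)) = ennreal (ramp (j n * j n * (1 / j n)^2) - ramp (j n * j n * ((1 / j n)^2 - R^2)))"
  proof -
   note K = ramp_kernel_integral[of R "j n * j n" "1 / j n", OF less_imp_le[OF R]]
   have k: "ind {0..R} y * (2 * (j n * j n) * y * ramp' (?B j n y)) = ?k y" for y
    by (simp add: h'_def)
   show ?thesis using K unfolding k by (subst nn_integral_eq_integral) (auto simp: indicator_def hn)
  qed
  also have "ennreal (C0 * Q) * ... <= ennreal (C0 * Q) * ennreal (ramp 1)"
  proof (intro mult_left_mono ennreal_leI)
   have "j n * j n * (1 / j n)^2 = 1" using j[of n] by (simp add: power2_eq_square)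
   thus "ramp (j n * j n * (1 / j n)^2) - ramp (j n * j n * ((1 / j n)^2 - R^2)) <= ramp 1"
    using ramp_bounds(1) by simp
  qed simp
  also have "... = ennreal (C0 * Q * ramp 1)" using C00 Q0 ramp_bounds(1) by (subst ennreal_mult) auto
  finally show ?thesis .
 qed
 have f2i: "integrable ?W (f2 n)" for n
  using f2m f2n[of n] by (intro integrableI_bounded) (auto intro: le_less_trans simp: ennreal_less_top)
 have "\<bar>(\<integral>z. f1 n z \<partial>?W) - ramp 1 * I\<bar> <= C0 * Q * ramp 1" for n
 proof -
  have "ramp 1 * I = (\<integral>z. f1 n z \<partial>?W) - (\<integral>z. f2 n z \<partial>?W)"
   using WF[of n] unfolding split using f1i f2i by simp
  moreover have "ennreal (norm (\<integral>z. f2 n z \<partial>?W)) <= ennreal (C0 * Q * ramp 1)"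
   using integral_norm_bound_ennreal[OF f2i] f2n order_trans by blast
  hence "norm (\<integral>z. f2 n z \<partial>?W) <= C0 * Q * ramp 1"
   using C00 Q0 ramp_bounds(1) by (subst (asm) ennreal_le_iff) auto
  ultimately show ?thesis by simp
 qed
 moreover have "(%n. \<bar>(\<integral>z. f1 n z \<partial>?W) - ramp 1 * I\<bar>) ----> \<bar>0 - ramp 1 * I\<bar>"
  using f1lim by (intro tendsto_rabs tendsto_diff tendsto_const) simp
 ultimately have "\<bar>0 - ramp 1 * I\<bar> <= C0 * Q * ramp 1" by (intro LIMSEQ_le_const2) auto
 moreover have r1: "0 < ramp 1" by (simp add: ramp_pos)
 ultimately have IQ: "\<bar>I\<bar> <= C0 * Q" by (simp add: abs_mult mult.commute)
 \<comment> \<open>The estimate for \<open>I\<close> says that this function has nonpositive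
   integral. It is nonnegative because \<open>be\<close> is supported where \<open>D > 0\<close>, so
   it vanishes, contradicting positivity at \<open>x0\<close>.\<close>
 define f where "f x = ind (ball 0 R) x * (D x * be x)" for x
 have bbe: "integrable lborel (?A be)"
 proof (rule Bochner_Integration.integrable_bound)
  show "integrable lborel (%x. Cb * be x)" using bei by simp
  have "(?A be) : bmeas borel"
   by (intro borel_measurable_continuous_on_indicator continuous_on_mult bc bec) (simp add: borel_open)
  thus "(?A be) : bmeas lborel" by simp
  show "AE x in lborel. norm (?C x be) <= norm (Cb * be x)"
  proof (rule AE_I2)
   fix x
   show "norm (?C x be) <= norm (Cb * be x)"
   proof (cases "x : ball 0 R")
    case True
    have "\<bar>b x\<bar> * \<bar>be x\<bar> <= \<bar>Cb\<bar> * \<bar>be x\<bar>" using Cb[OF True] by (intro mult_right_mono) auto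
    thus ?thesis using True by (simp add: abs_mult)
   qed simp
  qed
 qed
 have f_eq: "f x = s * (?C x be) - C0 * be x" for x
 proof (cases "x : ball 0 R")
  case False
  hence "be x = 0" using sub by (intro be0) blast
  thus ?thesis by (simp add: f_def)
 qed (simp add: f_def D_def algebra_simps)
 have fi: "integrable lborel f" unfolding f_eq[abs_def] using bbe bei by (intro Bochner_Integration.integrable_diff integrable_mult_right)
 have fn: "0 <= f x" for x
  unfolding f_def using be0[of x] Dpos[of x] beb[of x] by (cases "x : ball x0 de") auto
 have "(LINT x|lborel. f x) = s * I - C0 * Q"
  unfolding f_eq[abs_def] I_def Q_def set_lebesgue_integral_def using bbe bei by simp
 also have "... <= 0"
 proof -
  have "s * I <= \<bar>I\<bar>" using s abs_ge_self[of "s * I"] by (simp add: abs_mult)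
  thus ?thesis using IQ by linarith
 qed
 finally have "(LINT x|lborel. f x) = 0" using fn by (intro antisym integral_nonneg_AE) auto
 hence "AE x in lborel. f x = 0" using integral_nonneg_eq_0_iff_AE[OF fi] fn by simp
 moreover have "continuous_on (ball x0 de) f"
 proof -
  have "continuous_on (ball x0 de) (%x. D x * be x)" by (intro continuous_on_mult bec continuous_on_subset[OF Dc sub])
  thus ?thesis by (rule continuous_on_cong[THEN iffD1, rotated 2]) (use sub in \<open>auto simp: f_def\<close>)
 qed
 ultimately have "f x0 = 0" using de(1) by (intro continuous_AE_zero_ball[of x0 de f]) auto
 moreover have "0 < be x0" using de(1) by (simp add: be_def ramp_pos)
 ultimately show False using Dpos[of x0] de(1) x0 by (simp add: f_def)
qed
from this[of 1] this[of "- 1"] show ?thesis by auto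
qed

text \<open>The bound \<open>C\<close> of the weighted vertical derivative is uniform over all data
  with sup norm \<open>K\<close>. The bound of the horizontal part involves the energy of
  \<open>u\<close>, so it is recorded only qualitatively, inside \<open>bdd_field\<close>.\<close>

lemma regularity_field:
assumes reg: "regularity_radius TYPE('n::finite) a p lm lp K R"
shows "EX C>0. ALL (g :: 'n point => real) u. datum a g & sup_norm_sphere g = K & weak_solution a p lm lp g u -->
 (EX F. is_H1a_grad a 1 u F & bdd_field a R F & (ALL z:half_ball R. \<bar>snd z powr a * snd (F z)\<bar> <= C))"
proof -
let ?A = "%C F. C * sqrt (LINT z:half_ball 1|lborel. snd z powr a * (norm (F z))^2)"
obtain al C where al: "0 < al" and C: "0 < C" and *: "ALL (g :: 'n point => real) u.
   datum a g & sup_norm_sphere g = K & weak_solution a p lm lp g u -->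
   (EX F. is_H1a_grad a 1 u F &
    holder_norm al (half_ball R) (%z. fst (F z))
     <= ennreal (?A C F) &
    holder_norm al (half_ball R) (%z. snd z powr a * snd (F z)) <= ennreal C)"
 using reg unfolding regularity_radius_def by blast
show ?thesis
proof (intro exI[of _ C] conjI allI impI C)
 fix g u :: "'n point => real"
 assume "datum a g & sup_norm_sphere g = K & weak_solution a p lm lp g u"
 then obtain F where F: "is_H1a_grad a 1 u F"
  and h1: "holder_norm al (half_ball R) (%z. fst (F z)) <= ennreal (?A C F)"
  and h2: "holder_norm al (half_ball R) (%z. snd z powr a * snd (F z)) <= ennreal C" using * by blast
 define M where "M = max 0 (?A C F)"
 have b1: "norm (fst (F z)) <= M" if "z : half_ball R" for z unfolding M_def by (rule holder_norm_le(1)[OF h1 al that])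
 have b2: "\<bar>snd z powr a * snd (F z)\<bar> <= C" if "z : half_ball R" for z using holder_norm_le(1)[OF h2 al that] C by simp
 have "continuous_on (half_ball R) (%z. snd z powr - a * (snd z powr a * snd (F z)))"
  by (intro continuous_on_mult holder_norm_le(2)[OF h2 al] continuous_on_powr continuous_on_snd continuous_on_id continuous_on_const)
   (auto dest: half_ballD)
 moreover have "snd z powr - a * (snd z powr a * snd (F z)) = snd (F z)" if "z : half_ball R" for z
  using half_ballD(1)[OF that] by (simp add: mult.assoc[symmetric] powr_add[symmetric])
 ultimately have "continuous_on (half_ball R) (%z. snd (F z))" by (simp cong: continuous_on_cong)
 hence "continuous_on (half_ball R) (%z. (fst (F z), snd (F z)))"
  by (intro continuous_on_Pair holder_norm_le(2)[OF h1 al])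
 hence "bdd_field a R F"
  unfolding bdd_field_def using b1 b2
  by (intro conjI exI[of _ "max M C"] ballI) (auto simp: le_max_iff_disj)
 thus "EX F. is_H1a_grad a 1 u F & bdd_field a R F & (ALL z:half_ball R. \<bar>snd z powr a * snd (F z)\<bar> <= C)"
  using F b2 by blast
qed
qed

subsection \<open>The Weiss and Monneau functionals\<close>

lemma admissibleD:
assumes "admissible a R ps G"
shows "continuous_on (half_ball R \<union> thin_ball R) ps" "continuous_on (half_ball R) ps" "bdd_field a R G"
 "EX C>=0. ALL z:half_ball R \<union> thin_ball R. \<bar>ps z\<bar> <= C"
 "!!z. z : half_ball R ==> (ps has_derivative (%h. G z \<bullet> h)) (at z)"
proof -
show 1: "continuous_on (half_ball R \<union> thin_ball R) ps" and "bdd_field a R G"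
 and "!!z. z : half_ball R ==> (ps has_derivative (%h. G z \<bullet> h)) (at z)"
 using assms unfolding admissible_def by blast+
show "continuous_on (half_ball R) ps" by (rule continuous_on_subset[OF 1]) auto
obtain C where "ALL z:half_ball R \<union> thin_ball R. \<bar>ps z\<bar> <= C" using assms unfolding admissible_def by blast
thus "EX C>=0. ALL z:half_ball R \<union> thin_ball R. \<bar>ps z\<bar> <= C"
 by (intro exI[of _ "max 0 C"]) (auto simp: le_max_iff_disj)
qed

lemma admissible_subset: "admissible a R ps G ==> rh <= R ==> admissible a rh ps G"
using admissible_affine[of 1 rh 0 R a ps G 1] by (simp add: zero_prod_def[symmetric])

lemma conormal_subset: "conormal a R V b ==> rh <= R ==> conormal a rh V b"
using conormal_translate[of a R V b rh 0] by (simp add: zero_prod_def[symmetric])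

lemma admissible_translate:
"admissible a R ps G ==> rh + norm x0 <= R ==> admissible a rh (%z. ps (z + (x0, 0))) (%z. G (z + (x0, 0)))"
using admissible_affine[of 1 rh x0 R a ps G 1] by simp

lemma ray_derivative:
fixes th :: "('n::finite) point"
assumes "!!z. z : half_ball R ==> (v has_derivative (%h. V z \<bullet> h)) (at z)" "th : half_sphere 1" "0 < s" "s < R"
shows "((%s. v (s *. th)) has_real_derivative V (s *. th) \<bullet> th) (at s)"
proof -
have "((%s. s *. th) has_derivative (%h. h *. th)) (at s)" by (auto intro!: derivative_eq_intros)
from has_derivative_compose[OF this assms(1)[OF scaled_half_sphere[OF assms(2-4)]]]
have "((%s. v (s *. th)) has_derivative (%h. V (s *. th) \<bullet> (h *. th))) (at s)" .
thus ?thesis by (rule has_derivative_imp_has_field_derivative) simp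
qed

lemma sphere_slice_measurable:
fixes v :: "('n::finite) point => 'b::topological_space"
assumes v: "continuous_on (half_ball R) v" and s: "s : {0<..<R}"
shows "(%th. v (s *. th)) : bmeas (sph a)"
proof (rule continuous_on_measurable_sph, rule continuous_on_compose2[OF v])
show "continuous_on (half_sphere 1) (%th::'n point. s *. th)" by (intro continuous_on_scaleR continuous_on_const continuous_on_id)
show "(%th. s *. th) ` half_sphere 1 <= half_ball R"
 using s by (intro image_subsetI scaled_half_sphere) auto
qed

lemma bdd_field_one_bound:
fixes V :: "('n::finite) point => 'n point"
assumes a: "-1 < a" "a < 1" and V: "bdd_field a R V"
shows "s : {0<..<R} ==> (%th. V (s *. th) \<bullet> th) : bmeas (sph a)"
 and "0 < c ==> d < R ==> EX B. ALL s:{c..d}. ALL th:half_sphere 1. \<bar>V (s *. th) \<bullet> th\<bar> <= B"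
using sphere_average_continuous(3)[OF a V continuous_on_const[of _ 1], of 1 s]
 sphere_average_continuous(5)[OF a V continuous_on_const[of _ 1], of 1 c d] by auto

context
fixes a R :: real and v :: "('n::finite) point => real" and V :: "'n point => 'n point" and B :: real
assumes a: "-1 < a" "a < 1" and vc: "continuous_on (half_ball R) v"
 and vb: "!!z. z : half_ball R ==> \<bar>v z\<bar> <= B" and Vb: "bdd_field a R V"
 and vd: "!!z. z : half_ball R ==> (v has_derivative (%h. V z \<bullet> h)) (at z)"
begin

text \<open>The fixed factor \<open>k\<close> serves products in which \<open>u\<close> is evaluated
  at a moving radius while the flux of the gradient stays at a fixed one, as happens for the
  competitor in the Weiss inequality.\<close>

lemma weighted_average_derivative:
assumes k: "k : bmeas (sph a)" "!!th. th : half_sphere 1 ==> \<bar>k th\<bar> <= C" and s: "s : {0<..<R}"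
shows "((%s. \<integral>th. v (s *. th) * k th \<partial>sph a) has_real_derivative (\<integral>th. (V (s *. th) \<bullet> th) * k th \<partial>sph a)) (at s)"
proof (rule integral_param_has_derivative[OF finite_measure_sph[OF a(1)] _ _ _ _ _ s])
let ?A = "%s th. V (s *. th) \<bullet> th"
show "(%th. v (s *. th) * k th) : bmeas (sph a)" if "s : {0<..<R}" for s
 using sphere_slice_measurable[OF vc that] k by measurable
show "(%th. (?A s th) * k th) : bmeas (sph a)" if "s : {0<..<R}" for s
 using bdd_field_one_bound(1)[OF a Vb that] k by measurable
show "((%s. v (s *. th) * k th) has_real_derivative (?A s th) * k th) (at s)"
 if "th : space (sph a)" "s : {0<..<R}" for th s
 by (intro DERIV_cmult_right ray_derivative[OF vd]) (use that in auto)
fix c d :: real assume cd: "0 < c" "d < R"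
show "EX B. ALL s:{c..d}. ALL th:space (sph a). \<bar>v (s *. th) * k th\<bar> <= B"
proof (intro exI[of _ "B * C"] ballI)
 fix s and th :: "'n point" assume s: "s : {c..d}" and th: "th : space (sph a)"
 have z: "s *. th : half_ball R" using s th cd by (intro scaled_half_sphere) auto
 thus "\<bar>v (s *. th) * k th\<bar> <= B * C"
  unfolding abs_mult using vb[OF z] k(2)[of th] th by (intro mult_mono) auto
qed
obtain B' where B': "ALL s:{c..d}. ALL th:half_sphere 1. \<bar>V (s *. th) \<bullet> th\<bar> <= B'"
 using bdd_field_one_bound(2)[OF a Vb cd] by blast
show "EX B. ALL s:{c..d}. ALL th:space (sph a). \<bar>(?A s th) * k th\<bar> <= B"
proof (intro exI[of _ "B' * C"] ballI)
 fix s and th :: "'n point" assume "s : {c..d}" "th : space (sph a)"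
 thus "\<bar>(?A s th) * k th\<bar> <= B' * C"
  unfolding abs_mult using B' k(2)[of th] by (intro mult_mono) fastforce+
qed
qed

lemma average_derivative:
assumes s: "s : {0<..<R}"
shows "((%s. \<integral>th. v (s *. th) \<partial>sph a) has_real_derivative (\<integral>th. V (s *. th) \<bullet> th \<partial>sph a)) (at s)"
using weighted_average_derivative[of "%_. 1" 1, OF _ _ s] by simp

lemma square_average_derivative:
assumes s: "s : {0<..<R}"
shows "((%s. \<integral>th. (v (s *. th))^2 \<partial>sph a) has_real_derivative 2 * (\<integral>th. v (s *. th) * (V (s *. th) \<bullet> th) \<partial>sph a)) (at s)"
proof -
let ?A = "%s th. v (s *. th) * (V (s *. th) \<bullet> th)"
note sac = sphere_average_continuous[OF a Vb vc vb]
have "((%s. \<integral>th. (v (s *. th))^2 \<partial>sph a) has_real_derivative (\<integral>th. 2 * (?A s th) \<partial>sph a)) (at s)"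
proof (rule integral_param_has_derivative[OF finite_measure_sph[OF a(1)] _ _ _ _ _ s])
 show "(%th. (v (s *. th))^2) : bmeas (sph a)" if "s : {0<..<R}" for s
  using sphere_slice_measurable[OF vc that] by measurable
 show "(%th. 2 * (?A s th)) : bmeas (sph a)" if "s : {0<..<R}" for s
  using sac(3)[OF _ that] by measurable
 show "((%s. (v (s *. th))^2) has_real_derivative 2 * (?A s th)) (at s)"
  if "th : space (sph a)" "s : {0<..<R}" for th s
 proof -
  have "((%s. v (s *. th)) has_real_derivative V (s *. th) \<bullet> th) (at s)"
   by (rule ray_derivative[OF vd]) (use that in auto)
  from DERIV_power[OF this, of 2] show ?thesis by (simp add: mult_ac)
 qed
 fix c d :: real assume cd: "0 < c" "d < R"
 show "EX B. ALL s:{c..d}. ALL th:space (sph a). \<bar>(v (s *. th))^2\<bar> <= B"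
 proof (intro exI[of _ "B^2"] ballI)
  fix s and th :: "'n point" assume s: "s : {c..d}" and th: "th : space (sph a)"
  have z: "s *. th : half_ball R" using s th cd by (intro scaled_half_sphere) auto
  thus "\<bar>(v (s *. th))^2\<bar> <= B^2"
   using power_mono[OF vb[OF z], of 2] by simp
 qed
 obtain B' where B': "ALL s:{c..d}. ALL th:half_sphere 1. \<bar>v (s *. th) * (V (s *. th) \<bullet> th)\<bar> <= B'"
  using sac(5)[OF _ cd] by blast
 thus "EX B. ALL s:{c..d}. ALL th:space (sph a). \<bar>2 * (?A s th)\<bar> <= B"
  by (intro exI[of _ "2 * B'"]) (simp add: abs_mult)
qed
thus ?thesis by simp
qed

end

lemma continuous_ball_integrable:
fixes f :: "'a::euclidean_space => real"
assumes "continuous_on (cball 0 r) f"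
shows "set_integrable lborel (ball 0 r) f"
proof (rule set_integrable_subset)
show "set_integrable lborel (cball 0 r) f"
 unfolding set_integrable_def by (rule borel_integrable_compact[OF compact_cball assms])
qed auto

text \<open>All that is retained of the solution: a regular pair \<open>u\<close>, \<open>F\<close>
  and the boundary equation in conormal form. These hypotheses survive horizontal translation and
  restriction, so the results apply around every centre of the thin ball.\<close>

locale frequency_setting =
fixes a p lm lp R :: real and u :: "('n::finite) point => real" and F :: "'n point => 'n point"
assumes a: "-1 < a" "a < 1" and p: "2 <= p" and lm: "0 <= lm" and lp: "0 <= lp" and R: "0 < R"
 and adm: "admissible a R u F" and con: "conormal a R F (%x. boundary_term p lm lp (u (x, 0)))"
begin

abbreviation bt :: "real ^ 'n => real" where "bt x == boundary_term p lm lp (u (x, 0))"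
abbreviation pot :: "real ^ 'n => real" where "pot x == potential p lm lp (u (x, 0))"

text \<open>Unnormalised quantities: r^(1-N-a) \<open>Een\<close> is the numerator D + (2/p) G of
  the perturbed frequency, whereas \<open>Hen\<close> is already H, and \<open>Len\<close> is half
  its derivative.\<close>

definition Ien :: "real => real" where "Ien r = (\<integral>z. (norm (F z))^2 \<partial>hwt a r)"
definition Ben :: "real => real" where "Ben r = (LINT x:ball 0 r|lborel. pot x)"
definition Een :: "real => real" where "Een r = Ien r + 2 / p * Ben r"
definition Hen :: "real => real" where "Hen r = (\<integral>th. (u (r *. th))^2 \<partial>sph a)"
definition Len :: "real => real" where "Len r = (\<integral>th. u (r *. th) * (F (r *. th) \<bullet> th) \<partial>sph a)"

lemmas uD = admissibleD[OF adm]

lemma u_thin_continuous: "continuous_on (ball 0 R) (%x. u (x, 0))"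
by (rule continuous_on_compose2[OF uD(1)]) (auto simp: thin_ball_def intro!: continuous_on_Pair continuous_on_id continuous_on_const)

lemma u_bounded: obtains B where "0 <= B" "!!z. z : half_ball R ==> \<bar>u z\<bar> <= B" "!!x. x : ball 0 R ==> \<bar>u (x, 0)\<bar> <= B"
proof -
obtain B where "0 <= B" "ALL z:half_ball R \<union> thin_ball R. \<bar>u z\<bar> <= B" using uD(4) by blast
thus ?thesis by (intro that[of B]) (auto simp: thin_ball_def)
qed

lemma pot_cont: "continuous_on (ball 0 R) pot"
and bt_cont: "continuous_on (ball 0 R) bt"
using continuous_on_compose2[OF continuous_potential[OF p] u_thin_continuous]
 continuous_on_compose2[OF continuous_boundary_term[OF p] u_thin_continuous] by auto

lemma thin_integrable: "continuous_on (ball 0 R) f ==> r < R ==> set_integrable lborel (ball 0 r) (f :: real ^ 'n => real)"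
by (rule continuous_ball_integrable, rule continuous_on_subset) auto

lemma Ben_nonneg: "0 <= Ben r"
unfolding Ben_def set_lebesgue_integral_def
by (intro integral_nonneg_AE AE_I2) (simp add: potential_nonneg[OF lm lp])

lemma Ben_mono: "r <= s ==> s < R ==> Ben r <= Ben s"
unfolding Ben_def set_lebesgue_integral_def
using thin_integrable[OF pot_cont, of r] thin_integrable[OF pot_cont, of s] potential_nonneg[OF lm lp] unfolding set_integrable_def
by (intro integral_mono) (auto simp: indicator_def)

lemma F_L2: "r <= R ==> integrable (hwt a r) (%z. (norm (F z))^2)"
by (rule bdd_field_L2(3)[OF a admissibleD(3)[OF admissible_subset[OF adm]]])

lemma Ien_nonneg: "0 <= Ien r"
unfolding Ien_def by (intro integral_nonneg_AE AE_I2) simp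

lemma Ien_mono: "r <= s ==> s <= R ==> Ien r <= Ien s"
proof -
assume rs: "r <= s" "s <= R"
note i = F_L2[OF rs(2)]
have "Ien r = (\<integral>z. ind (half_ball r) z * (norm (F z))^2 \<partial>hwt a s)"
 unfolding Ien_def by (rule integral_wt_subset[OF borel_measurable_integrable[OF i] rs(1)])
also have "... <= Ien s"
 unfolding Ien_def
proof (rule integral_mono'[OF i])
 show "ind (half_ball r) z * (norm (F z))^2 <= (norm (F z))^2" for z by (simp add: indicator_def)
qed simp
finally show ?thesis .
qed

lemma Een_nonneg: "0 <= Een r"
unfolding Een_def using Ien_nonneg[of r] Ben_nonneg[of r] p by simp

text \<open>The field is tested with its own potential \<open>u\<close>; homogeneity turns the
  boundary term into the potential.\<close>

lemma divergence_u:
assumes r: "0 < r" "r < R"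
shows "Ien r + Ben r = r powr (real CARD('n) + a) * Len r"
proof -
let ?A = "(\<integral>z. F z \<bullet> F z \<partial>hwt a r)"
let ?B = "(LINT x:ball 0 r|lborel. bt x * u (x, 0))"
have "?A - ?B =
  r powr (real CARD('n) + a) * (\<integral>th. u (r *. th) * (F (r *. th) \<bullet> th) \<partial>sph a)"
 by (rule conormal_divergence[OF a con adm r])
moreover have "?A = Ien r" by (simp add: Ien_def power2_norm_eq_inner)
moreover have "?B = - Ben r"
 unfolding Ben_def potential_eq set_lebesgue_integral_def by simp
ultimately show ?thesis by (simp add: Len_def)
qed

lemma Len_cont: "continuous_on {0<..<R} Len"
proof -
obtain B where "!!z. z : half_ball R ==> \<bar>u z\<bar> <= B" using u_bounded by metis
thus ?thesis unfolding Len_def[abs_def] by (rule sphere_average_continuous(1)[OF a uD(3) uD(2)])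
qed

text \<open>The divergence theorem gives continuity of \<open>Ien + Ben\<close> only. Both summands
  are nondecreasing and \<open>2 / p <= 1\<close>, so the increments of \<open>Een\<close> are
  dominated by those of the sum.\<close>

lemma Een_cont: "continuous_on {0<..<R} Een"
proof -
have S: "continuous_on {0<..<R} (%r. Ien r + Ben r)"
proof -
 have "continuous_on {0<..<R} (%r. r powr (real CARD('n) + a) * Len r)"
  by (intro continuous_on_mult Len_cont continuous_on_powr continuous_on_id continuous_on_const) auto
 thus ?thesis by (rule continuous_on_cong[THEN iffD1, rotated 2]) (auto simp: divergence_u)
qed
have le: "\<bar>Een s - Een r\<bar> <= \<bar>(Ien s + Ben s) - (Ien r + Ben r)\<bar>" if rs: "r < R" "s < R" for r s
proof -
 have p2: "2 / p <= 1" "0 <= 2 / p" using p by auto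
 have *: "\<bar>Een s - Een r\<bar> <= \<bar>(Ien s + Ben s) - (Ien r + Ben r)\<bar>" if "r <= s" "s < R" for r s
 proof -
  have i: "0 <= Ien s - Ien r" "0 <= Ben s - Ben r" using Ien_mono[of r s] Ben_mono[of r s] that by auto
  define X where "X = 2 / p * (Ben s - Ben r)"
  have "Een s - Een r = (Ien s - Ien r) + X" by (simp add: Een_def X_def right_diff_distrib)
  moreover have "0 <= X" unfolding X_def by (rule mult_nonneg_nonneg[OF p2(2) i(2)])
  moreover have "X <= 1 * (Ben s - Ben r)" unfolding X_def by (rule mult_right_mono[OF p2(1) i(2)])
  moreover have "(Ien s - Ien r) + (Ben s - Ben r) <= \<bar>(Ien s + Ben s) - (Ien r + Ben r)\<bar>" by linarith
  ultimately show ?thesis using i by simp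
 qed
 show ?thesis using *[of r s] *[of s r] rs by (cases "r <= s") (auto simp: abs_minus_commute)
qed
show ?thesis
 unfolding continuous_on_def
proof (intro ballI)
 fix r assume r: "r : {0<..<R}"
 have "((%s. \<bar>(Ien s + Ben s) - (Ien r + Ben r)\<bar>) ---> 0) (at r within {0<..<R})"
  using S r unfolding continuous_on_def by (intro tendsto_rabs_zero LIM_zero) auto
 hence "((%s. Een s - Een r) ---> 0) (at r within {0<..<R})"
  by (rule Lim_null_comparison[rotated]) (use le r in \<open>auto simp: eventually_at_filter\<close>)
 thus "(Een ---> Een r) (at r within {0<..<R})" by (simp only: LIM_zero_iff)
qed
qed

lemma Hen_derivative:
assumes r: "r : {0<..<R}"
shows "(Hen has_real_derivative 2 * Len r) (at r)"
proof -
obtain B where "!!z. z : half_ball R ==> \<bar>u z\<bar> <= B" using u_bounded by metis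
thus ?thesis
 unfolding Hen_def[abs_def] Len_def by (rule square_average_derivative[OF a uD(2) _ uD(3) uD(5) r])
qed

lemma Hen_nonneg: "0 <= Hen r"
unfolding Hen_def by (intro integral_nonneg_AE AE_I2) simp

definition Qen :: "real => real" where "Qen r = (\<integral>th. (F (r *. th) \<bullet> th)^2 \<partial>sph a)"

lemma slice_integrable:
assumes r: "r : {0<..<R}"
shows "integrable (sph a) (%th. (u (r *. th))^2)" "integrable (sph a) (%th. u (r *. th) * (F (r *. th) \<bullet> th))"
 "integrable (sph a) (%th. (F (r *. th) \<bullet> th)^2)"
proof -
interpret S: finite_measure "sph a :: 'n point measure" by (rule finite_measure_sph[OF a(1)])
obtain B where B: "0 <= B" "!!z. z : half_ball R ==> \<bar>u z\<bar> <= B" using u_bounded by metis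
obtain C where C: "!!th. th : half_sphere 1 ==> \<bar>F (r *. th) \<bullet> th\<bar> <= C"
 using bdd_field_one_bound(2)[OF a uD(3), of r r] r by auto
have z: "r *. th : half_ball R" if "th : half_sphere 1" for th :: "'n point" using r that by (intro scaled_half_sphere) auto
note m = sphere_slice_measurable[OF uD(2) r] bdd_field_one_bound(1)[OF a uD(3) r]
have b1: "\<bar>u (r *. th)\<bar> <= B" if "th : half_sphere 1" for th using B(2)[OF z[OF that]] .
show "integrable (sph a) (%th. (u (r *. th))^2)"
 by (rule S.integrable_const_bound[where B = "B^2"], rule AE_I2)
  (use power_mono[OF b1, of _ 2] m in \<open>simp_all add: borel_measurable_power\<close>)
show "integrable (sph a) (%th. u (r *. th) * (F (r *. th) \<bullet> th))"
proof (rule S.integrable_const_bound[where B = "B * C"], rule AE_I2)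
 fix th :: "'n point" assume "th : space (sph a)"
 hence "th : half_sphere 1" by simp
 thus "norm (u (r *. th) * (F (r *. th) \<bullet> th)) <= B * C"
  unfolding real_norm_def abs_mult by (intro mult_mono b1 C B abs_ge_zero)
qed (rule borel_measurable_times[OF m])
show "integrable (sph a) (%th. (F (r *. th) \<bullet> th)^2)"
 by (rule S.integrable_const_bound[where B = "C^2"], rule AE_I2)
  (use power_mono[OF C, of _ 2] m in \<open>simp_all add: borel_measurable_power\<close>)
qed

text \<open>The expanded integral of (r F.th - ka u)^2, which by Euler's identity measures how far
  \<open>u\<close> is from being homogeneous of degree \<open>ka\<close>.\<close>

lemma Qen_ge: assumes r: "r : {0<..<R}" shows "0 <= r^2 * Qen r - 2 * ka * r * Len r + ka^2 * Hen r"
proof -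
let ?A = "%th. F (r *. th) \<bullet> th"
note i = slice_integrable[OF r]
have "0 <= (\<integral>th. (r * (?A th) - ka * u (r *. th))^2 \<partial>sph a)" by (intro integral_nonneg_AE AE_I2) simp
also have "... = (\<integral>th. r^2 * (?A th)^2 - 2 * ka * r * (u (r *. th) * (?A th)) + ka^2 * (u (r *. th))^2 \<partial>sph a)"
 by (rule Bochner_Integration.integral_cong) (simp_all add: power2_eq_square algebra_simps)
also have "... = r^2 * Qen r - 2 * ka * r * Len r + ka^2 * Hen r"
 unfolding Qen_def Len_def Hen_def using i by simp
finally show ?thesis .
qed

lemma Ben_scale:
assumes mw: "0 < mw" and r: "mw * r <= R"
shows "(LINT x:ball 0 r|lborel. potential p lm lp (mw powr - ka * u (mw *. x, 0))) = mw powr (- ka * p - real CARD('n)) * Ben (mw * r)"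
proof -
define f where "f x = ind (ball 0 (mw * r)) x *. pot x" for x
have fm: "f : bmeas borel" unfolding f_def
 by (intro borel_measurable_continuous_on_indicator continuous_on_subset[OF pot_cont]) (use r in \<open>auto simp: borel_open\<close>)
have "Ben (mw * r) = mw ^ CARD('n) * (LINT x|lborel. f (mw *. x))"
 unfolding Ben_def set_lebesgue_integral_def f_def[symmetric] using lborel_integral_affine[OF fm mw, of 0] by simp
hence B: "mw powr - real CARD('n) * Ben (mw * r) = (LINT x|lborel. f (mw *. x))"
 using mw by (simp add: powr_realpow[symmetric] mult.assoc[symmetric] powr_add[symmetric])
have P: "potential p lm lp (mw powr - ka * t) = mw powr (- ka * p) * potential p lm lp t" for t
 using potential_scale[of "mw powr - ka"] mw by (simp add: powr_powr)
have i: "ind (ball 0 r) x = (ind (ball 0 (mw * r)) (mw *. x) :: real)" for x :: "real ^ 'n"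
 using mw by (simp add: indicator_def)
have "(LINT x:ball 0 r|lborel. potential p lm lp (mw powr - ka * u (mw *. x, 0))) = (LINT x|lborel. mw powr (- ka * p) * f (mw *. x))"
 unfolding set_lebesgue_integral_def f_def P i by (simp add: mult_ac)
also have "... = mw powr (- ka * p) * (mw powr - real CARD('n) * Ben (mw * r))" by (simp add: B)
also have "... = mw powr (- ka * p - real CARD('n)) * Ben (mw * r)"
 by (simp only: mult.assoc[symmetric] powr_add[symmetric] add_uminus_conv_diff)
finally show ?thesis .
qed

text \<open>The exponent is 2(1 - ka) from the amplitude of the rescaled gradient plus -a-(N+1) from
  the change of variables.\<close>

lemma Ien_scale:
assumes mw: "0 < mw" and r: "mw * r <= R"
shows "integrable (hwt a r) (%z. (norm (mw powr (1 - ka) *. F (mw *. z)))^2)" (is "integrable ?W ?f")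
 and "(\<integral>z. (norm (mw powr (1 - ka) *. F (mw *. z)))^2 \<partial>hwt a r) <= mw powr (- 2 * ka - (real CARD('n) + a - 1)) * Ien (mw * r)"
proof -
let ?A = "(- a - real (CARD('n) + 1))"
let ?B = "(half_ball (mw * r))"
let ?C = "(- 2 * ka - (real CARD('n) + a - 1))"
let ?D = "(\<integral>z. ?f z \<partial>?W)"
have sub: "mw * r + norm (0 :: real ^ 'n) <= mw * r" by simp
note Fs = admissibleD(3)[OF admissible_subset[OF adm r]]
have "bdd_field a r (%z. mw powr (1 - ka) *. F (mw *. z))"
 using bdd_field_affine[OF mw sub Fs, of "mw powr (1 - ka)"] by (simp add: zero_prod_def[symmetric])
thus i: "integrable ?W ?f" by (rule bdd_field_L2(3)[OF a])
let ?k = "mw powr (2 - 2 * ka)"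
have k: "(norm (mw powr (1 - ka) *. F (mw *. z)))^2 = ?k * (norm (F (mw *. z)))^2" for z
 by (simp add: power_mult_distrib power2_eq_square[of "mw powr (1 - ka)"] powr_add[symmetric])
define h where "h z = ennreal ((norm (F z))^2)" for z
have hm: "h : bmeas (wt a ?B)"
 unfolding h_def using bdd_field_L2(1)[OF a Fs] by measurable
have hm': "(%z. h (mw *. z + (0, 0))) : bmeas ?W" by (rule affine_measurable[OF mw sub hm])
have "ennreal ?D = (\<integral>\<^sup>+z. ennreal (?f z) \<partial>?W)" by (rule nn_integral_eq_integral[OF i, symmetric]) simp
also have "... = (\<integral>\<^sup>+z. ennreal ?k * h (mw *. z + (0, 0)) \<partial>?W)"
 unfolding k h_def by (simp add: ennreal_mult zero_prod_def[symmetric])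
also have "... = ennreal ?k * (\<integral>\<^sup>+z. h (mw *. z + (0, 0)) \<partial>?W)" by (rule nn_integral_cmult[OF hm'])
also have "... <= ennreal ?k * (ennreal (mw powr ?A) * (\<integral>\<^sup>+z. h z \<partial>wt a ?B))"
 by (intro mult_left_mono nn_integral_wt_affine_le[OF mw sub hm]) simp
also have "(\<integral>\<^sup>+z. h z \<partial>wt a ?B) = ennreal (Ien (mw * r))"
 unfolding h_def Ien_def by (rule nn_integral_eq_integral[OF F_L2[OF r]]) simp
also have "ennreal ?k * (ennreal (mw powr ?A) * ennreal (Ien (mw * r))) =
  ennreal (?k * mw powr ?A * Ien (mw * r))"
 using Ien_nonneg by (simp add: ennreal_mult mult.assoc)
also have "?k * mw powr ?A = mw powr ?C"
 unfolding powr_add[symmetric] by (simp add: algebra_simps)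
finally show "?D <= mw powr ?C * Ien (mw * r)"
 using Ien_nonneg by (subst (asm) ennreal_le_iff) auto
qed

text \<open>
The homogeneous rescaling of \<open>u\<close> is used as a competitor: by convexity of the energy, the gain
is bounded below by the boundary flux of \<open>u\<close> tested with the difference.
\<close>

lemma weiss_inequality:
assumes ka: "0 <= ka" and r: "0 < r" "mw * r < R" and mw: "1 < mw"
shows "mw powr (- 2 * ka - (real CARD('n) + a - 1)) * Een (mw * r) >=
 Een r + 2 * r powr (real CARD('n) + a) * (mw powr - ka * (\<integral>th. u ((mw * r) *. th) * (F (r *. th) \<bullet> th) \<partial>sph a) - Len r)"
proof -
let ?A = "(- 2 * ka - (real CARD('n) + a - 1))"
let ?B = "%w. (LINT x:ball 0 r|lborel. bt x * w (x, 0))"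
let ?C = "%w. (LINT x:ball 0 r|lborel. potential p lm lp (w (x, 0)))"
let ?D = "%w. (\<integral>th. w (r *. th) * (F (r *. th) \<bullet> th) \<partial>sph a)"
let ?E = "(real CARD('n) + a)"
let ?F = "%x w. p * (bt x * w (x, 0)) + p * pot x"
\<comment> \<open>The rescaled function lives on the half ball of this radius, which still exceeds
  \<open>r\<close>.\<close>
define rh where "rh = R / mw"
have l0: "0 < mw" using mw by simp
have rh: "mw * rh = R" "r < rh" "rh <= R" using mw r R by (auto simp: rh_def field_simps)
have r_R: "r <= R" using rh by simp
define w where "w z = mw powr - ka * u (mw *. z)" for z
define W where "W z = mw powr (1 - ka) *. F (mw *. z)" for z
let ?M = "wt a (half_ball r :: 'n point set)"
have W: "admissible a rh w W"
proof -
 have "mw powr - ka * mw = mw powr (1 - ka)" using l0 by (simp add: powr_diff powr_minus field_simps)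
 thus ?thesis
  using admissible_affine[of mw rh "0 :: real ^ 'n" R a u F "mw powr - ka"] l0 rh adm
  by (simp add: w_def[abs_def] W_def[abs_def] zero_prod_def[symmetric])
qed
have C: "conormal a rh F bt" by (rule conormal_subset[OF con rh(3)])
have FW: "(\<integral>z. F z \<bullet> W z \<partial>?M) - (?B w) = r powr ?E * (?D w)"
 by (rule conormal_divergence[OF a C W r(1) rh(2)])
have FF: "Ien r + Ben r = r powr ?E * Len r" using divergence_u r rh by simp
have adr: "bdd_field a r F" "bdd_field a r W"
 using admissibleD(3)[OF admissible_subset[OF adm r_R]] admissibleD(3)[OF admissible_subset[OF W less_imp_le[OF rh(2)]]] .
have iF: "integrable ?M (%z. (norm (F z))^2)" and iW: "integrable ?M (%z. (norm (W z))^2)" and iFW: "integrable ?M (%z. F z \<bullet> W z)"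
 using bdd_field_L2(3)[OF a adr(1)] bdd_field_L2(3)[OF a adr(2)] bdd_field_inner_integrable[OF a adr] .
have c1: "2 * (\<integral>z. F z \<bullet> W z \<partial>?M) - Ien r <= (\<integral>z. (norm (W z))^2 \<partial>?M)"
proof -
 have "2 * (\<integral>z. F z \<bullet> W z \<partial>?M) - Ien r = (\<integral>z. 2 * (F z \<bullet> W z) - (norm (F z))^2 \<partial>?M)"
  unfolding Ien_def using iF iFW by simp
 also have "... <= (\<integral>z. (norm (W z))^2 \<partial>?M)"
 proof (rule integral_mono)
  show "integrable ?M (%z. 2 * (F z \<bullet> W z) - (norm (F z))^2)" using iF iFW by simp
  fix z
  have "0 <= (F z - W z) \<bullet> (F z - W z)" by simp
  thus "2 * (F z \<bullet> W z) - (norm (F z))^2 <= (norm (W z))^2"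
   unfolding power2_norm_eq_inner inner_diff_left inner_diff_right by (simp add: inner_commute)
 qed (rule iW)
 finally show ?thesis .
qed
have wc: "continuous_on (ball 0 rh) (%x. w (x, 0))"
 by (rule continuous_on_compose2[OF admissibleD(1)[OF W]]) (auto simp: thin_ball_def intro!: continuous_on_Pair continuous_on_id continuous_on_const)
have ucr: "continuous_on (cball 0 r) (%x. u (x, 0))" and wcr: "continuous_on (cball 0 r) (%x. w (x, 0))"
proof -
 have "cball 0 r <= ball (0 :: real ^ 'n) R" "cball 0 r <= ball (0 :: real ^ 'n) rh" using rh by auto
 thus "continuous_on (cball 0 r) (%x. u (x, 0))" "continuous_on (cball 0 r) (%x. w (x, 0))"
  using continuous_on_subset[OF u_thin_continuous] continuous_on_subset[OF wc] by blast+
qed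
have btr: "continuous_on (cball 0 r) bt" by (rule continuous_on_subset[OF bt_cont]) (use rh in auto)
have i1: "set_integrable lborel (ball 0 r) (%x. bt x * w (x, 0))"
 and i2: "set_integrable lborel (ball 0 r) pot"
 and i3: "set_integrable lborel (ball 0 r) (%x. potential p lm lp (w (x, 0)))"
 using continuous_ball_integrable[OF continuous_on_mult[OF btr wcr]]
  continuous_ball_integrable[OF continuous_on_compose2[OF continuous_potential[OF p] ucr subset_UNIV]]
  continuous_ball_integrable[OF continuous_on_compose2[OF continuous_potential[OF p] wcr subset_UNIV]] .
\<comment> \<open>The tangent inequality at \<open>u\<close>, integrated; the identity - p bt u = p
  pot turns its linear term in \<open>u\<close> into a multiple of \<open>Ben r\<close>.\<close>
have c2: "Ben r - (p * (?B w) + p * Ben r) <= (?C w)"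
proof -
 have "Ben r - (p * (?B w) + p * Ben r) = (LINT x:ball 0 r|lborel. pot x - (?F x w))"
  unfolding Ben_def using i1 i2 by (simp add: set_integral_diff set_integral_add)
 also have "... <= (?C w)"
 proof (rule set_integral_mono[OF _ i3])
  show "set_integrable lborel (ball 0 r) (%x. pot x - (?F x w))"
   using i1 i2 by (intro set_integral_diff set_integral_add) auto
  fix x :: "real ^ 'n"
  have "pot x - p * bt x * (w (x, 0) - u (x, 0)) <= potential p lm lp (w (x, 0))"
   using potential_convex[OF p lm lp] .
  moreover have "pot x = - (bt x * u (x, 0))" by (rule potential_eq)
  hence "p * pot x = - (p * bt x * u (x, 0))" by simp
  ultimately show "pot x - (?F x w) <= potential p lm lp (w (x, 0))"
   by (simp only: right_diff_distrib mult.assoc)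
 qed
 finally show ?thesis .
qed
have s1: "(\<integral>z. (norm (W z))^2 \<partial>?M) <= mw powr ?A * Ien (mw * r)"
 unfolding W_def by (rule Ien_scale(2)) (use l0 r in auto)
\<comment> \<open>The potential scales with the exponent -ka p - N. Since \<open>mw > 1\<close>,
  \<open>p >= 2\<close> and \<open>a < 1\<close>, the larger exponent of the gradient part may be
  used for both terms.\<close>
have s2: "(?C w) <= mw powr ?A * Ben (mw * r)"
proof -
 have "(?C w) = mw powr (- ka * p - real CARD('n)) * Ben (mw * r)"
  unfolding w_def using Ben_scale[of mw r ka] l0 r by simp
 also have "... <= mw powr ?A * Ben (mw * r)"
 proof (intro mult_right_mono powr_mono Ben_nonneg)
  have "ka * 2 <= ka * p" using ka p by (intro mult_left_mono) auto
  thus "- ka * p - real CARD('n) <= - 2 * ka - (real CARD('n) + a - 1)" using a by simp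
 qed (use mw in simp)
 finally show ?thesis .
qed
have J: "(?D w) = mw powr - ka * (\<integral>th. u ((mw * r) *. th) * (F (r *. th) \<bullet> th) \<partial>sph a)" (is "_ = ?J")
 by (simp add: w_def mult.assoc)
have "2 / p * (Ben r - (p * (?B w) + p * Ben r)) <= 2 / p * (mw powr ?A * Ben (mw * r))"
 using c2 s2 p by (intro mult_left_mono) auto
hence "2 / p * Ben r - 2 * (?B w) - 2 * Ben r <= mw powr ?A * (2 / p * Ben (mw * r))"
 using p by (simp add: right_diff_distrib distrib_left mult_ac)
hence "Ien r + 2 / p * Ben r + 2 * ((\<integral>z. F z \<bullet> W z \<partial>?M) - (?B w) - (Ien r + Ben r))
  <= mw powr ?A * Een (mw * r)"
proof -
 define X Y Z where "X = 2 / p * Ben r" and "Y = mw powr ?A * (2 / p * Ben (mw * r))"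
  and "Z = mw powr ?A * Ien (mw * r)"
 have "X - 2 * (?B w) - 2 * Ben r <= Y"
  using \<open>2 / p * Ben r - 2 * _ - 2 * Ben r <= _\<close> by (simp only: X_def Y_def)
 moreover have "2 * (\<integral>z. F z \<bullet> W z \<partial>?M) - Ien r <= Z" unfolding Z_def by (rule order_trans[OF c1 s1])
 moreover have "x - 2 * b - 2 * c <= y ==> 2 * d - e <= z ==> e + x + 2 * (d - b - (e + c)) <= z + y" for b c d e x y z :: real
  by (simp add: algebra_simps)
 ultimately have "Ien r + X + 2 * ((\<integral>z. F z \<bullet> W z \<partial>?M) - (?B w) - (Ien r + Ben r)) <= Z + Y"
  by blast
 moreover have "mw powr ?A * Een (mw * r) = Z + Y"
  unfolding Een_def Y_def Z_def by (rule distrib_left)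
 ultimately show ?thesis unfolding X_def by (simp only:)
qed
moreover have "(\<integral>z. F z \<bullet> W z \<partial>?M) - (?B w) - (Ien r + Ben r) = r powr ?E * (?J - Len r)"
 unfolding FW FF J by (simp add: right_diff_distrib)
ultimately show ?thesis unfolding Een_def[of r] by (simp add: mult.assoc)
qed

end

lemma sph_bounded_integrable:
fixes f :: "('n::finite) point => real"
assumes a: "-1 < a" and m: "f : bmeas (sph a)" and b: "!!th. th : half_sphere 1 ==> \<bar>f th\<bar> <= C"
shows "integrable (sph a) f"
proof -
interpret S: finite_measure "sph a :: 'n point measure" by (rule finite_measure_sph[OF a])
show ?thesis by (rule S.integrable_const_bound[where B = C, OF AE_I2 m]) (use b in simp)
qed

context frequency_setting
begin

text \<open>The functional is known to be continuous, not differentiable. At each radius x the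
  inequality \<open>weiss_inequality\<close> with \<open>mw = s / x\<close> provides a minorant on s
  > x that touches it at x, is differentiable there and has nonnegative derivative; this is the Dini
  condition.\<close>

lemma weiss_nondecreasing:
assumes ka: "0 <= ka" and r: "0 < r1" "r1 <= r2" "r2 < R"
shows "r1 powr (- 2 * ka - (real CARD('n) + a - 1)) * Een r1 - ka * (r1 powr (- 2 * ka) * Hen r1) <=
 r2 powr (- 2 * ka - (real CARD('n) + a - 1)) * Een r2 - ka * (r2 powr (- 2 * ka) * Hen r2)"
proof -
let ?A = "%c. - 2 * ka - c"
let ?B = "(- 2 * ka - 1)"
let ?C = "(1 - 2 * ka)"
let ?D = "(- 2 * ka)"
let ?E = "%s x A. (s / x) powr - ka * A s - Len x"
let ?F = "(real CARD('n) + a)"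
define c where "c = real CARD('n) + a - 1"
define W where "W r = r powr (?A c) * Een r - ka * (r powr ?D * Hen r)" for r
have "W r1 <= W r2"
proof (rule dini_nondecreasing[OF _ r(2)])
 have sub: "{r1..r2} <= {0<..<R}" using r by auto
 have Hc: "continuous_on {0<..<R} Hen"
  using Hen_derivative DERIV_isCont continuous_at_imp_continuous_on by blast
 show "continuous_on {r1..r2} W"
  unfolding W_def using r
  by (intro continuous_on_diff continuous_on_mult continuous_on_powr continuous_on_id continuous_on_const
    continuous_on_subset[OF Een_cont sub] continuous_on_subset[OF Hc sub]) auto
 fix x e :: real assume x: "r1 <= x" "x < r2" and e: "0 < e"
 have x0: "0 < x" "x < R" using x r by auto
 have xR: "x : {0<..<R}" using x0 by simp
 define A where "A s = (\<integral>th. u (s *. th) * (F (x *. th) \<bullet> th) \<partial>sph a)" for s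
 obtain B where B: "!!z. z : half_ball R ==> \<bar>u z\<bar> <= B" using u_bounded by metis
 have "EX C. ALL s:{x..x}. ALL th:half_sphere 1. \<bar>F (s *. th) \<bullet> th\<bar> <= C"
  by (rule bdd_field_one_bound(2)[OF a uD(3) x0])
 then obtain C where C: "!!th. th : half_sphere 1 ==> \<bar>F (x *. th) \<bullet> th\<bar> <= C" by auto
 have dA: "(A has_real_derivative Qen x) (at x)"
  using weighted_average_derivative[OF a uD(2) B uD(3) uD(5) bdd_field_one_bound(1)[OF a uD(3) xR] C xR]
  by (simp add: A_def[abs_def] Qen_def power2_eq_square)
 have Ax: "A x = Len x" by (simp add: A_def Len_def)
 \<comment> \<open>The minorant: the energy at \<open>s\<close> is replaced by the lower bound from
   the rescaled competitor, in which the flux of \<open>F\<close> stays at radius \<open>x\<close>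
   and only \<open>u\<close> moves.\<close>
 define Ph where "Ph s = x powr (?A c) * Een x + 2 * x powr ?C * (?E s x A) - ka * (s powr ?D * Hen s)" for s
 define D where "D = 2 * x powr ?C * (- ka / x * Len x + Qen x) - ka * (- 2 * ka * x powr ?B * Hen x + 2 * Len x * x powr ?D)"
 have dp: "((%s. (s / x) powr - ka) has_real_derivative - ka / x) (at x)"
  using x0 by (auto intro!: derivative_eq_intros)
 have dq: "((%s. s powr ?D) has_real_derivative - 2 * ka * x powr ?B) (at x)"
  by (rule has_real_derivative_powr[OF x0(1)])
 have "((%s. (s / x) powr - ka * A s) has_real_derivative - ka / x * A x + Qen x * (x / x) powr - ka) (at x)"
  by (rule DERIV_mult[OF dp dA])
 hence d1: "((%s. (s / x) powr - ka * A s) has_real_derivative - ka / x * Len x + Qen x) (at x)"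
  using x0 by (simp add: Ax)
 have d2: "((%s. s powr ?D * Hen s) has_real_derivative - 2 * ka * x powr ?B * Hen x + 2 * Len x * x powr ?D) (at x)"
  by (rule DERIV_mult[OF dq Hen_derivative[OF xR]])
 have d3: "((%s. x powr (?A c) * Een x + 2 * x powr ?C * (?E s x A)) has_real_derivative
   0 + 2 * x powr ?C * (- ka / x * Len x + Qen x - 0)) (at x)"
  by (intro DERIV_add DERIV_const DERIV_cmult DERIV_diff d1)
 have dPh: "(Ph has_real_derivative D) (at x)"
  using DERIV_diff[OF d3 DERIV_cmult[OF d2, of ka]] unfolding Ph_def[abs_def] D_def by simp
 have "x powr ?C = x powr ?B * x powr 2" by (simp add: powr_add[symmetric])
 hence e1: "x powr ?C = x powr ?B * x^2" using x0 by simp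
 have "x powr ?D = x powr ?B * x powr 1" by (simp only: powr_add[symmetric]) simp
 hence e2: "x powr ?D = x powr ?B * x" using x0 by simp
 \<comment> \<open>The derivative of the minorant is a positive multiple of the complete square of
   \<open>Qen_ge\<close>.\<close>
 have "D = 2 * x powr ?B * (x^2 * Qen x - 2 * ka * x * Len x + ka^2 * Hen x)"
  unfolding D_def e1 e2 using x0 by (simp add: field_simps power2_eq_square)
 also have "0 <= ..." by (intro mult_nonneg_nonneg Qen_ge xR) auto
 finally have D0: "0 <= D" .
 have Phx: "Ph x = W x" using x0 by (simp add: Ph_def W_def Ax)
 have Phs: "Ph s <= W s" if s: "x < s" "s < R" for s
 proof -
  have ineq: "Een x + 2 * x powr ?F * (?E s x A) <= (s / x) powr (?A c) * Een s"
   using weiss_inequality[OF ka x0(1), of "s / x"] s x0 by (simp add: A_def c_def)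
  have "x powr (?A c) * (Een x + 2 * x powr ?F * (?E s x A))
    <= x powr (?A c) * ((s / x) powr (?A c) * Een s)"
   by (rule mult_left_mono[OF ineq]) simp
  moreover have "x powr (?A c) * (s / x) powr (?A c) = s powr (?A c)"
   using s x0 by (simp add: powr_mult[symmetric])
  moreover have "x powr (?A c) * x powr ?F = x powr ?C"
   by (simp add: powr_add[symmetric] c_def algebra_simps)
  ultimately have "x powr (?A c) * Een x + 2 * x powr ?C * (?E s x A) <= s powr (?A c) * Een s"
   by (simp only: distrib_left mult.assoc[symmetric] mult.left_commute[of _ 2])
    (simp only: mult.assoc mult.left_commute[of _ 2])
  thus ?thesis unfolding Ph_def W_def by linarith
 qed
 have "(%h. (Ph (x + h) - Ph x) / h) \<midarrow>0\<rightarrow> D" using dPh by (simp add: DERIV_def)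
 hence "eventually (%h. - e < (Ph (x + h) - Ph x) / h) (at 0)" using D0 e by (intro order_tendstoD(1)) auto
 then obtain d where d: "0 < d" "!!h. h ~= 0 ==> \<bar>h\<bar> < d ==> - e < (Ph (x + h) - Ph x) / h"
  unfolding eventually_at by (auto simp: dist_real_def)
 show "EX h>0. x + h <= r2 & (ALL t:{0<..<h}. W (x + t) >= W x - e * t)"
 proof (intro exI[of _ "min d (r2 - x)"] conjI ballI)
  fix t assume t: "t : {0<..<min d (r2 - x)}"
  hence "- e < (Ph (x + t) - Ph x) / t" by (intro d(2)) auto
  hence "- e * t < Ph (x + t) - Ph x" using t by (simp add: pos_less_divide_eq)
  moreover have "Ph (x + t) <= W (x + t)" using t r by (intro Phs) auto
  ultimately show "W (x + t) >= W x - e * t" unfolding Phx by linarith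
 qed (use d x in auto)
qed
thus ?thesis by (simp only: W_def c_def)
qed

text \<open>
If the frequency were below \<open>k\<close> at some radius then, by monotonicity of the Weiss functional with
an exponent \<open>ka < k\<close>, it would stay below \<open>ka\<close> at all smaller radii.
\<close>

lemma frequency_lower:
assumes lim: "((%r. r powr (- (real CARD('n) + a - 1)) * Een r / Hen r) ---> k) (at_right 0)" and r: "0 < r" "r < R"
shows "k * Hen r <= r powr (- (real CARD('n) + a - 1)) * Een r"
proof (rule ccontr)
define c where "c = real CARD('n) + a - 1"
define T where "T s = s powr - c * Een s" for s
assume "~ k * Hen r <= r powr (- (real CARD('n) + a - 1)) * Een r"
hence less: "T r < k * Hen r" by (simp add: T_def c_def)
have T0: "0 <= T s" for s unfolding T_def using Een_nonneg by simp
have H: "0 < Hen r" using less T0[of r] Hen_nonneg[of r] by (cases "Hen r = 0") auto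
\<comment> \<open>An exponent strictly between the frequency at \<open>r\<close> and its limit
  \<open>k\<close>: the gap on one side makes the functional negative at \<open>r\<close>, the gap
  on the other yields the contradiction.\<close>
define ka where "ka = (T r / Hen r + k) / 2"
have lt: "T r / Hen r < k" using less H by (simp add: pos_divide_less_eq)
have mid: "x < (x + k) / 2" "(x + k) / 2 < k" if "x < k" for x using that by auto
have ka: "T r / Hen r < ka" "ka < k" using mid[OF lt] by (simp_all only: ka_def)
have "0 <= T r / Hen r" using T0 H by simp
hence ka0: "0 <= ka" using ka by simp
have Wr: "s powr (- 2 * ka - c) * Een s - ka * (s powr (- 2 * ka) * Hen s) = s powr (- 2 * ka) * (T s - ka * Hen s)" for s
 by (simp add: T_def right_diff_distrib mult.assoc[symmetric] powr_add[symmetric])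
have freq: "T s / Hen s < ka" if s: "0 < s" "s <= r" for s
proof -
 have "s powr (- 2 * ka) * (T s - ka * Hen s) <= r powr (- 2 * ka) * (T r - ka * Hen r)"
  using weiss_nondecreasing[OF ka0 s r(2)] unfolding c_def[symmetric] Wr .
 also have "... < 0" using ka(1) H r by (simp add: mult_pos_neg pos_divide_less_eq)
 finally have "T s < ka * Hen s" using s by (simp add: mult_less_0_iff)
 \<comment> \<open>As \<open>T s\<close> is nonnegative, the strict inequality also excludes
   \<open>Hen s = 0\<close>, so dividing is legitimate at every smaller radius.\<close>
 moreover from this have "0 < Hen s" using T0[of s] Hen_nonneg[of s] by (cases "Hen s = 0") auto
 ultimately show ?thesis by (simp add: pos_divide_less_eq)
qed
have "k <= ka"
proof (rule tendsto_upperbound[OF lim])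
 show "eventually (%s. s powr (- (real CARD('n) + a - 1)) * Een s / Hen s <= ka) (at_right 0)"
  unfolding eventually_at_right_field using freq r by (intro exI[of _ r]) (auto simp: T_def c_def less_imp_le)
qed simp
thus False using ka by simp
qed

section \<open>Consequences of the lower frequency bound\<close>

context
fixes k :: nat
assumes freq: "!!r. 0 < r ==> r < R ==> real k * Hen r <= r powr (- (real CARD('n) + a - 1)) * Een r"
begin

text \<open>By the divergence theorem r \<open>Len\<close> is the normalised sum
  \<open>Ien + Ben\<close>, and this dominates the perturbed energy because
  \<open>2 / p <= 1\<close>.\<close>

lemma Len_lower:
assumes r: "0 < r" "r < R"
shows "real k * Hen r <= r * Len r"
proof -
let ?A = "(- (real CARD('n) + a - 1))"
have "real k * Hen r <= r powr ?A * Een r" by (rule freq[OF r])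
also have "... <= r powr ?A * (Ien r + Ben r)"
proof (intro mult_left_mono)
 have "2 / p * Ben r <= 1 * Ben r" using p Ben_nonneg by (intro mult_right_mono) auto
 thus "Een r <= Ien r + Ben r" by (simp add: Een_def)
qed simp
also have "... = (r powr ?A * r powr (real CARD('n) + a)) * Len r"
 unfolding divergence_u[OF r] by simp
also have "r powr ?A * r powr (real CARD('n) + a) = r"
 using r by (simp add: powr_add[symmetric])
finally show ?thesis .
qed

text \<open>The derivative of r^(-2k) \<open>Hen\<close> is 2 r^(-2k-1) (r \<open>Len\<close> - k
  \<open>Hen\<close>), nonnegative by \<open>Len_lower\<close>.\<close>

lemma Hen_growth:
assumes r: "0 < r" "r <= s" "s < R"
shows "Hen r <= (r / s) ^ (2 * k) * Hen s"
proof -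
define b where "b = - 2 * real k"
have "r powr b * Hen r <= s powr b * Hen s"
proof (rule DERIV_nonneg_imp_nondecreasing[OF r(2)])
 fix x assume x: "r <= x" "x <= s"
 have x0: "0 < x" "x < R" using x r by auto
 have "((%x. x powr b * Hen x) has_real_derivative b * x powr (b - 1) * Hen x + 2 * Len x * x powr b) (at x)"
  by (rule DERIV_mult[OF has_real_derivative_powr Hen_derivative]) (use x0 in auto)
 moreover have "b * x powr (b - 1) * Hen x + 2 * Len x * x powr b = 2 * x powr (b - 1) * (x * Len x - real k * Hen x)"
 proof -
  have "x powr b = x powr (b - 1) * x powr 1" by (simp only: powr_add[symmetric]) simp
  hence "x powr b = x powr (b - 1) * x" using x0 by simp
  thus ?thesis by (simp add: b_def algebra_simps)
 qed
 moreover have "0 <= 2 * x powr (b - 1) * (x * Len x - real k * Hen x)"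
  using Len_lower[OF x0] by (intro mult_nonneg_nonneg) auto
 ultimately show "EX y. ((%x. x powr b * Hen x) has_real_derivative y) (at x) & 0 <= y" by metis
qed
hence "r powr (2 * real k) * (r powr b * Hen r) <= r powr (2 * real k) * (s powr b * Hen s)" by (rule mult_left_mono) simp
moreover have "r powr (2 * real k) * (r powr b * Hen r) = Hen r"
 using r by (simp add: mult.assoc[symmetric] powr_add[symmetric] b_def)
moreover have "r powr (2 * real k) * (s powr b * Hen s) = (r / s) ^ (2 * k) * Hen s"
 using r by (simp add: b_def powr_minus powr_realpow[symmetric] powr_divide field_simps)
ultimately show ?thesis by simp
qed

section \<open>The Monneau functional\<close>

context
fixes q :: "'n point => real"
assumes q: "admissible a R q (grad q)" "conormal a R (grad q) (%_. 0)" and euler: "!!z. grad q z \<bullet> z = real k * q z"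
begin

text \<open>\<open>Mdiff\<close> is H of the difference, \<open>2 * Mflux\<close> its derivative,
  and \<open>Mder\<close> the resulting derivative of the Monneau functional.\<close>

definition Mdiff :: "real => real" where "Mdiff s = (\<integral>th. (u (s *. th) - q (s *. th))^2 \<partial>sph a)"
definition Mflux :: "real => real" where
"Mflux s = (\<integral>th. (u (s *. th) - q (s *. th)) * ((F (s *. th) - grad q (s *. th)) \<bullet> th) \<partial>sph a)"
definition Mder :: "real => real" where
"Mder s = 2 * Mflux s / s ^ (2 * k) - real (2 * k) * Mdiff s / s ^ (2 * k + 1)"

lemmas qD = admissibleD[OF q(1)]

lemma Mdiff_derivative: "s : {0<..<R} ==> (Mdiff has_real_derivative 2 * Mflux s) (at s)"
and Mflux_continuous: "continuous_on {0<..<R} Mflux"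
proof -
obtain B where B: "!!z. z : half_ball R ==> \<bar>u z\<bar> <= B" using u_bounded by metis
obtain B' where B': "!!z. z : half_ball R ==> \<bar>q z\<bar> <= B'" using qD(4) by blast
have b: "\<bar>u z - q z\<bar> <= B + B'" if "z : half_ball R" for z
 using B[OF that] B'[OF that] by linarith
have c: "continuous_on (half_ball R) (%z. u z - q z)" by (rule continuous_on_diff[OF uD(2) qD(2)])
have d: "((%z. u z - q z) has_derivative (%h. (F z - grad q z) \<bullet> h)) (at z)" if "z : half_ball R" for z
 using has_derivative_diff[OF uD(5)[OF that] qD(5)[OF that]] by (simp add: inner_diff_left)
have V: "bdd_field a R (%z. F z - grad q z)"
 unfolding bdd_field_def
proof (intro conjI)
 show "continuous_on (half_ball R) (%z. F z - grad q z)"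
  using uD(3) qD(3) unfolding bdd_field_def by (intro continuous_on_diff) auto
 obtain C where C: "ALL z:half_ball R. norm (fst (F z)) <= C & \<bar>snd z powr a * snd (F z)\<bar> <= C"
  using uD(3) unfolding bdd_field_def by blast
 obtain C' where C': "ALL z:half_ball R. norm (fst (grad q z)) <= C' & \<bar>snd z powr a * snd (grad q z)\<bar> <= C'"
  using qD(3) unfolding bdd_field_def by blast
 show "EX C. ALL z:half_ball R. norm (fst (F z - grad q z)) <= C & \<bar>snd z powr a * snd (F z - grad q z)\<bar> <= C"
 proof (intro exI[of _ "C + C'"] ballI conjI)
  fix z :: "'n point" assume z: "z : half_ball R"
  show "norm (fst (F z - grad q z)) <= C + C'"
   using norm_triangle_ineq4[of "fst (F z)" "fst (grad q z)"] C C' z by fastforce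
  show "\<bar>snd z powr a * snd (F z - grad q z)\<bar> <= C + C'"
   using abs_triangle_ineq4[of "snd z powr a * snd (F z)" "snd z powr a * snd (grad q z)"] C C' z
   by (fastforce simp: right_diff_distrib)
 qed
qed
show "(Mdiff has_real_derivative 2 * Mflux s) (at s)" if "s : {0<..<R}"
 unfolding Mdiff_def[abs_def] Mflux_def using square_average_derivative[OF a c b V d that] .
show "continuous_on {0<..<R} Mflux"
 unfolding Mflux_def[abs_def] by (rule sphere_average_continuous(1)[OF a V c b])
qed

lemma monneau_derivative:
assumes s: "s : {0<..<R}"
shows "((%s. Mdiff s / s ^ (2 * k)) has_real_derivative Mder s) (at s)"
proof -
let ?A = "(- real (2 * k))"
let ?B = "(- real (2 * k) - 1)"
let ?C = "(%s. Mdiff s * s powr ?A)"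
have p1: "((%s. s powr ?A) has_real_derivative - real (2 * k) * s powr ?B) (at s)"
 by (rule has_real_derivative_powr) (use s in simp)
have "(?C has_real_derivative 2 * Mflux s * s powr ?A + - real (2 * k) * s powr ?B * Mdiff s) (at s)"
 by (rule DERIV_mult[OF Mdiff_derivative[OF s] p1])
moreover have e: "s powr (- real m) = inverse (s ^ m)" if "0 < s" for s :: real and m
 using that by (simp add: powr_minus powr_realpow)
have "- real (2 * k) - 1 = - real (2 * k + 1)" by simp
hence "s powr ?B = s powr (- real (2 * k + 1))" by (simp only:)
hence "2 * Mflux s * s powr ?A + - real (2 * k) * s powr ?B * Mdiff s = Mder s"
 using e[of s "2 * k"] e[of s "2 * k + 1"] s by (simp add: Mder_def divide_inverse)
ultimately have d: "(?C has_real_derivative Mder s) (at s)" by simp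
show ?thesis
proof (rule has_field_derivative_transform_within_open[OF d _ s])
 fix x assume "x : {0<..<R}"
 thus "Mdiff x * x powr ?A = Mdiff x / x ^ (2 * k)"
  using e[of x "2 * k"] by (simp only: divide_inverse) simp
qed simp
qed

lemma Mder_continuous: "continuous_on {0<..<R} Mder"
proof -
have "continuous_on {0<..<R} Mdiff"
 using Mdiff_derivative DERIV_isCont continuous_at_imp_continuous_on by blast
thus ?thesis
 unfolding Mder_def[abs_def]
 by (intro continuous_on_diff continuous_on_divide continuous_on_mult continuous_on_const Mflux_continuous
   continuous_on_power continuous_on_id) auto
qed

text \<open>Expanding the squares, the terms in \<open>q\<close> alone cancel by Euler's identity.
  The mixed flux of \<open>F\<close> against \<open>q\<close> is exchanged for that of
  \<open>grad q\<close> against \<open>u\<close> by two divergence identities with the same volume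
  term; as \<open>q\<close> has zero conormal derivative, the exchange leaves only the integral of
  \<open>bt * q\<close>. What remains besides it is \<open>r * Len r - k * Hen r\<close>, which is
  nonnegative.\<close>

lemma Mder_lower:
assumes r: "0 < r" "r < R"
shows "2 / r ^ (2 * k + 1) * (r powr (- (real CARD('n) + a - 1)) * (LINT x:ball 0 r|lborel. bt x * q (x, 0))) <= Mder r"
proof -
let ?A = "(- (real CARD('n) + a - 1))"
let ?B = "%r th. r *. th"
let ?C = "(real CARD('n) + a)"
let ?D = "%r. (\<integral>z. F z \<bullet> grad q z \<partial>hwt a r)"
let ?E = "%r. (\<integral>th. u (?B r th) * (grad q (?B r th) \<bullet> th) \<partial>sph a)"
let ?F = "%r. (\<integral>z. grad q z \<bullet> F z \<partial>hwt a r)"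
let ?G = "%r th. F (?B r th) \<bullet> th"
have rR: "r : {0<..<R}" using r by simp
define X where "X = (LINT x:ball 0 r|lborel. bt x * q (x, 0))"
define UQ where "UQ = (\<integral>th. u (?B r th) * q (?B r th) \<partial>sph a)"
define QQ where "QQ = (\<integral>th. (q (?B r th))^2 \<partial>sph a)"
define QF where "QF = (\<integral>th. q (?B r th) * (?G r th) \<partial>sph a)"
define ka where "ka = real k / r"
have rk: "r * (ka * Y) = real k * Y" for Y using r by (simp add: ka_def)
have eu: "grad q (?B r th) \<bullet> th = ka * q (?B r th)" for th
 using euler[of "r *. th"] r by (simp add: ka_def field_simps)
obtain B where B: "0 <= B" "!!z. z : half_ball R ==> \<bar>u z\<bar> <= B" using u_bounded by metis
obtain B' where B': "0 <= B'" "!!z. z : half_ball R ==> \<bar>q z\<bar> <= B'" using qD(4) by blast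
have "EX C. ALL s:{r..r}. ALL th:half_sphere 1. \<bar>F (s *. th) \<bullet> th\<bar> <= C"
 by (rule bdd_field_one_bound(2)[OF a uD(3) r])
then obtain C where C: "!!th. th : half_sphere 1 ==> \<bar>F (?B r th) \<bullet> th\<bar> <= C" by auto
have z: "r *. th : half_ball R" if "th : half_sphere 1" for th :: "'n point" by (rule scaled_half_sphere[OF that r])
note mu = sphere_slice_measurable[OF uD(2) rR] and mq = sphere_slice_measurable[OF qD(2) rR] and mF = bdd_field_one_bound(1)[OF a uD(3) rR]
have iUQ: "integrable (sph a) (%th. u (?B r th) * q (?B r th))"
 by (rule sph_bounded_integrable[where C = "B * B'", OF a(1) borel_measurable_times[OF mu mq]])
  (unfold abs_mult, intro mult_mono B B' z abs_ge_zero)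
have iQQ: "integrable (sph a) (%th. (q (?B r th))^2)"
 unfolding power2_eq_square
 by (rule sph_bounded_integrable[where C = "B' * B'", OF a(1) borel_measurable_times[OF mq mq]])
  (unfold abs_mult, intro mult_mono B B' z abs_ge_zero)
have iQF: "integrable (sph a) (%th. q (?B r th) * (?G r th))"
 by (rule sph_bounded_integrable[where C = "B' * C", OF a(1) borel_measurable_times[OF mq mF]])
  (unfold abs_mult, intro mult_mono C B' z abs_ge_zero)
note iU = slice_integrable[OF rR]
have flux: "Mflux r = Len r - QF - ka * (UQ - QQ)"
proof -
 have "Mflux r = (\<integral>th. u (?B r th) * (?G r th) - q (?B r th) * (?G r th)
   - ka * (u (?B r th) * q (?B r th) - (q (?B r th))^2) \<partial>sph a)"
  unfolding Mflux_def inner_diff_left eu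
  by (rule Bochner_Integration.integral_cong[OF refl]) (simp add: algebra_simps power2_eq_square)
 also have "... = Len r - QF - ka * (UQ - QQ)"
  unfolding Len_def QF_def UQ_def QQ_def using iU iUQ iQQ iQF by simp
 finally show ?thesis .
qed
have diff: "Mdiff r = Hen r - 2 * UQ + QQ"
proof -
 have "Mdiff r = (\<integral>th. (u (?B r th))^2 - 2 * (u (?B r th) * q (?B r th)) + (q (?B r th))^2 \<partial>sph a)"
  unfolding Mdiff_def by (rule Bochner_Integration.integral_cong[OF refl]) (simp add: algebra_simps power2_eq_square)
 also have "... = Hen r - 2 * UQ + QQ" unfolding Hen_def UQ_def QQ_def using iU iUQ iQQ by simp
 finally show ?thesis .
qed
have d1: "(?D r) - X = r powr ?C * QF"
 unfolding X_def QF_def by (rule conormal_divergence[OF a con q(1) r])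
have "(?F r) - (LINT x:ball 0 r|lborel. 0 * u (x, 0)) =
  r powr ?C * (?E r)"
 by (rule conormal_divergence[OF a q(2) adm r])
moreover have "(?E r) = ka * UQ"
 unfolding eu UQ_def by (simp add: mult.left_commute)
moreover have "(LINT x:ball 0 r|lborel. 0 * u (x, 0)) = 0" unfolding set_lebesgue_integral_def by simp
moreover have "(?F r) = (?D r)"
 by (simp only: inner_commute)
ultimately have "(?D r) = r powr ?C * (ka * UQ)" by simp
with d1 have "r powr ?C * QF = r powr ?C * (ka * UQ) - X" by simp
hence "r powr ?A * (r powr ?C * QF) =
  r powr ?A * (r powr ?C * (ka * UQ) - X)" by simp
moreover have "r powr ?A * (r powr ?C * Y) = r * Y" for Y
 using r by (simp add: mult.assoc[symmetric] powr_add[symmetric])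
ultimately have QF: "r * QF = real k * UQ - r powr ?A * X"
 by (simp only: right_diff_distrib rk)
have "Mder r = 2 / r ^ (2 * k + 1) * (r * Mflux r - real k * Mdiff r)"
 unfolding Mder_def using r by (simp add: field_simps)
also have "r * Mflux r - real k * Mdiff r = r * Len r - real k * Hen r + r powr ?A * X"
proof -
 have "r * Mflux r = r * Len r - r * QF - real k * (UQ - QQ)" unfolding flux by (simp only: right_diff_distrib[of r] rk)
 thus ?thesis unfolding diff QF by (simp add: algebra_simps)
qed
finally have "Mder r = 2 / r ^ (2 * k + 1) * (r * Len r - real k * Hen r + r powr ?A * X)" .
moreover have "2 / r ^ (2 * k + 1) * (r powr ?A * X) <=
  2 / r ^ (2 * k + 1) * (r * Len r - real k * Hen r + r powr ?A * X)"
 by (intro mult_left_mono) (use Len_lower[OF r] r in auto)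
ultimately show ?thesis unfolding X_def[symmetric] by (simp only:)
qed

end

end

end

subsection \<open>Growth on the thin ball\<close>

text \<open>The function C t^(1-a)/(1-a) is a primitive of the bound, and its sum with either sign
  of \<open>g\<close> is nondecreasing. Letting the lower end tend to 0 is possible because
  \<open>a < 1\<close>.\<close>

lemma derivative_powr_bound:
fixes g :: "real => real"
assumes a: "a < 1" and s: "0 < s" and C: "0 <= C"
 and d: "!!t. 0 < t ==> t <= s ==> (g has_real_derivative g' t) (at t)"
 and b: "!!t. 0 < t ==> t <= s ==> \<bar>g' t\<bar> <= C * t powr - a"
 and lim: "(g ---> g0) (at_right 0)"
shows "\<bar>g s - g0\<bar> <= C * (s powr (1 - a) / (1 - a))"
proof -
define h where "h t = C * (t powr (1 - a) / (1 - a))" for t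
have h0: "0 <= h t" for t unfolding h_def using C a by simp
have hd: "(h has_real_derivative C * t powr - a) (at t)" if "0 < t" for t
proof -
 have "((%t. t powr (1 - a)) has_real_derivative (1 - a) * t powr ((1 - a) - 1)) (at t)"
  by (rule has_real_derivative_powr[OF that])
 from DERIV_cmult[OF DERIV_cdivide[OF this, of "1 - a"], of C]
 show ?thesis unfolding h_def[abs_def] using a by simp
qed
have le: "\<bar>g s - g t\<bar> <= h s" if t: "0 < t" "t <= s" for t
proof -
 have m: "(h t + si * g t) <= (h s + si * g s)" if si: "\<bar>si\<bar> = 1" for si
 proof (rule DERIV_nonneg_imp_nondecreasing[OF t(2)])
  fix x assume x: "t <= x" "x <= s"
  have "((%x. h x + si * g x) has_real_derivative C * x powr - a + si * g' x) (at x)"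
   using x t by (intro DERIV_add DERIV_cmult hd d) auto
  moreover have "\<bar>si * g' x\<bar> <= C * x powr - a" using b[of x] x t si by (simp add: abs_mult)
  hence "0 <= C * x powr - a + si * g' x" by linarith
  ultimately show "EX y. ((%x. h x + si * g x) has_real_derivative y) (at x) & 0 <= y" by blast
 qed
 show ?thesis using m[of 1] m[of "- 1"] h0[of t] by simp
qed
have "((%t. \<bar>g s - g t\<bar>) ---> \<bar>g s - g0\<bar>) (at_right 0)" by (intro tendsto_rabs tendsto_diff tendsto_const lim)
moreover have "eventually (%t. \<bar>g s - g t\<bar> <= h s) (at_right 0)"
 unfolding eventually_at_right_field using le s by (intro exI[of _ s]) auto
ultimately have "\<bar>g s - g0\<bar> <= h s" by (rule tendsto_upperbound) simp
thus ?thesis by (simp only: h_def)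
qed

abbreviation sph_mass :: "'n::finite itself => real => real" where
"sph_mass _ a == measure (sph a :: 'n point measure) (half_sphere 1)"

lemma sphere_average_tendsto:
fixes v :: "('n::finite) point => real"
assumes a: "-1 < a" and R: "0 < R" and vc: "continuous_on (half_ball R \<union> thin_ball R) v"
 and vb: "!!z. z : half_ball R ==> \<bar>v z\<bar> <= B"
shows "((%s. \<integral>th. v (s *. th) \<partial>sph a) ---> measure (sph a :: 'n point measure) (half_sphere 1) * v 0) (at_right 0)"
proof (rule tendstoI)
let ?m = "measure (sph a :: 'n point measure) (half_sphere 1)"
let ?A = "%s. (\<integral>th. v (s *. th) \<partial>sph a)"
interpret S: finite_measure "sph a :: 'n point measure" by (rule finite_measure_sph[OF a])
fix e :: real assume e: "0 < e"
define e' where "e' = e / (?m + 1)"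
have m0: "0 <= ?m" by simp
have m1: "0 < ?m + 1" using m0 by linarith
have e': "0 < e'" unfolding e'_def by (rule divide_pos_pos[OF e m1])
have "0 : half_ball R \<union> (thin_ball R :: 'n point set)" using R by (simp add: thin_ball_def zero_prod_def)
then obtain d where d: "0 < d" "!!z. z : half_ball R \<union> thin_ball R ==> dist z 0 < d ==> dist (v z) (v 0) < e'"
 using vc e' unfolding continuous_on_iff by metis
have "dist (?A s) (?m * v 0) < e" if s: "0 < s" "s < min d R" for s
proof -
 have i: "integrable (sph a) (%th. v (s *. th))"
 proof (rule sph_bounded_integrable[OF a])
  show "(%th. v (s *. th)) : bmeas (sph a)"
   by (rule sphere_slice_measurable[of R], rule continuous_on_subset[OF vc]) (use s in auto)
  show "\<bar>v (s *. th)\<bar> <= B" if "th : half_sphere 1" for th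
   by (rule vb, rule scaled_half_sphere[OF that]) (use s in auto)
 qed
 have "(?A s) - ?m * v 0 = (\<integral>th. v (s *. th) - v 0 \<partial>sph a)" using i by simp
 hence "dist (?A s) (?m * v 0) = \<bar>\<integral>th. v (s *. th) - v 0 \<partial>sph a\<bar>" by (simp add: dist_real_def)
 also have "... <= (\<integral>th. \<bar>v (s *. th) - v 0\<bar> \<partial>sph a)" by (rule integral_abs_bound)
 also have "... <= (\<integral>th. e' \<partial>(sph a :: 'n point measure))"
 proof (rule integral_mono)
  show "integrable (sph a) (%th. \<bar>v (s *. th) - v 0\<bar>)" using i by simp
  fix th :: "'n point" assume "th : space (sph a)"
  hence th: "th : half_sphere 1" by simp
  have "dist (v (s *. th)) (v 0) < e'"
  proof (rule d(2))
   show "s *. th : half_ball R \<union> thin_ball R" using scaled_half_sphere[OF th, of s R] s by simp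
   show "dist (s *. th) 0 < d" unfolding dist_norm using s half_sphereD(2)[OF th] by simp
  qed
  thus "\<bar>v (s *. th) - v 0\<bar> <= e'" by (simp add: dist_real_def)
 qed simp
 also have "... = ?m * e'" by simp
 also have "... < e"
 proof -
  have "?m * e' < (?m + 1) * e'" using e' by simp
  also have "... = e" using m1 by (simp add: e'_def)
  finally show ?thesis .
 qed
 finally show ?thesis .
qed
thus "eventually (%s. dist (?A s) (?m * v 0) < e) (at_right 0)"
 unfolding eventually_at_right_field using d R by (intro exI[of _ "min d R"]) auto
qed

lemma measure_sph_pos:
assumes a: "-1 < a"
shows "0 < measure (sph a :: ('n::finite) point measure) (half_sphere 1)"
proof (rule ccontr)
let ?A = "%z. (real CARD('n) + 1) * snd (sgn z) powr a"
let ?B = "(lborel :: 'n point measure)"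
let ?C = "(sph a :: 'n point measure)"
interpret S: finite_measure "sph a :: 'n point measure" by (rule finite_measure_sph[OF a])
assume "~ 0 < measure ?C (half_sphere 1)"
hence "emeasure ?C (half_sphere 1) = 0"
 by (simp add: S.emeasure_eq_measure less_le)
hence "(\<integral>\<^sup>+th. 1 \<partial>?C) = 0" by simp
hence "(\<integral>\<^sup>+z\<in>half_ball 1. (ennreal (?A z) * 1) \<partial>?B) = 0"
 by (subst (asm) nn_integral_sph) auto
hence "AE z in ?B. ennreal (?A z) * 1 * ind (half_ball 1) z = 0"
 by (subst (asm) nn_integral_0_iff_AE) measurable
hence ae: "AE z in ?B. z \<notin> half_ball 1"
proof eventually_elim
 fix z :: "'n point"
 assume z: "ennreal (?A z) * 1 * ind (half_ball 1) z = 0"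
 show "z \<notin> half_ball 1"
 proof
  assume "z : half_ball 1"
  hence "0 < snd (sgn z)" using half_sphereD(1)[OF sgn_half_ball] by blast
  hence "0 < (real CARD('n) + 1) * snd (sgn z) powr a" by (intro mult_pos_pos) auto
  thus False using z \<open>z : half_ball 1\<close> by (simp add: ennreal_eq_0_iff)
 qed
qed
have "(0, 1/2) : (half_ball 1 :: 'n point set)" by (simp add: half_ball_def norm_Pair)
then obtain e where e: "0 < e" "ball (0, 1/2) e <= (half_ball 1 :: 'n point set)" using open_half_ball open_contains_ball by blast
have "(1 :: real) = 0"
 by (rule continuous_AE_zero_ball[of "(0, 1/2) :: 'n point" e "%_. 1"]) (use ae e in \<open>auto elim!: eventually_mono\<close>)
thus False by simp
qed

lemma measure_rad:
assumes b: "-1 < b" and rh: "0 <= rh"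
shows "measure (rad b rh) {0<..<rh} = rh powr (b + 1) / (b + 1)"
proof -
have "emeasure (rad b rh) {0<..<rh} = (\<integral>\<^sup>+s. 1 \<partial>rad b rh)" by simp
also have "... = (\<integral>\<^sup>+s\<in>{0<..<rh}. (ennreal (s powr b) * 1) \<partial>lborel)" by (rule nn_integral_rad) simp
also have "... = ennreal (rh powr (b + 1) / (b + 1))" using nn_integral_powr_finite[OF b rh] by simp
finally show ?thesis using b by (simp add: measure_def)
qed

text \<open>Averages over spheres around two centres are compared through integrals over nested half balls.\<close>

lemma average_comparison:
fixes w :: "('n::finite) point => real"
assumes a: "-1 < a" and wc: "continuous_on (half_ball R) w"
 and wn: "!!z. z : half_ball R ==> 0 <= w z" and wb: "!!z. z : half_ball R ==> w z <= B"
 and rh: "0 < rh" "rh + norm x0 <= rh'" "rh' <= R"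
 and lower: "!!s. 0 < s ==> s < rh ==> al <= (\<integral>th. w (s *. th + (x0, 0)) \<partial>sph a)"
 and upper: "!!s. 0 < s ==> s < rh' ==> (\<integral>th. w (s *. th) \<partial>sph a) <= be"
shows "al * rh powr (real CARD('n) + a + 1) <= be * rh' powr (real CARD('n) + a + 1)"
proof -
let ?b = "real CARD('n) + a"
let ?A = "(\<integral>z. w z \<partial>hwt a rh')"
let ?B = "%rh. (\<integral>z. w (z + (x0, 0)) \<partial>hwt a rh)"
have b: "-1 < ?b" using a by simp
have rh': "0 <= rh'" using rh norm_ge_zero[of x0] by linarith
have bnd: "integrable (hwt a r) f" if "continuous_on (half_ball r) f" "!!z. z : half_ball r ==> \<bar>f z\<bar> <= B"
 for f :: "'n point => real" and r
proof -
 interpret W: finite_measure "wt a (half_ball r :: 'n point set)" by (rule finite_measure_wt[OF a])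
 show ?thesis by (rule W.integrable_const_bound[where B = B, OF AE_I2 continuous_on_measurable_wt]) (use that in auto)
qed
have wB: "\<bar>w z\<bar> <= B" if "z : half_ball R" for z using wn[OF that] wb[OF that] by simp
have sub: "1 * rh + norm x0 <= rh'" using rh by simp
have T: "z + (x0, 0) : half_ball rh'" if "z : half_ball rh" for z
 using affine_half_ball[OF _ sub that] by simp
have i': "integrable (hwt a rh') w"
 using half_ball_mono[OF rh(3)] by (intro bnd continuous_on_subset[OF wc] wB) auto
have i: "integrable (hwt a rh) (%z. w (z + (x0, 0)))"
proof (rule bnd)
 show "continuous_on (half_ball rh) (%z. w (z + (x0, 0)))"
  using T half_ball_mono[OF rh(3)] by (intro continuous_on_compose2[OF wc] continuous_on_add continuous_on_id continuous_on_const) blast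
 show "\<bar>w (z + (x0, 0))\<bar> <= B" if "z : half_ball rh" for z using T[OF that] half_ball_mono[OF rh(3)] by (intro wB) blast
qed
\<comment> \<open>The shifted half ball is contained in the large one, and \<open>w\<close> is
  nonnegative.\<close>
have le: "(?B rh) <= ?A"
proof -
 have n: "0 <= w z" if "z : half_ball rh'" for z using that half_ball_mono[OF rh(3)] wn by blast
 have n0: "0 <= ?A" by (intro integral_nonneg_AE AE_I2) (simp add: n)
 have "ennreal (?B rh) = (\<integral>\<^sup>+z. ennreal (w (z + (x0, 0))) \<partial>hwt a rh)"
  by (rule nn_integral_eq_integral[OF i, symmetric], rule AE_I2) (use T n in simp)
 also have "... <= (\<integral>\<^sup>+z. ennreal (w z) \<partial>hwt a rh')"
  using nn_integral_wt_affine_le[OF _ sub, of "%z. ennreal (w z)" a] borel_measurable_integrable[OF i'] by simp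
 also have "... = ennreal ?A"
  by (rule nn_integral_eq_integral[OF i'], rule AE_I2) (simp add: n)
 finally show ?thesis using n0 by (subst (asm) ennreal_le_iff) auto
qed
interpret P: finite_measure "rad ?b rh" by (rule finite_measure_rad[OF b]) (use rh in simp)
interpret P': finite_measure "rad ?b rh'" by (rule finite_measure_rad[OF b rh'])
note pi = polar_integral[OF a less_imp_le[OF rh(1)] i] and pi' = polar_integral[OF a rh' i']
\<comment> \<open>The total masses of the radial measures produce the powers of the two
  radii.\<close>
have "al * (rh powr (?b + 1) / (?b + 1)) = (\<integral>s. al \<partial>rad ?b rh)" using measure_rad[OF b, of rh] rh by simp
also have "... <= (\<integral>s. (\<integral>th. w (s *. th + (x0, 0)) \<partial>sph a) \<partial>rad ?b rh)"
 using pi(1) lower by (intro integral_mono) auto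
also have "... = (?B rh)" by (rule pi(2)[symmetric])
also have "... <= ?A" by (rule le)
also have "... = (\<integral>s. (\<integral>th. w (s *. th) \<partial>sph a) \<partial>rad ?b rh')" by (rule pi'(2))
also have "... <= (\<integral>s. be \<partial>rad ?b rh')"
 using pi'(1) upper by (intro integral_mono) auto
also have "... = be * (rh' powr (?b + 1) / (?b + 1))" using measure_rad[OF b rh'] by simp
finally have "(al * rh powr (?b + 1)) / (?b + 1) <= (be * rh' powr (?b + 1)) / (?b + 1)" by simp
thus ?thesis using b by (simp add: divide_le_cancel)
qed

lemma ball_integral_bound:
fixes f :: "real ^ 'n::finite => real"
assumes f: "continuous_on (cball 0 r) f" and b: "!!x. x : ball 0 r ==> \<bar>f x\<bar> <= C" and r: "0 <= r"
shows "\<bar>LINT x:ball 0 r|lborel. f x\<bar> <= C * (unit_ball_vol (real CARD('n)) * r ^ CARD('n))"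
proof -
let ?A = "(ball (0 :: real ^ 'n) r)"
have i: "integrable lborel (%x. ind (ball 0 r) x *. f x)"
 using continuous_ball_integrable[OF f] unfolding set_integrable_def .
have ib: "integrable lborel (ind ?A :: _ => real)"
 using emeasure_lborel_ball_finite[of "0 :: real ^ 'n" r] by (intro integrable_real_indicator) auto
have "\<bar>LINT x:ball 0 r|lborel. f x\<bar> <= (LINT x|lborel. \<bar>ind (ball 0 r) x *. f x\<bar>)"
 unfolding set_lebesgue_integral_def by (rule integral_abs_bound)
also have "... <= (LINT x|lborel. C * ind ?A x)"
proof (rule integral_mono)
 show "integrable lborel (%x. \<bar>ind (ball 0 r) x *. f x\<bar>)" by (rule Bochner_Integration.integrable_abs[OF i])
 show "integrable lborel (%x. C * ind ?A x)" by (rule integrable_mult_right[OF ib])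
qed (use b in \<open>auto simp: indicator_def\<close>)
also have "... = C * measure lborel ?A" by simp
also have "measure lborel ?A = unit_ball_vol (real CARD('n)) * r ^ CARD('n)"
 using content_ball[OF r, of "0 :: real ^ 'n"] by simp
finally show ?thesis .
qed

text \<open>Explicit, hence the same for all solutions with the same bounds. \<open>C2\<close>
  bounds the vertical variation of \<open>u\<close>, and \<open>C1\<close> the deviation of
  spherical averages from the value at the centre. The powers of 3 and 2 compare half balls of radii
  R/4 and 3R/4, respectively r and 2r; the square root undoes the passage to \<open>u^2\<close>, and
  8/R comes from the growth of \<open>Hen\<close> between the radii 2r and R/4.\<close>

definition growth_const :: "'n::finite itself => real => real => real => real => nat => real" where
"growth_const _ a R C L k =
 (let m = measure (sph a :: 'n point measure) (half_sphere 1);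
    C2 = C * (R powr (1 - a) / (1 - a));
    C1 = C * unit_ball_vol (real CARD('n)) * (R powr (1 - a) / (1 - a))
  in sqrt (2 powr (real CARD('n) + a + 1)) * (8 / R) ^ k *
   (L + ((m * (L + C2) + C1) * 3 powr (real CARD('n) + a + 1) + C1) / m + C2))"

context frequency_setting
begin

lemma frequency_setting_translate:
assumes x0: "norm x0 < R"
shows "frequency_setting a p lm lp (R - norm x0) (%z. u (z + (x0, 0))) (%z. F (z + (x0, 0)))"
proof
show "conormal a (R - norm x0) (%z. F (z + (x0, 0))) (%x. boundary_term p lm lp (u ((x, 0) + (x0, 0))))"
 using conormal_translate[OF con, of "R - norm x0" x0] by simp
show "admissible a (R - norm x0) (%z. u (z + (x0, 0))) (%z. F (z + (x0, 0)))"
 by (rule admissible_translate[OF adm]) simp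
qed (use a p lm lp x0 in auto)

text \<open>Subharmonicity of \<open>u^2\<close> up to the boundary: by \<open>divergence_u\<close>
  the derivative of \<open>Hen\<close> is nonnegative, thanks to the sign of the nonlinearity, and
  \<open>Hen\<close> tends to the mass times the square of the central value.\<close>

lemma Hen_ge_centre:
assumes s: "0 < s" "s < R"
shows "sph_mass TYPE('n) a * (u 0)^2 <= Hen s"
proof -
obtain B where B: "!!z. z : half_ball R ==> \<bar>u z\<bar> <= B" using u_bounded by metis
have lim: "(Hen ---> sph_mass TYPE('n) a * (u 0)^2) (at_right 0)"
 unfolding Hen_def[abs_def]
proof (rule sphere_average_tendsto[OF a(1) R])
 show "continuous_on (half_ball R \<union> thin_ball R) (%z. (u z)^2)" by (intro continuous_on_power uD(1))
 show "\<bar>(u z)^2\<bar> <= B^2" if "z : half_ball R" for z using power_mono[OF B[OF that], of 2] by simp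
qed
have "Hen t <= Hen s" if t: "0 < t" "t <= s" for t
proof (rule DERIV_nonneg_imp_nondecreasing[OF t(2)])
 fix x assume x: "t <= x" "x <= s"
 have x0: "0 < x" "x < R" using x t s by auto
 have "0 <= x powr (real CARD('n) + a) * Len x"
  using divergence_u[OF x0] Ien_nonneg[of x] Ben_nonneg[of x] by simp
 hence "0 <= 2 * Len x" using x0 by (simp add: zero_le_mult_iff)
 thus "EX y. (Hen has_real_derivative y) (at x) & 0 <= y" using Hen_derivative[of x] x0 by auto
qed
hence "eventually (%t. Hen t <= Hen s) (at_right 0)"
 unfolding eventually_at_right_field using s by (intro exI[of _ s]) auto
thus ?thesis by (rule tendsto_upperbound[OF lim]) simp
qed

text \<open>Tested with the constant 1, the divergence theorem expresses the derivative of the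
  average by the integral of the nonlinearity over the thin ball, of size at most C times the volume
  t^N; divided by t^(N+a) this is an integrable power t^-a.\<close>

lemma average_near_centre:
assumes C: "!!x. x : ball 0 R ==> \<bar>bt x\<bar> <= C" and s: "0 < s" "s < R"
shows "\<bar>(\<integral>th. u (s *. th) \<partial>sph a) - sph_mass TYPE('n) a * u 0\<bar> <= C * unit_ball_vol (real CARD('n)) * (s powr (1 - a) / (1 - a))"
proof (rule derivative_powr_bound[OF a(2) s(1)])
let ?A = "(real CARD('n) + a)"
let ?B = "(%s. \<integral>th. u (s *. th) \<partial>sph a)"
let ?C = "%t. (\<integral>th. F (t *. th) \<bullet> th \<partial>sph a)"
obtain B where B: "!!z. z : half_ball R ==> \<bar>u z\<bar> <= B" using u_bounded by metis
have C0: "0 <= C" using C[of 0] R by force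
thus "0 <= C * unit_ball_vol (real CARD('n))" by simp
show "(?B ---> sph_mass TYPE('n) a * u 0) (at_right 0)"
 by (rule sphere_average_tendsto[OF a(1) R uD(1) B])
fix t assume t: "0 < t" "t <= s"
have tR: "t < R" using t s by simp
show "(?B has_real_derivative (?C t)) (at t)"
 by (rule average_derivative[OF a uD(2) B uD(3) uD(5)]) (use t tR in auto)
have g1: "grad (%_::'n point. 1 :: real) z = 0" for z by (rule grad_unique) simp
have ad1: "admissible a R (%_::'n point. 1) (grad (%_. 1))"
 by (rule admissible_even[OF a(1) R smooth_const]) simp
have "(\<integral>z. F z \<bullet> grad (%_. 1) z \<partial>hwt a t) - (LINT x:ball 0 t|lborel. bt x * 1) =
  t powr ?A * (\<integral>th. 1 * (F (t *. th) \<bullet> th) \<partial>sph a)"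
 by (rule conormal_divergence[OF a con ad1 t(1) tR])
hence "t powr ?A * (?C t) = - (LINT x:ball 0 t|lborel. bt x)"
 by (simp add: g1)
moreover have "\<bar>LINT x:ball 0 t|lborel. bt x\<bar> <= C * (unit_ball_vol (real CARD('n)) * t ^ CARD('n))"
 by (rule ball_integral_bound[OF continuous_on_subset[OF bt_cont] C]) (use t tR in auto)
ultimately have "t powr ?A * \<bar>\<integral>th. F (t *. th) \<bullet> th \<partial>sph a\<bar> <= C * unit_ball_vol (real CARD('n)) * t powr real CARD('n)"
 using t by (simp add: abs_mult[symmetric] powr_realpow abs_mult)
hence "t powr - ?A * (t powr ?A * \<bar>\<integral>th. F (t *. th) \<bullet> th \<partial>sph a\<bar>)
  <= t powr - ?A * (C * unit_ball_vol (real CARD('n)) * t powr real CARD('n))" by (rule mult_left_mono) simp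
moreover have "t powr - ?A * (t powr ?A * Y) = Y" for Y
 using t by (simp add: mult.assoc[symmetric] powr_add[symmetric])
moreover have "t powr - ?A * (Y * t powr real CARD('n)) = Y * t powr - a" for Y
 by (simp add: mult.left_commute powr_add[symmetric])
ultimately show "\<bar>\<integral>th. F (t *. th) \<bullet> th \<partial>sph a\<bar> <= C * unit_ball_vol (real CARD('n)) * t powr - a" by (simp only:)
qed

text \<open>The bound on y^a u_y makes the vertical derivative of size y^-a, which is integrable
  down to the thin ball.\<close>

lemma vertical_variation:
assumes C: "!!z. z : half_ball R ==> \<bar>snd z powr a * snd (F z)\<bar> <= C" and z: "z : half_ball R"
shows "\<bar>u z - u (fst z, 0)\<bar> <= C * (R powr (1 - a) / (1 - a))"
proof -
have y: "0 < snd z" using half_ballD[OF z] by simp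
have yR: "snd z <= R" using half_ballD(2)[OF z] norm_snd_le[of "snd z" "fst z"] by simp
have C0: "0 <= C" using C[OF z] by linarith
have in_ball: "(fst z, t) : half_ball R" if t: "0 < t" "t <= snd z" for t
proof -
 have "norm (fst z, t) <= norm (fst z, snd z)" using power_mono[OF t(2), of 2] t by (cases z) (simp add: norm_Pair)
 thus ?thesis using t half_ballD(2)[OF z] by (simp add: half_ball_def)
qed
have "\<bar>u (fst z, snd z) - u (fst z, 0)\<bar> <= C * (snd z powr (1 - a) / (1 - a))"
proof (rule derivative_powr_bound[OF a(2) y C0, where g' = "%t. snd (F (fst z, t))"])
 fix t assume t: "0 < t" "t <= snd z"
 have "((%t. (fst z, t)) has_derivative (%h. (0, h))) (at t)" by (intro has_derivative_Pair has_derivative_const has_derivative_ident)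
 from has_derivative_compose[OF this uD(5)[OF in_ball[OF t]]]
 show "((%t. u (fst z, t)) has_real_derivative snd (F (fst z, t))) (at t)"
  by (rule has_derivative_imp_has_field_derivative) (simp add: inner_prod_def)
 have "t powr - a * \<bar>t powr a * snd (F (fst z, t))\<bar> <= t powr - a * C"
  using C[OF in_ball[OF t]] by (intro mult_left_mono) auto
 moreover have "t powr - a * \<bar>t powr a * Y\<bar> = \<bar>Y\<bar>" for Y
  using t by (simp add: abs_mult mult.assoc[symmetric] powr_add[symmetric])
 ultimately show "\<bar>snd (F (fst z, t))\<bar> <= C * t powr - a" by (simp add: mult.commute)
next
 show "((%t. u (fst z, t)) ---> u (fst z, 0)) (at_right 0)"
 proof (rule continuous_on_tendsto_compose[OF uD(1)])
  show "((%t. (fst z, t)) ---> (fst z, 0)) (at_right 0)" by (intro tendsto_Pair tendsto_const tendsto_ident_at)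
  show "(fst z, 0) : half_ball R \<union> thin_ball R"
   using norm_fst_le[of "fst z" "snd z"] half_ballD(2)[OF z] by (simp add: thin_ball_def)
  show "eventually (%t. (fst z, t) : half_ball R \<union> thin_ball R) (at_right 0)"
   unfolding eventually_at_right_field using in_ball y by (intro exI[of _ "snd z"]) auto
 qed
qed
also have "... <= C * (R powr (1 - a) / (1 - a))"
 using a y yR C0 by (intro mult_left_mono divide_right_mono powr_mono2) auto
finally show ?thesis by simp
qed

text \<open>
One of the two signs of \<open>u\<close> is controlled on the thin ball by the nonlinearity. The other one is
then controlled by a Harnack-type argument, based on the mean value property up to the bounded
conormal derivative and on \<open>u 0 = 0\<close>. Finally, the growth of \<open>Hen\<close> is transferred to the values of \<open>u\<close>,
whose square is subharmonic.
\<close>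

lemma thin_growth:
assumes freq: "!!r. 0 < r ==> r < R ==> real k * Hen r <= r powr (- (real CARD('n) + a - 1)) * Een r"
 and k: "1 <= k" and C: "!!z. z : half_ball R ==> \<bar>snd z powr a * snd (F z)\<bar> <= C"
 and si: "\<bar>si\<bar> = 1" and L: "!!x. x : ball 0 R ==> si * u (x, 0) <= L" "0 <= L"
 and x: "norm x < r" "r <= R / 8"
shows "\<bar>u (x, 0)\<bar> <= growth_const TYPE('n) a R C L k * r ^ k"
proof -
let ?A = "%s y a. (\<integral>th. u (s *. th + (y, 0)) \<partial>sph a)"
let ?B = "%a y. sph_mass TYPE('n) a * u (y, 0)"
let ?C = "(%t. (t / (R / 2)) ^ (2 * k) * Hen (R / 2))"
note H = Hen_growth[OF freq]
have m: "0 < sph_mass TYPE('n) a" by (rule measure_sph_pos[OF a(1)])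
define d where "d = real CARD('n) + a + 1"
define C2 where "C2 = C * (R powr (1 - a) / (1 - a))"
define C1 where "C1 = C * unit_ball_vol (real CARD('n)) * (R powr (1 - a) / (1 - a))"
have C0: "0 <= C"
proof -
 have "(0, R / 2) : (half_ball R :: 'n point set)" using R by (simp add: half_ball_def norm_Pair)
 from C[OF this] show ?thesis by linarith
qed
have C12: "0 <= C1" "0 <= C2" using C0 a by (auto simp: C1_def C2_def)
have btb: "\<bar>bt x\<bar> <= C" if "x : ball 0 R" for x by (rule conormal_bounded[OF a con C that])
have vert: "\<bar>u z - u (fst z, 0)\<bar> <= C2" if "z : half_ball R" for z
 unfolding C2_def by (rule vertical_variation[OF C that])
have fst_ball: "fst z : ball 0 rh" if "z : half_ball rh" for z :: "'n point" and rh
 using norm_fst_le[of "fst z" "snd z"] half_ballD(2)[OF that] by simp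
have avg: "\<bar>(?A s y a) - sph_mass TYPE('n) a * u (y, 0)\<bar> <= C1" if y: "norm y < R" and s: "0 < s" "s < R - norm y" for y s
proof -
 interpret T: frequency_setting a p lm lp "R - norm y" "%z. u (z + (y, 0))" "%z. F (z + (y, 0))"
  by (rule frequency_setting_translate[OF y])
 have b: "\<bar>T.bt x\<bar> <= C" if "x : ball 0 (R - norm y)" for x
  using btb[of "x + y"] that norm_triangle_ineq[of x y] by simp
 have "\<bar>(?A s y a) - sph_mass TYPE('n) a * u (0 + (y, 0))\<bar> <= C * unit_ball_vol (real CARD('n)) * (s powr (1 - a) / (1 - a))"
  by (rule T.average_near_centre[OF b s])
 also have "... <= C1"
  unfolding C1_def using C0 a s order_trans[OF less_imp_le[OF s(2)], of R] by (intro mult_left_mono divide_right_mono powr_mono2 mult_nonneg_nonneg) auto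
 finally show ?thesis by simp
qed
\<comment> \<open>Here \<open>k >= 1\<close> enters: \<open>Hen\<close> tends to 0 at the centre,
  and it dominates the central value squared.\<close>
have u0: "u 0 = 0"
proof -
 have "(?C ---> (0 / (R / 2)) ^ (2 * k) * Hen (R / 2)) (at_right 0)"
  using R by (intro tendsto_mult tendsto_power tendsto_divide tendsto_ident_at tendsto_const) auto
 hence lim: "(?C ---> 0) (at_right 0)" using k by (simp add: power_0_left)
 have "sph_mass TYPE('n) a * (u 0)^2 <= 0"
 proof (rule tendsto_lowerbound[OF lim])
  have "sph_mass TYPE('n) a * (u 0)^2 <= (t / (R / 2)) ^ (2 * k) * Hen (R / 2)" if "0 < t" "t < R / 2" for t
   using Hen_ge_centre[of t] H[of t "R / 2"] that R by simp
  thus "eventually (%t. sph_mass TYPE('n) a * (u 0)^2 <= (t / (R / 2)) ^ (2 * k) * Hen (R / 2)) (at_right 0)"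
   unfolding eventually_at_right_field using R by (intro exI[of _ "R / 2"]) auto
 qed simp
 thus ?thesis using m by (simp add: mult_le_0_iff)
qed
define be where "be = sph_mass TYPE('n) a * (L + C2) + C1"
have be0: "0 <= be" unfolding be_def using m L C12 by simp
define U where "U = L + (be * 3 powr d + C1) / sph_mass TYPE('n) a"
obtain B where B: "!!z. z : half_ball R ==> \<bar>u z\<bar> <= B" using u_bounded by metis
have thin: "\<bar>u (y, 0)\<bar> <= U" if y: "norm y < R / 2" for y
proof -
 \<comment> \<open>Nonnegative on the whole half ball: \<open>L\<close> bounds the controlled sign
   on the thin ball, and \<open>C2\<close> pays for moving up vertically.\<close>
 define w where "w z = L + C2 - si * u z" for z
 have siu: "\<bar>si * t\<bar> = \<bar>t\<bar>" for t using si by (simp add: abs_mult)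
 have iu: "integrable (sph a) (%th. u (s *. th + (v, 0)))" if "0 < s" "s < R - norm v" "norm v < R" for s v
 proof -
  interpret T: frequency_setting a p lm lp "R - norm v" "%z. u (z + (v, 0))" "%z. F (z + (v, 0))"
   by (rule frequency_setting_translate[OF that(3)])
  have sT: "s : {0<..<R - norm v}" using that by simp
  obtain B where B: "!!z. z : half_ball (R - norm v) ==> \<bar>u (z + (v, 0))\<bar> <= B" using T.u_bounded by metis
  show ?thesis
   by (rule sph_bounded_integrable[OF a(1) sphere_slice_measurable[OF T.uD(2) sT]], rule B, rule scaled_half_sphere) (use that in auto)
 qed
 have iw: "(\<integral>th. w (s *. th + (v, 0)) \<partial>sph a) = sph_mass TYPE('n) a * (L + C2) - si * (\<integral>th. u (s *. th + (v, 0)) \<partial>sph a)"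
  if "0 < s" "s < R - norm v" "norm v < R" for s v
 proof -
  interpret S: finite_measure "sph a :: 'n point measure" by (rule finite_measure_sph[OF a(1)])
  show ?thesis unfolding w_def using iu[OF that] by simp
 qed
 \<comment> \<open>The Harnack argument: averages of \<open>w\<close> around 0 are at most
   \<open>be\<close> because \<open>u 0 = 0\<close>; those around y, taken over a half ball of
   radius R/4 inside the one of radius 3R/4 around 0, are then bounded too, which limits how far
   \<open>u\<close> can go in the uncontrolled sign.\<close>
 have "(sph_mass TYPE('n) a * (L + C2) - si * (?B a y) - C1) * (R / 4) powr d <= be * (3 * (R / 4)) powr d"
  unfolding d_def
 proof (rule average_comparison[OF a(1), of R w])
  show "continuous_on (half_ball R) w" unfolding w_def by (intro continuous_on_diff continuous_on_mult continuous_on_const uD(2))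
  fix z :: "'n point" assume z: "z : half_ball R"
  have "si * (u z - u (fst z, 0)) <= C2" using vert[OF z] siu[of "u z - u (fst z, 0)"] by linarith
  thus "0 <= w z" using L(1)[OF fst_ball[OF z]] unfolding w_def right_diff_distrib by linarith
  show "w z <= L + C2 + B" unfolding w_def using B[OF z] siu[of "u z"] by linarith
 next
  fix s assume s: "0 < s" "s < R / 4"
  have sR: "s < R - norm y" "norm y < R" using s y R by auto
  have "\<bar>si * ((?A s y a) - sph_mass TYPE('n) a * u (y, 0))\<bar> <= C1" unfolding siu by (rule avg[OF sR(2) s(1) sR(1)])
  thus "sph_mass TYPE('n) a * (L + C2) - si * (?B a y) - C1 <= (\<integral>th. w (s *. th + (y, 0)) \<partial>sph a)"
   unfolding iw[OF s(1) sR] right_diff_distrib by linarith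
 next
  fix s assume s: "0 < s" "s < 3 * (R / 4)"
  have sR: "s < R - norm (0 :: real ^ 'n)" "norm (0 :: real ^ 'n) < R" using s R by auto
  have "\<bar>si * ((\<integral>th. u (s *. th + (0, 0)) \<partial>sph a) - sph_mass TYPE('n) a * u (0, 0))\<bar> <= C1" unfolding siu by (rule avg[OF sR(2) s(1) sR(1)])
  thus "(\<integral>th. w (s *. th) \<partial>sph a) <= be"
   using iw[OF s(1) sR] u0 unfolding be_def by (simp add: zero_prod_def[symmetric] abs_le_iff)
 qed (use R y in auto)
 also have "(3 * (R / 4)) powr d = 3 powr d * (R / 4) powr d" by (rule powr_mult)
 finally have "(sph_mass TYPE('n) a * (L + C2) - si * (?B a y) - C1) * (R / 4) powr d <= (be * 3 powr d) * (R / 4) powr d" by simp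
 hence "sph_mass TYPE('n) a * (L + C2) - si * (?B a y) - C1 <= be * 3 powr d" using R by (simp add: mult_le_cancel_right)
 moreover have "0 <= sph_mass TYPE('n) a * (L + C2)" using m L C12 by simp
 ultimately have "sph_mass TYPE('n) a * (- (si * u (y, 0))) <= be * 3 powr d + C1" by (simp add: mult.left_commute)
 hence "- (si * u (y, 0)) <= (be * 3 powr d + C1) / sph_mass TYPE('n) a" using m by (simp add: pos_le_divide_eq mult.commute)
 moreover have "0 <= (be * 3 powr d + C1) / sph_mass TYPE('n) a" using m be0 C12 by simp
 moreover have "si * u (y, 0) <= L" using y R by (intro L) simp
 ultimately have "\<bar>si * u (y, 0)\<bar> <= U" unfolding U_def using L(2) by linarith
 thus ?thesis unfolding siu .
qed
have U: "\<bar>u z\<bar> <= U + C2" if z: "z : half_ball (R / 2)" for z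
proof -
 have "z : half_ball R" using z half_ball_mono[of "R / 2" R] R by auto
 from vert[OF this] thin[of "fst z"] fst_ball[OF z] show ?thesis by simp
qed
have U0: "0 <= U + C2" using thin[of 0] C12 R by force
have r: "0 < r" using x norm_ge_zero[of x] by linarith
\<comment> \<open>Subharmonicity around \<open>x\<close>, transferred to the centre 0: since
  \<open>norm x < r\<close>, the half ball of radius \<open>r\<close> around \<open>x\<close> lies
  in the one of radius 2r around 0.\<close>
have "(sph_mass TYPE('n) a * (u (x, 0))^2) * r powr d <= Hen (2 * r) * (2 * r) powr d"
 unfolding d_def
proof (rule average_comparison[OF a(1), of R "%z. (u z)^2"])
 show "continuous_on (half_ball R) (%z. (u z)^2)" by (intro continuous_on_power uD(2))
 show "(u z)^2 <= B^2" if "z : half_ball R" for z using power_mono[OF B[OF that], of 2] by simp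
 fix s assume s: "0 < s" "s < r"
 have xR: "norm x < R" using x R by simp
 interpret T: frequency_setting a p lm lp "R - norm x" "%z. u (z + (x, 0))" "%z. F (z + (x, 0))"
  by (rule frequency_setting_translate[OF xR])
 have "s < R - norm x" using s x R by linarith
 from T.Hen_ge_centre[OF s(1) this]
 show "sph_mass TYPE('n) a * (u (x, 0))^2 <= (\<integral>th. (u (s *. th + (x, 0)))^2 \<partial>sph a)" by (simp add: T.Hen_def)
next
 fix s assume s: "0 < s" "s < 2 * r"
 have "Hen s <= (s / (2 * r)) ^ (2 * k) * Hen (2 * r)" using s x R by (intro H) auto
 also have "... <= 1 * Hen (2 * r)" using s Hen_nonneg by (intro mult_right_mono power_le_one) auto
 finally show "(\<integral>th. (u (s *. th))^2 \<partial>sph a) <= Hen (2 * r)" by (simp add: Hen_def)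
qed (use r x R in auto)
also have "(2 * r) powr d = 2 powr d * r powr d" using r by (simp add: powr_mult)
finally have "(sph_mass TYPE('n) a * (u (x, 0))^2) * r powr d <= (2 powr d * Hen (2 * r)) * r powr d" by (simp only: mult_ac)
hence "sph_mass TYPE('n) a * (u (x, 0))^2 <= 2 powr d * Hen (2 * r)" using r by (subst (asm) mult_le_cancel_right) auto
\<comment> \<open>The radius 2r is admissible because \<open>r <= R / 8\<close>; this step brings in
  the factor r^(2k).\<close>
also have "Hen (2 * r) <= (2 * r / (R / 4)) ^ (2 * k) * Hen (R / 4)" using r x R by (intro H) auto
also have "Hen (R / 4) <= sph_mass TYPE('n) a * (U + C2)^2"
proof -
 interpret S: finite_measure "sph a :: 'n point measure" by (rule finite_measure_sph[OF a(1)])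
 have "Hen (R / 4) <= (\<integral>th. (U + C2)^2 \<partial>(sph a :: 'n point measure))"
  unfolding Hen_def
 proof (rule integral_mono)
  show "integrable (sph a) (%th. (u ((R / 4) *. th))^2)" by (rule slice_integrable(1)) (use R in auto)
  fix th :: "'n point" assume "th : space (sph a)"
  hence "(R / 4) *. th : half_ball (R / 2)" using R by (intro scaled_half_sphere) auto
  from power_mono[OF U[OF this], of 2] show "(u ((R / 4) *. th))^2 <= (U + C2)^2" by simp
 qed simp
 thus ?thesis by simp
qed
finally have "sph_mass TYPE('n) a * (u (x, 0))^2 <= 2 powr d * ((2 * r / (R / 4)) ^ (2 * k) * (sph_mass TYPE('n) a * (U + C2)^2))"
 using R r by (simp add: mult_left_mono)
moreover have "2 * r / (R / 4) = 8 / R * r" using R by (simp add: field_simps)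
ultimately have "sph_mass TYPE('n) a * (u (x, 0))^2 <= sph_mass TYPE('n) a * (2 powr d * ((8 / R * r) ^ (2 * k) * (U + C2)^2))" by (simp only: mult.left_commute[of "sph_mass TYPE('n) a"])
hence "(u (x, 0))^2 <= 2 powr d * ((8 / R * r) ^ (2 * k) * (U + C2)^2)" using m by (simp add: mult_le_cancel_left)
also have "... = (sqrt (2 powr d) * (8 / R) ^ k * (U + C2) * r ^ k)^2"
 unfolding power_mult_distrib power_even_eq by simp
finally have "\<bar>u (x, 0)\<bar> <= \<bar>sqrt (2 powr d) * (8 / R) ^ k * (U + C2) * r ^ k\<bar>" by (simp only: abs_le_square_iff)
also have "... = sqrt (2 powr d) * (8 / R) ^ k * (U + C2) * r ^ k" using U0 R r by (simp add: abs_mult)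
finally show ?thesis
 unfolding growth_const_def Let_def C1_def[symmetric] C2_def[symmetric] d_def[symmetric] be_def[symmetric] U_def[symmetric] .
qed

end

section \<open>Decay of the nonlinearity on the thin ball\<close>

lemma boundary_term_one_sided:
assumes p: "2 <= p" and l: "0 < lp" and b: "\<bar>boundary_term p lm lp t\<bar> <= C"
shows "t <= (C / lp) powr (1 / (p - 1))"
proof (cases "0 < t")
case True
hence "lp * t powr (p - 1) <= C"
 using b l by (simp add: boundary_term_def pos_part_def neg_part_def abs_mult)
hence "t powr (p - 1) <= C / lp" using l by (simp add: pos_le_divide_eq mult.commute)
hence "(t powr (p - 1)) powr (1 / (p - 1)) <= (C / lp) powr (1 / (p - 1))" using p by (intro powr_mono2) auto
thus ?thesis using True p by (simp add: powr_powr)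
next
case False
thus ?thesis using powr_ge_zero[of "C / lp" "1 / (p - 1)"] by linarith
qed

lemma boundary_term_minus: "boundary_term p lm lp (- t) = - boundary_term p lp lm t"
by (simp add: boundary_term_def pos_part_def neg_part_def)

lemma boundary_term_growth:
assumes p: "2 <= p" and l: "0 <= lm" "0 <= lp" and t: "\<bar>t\<bar> <= T"
shows "\<bar>boundary_term p lm lp t\<bar> <= (lm + lp) * T powr (p - 1)"
proof -
have "pos_part t powr (p - 1) <= T powr (p - 1)" "neg_part t powr (p - 1) <= T powr (p - 1)"
 using t p by (intro powr_mono2; auto simp: pos_part_def neg_part_def)+
hence "lp * pos_part t powr (p - 1) <= lp * T powr (p - 1)" "lm * neg_part t powr (p - 1) <= lm * T powr (p - 1)"
 using l by (auto intro: mult_left_mono)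
moreover have "0 <= lp * pos_part t powr (p - 1)" "0 <= lm * neg_part t powr (p - 1)"
 using l by auto
ultimately show ?thesis unfolding boundary_term_def distrib_right by linarith
qed

text \<open>The witness is chosen before \<open>u\<close> and \<open>F\<close>, so it may depend on
  the parameters and on \<open>C\<close> only. The growth estimate applies to small radii, positive
  \<open>k\<close> and a nonlinearity that does not vanish identically; elsewhere the plain bound
  \<open>C\<close> is enough.\<close>

lemma boundary_growth:
fixes a p lm lp R C :: real and k :: nat
assumes p: "2 <= p" and l: "0 <= lm" "0 <= lp" and R: "0 < R" and C: "0 <= C"
shows "EX T>=0. ALL (u :: ('n::finite) point => real) F. frequency_setting a p lm lp R u F &
  (ALL z:half_ball R. \<bar>snd z powr a * snd (F z)\<bar> <= C) &
  (ALL r. 0 < r & r < R --> real k * frequency_setting.Hen a u r <= r powr (- (real CARD('n) + a - 1)) * frequency_setting.Een a p lm lp u F r) -->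
  (ALL x r. norm x < r & r < R --> \<bar>boundary_term p lm lp (u (x, 0))\<bar> <= T * r powr (real k * (p - 1)))"
proof -
define e where "e = real k * (p - 1)"
have e0: "0 <= e" unfolding e_def using p by simp
\<comment> \<open>The sign of \<open>u\<close> that the nonlinearity controls. If
  \<open>lp = 0\<close>, the other constant is used, through the symmetry that exchanges
  \<open>lm\<close> and \<open>lp\<close> under u -> -u.\<close>
define si :: real where "si = (if 0 < lp then 1 else - 1)"
define L where "L = (if 0 < lp then (C / lp) powr (1 / (p - 1)) else (C / lm) powr (1 / (p - 1)))"
define G where "G = \<bar>growth_const TYPE('n) a R C L k\<bar>"
\<comment> \<open>One summand for each regime, the fine estimate and the coarse one.\<close>
define T where "T = (lm + lp) * G powr (p - 1) + C * (8 / R) powr e"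
have T1: "0 <= (lm + lp) * G powr (p - 1)" "0 <= C * (8 / R) powr e" using l C by auto
have "\<bar>boundary_term p lm lp (u (x, 0))\<bar> <= T * r powr e"
 if fs: "frequency_setting a p lm lp R u F" and Fb: "ALL z:half_ball R. \<bar>snd z powr a * snd (F z)\<bar> <= C"
  and fr: "ALL r. 0 < r & r < R --> real k * frequency_setting.Hen a u r <= r powr (- (real CARD('n) + a - 1)) * frequency_setting.Een a p lm lp u F r"
  and x: "norm x < r" "r < R" for u :: "'n point => real" and F x r
proof -
 interpret frequency_setting a p lm lp R u F by (rule fs)
 have freq: "real k * Hen r <= r powr (- (real CARD('n) + a - 1)) * Een r" if "0 < r" "r < R" for r using fr that by blast
 have Fb': "\<bar>snd z powr a * snd (F z)\<bar> <= C" if "z : half_ball R" for z using Fb that by blast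
 have btb: "\<bar>bt x\<bar> <= C" if "x : ball 0 R" for x by (rule conormal_bounded[OF a con Fb' that])
 have r: "0 < r" using x norm_ge_zero[of x] by linarith
 \<comment> \<open>For \<open>k = 0\<close> the exponent is 0, and for \<open>r > R / 8\<close> the
   base exceeds 1: in both cases the power is at least 1 and the bound \<open>C\<close> can be
   multiplied by it.\<close>
 have coarse: "\<bar>bt x\<bar> <= T * r powr e" if "1 <= (8 / R * r) powr e"
 proof -
  have "\<bar>bt x\<bar> <= C" using x by (intro btb) simp
  also have "... <= C * (8 / R * r) powr e" using mult_left_mono[OF that C] by simp
  also have "... = C * (8 / R) powr e * r powr e" by (simp only: powr_mult mult.assoc)
  also have "... <= T * r powr e" using T1 unfolding T_def by (intro mult_right_mono) auto
  finally show ?thesis .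
 qed
 consider "k = 0" | "R / 8 < r" | "lm = 0" "lp = 0" | "1 <= k" "r <= R / 8" "0 < lm | 0 < lp" using l by fastforce
 thus ?thesis
 proof cases
  case 1
  thus ?thesis using r R by (intro coarse) (simp add: e_def)
 next
  case 2
  thus ?thesis using R e0 by (intro coarse ge_one_powr_ge_zero) (simp_all add: field_simps)
 next
  case 3
  thus ?thesis using T1 unfolding T_def by (simp add: boundary_term_def)
 next
  case 4
  have si1: "\<bar>si\<bar> = 1" by (simp add: si_def)
  have L0: "0 <= L" by (simp add: L_def)
  have sL: "si * u (y, 0) <= L" if "y : ball 0 R" for y
  proof (cases "0 < lp")
   case True
   thus ?thesis using boundary_term_one_sided[OF p True btb[OF that]] by (simp add: si_def L_def)
  next
   case False
   hence "0 < lm" using 4 by simp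
   moreover have "\<bar>boundary_term p lp lm (- u (y, 0))\<bar> <= C" using btb[OF that] by (simp add: boundary_term_minus)
   ultimately show ?thesis using boundary_term_one_sided[OF p] False by (simp add: si_def L_def)
  qed
  have "\<bar>u (x, 0)\<bar> <= growth_const TYPE('n) a R C L k * r ^ k"
   by (rule thin_growth[OF freq 4(1) Fb' si1 sL L0 x(1) 4(2)])
  also have "... <= G * r ^ k" unfolding G_def using r by (intro mult_right_mono) auto
  finally have "\<bar>bt x\<bar> <= (lm + lp) * (G * r ^ k) powr (p - 1)" by (rule boundary_term_growth[OF p l])
  also have "(G * r ^ k) powr (p - 1) = G powr (p - 1) * r powr e"
   using r by (simp add: powr_mult powr_powr powr_realpow[symmetric] e_def)
  also have "(lm + lp) * ... <= T * r powr e" using T1 unfolding T_def by (simp add: mult.assoc[symmetric] mult_right_mono)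
  finally show ?thesis .
 qed
qed
moreover have "0 <= T" using T1 by (simp add: T_def)
ultimately show ?thesis unfolding e_def by (intro exI[of _ T]) blast
qed

theorem proposition3p11:
  fixes a p lm lp K R\<^sub>0 :: real and k :: nat
    and q :: "('n::finite) point \<Rightarrow> real"
  assumes "-1 < a" "a < 1" "2 \<le> p" "0 \<le> lm" "0 \<le> lp"
    and "regularity_radius TYPE('n) a p lm lp K R\<^sub>0"
    and "q \<in> hom_polys a k"
  shows "\<exists>C>0. \<forall>(g :: 'n point \<Rightarrow> real) (u :: 'n point \<Rightarrow> real).
    datum a g \<and> sup_norm_sphere g = K \<and>
    weak_solution a p lm lp g u \<and>
    continuous_on (half_ball 1 \<union> thin_ball 1) u \<and>
    (\<exists>z\<in>half_ball 1. u z \<noteq> 0) \<and>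
    (perturbed_frequency a p lm lp u \<longlongrightarrow> real k) (at_right 0)
    \<longrightarrow>
    monneau a k u q C1_differentiable_on {0<..<R\<^sub>0 / 2} \<and>
    (\<forall>r\<in>{0<..<R\<^sub>0 / 2}. deriv (monneau a k u q) r \<ge> - C * r powr (real k * (p - 2) - a))"
proof -
let ?A = "%real. real k * (p - 2) - a"
let ?B = "%F C. ALL z:half_ball R\<^sub>0. \<bar>snd z powr a * snd (F z)\<bar> <= C"
let ?C = "(half_ball R\<^sub>0)"
note a = assms(1,2) and p = assms(3) and l = assms(4,5) and reg = assms(6)
define c where "c = real CARD('n) + a - 1"
have R: "0 < R\<^sub>0" "R\<^sub>0 < 1" using reg by (auto simp: regularity_radius_def)
note R01 = R
have qs: "smooth q" and qev: "!!x y. q (x, - y) = q (x, y)" and qhom: "!!mw z. 0 <= mw ==> q (mw *. z) = mw ^ k * q z" and qah: "a_harmonic a q"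
 using assms(7) smooth_real_polynomial_function by (auto simp: hom_polys_def)
have q1: "admissible a R\<^sub>0 q (grad q)" by (rule admissible_even[OF a(1) R(1) qs qev])
have q2: "conormal a R\<^sub>0 (grad q) (%_. 0)" by (rule a_harmonic_conormal[OF a qs qev qah admissibleD(3)[OF q1]])
have eul: "grad q z \<bullet> z = real k * q z" for z by (rule homogeneous_euler[OF qs qhom])
obtain Q where Q: "0 <= Q" "!!z. norm z < 1 ==> \<bar>q z\<bar> <= Q"
 using bounded_on_half_ball[OF smooth_continuous[OF qs], of 1] by (metis real_norm_def)
\<comment> \<open>Homogeneity, applied to the point scaled into the unit ball.\<close>
have qb: "\<bar>q (x, 0)\<bar> <= Q * r ^ k" if "norm x < r" for x r
proof -
 have r: "0 < r" using that norm_ge_zero[of x] by linarith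
 have "norm ((1 / r) *. (x, 0 :: real)) < 1" using that r by (simp add: norm_Pair)
 hence "r ^ k * \<bar>q ((1 / r) *. (x, 0))\<bar> <= r ^ k * Q" using r Q by (intro mult_left_mono) auto
 moreover have "q (x, 0) = r ^ k * q ((1 / r) *. (x, 0))" using qhom[of r "(1 / r) *. (x, 0)"] r by simp
 ultimately show ?thesis using r by (simp add: abs_mult mult.commute)
qed
\<comment> \<open>This constant and \<open>T\<close> below are fixed before the datum and the
  solution; the uniformity of the result rests on this order.\<close>
obtain C where C: "0 < C" "ALL (g :: 'n point => real) u. datum a g & sup_norm_sphere g = K & weak_solution a p lm lp g u -->
 (EX F. is_H1a_grad a 1 u F & bdd_field a R\<^sub>0 F & (?B F C))"
 using regularity_field[OF reg] by blast
obtain T where T0: "0 <= T" and T: "ALL (u :: 'n point => real) F. frequency_setting a p lm lp R\<^sub>0 u F &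
  (?B F C) &
  (ALL r. 0 < r & r < R\<^sub>0 --> real k * frequency_setting.Hen a u r <= r powr (- (real CARD('n) + a - 1)) * frequency_setting.Een a p lm lp u F r) -->
  (ALL x r. norm x < r & r < R\<^sub>0 --> \<bar>boundary_term p lm lp (u (x, 0))\<bar> <= T * r powr (real k * (p - 1)))"
 using boundary_growth[OF p l R(1) less_imp_le[OF C(1)], where ?'n = 'n] by blast
define V where "V = unit_ball_vol (real CARD('n))"
have V0: "0 <= V" by (simp add: V_def)
\<comment> \<open>The factor 2 is that of \<open>Mder_lower\<close>; \<open>T\<close>,
  \<open>Q\<close> and \<open>V\<close> bound the nonlinearity, the polynomial and the volume of the
  thin ball.\<close>
define C' where "C' = 2 * T * Q * V"
have C'0: "0 <= C'" using T0 Q V0 by (simp add: C'_def)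
\<comment> \<open>Adding 1 guarantees a positive constant even when \<open>C'\<close> is 0.\<close>
have main: "monneau a k u q C1_differentiable_on {0<..<R\<^sub>0 / 2} &
 (ALL r:{0<..<R\<^sub>0 / 2}. deriv (monneau a k u q) r >= - (C' + 1) * r powr (?A real))"
 if g: "datum a g" "sup_norm_sphere g = K" and ws: "weak_solution a p lm lp g u"
  and uc: "continuous_on (half_ball 1 \<union> thin_ball 1) u"
  and lim: "(perturbed_frequency a p lm lp u ---> real k) (at_right 0)" for g u :: "'n point => real"
proof -
 obtain F where F: "is_H1a_grad a 1 u F" "bdd_field a R\<^sub>0 F" and Fb: "ALL z:half_ball R\<^sub>0. \<bar>snd z powr a * snd (F z)\<bar> <= C"
  using C(2) g ws by blast
 have sub: "half_ball R\<^sub>0 \<union> thin_ball R\<^sub>0 <= half_ball 1 \<union> (thin_ball 1 :: 'n point set)"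
  using R half_ball_mono[of R\<^sub>0 1] by (auto simp: thin_ball_def)
 have ucR: "continuous_on (half_ball r \<union> thin_ball r) u" if "r <= R\<^sub>0" for r
 proof -
  have "half_ball r \<union> thin_ball r <= half_ball R\<^sub>0 \<union> (thin_ball R\<^sub>0 :: 'n point set)"
   using that half_ball_mono[OF that] by (auto simp: thin_ball_def)
  thus ?thesis using continuous_on_subset[OF uc] sub by blast
 qed
 have FR: "is_H1a_grad a r u F" if "r <= 1" for r
  using is_H1a_grad_affine[of 1 r "0 :: real ^ 'n" 1 a u F 1] F(1) that by (simp add: zero_prod_def[symmetric])
 \<comment> \<open>Since the radius is below 1, the closed half ball is a compact part of the set
   where \<open>u\<close> is continuous. This bound depends on \<open>u\<close>, but it serves
   integrability only and does not enter the final constant.\<close>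
 have ub: "EX C. ALL z:half_ball R\<^sub>0 \<union> thin_ball R\<^sub>0. \<bar>u z\<bar> <= C"
 proof -
  let ?S = "{z :: 'n point. 0 <= snd z} \<inter> cball 0 R\<^sub>0"
  have "?S <= half_ball 1 \<union> thin_ball 1"
  proof
   fix z :: "'n point" assume z: "z : ?S"
   hence n: "norm z < 1" using R by simp
   moreover have "norm (fst z) < 1" using norm_fst_le[of "fst z" "snd z"] n by simp
   ultimately show "z : half_ball 1 \<union> thin_ball 1"
    using z by (cases "snd z = 0") (auto simp: half_ball_def thin_ball_def mem_Times_iff)
  qed
  moreover have "compact ?S" by (intro closed_Int_compact compact_cball closed_Collect_le continuous_intros)
  ultimately have "bounded (u ` ?S)" by (intro compact_imp_bounded compact_continuous_image continuous_on_subset[OF uc])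
  then obtain B where B: "ALL z:?S. \<bar>u z\<bar> <= B" unfolding bounded_iff by auto
  have "half_ball R\<^sub>0 \<union> thin_ball R\<^sub>0 <= ?S" by (auto simp: half_ball_def thin_ball_def norm_Pair)
  thus ?thesis using B by blast
 qed
 have adm: "admissible a R\<^sub>0 u F"
  unfolding admissible_def
 proof (intro conjI ballI FR ucR ub F)
  have "continuous_on ?C u" by (rule continuous_on_subset[OF ucR]) auto
  moreover have "continuous_on ?C F" using F(2) by (simp add: bdd_field_def)
  ultimately show "(u has_derivative (%h. F z \<bullet> h)) (at z)" if "z : half_ball R\<^sub>0" for z
   using R that by (intro H1a_has_derivative[OF FR]) auto
 qed (use R in auto)
 interpret frequency_setting a p lm lp R\<^sub>0 u F
  by (unfold_locales; (rule a p l R adm)?) (rule weak_solution_conormal[OF a p ws uc F(1) R(2) F(2)])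
 \<comment> \<open>Translation of the frequency, defined with chosen gradients and traces on each
   half ball, into the quantities of the locale, so that the limit assumption can be used.\<close>
 have pf: "perturbed_frequency a p lm lp u r = r powr - c * Een r / Hen r" if r: "0 < r" "r < R\<^sub>0" for r
 proof -
  have r1: "r <= 1" using r R01 by linarith
  have uH: "u : H1a a r" using FR[OF r1] by (auto simp: H1a_def)
  have "continuous_on (half_sphere r) u"
   by (rule continuous_on_subset[OF uD(2)]) (use r in \<open>auto simp: half_sphere_def half_ball_def\<close>)
  hence h: "height_H a u r = Hen r" unfolding Hen_def by (rule height_H_sph[OF r(1)])
  have d: "energy_D a u r = r powr - c * Ien r"
   unfolding Ien_def c_def by (rule energy_D_eq[OF a(1) FR[OF r1]])
  have g: "boundary_G a p lm lp u r = r powr - c * Ben r"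
   unfolding Ben_def c_def by (rule boundary_G_eq[OF a r(1) p uH ucR]) (use r in simp)
  show ?thesis unfolding perturbed_frequency_def h d g Een_def by (simp add: algebra_simps)
 qed
 have "((%r. r powr (- (real CARD('n) + a - 1)) * Een r / Hen r) ---> real k) (at_right 0)"
 proof (rule Lim_transform_eventually[OF lim])
  show "eventually (%r. perturbed_frequency a p lm lp u r = r powr (- (real CARD('n) + a - 1)) * Een r / Hen r) (at_right 0)"
   unfolding eventually_at_right_field using pf R by (intro exI[of _ R\<^sub>0]) (simp add: c_def)
 qed
 note freq = frequency_lower[OF this]
 have mon: "monneau a k u q r = Mdiff q r / r ^ (2 * k)" if r: "0 < r" "r < R\<^sub>0" for r
 proof -
  have "continuous_on ?C (%z. u z - q z)" by (intro continuous_on_diff uD(2) smooth_continuous[OF qs])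
  hence "continuous_on (half_sphere r) (%z. u z - q z)"
   by (rule continuous_on_subset) (use r in \<open>auto simp: half_sphere_def half_ball_def\<close>)
  from height_H_sph[OF r(1) this, of a] show ?thesis by (simp add: monneau_def Mdiff_def[OF freq q1 q2 eul])
 qed
 have der: "(monneau a k u q has_real_derivative Mder k q r) (at r)" if r: "r : {0<..<R\<^sub>0}" for r
  by (rule has_field_derivative_transform_within_open[OF monneau_derivative[OF freq q1 q2 eul r] _ r])
   (use mon in auto)
 show ?thesis
 proof (intro conjI ballI)
  show "monneau a k u q C1_differentiable_on {0<..<R\<^sub>0 / 2}"
   unfolding C1_differentiable_on_def
  proof (intro exI[of _ "Mder k q"] conjI ballI)
   show "(monneau a k u q has_vector_derivative Mder k q r) (at r)" if "r : {0<..<R\<^sub>0 / 2}" for r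
    using der[of r] that by (simp add: has_real_derivative_iff_has_vector_derivative)
   show "continuous_on {0<..<R\<^sub>0 / 2} (Mder k q)"
    by (rule continuous_on_subset[OF Mder_continuous[OF freq q1 q2 eul]]) (use R in auto)
  qed
  fix r assume "r : {0<..<R\<^sub>0 / 2}"
  hence r: "0 < r" "r < R\<^sub>0" by auto
  define X where "X = (LINT x:ball 0 r|lborel. bt x * q (x, 0))"
  define e where "e = real k * (p - 1)"
  have sb: "cball 0 r <= ball (0 :: real ^ 'n) R\<^sub>0" using r by auto
  have "\<bar>X\<bar> <= (T * r powr e * (Q * r ^ k)) * (V * r ^ CARD('n))"
   unfolding X_def V_def
  proof (rule ball_integral_bound)
   show "continuous_on (cball 0 r) (%x. bt x * q (x, 0))"
    by (intro continuous_on_mult continuous_on_subset[OF bt_cont sb] continuous_on_compose2[OF smooth_continuous[OF qs, of UNIV]]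
      continuous_on_Pair continuous_on_id continuous_on_const) auto
   fix x :: "real ^ 'n" assume x: "x : ball 0 r"
   have "\<bar>bt x\<bar> <= T * r powr e"
    using T frequency_setting_axioms Fb freq x r unfolding e_def by (metis mem_ball_0)
   thus "\<bar>bt x * q (x, 0)\<bar> <= T * r powr e * (Q * r ^ k)"
    unfolding abs_mult using qb[of x r] x T0 by (intro mult_mono) auto
  qed (use r in simp)
  hence X: "\<bar>X\<bar> <= T * Q * V * r powr (e + real k + real CARD('n))"
   using r by (simp add: powr_add powr_realpow mult_ac)
  have Md: "2 / r ^ (2 * k + 1) * (r powr - c * X) <= Mder k q r"
   unfolding X_def c_def by (rule Mder_lower[OF freq q1 q2 eul r])
  have "2 / r ^ (2 * k + 1) * (r powr - c * \<bar>X\<bar>) <= 2 / r ^ (2 * k + 1) * (r powr - c * (T * Q * V * r powr (e + real k + real CARD('n))))"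
   using r X by (intro mult_left_mono) auto
  also have "... = C' * r powr (?A real)"
  proof -
   have "2 / r ^ (2 * k + 1) = 2 * r powr - real (2 * k + 1)"
    using r by (simp only: powr_minus powr_realpow divide_inverse)
   moreover have "r powr - real (2 * k + 1) * r powr - c * r powr (e + real k + real CARD('n)) = r powr (?A real)"
    unfolding powr_add[symmetric] by (rule arg_cong[where f = "%t. r powr t"]) (simp add: e_def c_def algebra_simps)
   ultimately show ?thesis by (simp only: C'_def) (simp only: mult_ac)
  qed
  also have "... <= (C' + 1) * r powr (?A real)" by (intro mult_right_mono) auto
  finally have le: "2 / r ^ (2 * k + 1) * (r powr - c * \<bar>X\<bar>) <= (C' + 1) * r powr (?A real)" .
  have "- (2 / r ^ (2 * k + 1) * (r powr - c * \<bar>X\<bar>)) = 2 / r ^ (2 * k + 1) * (r powr - c * - \<bar>X\<bar>)" by simp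
  also have "... <= 2 / r ^ (2 * k + 1) * (r powr - c * X)" using r by (intro mult_left_mono) auto
  also note Md
  finally have "- ((C' + 1) * r powr (?A real)) <= Mder k q r" by (rule order_trans[OF le_imp_neg_le[OF le]])
  moreover have "deriv (monneau a k u q) r = Mder k q r" by (rule DERIV_imp_deriv[OF der]) (use r in simp)
  ultimately show "deriv (monneau a k u q) r >= - (C' + 1) * r powr (?A real)" by (simp only: mult_minus_left)
 qed
qed
show ?thesis
 by (rule exI[of _ "C' + 1"]) (use main C'0 in \<open>auto simp del: minus_add_distrib\<close>)
qed

end
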